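(* For a semantics $\sigma\in\{\mathtt{co},\mathtt{st},\mathtt{pr},\mathtt{sst}\}$, let $\mathsf{CF\text{-}CA}^{\sigma}$ be the following decision problem. Input: an argumentation framework $\Lambda=\langle A,R\rangle$, an argument $g\in A$, a $\sigma$-labelling $\mathcal{L}$ of $\Lambda$, and an argument $g'\in A$. Question: is there a counterfactual $\mathcal{L}'\in\mathcal{CF}^{\sigma}(g,\mathcal{L})$ in which $g'$ is accepted, i.e. with $\mathcal{L}'(g')=\mathbf{in}$? Then $\mathsf{CF\text{-}CA}^{\sigma}$ is: (1) $NP$-hard and in $\Theta_2^p$ for $\sigma\in\{\mathtt{co},\mathtt{st}\}$; and (2) $\Sigma_2^p$-hard and in $\Theta_3^p$ for $\sigma\in\{\mathtt{pr},\mathtt{sst}\}$.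
   Context: An argumentation framework (AF) is a pair $\Lambda=\langle A,R\rangle$ with $A$ a (finite) set of arguments and $R\subseteq A\times A$ a set of attacks. For $S\subseteq A$ let $\mathit{Def}(S)=\{a\in A\mid \exists b\in S,\ (b,a)\in R\}$ and $\mathit{Acc}(S)=\{a\in A\mid \forall (b,a)\in R,\ b\in \mathit{Def}(S)\}$. $S$ is conflict-free iff $S\cap \mathit{Def}(S)=\emptyset$, and admissible iff it is conflict-free and $S\subseteq \mathit{Acc}(S)$. A set $S\subseteq A$ is an extension called: complete ($\mathtt{co}$) iff it is admissible and $S=\mathit{Acc}(S)$; preferred ($\mathtt{pr}$) iff it is a $\subseteq$-maximal complete extension; stable ($\mathtt{st}$) iff it is a preferred extension with $S\cup \mathit{Def}(S)=A$; semi-stable ($\mathtt{sst}$) iff it is a preferred extension such that $S\cup \mathit{Def}(S)$ is $\subseteq$-maximal (among preferred extensions). A labelling is a total function $\mathcal{L}:A\to\{\mathbf{in},\mathbf{out},\mathbf{und}\}$. The labelling corresponding to an extension $E$ assigns $\mathbf{in}$ to the elements of $E$, $\mathbf{out}$ to the elements of $\mathit{Def}(E)$, and $\mathbf{und}$ to all other arguments. A $\sigma$-labelling of $\Lambda$ is the labelling corresponding to a $\sigma$-extension of $\Lambda$; $\sigma(\Lambda)$ denotes the set of $\sigma$-labellings of $\Lambda$. The distance between labellings is $\delta(\mathcal{L},\mathcal{L}')=|\{a\in A\mid \mathcal{L}(a)\neq\mathcal{L}'(a)\}|$. Counterfactuals: for $g\in A$ and $\mathcal{L}\in\sigma(\Lambda)$,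 a labelling $\mathcal{L}'\in\sigma(\Lambda)$ is a counterfactual of $\mathcal{L}$ w.r.t. $g$ if (i) $\mathcal{L}(g)\neq\mathcal{L}'(g)$, and (ii) there is no $\mathcal{L}''\in\sigma(\Lambda)$ with $\mathcal{L}(g)\neq\mathcal{L}''(g)$ and $\delta(\mathcal{L},\mathcal{L}'')<\delta(\mathcal{L},\mathcal{L}')$. $\mathcal{CF}^{\sigma}(g,\mathcal{L})$ denotes the set of all of them. Complexity: $\Sigma_1^p=NP$, $\Sigma_2^p=NP^{NP}$; $\Theta_h^p$ is the class of problems decidable in polynomial time by a deterministic Turing machine performing $O(\log n)$ calls to an oracle in $\Sigma_{h-1}^p$. *)

theory Defs
  imports Complex_Main "HOL-Library.Landau_Symbols" "HOL-Computational_Algebra.Polynomial"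
begin

section \<open>Argumentation frameworks\<close>

record 'a af =
  args :: "'a set"
  atts :: "('a \<times> 'a) set"

definition wf_af :: "'a af \<Rightarrow> bool" where
  "wf_af F \<longleftrightarrow> finite (args F) \<and> atts F \<subseteq> args F \<times> args F"

definition Def :: "'a af \<Rightarrow> 'a set \<Rightarrow> 'a set" where
  "Def F S = {a \<in> args F. \<exists>b\<in>S. (b, a) \<in> atts F}"

definition Acc :: "'a af \<Rightarrow> 'a set \<Rightarrow> 'a set" where
  "Acc F S = {a \<in> args F. \<forall>b. (b, a) \<in> atts F \<longrightarrow> b \<in> Def F S}"

definition conflict_free :: "'a af \<Rightarrow> 'a set \<Rightarrow> bool" where
  "conflict_free F S \<longleftrightarrow> S \<inter> Def F S = {}"

definition admissible :: "'a af \<Rightarrow> 'a set \<Rightarrow> bool" where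
  "admissible F S \<longleftrightarrow> conflict_free F S \<and> S \<subseteq> Acc F S"

definition complete_ext :: "'a af \<Rightarrow> 'a set \<Rightarrow> bool" where
  "complete_ext F S \<longleftrightarrow> S \<subseteq> args F \<and> admissible F S \<and> S = Acc F S"

definition preferred_ext :: "'a af \<Rightarrow> 'a set \<Rightarrow> bool" where
  "preferred_ext F S \<longleftrightarrow> complete_ext F S \<and> \<not> (\<exists>T. complete_ext F T \<and> S \<subset> T)"

definition stable_ext :: "'a af \<Rightarrow> 'a set \<Rightarrow> bool" where
  "stable_ext F S \<longleftrightarrow> preferred_ext F S \<and> S \<union> Def F S = args F"

definition semi_stable_ext :: "'a af \<Rightarrow> 'a set \<Rightarrow> bool" where
  "semi_stable_ext F S \<longleftrightarrow> preferred_ext F S \<and>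
     \<not> (\<exists>T. preferred_ext F T \<and> S \<union> Def F S \<subset> T \<union> Def F T)"

datatype semantics = CO | PR | ST | SST

fun extension :: "semantics \<Rightarrow> 'a af \<Rightarrow> 'a set \<Rightarrow> bool" where
  "extension CO = complete_ext"
| "extension PR = preferred_ext"
| "extension ST = stable_ext"
| "extension SST = semi_stable_ext"

section \<open>Labellings and counterfactuals\<close>

datatype label = In | Out | Und

text \<open>A labelling is a function on the whole type. Those obtained from extensions are
  constantly \<open>Und\<close> outside the arguments, so they correspond one-to-one to their
  restrictions to \<open>args F\<close>.\<close>

definition labelling_of :: "'a af \<Rightarrow> 'a set \<Rightarrow> 'a \<Rightarrow> label" where
  "labelling_of F E a = (if a \<in> E then In else if a \<in> Def F E then Out else Und)"

definition labellings :: "semantics \<Rightarrow> 'a af \<Rightarrow> ('a \<Rightarrow> label) set" where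
  "labellings \<sigma> F = labelling_of F ` {E. extension \<sigma> F E}"

definition label_dist :: "'a af \<Rightarrow> ('a \<Rightarrow> label) \<Rightarrow> ('a \<Rightarrow> label) \<Rightarrow> nat" where
  "label_dist F L L' = card {a \<in> args F. L a \<noteq> L' a}"

definition counterfactuals ::
  "semantics \<Rightarrow> 'a af \<Rightarrow> 'a \<Rightarrow> ('a \<Rightarrow> label) \<Rightarrow> ('a \<Rightarrow> label) set" where
  "counterfactuals \<sigma> F g L = {L' \<in> labellings \<sigma> F. L g \<noteq> L' g \<and>
     \<not> (\<exists>L''\<in>labellings \<sigma> F. L g \<noteq> L'' g \<and> label_dist F L L'' < label_dist F L L')}"

section \<open>Oracle Turing machines\<close>

text \<open>Multi-tape nondeterministic oracle machines. States and tape symbols are natural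
  numbers; finiteness of the transition table makes only finitely many of them matter.
  Symbol 0 is the blank, and 1 and 2 encode the two bits. A tape is two-way infinite and is
  paired with its head position. Tape 0 carries the input; tape 1 is the query tape, and also
  the output tape when the machine computes a function.\<close>

datatype move = GoLeft | Stay | GoRight

type_synonym tape = "(int \<Rightarrow> nat) \<times> int"

type_synonym config = "nat \<times> tape list"

type_synonym lang = "bool list set"

record otm =
  ntapes :: nat
  start_st :: nat
  accept_st :: nat
  query_st :: nat
  yes_st :: nat
  no_st :: nat
  trans :: "((nat \<times> nat list) \<times> (nat \<times> (nat \<times> move) list)) set"

definition wf_otm :: "otm \<Rightarrow> bool" where
  "wf_otm M \<longleftrightarrow> 2 \<le> ntapes M \<and> finite (trans M) \<and>
     (\<forall>((q, rs), (q', acts)) \<in> trans M. length rs = ntapes M \<and> length acts = ntapes M)"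

definition deterministic :: "otm \<Rightarrow> bool" where
  "deterministic M \<longleftrightarrow> single_valued (trans M)"

fun bit_sym :: "bool \<Rightarrow> nat" where
  "bit_sym False = 1"
| "bit_sym True = 2"

fun offset :: "move \<Rightarrow> int" where
  "offset GoLeft = -1"
| "offset Stay = 0"
| "offset GoRight = 1"

fun read :: "tape \<Rightarrow> nat" where
  "read (f, h) = f h"

fun act :: "tape \<Rightarrow> nat \<times> move \<Rightarrow> tape" where
  "act (f, h) (s, m) = (f(h := s), h + offset m)"

definition blank_tape :: tape where
  "blank_tape = ((\<lambda>_. 0), 0)"

definition input_tape :: "bool list \<Rightarrow> tape" where
  "input_tape x =
     ((\<lambda>i. if 0 \<le> i \<and> i < int (length x) then bit_sym (x ! nat i) else 0), 0)"

definition init :: "otm \<Rightarrow> bool list \<Rightarrow> config" where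
  "init M x = (start_st M, input_tape x # replicate (ntapes M - 1) blank_tape)"

text \<open>The word on a tape is the maximal block of bits starting at cell 0, wherever the
  head is.\<close>

definition holds_word :: "tape \<Rightarrow> bool list \<Rightarrow> bool" where
  "holds_word tp w \<longleftrightarrow> (\<forall>i < length w. fst tp (int i) = bit_sym (w ! i)) \<and>
     fst tp (int (length w)) \<notin> range bit_sym"

text \<open>In the query state the table is not consulted: in one step the machine learns
  whether the word on the query tape belongs to the oracle.\<close>

inductive step :: "otm \<Rightarrow> lang \<Rightarrow> config \<Rightarrow> config \<Rightarrow> bool" for M B where
  ordinary: "q \<noteq> query_st M \<Longrightarrow> ((q, map read tps), (q', acts)) \<in> trans M \<Longrightarrow>
     step M B (q, tps) (q', map2 act tps acts)"
| ask: "step M B (query_st M, tps)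
     (if \<exists>w\<in>B. holds_word (tps ! 1) w then yes_st M else no_st M, tps)"

text \<open>\<open>run M B c t k c'\<close>: some computation leads from \<open>c\<close> to \<open>c'\<close> in \<open>t\<close> steps, of which
  \<open>k\<close> are oracle queries.\<close>

inductive run :: "otm \<Rightarrow> lang \<Rightarrow> config \<Rightarrow> nat \<Rightarrow> nat \<Rightarrow> config \<Rightarrow> bool" for M B c where
  run_refl: "run M B c 0 0 c"
| run_step: "run M B c t k c' \<Longrightarrow> step M B c' c'' \<Longrightarrow>
     run M B c (Suc t) (if fst c' = query_st M then Suc k else k) c''"

definition halted :: "otm \<Rightarrow> lang \<Rightarrow> config \<Rightarrow> bool" where
  "halted M B c \<longleftrightarrow> \<not> (\<exists>c'. step M B c c')"

definition language :: "otm \<Rightarrow> lang \<Rightarrow> lang" where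
  "language M B =
     {x. \<exists>t k c. run M B (init M x) t k c \<and> halted M B c \<and> fst c = accept_st M}"

text \<open>The bounds quantify over all partial computations; the time bound thus forces every
  computation path to halt.\<close>

definition poly_time :: "otm \<Rightarrow> lang \<Rightarrow> bool" where
  "poly_time M B \<longleftrightarrow> (\<exists>p :: nat poly. \<forall>x t k c.
     run M B (init M x) t k c \<longrightarrow> t \<le> poly p (length x))"

definition log_queries :: "otm \<Rightarrow> lang \<Rightarrow> bool" where
  "log_queries M B \<longleftrightarrow> (\<exists>q :: nat \<Rightarrow> nat. (\<lambda>n. real (q n)) \<in> O(\<lambda>n. ln (real n)) \<and>
     (\<forall>x t k c. run M B (init M x) t k c \<longrightarrow> k \<le> q (length x)))"

section \<open>Complexity classes\<close>

text \<open>Machines without oracle are machines with the empty oracle, which answers every query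
  negatively.\<close>

definition P_class :: "lang set" where
  "P_class = {language M {} | M. wf_otm M \<and> deterministic M \<and> poly_time M {}}"

definition NP_rel :: "lang \<Rightarrow> lang set" where
  "NP_rel B = {language M B | M. wf_otm M \<and> poly_time M B}"

definition NP :: "lang set" where
  "NP = NP_rel {}"

fun Sigma_p :: "nat \<Rightarrow> lang set" where
  "Sigma_p 0 = P_class"
| "Sigma_p (Suc 0) = NP"
| "Sigma_p (Suc (Suc h)) = (\<Union>B \<in> Sigma_p (Suc h). NP_rel B)"

definition Theta_p :: "nat \<Rightarrow> lang set" where
  "Theta_p h = {language M B | M B. B \<in> Sigma_p (h - 1) \<and>
     wf_otm M \<and> deterministic M \<and> poly_time M B \<and> log_queries M B}"

definition FP :: "(bool list \<Rightarrow> bool list) set" where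
  "FP = {f. \<exists>M. wf_otm M \<and> deterministic M \<and> poly_time M {} \<and>
     (\<forall>x. \<exists>t k c. run M {} (init M x) t k c \<and> halted M {} c \<and> holds_word (snd c ! 1) (f x))}"

text \<open>Hardness under polynomial-time many-one reductions. The set \<open>I\<close> consists of the codes
  of legal inputs of the problem \<open>Q\<close>: a reduction may only produce legal inputs.\<close>

definition hard_for :: "lang set \<Rightarrow> lang \<Rightarrow> lang \<Rightarrow> bool" where
  "hard_for C I Q \<longleftrightarrow> (\<forall>L \<in> C. \<exists>f \<in> FP. \<forall>x. f x \<in> I \<and> (x \<in> L \<longleftrightarrow> f x \<in> Q))"

section \<open>The decision problem\<close>

definition legal_input ::
  "semantics \<Rightarrow> 'a af \<Rightarrow> 'a \<Rightarrow> ('a \<Rightarrow> label) \<Rightarrow> 'a \<Rightarrow> bool" where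
  "legal_input \<sigma> F g L g' \<longleftrightarrow>
     wf_af F \<and> g \<in> args F \<and> L \<in> labellings \<sigma> F \<and> g' \<in> args F"

fun label_code :: "label \<Rightarrow> bool list" where
  "label_code In = [True, False]"
| "label_code Out = [False, True]"
| "label_code Und = [False, False]"

text \<open>Binary code of an input relative to an enumeration \<open>xs\<close> of the arguments: their number
  in unary, the attack matrix, the characteristic vectors of \<open>g\<close> and \<open>g'\<close>, and the labels.
  Names of arguments are not recorded, so inputs with equal codes are isomorphic.\<close>

definition encode ::
  "'a list \<Rightarrow> 'a af \<Rightarrow> 'a \<Rightarrow> ('a \<Rightarrow> label) \<Rightarrow> 'a \<Rightarrow> bool list" where
  "encode xs F g L g' =
     replicate (length xs) True @ [False] @
     concat (map (\<lambda>a. map (\<lambda>b. (a, b) \<in> atts F) xs) xs) @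
     map (\<lambda>a. a = g) xs @ map (\<lambda>a. a = g') xs @
     concat (map (\<lambda>a. label_code (L a)) xs)"

definition CF_CA_inputs :: "semantics \<Rightarrow> lang" where
  "CF_CA_inputs \<sigma> = {encode xs F g L g' | xs (F :: nat af) g L g'.
     distinct xs \<and> set xs = args F \<and> legal_input \<sigma> F g L g'}"

definition CF_CA :: "semantics \<Rightarrow> lang" where
  "CF_CA \<sigma> = {encode xs F g L g' | xs (F :: nat af) g L g'.
     distinct xs \<and> set xs = args F \<and> legal_input \<sigma> F g L g' \<and>
     (\<exists>L' \<in> counterfactuals \<sigma> F g L. L' g' = In)}"

end

theory Submission
  imports Defs
begin

text \<open>Membership: the number of arguments on which a labelling agrees with the given one is doubled
  and increased by one if \<open>g'\<close> is accepted. The best such score among the labellings that differ at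
  \<open>g\<close> is odd iff some counterfactual accepts \<open>g'\<close>, and a binary search finds it with logarithmically
  many queries whether a given score is reached.

  Hardness: computations of nondeterministic machines are described by clauses, and clauses by
  frameworks in which all labellings that differ at \<open>g\<close> accept \<open>g'\<close> or none does, so that the
  distance plays no role. For the second level, a labelling fixes an accepting computation and the
  computations that justify the queries answered by yes; it is preferred without accepting
  \<open>g\<close> only if no choice of the remaining variables refutes a query answered by no.

  Machines are compiled from programs on stacks, and polynomial-time functions are given by
  arithmetic expressions with bounded sums.\<close>

section \<open>Computation trees\<close>

text \<open>A hard instance contains a labelling that the reduction must write down without knowing
  the answer. For \<open>CO\<close> it is that of the empty extension. Otherwise a literal of a
  distinguished variable is added to every clause: making all variables true is then a known
  extension, and changing \<open>g\<close> means giving up this literal or the formula that it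
  satisfies. An answer yes of the oracle has an NP certificate, an answer no has none. So the
  formula for the second level has the form exists-forall: outer variables describe the main
  computation and certificates for the answers yes, inner ones a certificate that refutes one answer
  no. Variables, clauses and arguments are numbers with few digits in a base polynomial in the input
  length, so that attacks are decided by arithmetic on digits. A machine has a single query state;
  therefore the search program contains one query, inside its loop. Guesses have the length of the
  input, which suffices because codes are longer than the sets to be guessed.\<close>

inductive outs :: "otm \<Rightarrow> lang \<Rightarrow> config \<Rightarrow> nat \<Rightarrow> nat \<Rightarrow> config set \<Rightarrow> bool" for M B where
  outs_refl: "outs M B c n k {c}"
| outs_step: "step M B c c0 \<Longrightarrow> (\<And>c'. step M B c c' \<Longrightarrow> outs M B c' n k (G c')) \<Longrightarrow>
     outs M B c (Suc n) (k + of_bool (fst c = query_st M)) (\<Union>c'\<in>{c'. step M B c c'}. G c')"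

lemma outs_mono: "outs M B c n k S \<Longrightarrow> n \<le> n' \<Longrightarrow> k \<le> k' \<Longrightarrow> outs M B c n' k' S"
proof (induction arbitrary: n' k' rule: outs.induct)
  case (outs_refl c n k)
  show ?case by (rule outs.outs_refl)
next
  case (outs_step c c0 n k G)
  obtain n'' where n'': "n' = Suc n''" "n \<le> n''"
    using outs_step.prems(1) by (cases n') auto
  let ?q = "of_bool (fst c = query_st M) :: nat"
  have "outs M B c (Suc n'') ((k' - ?q) + ?q) (\<Union>c'\<in>{c'. step M B c c'}. G c')"
    using outs_step n'' by (intro outs.outs_step) auto
  moreover have "k' - ?q + ?q = k'"
    using outs_step.prems(2) by simp
  ultimately show ?case
    using n'' by simp
qed

text \<open>\<open>outs M B c n k S\<close> describes a computation tree of depth at most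
  \<open>n\<close> with at most \<open>k\<close> queries on a branch and with leaves
  \<open>S\<close>. Leaves need not be halted, so trees can be grafted onto them; this makes
  programs composable. The premise on \<open>c0\<close> keeps a stuck configuration from being an
  inner node without leaves.\<close>

lemma outs_trans:
  assumes "outs M B c n k S" and "\<And>c'. c' \<in> S \<Longrightarrow> outs M B c' n' k' (G c')"
  shows "outs M B c (n + n') (k + k') (\<Union>c'\<in>S. G c')"
  using assms
proof (induction rule: outs.induct)
  case (outs_refl c n k)
  then show ?case by (auto intro: outs_mono)
next
  case (outs_step c c0 n k H)
  have "outs M B c (Suc (n + n')) ((k + k') + of_bool (fst c = query_st M))
    (\<Union>c'\<in>{c'. step M B c c'}. (\<Union>c''\<in>H c'. G c''))"
  proof (rule outs.outs_step)
    fix c'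
    assume "step M B c c'"
    then show "outs M B c' (n + n') (k + k') (\<Union>c''\<in>H c'. G c'')"
      by (rule outs_step.IH) (use outs_step.prems \<open>step M B c c'\<close> in blast)
  qed (rule outs_step.hyps(1))
  then show ?case
    by (simp add: add_ac UN_UN_flatten)
qed

text \<open>\<open>run\<close> grows at its end whereas a tree branches at its root; this rule and
  the next one unfold runs from the front.\<close>

lemma run_cons:
  "run M B c1 t k c' \<Longrightarrow> step M B c c1 \<Longrightarrow>
    run M B c (Suc t) (k + of_bool (fst c = query_st M)) c'"
proof (induction rule: run.induct)
  case run_refl
  then show ?case using run.run_step[OF run.run_refl, of M B c c1] by auto
next
  case (run_step t k c' c'')
  then show ?case using run.run_step[of M B c "Suc t" _ c' c''] by fastforce
qed

lemma run_head:
  assumes "run M B c t k c'"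
  obtains (refl) "t = 0" "k = 0" "c' = c"
  | (step) c1 t' k' where "step M B c c1" "run M B c1 t' k' c'" "t = Suc t'"
      "k = k' + of_bool (fst c = query_st M)"
  using assms
proof (induction arbitrary: thesis rule: run.induct)
  case run_refl
  then show ?case by blast
next
  case (run_step t k c' c'')
  show ?case
  proof (rule run_step.IH)
    assume "t = 0" "k = 0" "c' = c"
    then show thesis
      using run_step.hyps(2) run_step.prems(2)[of c'' 0 0, OF _ run.run_refl] by auto
  next
    fix c1 t' k'
    assume *: "step M B c c1" "run M B c1 t' k' c'" "t = Suc t'"
      "k = k' + of_bool (fst c = query_st M)"
    show thesis
      using run_step.prems(2)[OF *(1) run.run_step[OF *(2) run_step.hyps(2)]] * by auto
  qed
qed

text \<open>A halted leaf cannot be passed. So once all leaves are halted, the tree bounds every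
  partial run, and a halted end of a run is a leaf.\<close>

lemma outs_run:
  "outs M B c n k S \<Longrightarrow> (\<And>c. c \<in> S \<Longrightarrow> halted M B c) \<Longrightarrow> run M B c t j c' \<Longrightarrow>
    t \<le> n \<and> j \<le> k \<and> (halted M B c' \<longrightarrow> c' \<in> S)"
proof (induction arbitrary: t j rule: outs.induct)
  case (outs_refl c n k)
  from outs_refl(2) show ?case
    by (cases rule: run_head) (use outs_refl(1) in \<open>auto simp: halted_def\<close>)
next
  case (outs_step c c0 n k G)
  from outs_step.prems(2) show ?case
  proof (cases rule: run_head)
    case refl
    then show ?thesis using outs_step.hyps(1) unfolding halted_def by blast
  next
    case (step c1 t' k')
    then show ?thesis
      using outs_step.IH[OF step(1) _ step(2)] outs_step.prems(1) by fastforce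
  qed
qed

lemma outs_reach: "outs M B c n k S \<Longrightarrow> c' \<in> S \<Longrightarrow> \<exists>t j. run M B c t j c'"
proof (induction rule: outs.induct)
  case (outs_refl c n k)
  then show ?case by (auto intro: run.run_refl)
next
  case (outs_step c c0 n k G)
  then show ?case by (blast dest: run_cons)
qed

section \<open>Stack programs\<close>

text \<open>\<open>If r v\<close> compares the top symbol of stack \<open>r\<close> with
  \<open>v\<close>: 0 for the empty stack, 1 and 2 for the bits. \<open>While r\<close> runs until
  stack \<open>r\<close> is empty, and \<open>AskIf\<close> asks the oracle for the reversed stack
  1.\<close>

datatype cmd = Skip | Push nat bool | Pop nat | Guess nat | Seq cmd cmd (infixr ";;" 60)
  | If nat nat cmd cmd | While nat cmd | AskIf cmd cmd

type_synonym st = "nat \<Rightarrow> bool list"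

definition top_sym :: "bool list \<Rightarrow> nat" where
  "top_sym xs = (case xs of [] \<Rightarrow> 0 | b # _ \<Rightarrow> bit_sym b)"

lemma top_sym_simps [simp]: "top_sym [] = 0" "top_sym (b # xs) = bit_sym b"
  by (simp_all add: top_sym_def)

lemma bit_sym_simps [simp]: "bit_sym b \<noteq> 0" "bit_sym b \<le> 2" "bit_sym b = 2 \<longleftrightarrow> b"
  "bit_sym b = Suc 0 \<longleftrightarrow> \<not> b" "bit_sym b = bit_sym b' \<longleftrightarrow> b = b'"
  by (cases b; cases b'; simp)+

lemma top_sym_le [simp]: "top_sym xs \<le> 2" and top_sym_0 [simp]: "top_sym xs = 0 \<longleftrightarrow> xs = []"
  by (cases xs; simp)+

text \<open>The set of outcomes is exact, the numbers of steps and queries are upper bounds. The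
  costs are those of the compiled code: \<open>Push\<close> moves the head and then writes,
  \<open>If\<close> adds the test and the jump behind the other branch.\<close>

inductive exec :: "lang \<Rightarrow> cmd \<Rightarrow> st \<Rightarrow> nat \<Rightarrow> nat \<Rightarrow> st set \<Rightarrow> bool" for B where
  exec_Skip: "exec B Skip s n k {s}"
| exec_Push: "2 \<le> n \<Longrightarrow> exec B (Push r b) s n k {s(r := b # s r)}"
| exec_Pop: "1 \<le> n \<Longrightarrow> s r \<noteq> [] \<Longrightarrow> exec B (Pop r) s n k {s(r := tl (s r))}"
| exec_Guess: "2 \<le> n \<Longrightarrow> exec B (Guess r) s n k {s(r := False # s r), s(r := True # s r)}"
| exec_Seq: "exec B c s n k S \<Longrightarrow> (\<And>s'. s' \<in> S \<Longrightarrow> exec B d s' n' k' (G s')) \<Longrightarrow>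
    n + n' \<le> N \<Longrightarrow> k + k' \<le> K \<Longrightarrow> exec B (c ;; d) s N K (\<Union>s'\<in>S. G s')"
| exec_If: "exec B (if top_sym (s r) = v then c else d) s n k S \<Longrightarrow> n + 2 \<le> N \<Longrightarrow> 
    exec B (If r v c d) s N k S"
| exec_While_end: "s r = [] \<Longrightarrow> 1 \<le> n \<Longrightarrow> exec B (While r c) s n k {s}"
| exec_While_step: "s r \<noteq> [] \<Longrightarrow> exec B c s n k S \<Longrightarrow>
    (\<And>s'. s' \<in> S \<Longrightarrow> exec B (While r c) s' n' k' (G s')) \<Longrightarrow> n + n' + 2 \<le> N \<Longrightarrow> k + k' \<le> K \<Longrightarrow>
    exec B (While r c) s N K (\<Union>s'\<in>S. G s')"
| exec_AskIf: "exec B (if rev (s 1) \<in> B then c else d) s n k S \<Longrightarrow> n + 2 \<le> N \<Longrightarrow> k + 1 \<le> K \<Longrightarrow>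
    exec B (AskIf c d) s N K S"

section \<open>Compilation of programs to transition tables\<close>

fun csize :: "cmd \<Rightarrow> nat" where
  "csize Skip = 0"
| "csize (Push r b) = 2"
| "csize (Pop r) = 1"
| "csize (Guess r) = 2"
| "csize (c ;; d) = csize c + csize d"
| "csize (If r v c d) = csize c + csize d + 2"
| "csize (While r c) = csize c + 2"
| "csize (AskIf c d) = csize c + csize d + 2"

fun regs :: "cmd \<Rightarrow> nat set" where
  "regs Skip = {}"
| "regs (Push r b) = {r}"
| "regs (Pop r) = {r}"
| "regs (Guess r) = {r}"
| "regs (c ;; d) = regs c \<union> regs d"
| "regs (If r v c d) = {r} \<union> regs c \<union> regs d"
| "regs (While r c) = {r} \<union> regs c"
| "regs (AskIf c d) = regs c \<union> regs d"

lemma finite_regs: "finite (regs c)"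
  by (induction c) auto

type_synonym action = "nat \<times> (nat \<times> move) list"

definition stay :: "nat list \<Rightarrow> (nat \<times> move) list" where
  "stay rs = map (\<lambda>v. (v, Stay)) rs"

definition upd :: "nat \<Rightarrow> nat \<Rightarrow> move \<Rightarrow> nat list \<Rightarrow> (nat \<times> move) list" where
  "upd r v m rs = (stay rs)[r := (v, m)]"

definition forward :: "nat \<Rightarrow> move" where
  "forward r = (if r = 0 then GoLeft else GoRight)"

definition backward :: "nat \<Rightarrow> move" where
  "backward r = (if r = 0 then GoRight else GoLeft)"

definition reads :: "nat \<Rightarrow> nat list set" where
  "reads K = {rs. set rs \<subseteq> {..2} \<and> length rs = K}"

definition instr :: "nat \<Rightarrow> nat \<Rightarrow> (nat list \<Rightarrow> action set) \<Rightarrow> ((nat \<times> nat list) \<times> action) set" where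
  "instr K q f = (\<Union>rs\<in>reads K. (\<lambda>x. ((q, rs), x)) ` f rs)"

lemma instr_iff: "((q', rs), x) \<in> instr K q f \<longleftrightarrow> q' = q \<and> rs \<in> reads K \<and> x \<in> f rs"
  by (auto simp: instr_def)

text \<open>The code lives in the states from \<open>a\<close> to \<open>a + csize c - 1\<close> and
  is left for \<open>a + csize c\<close>. \<open>AskIf\<close> puts no entry at \<open>a\<close>:
  this is the query state, where the table is not consulted.\<close>

fun compile :: "nat \<Rightarrow> cmd \<Rightarrow> nat \<Rightarrow> ((nat \<times> nat list) \<times> action) set" where
  "compile K Skip a = {}"
| "compile K (Push r b) a = instr K a (\<lambda>rs. {(a + 1, upd r (rs ! r) (forward r) rs)}) \<union>
     instr K (a + 1) (\<lambda>rs. {(a + 2, upd r (bit_sym b) Stay rs)})"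
| "compile K (Pop r) a = instr K a (\<lambda>rs. {(a + 1, upd r 0 (backward r) rs)})"
| "compile K (Guess r) a = instr K a (\<lambda>rs. {(a + 1, upd r (rs ! r) (forward r) rs)}) \<union>
     instr K (a + 1) (\<lambda>rs. {(a + 2, upd r 1 Stay rs), (a + 2, upd r 2 Stay rs)})"
| "compile K (c ;; d) a = compile K c a \<union> compile K d (a + csize c)"
| "compile K (If r v c d) a =
     instr K a (\<lambda>rs. {(if rs ! r = v then a + 1 else a + 2 + csize c, stay rs)}) \<union>
     compile K c (a + 1) \<union> instr K (a + 1 + csize c) (\<lambda>rs. {(a + 2 + csize c + csize d, stay rs)}) \<union>
     compile K d (a + 2 + csize c)"
| "compile K (While r c) a =
     instr K a (\<lambda>rs. {(if rs ! r \<noteq> 0 then a + 1 else a + 2 + csize c, stay rs)}) \<union>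
     compile K c (a + 1) \<union> instr K (a + 1 + csize c) (\<lambda>rs. {(a, stay rs)})"
| "compile K (AskIf c d) a =
     compile K c (a + 1) \<union> instr K (a + 1 + csize c) (\<lambda>rs. {(a + 2 + csize c + csize d, stay rs)}) \<union>
     compile K d (a + 2 + csize c)"

text \<open>Where the query state may lie: at the \<open>AskIf\<close>, whose branches must start at
  the answer states, and at no other state of the code.\<close>

fun asks :: "otm \<Rightarrow> cmd \<Rightarrow> nat \<Rightarrow> bool" where
  "asks M Skip a = True"
| "asks M (Push r b) a = (query_st M \<notin> {a, a + 1})"
| "asks M (Pop r) a = (query_st M \<noteq> a)"
| "asks M (Guess r) a = (query_st M \<notin> {a, a + 1})"
| "asks M (c ;; d) a = (asks M c a \<and> asks M d (a + csize c))"
| "asks M (If r v c d) a =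
     (query_st M \<notin> {a, a + 1 + csize c} \<and> asks M c (a + 1) \<and> asks M d (a + 2 + csize c))"
| "asks M (While r c) a = (query_st M \<notin> {a, a + 1 + csize c} \<and> asks M c (a + 1))"
| "asks M (AskIf c d) a =
     (query_st M = a \<and> yes_st M = a + 1 \<and> no_st M = a + 2 + csize c \<and>
      asks M c (a + 1) \<and> asks M d (a + 2 + csize c))"

fun ask_free :: "cmd \<Rightarrow> bool" where
  "ask_free (AskIf c d) = False"
| "ask_free (c ;; d) = (ask_free c \<and> ask_free d)"
| "ask_free (If r v c d) = (ask_free c \<and> ask_free d)"
| "ask_free (While r c) = ask_free c"
| "ask_free c = True"

fun guess_free :: "cmd \<Rightarrow> bool" where
  "guess_free (Guess r) = False"
| "guess_free (AskIf c d) = (guess_free c \<and> guess_free d)"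
| "guess_free (c ;; d) = (guess_free c \<and> guess_free d)"
| "guess_free (If r v c d) = (guess_free c \<and> guess_free d)"
| "guess_free (While r c) = guess_free c"
| "guess_free c = True"

lemma asks_ask_free:
  "ask_free c \<Longrightarrow> query_st M \<notin> {a..<a + csize c} \<Longrightarrow> asks M c a"
  by (induction c arbitrary: a) auto

lemma compile_source: "((q, rs), x) \<in> compile K c a \<Longrightarrow> a \<le> q \<and> q < a + csize c \<and> rs \<in> reads K"
  by (induction c arbitrary: a) (force simp: instr_iff)+

lemma compile_outside [simp]:
  "q < a \<Longrightarrow> ((q, rs), x) \<notin> compile K c a" "a + csize c \<le> q \<Longrightarrow> ((q, rs), x) \<notin> compile K c a"
  by (auto dest: compile_source)

lemma finite_reads: "finite (reads K)"
  unfolding reads_def by (rule finite_lists_length_eq) simp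

lemma finite_compile: "finite (compile K c a)"
  by (induction c arbitrary: a) (auto simp: instr_def finite_reads)

lemma compile_length: "((q, rs), (q', acts)) \<in> compile K c a \<Longrightarrow> length acts = K"
  by (induction c arbitrary: a) (auto simp: instr_iff upd_def stay_def reads_def)

lemma compile_single_valued:
  assumes "guess_free c" "((q, rs), x) \<in> compile K c a" "((q, rs), y) \<in> compile K c a"
  shows "x = y"
  using assms
  by (induction c arbitrary: a) (force simp: instr_iff dest: compile_source)+

text \<open>The table is fixed on the states of the block only, so the property passes to
  subprograms and the rest of the machine stays free.\<close>

definition block :: "otm \<Rightarrow> cmd \<Rightarrow> nat \<Rightarrow> bool" where
  "block M c a \<longleftrightarrow> (\<forall>q rs x. a \<le> q \<and> q < a + csize c \<longrightarrow>
     (((q, rs), x) \<in> trans M \<longleftrightarrow> ((q, rs), x) \<in> compile (ntapes M) c a))"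


lemma block_instr:
  assumes "block M c a"
  shows "c = Push r b \<Longrightarrow> ((a, rs), x) \<in> trans M \<longleftrightarrow>
      rs \<in> reads (ntapes M) \<and> x = (a + 1, upd r (rs ! r) (forward r) rs)"
    and "c = Push r b \<Longrightarrow> ((Suc a, rs), x) \<in> trans M \<longleftrightarrow>
      rs \<in> reads (ntapes M) \<and> x = (a + 2, upd r (bit_sym b) Stay rs)"
    and "c = Pop r \<Longrightarrow> ((a, rs), x) \<in> trans M \<longleftrightarrow>
      rs \<in> reads (ntapes M) \<and> x = (a + 1, upd r 0 (backward r) rs)"
    and "c = Guess r \<Longrightarrow> ((a, rs), x) \<in> trans M \<longleftrightarrow>
      rs \<in> reads (ntapes M) \<and> x = (a + 1, upd r (rs ! r) (forward r) rs)"
    and "c = Guess r \<Longrightarrow> ((Suc a, rs), x) \<in> trans M \<longleftrightarrow>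
      rs \<in> reads (ntapes M) \<and> x \<in> {(a + 2, upd r 1 Stay rs), (a + 2, upd r 2 Stay rs)}"
    and "c = If r v d e \<Longrightarrow> ((a, rs), x) \<in> trans M \<longleftrightarrow>
      rs \<in> reads (ntapes M) \<and> x = (if rs ! r = v then a + 1 else a + 2 + csize d, stay rs)"
    and "c = If r v d e \<or> c = AskIf d e \<Longrightarrow> ((a + 1 + csize d, rs), x) \<in> trans M \<longleftrightarrow>
      rs \<in> reads (ntapes M) \<and> x = (a + 2 + csize d + csize e, stay rs)"
    and "c = While r d \<Longrightarrow> ((a, rs), x) \<in> trans M \<longleftrightarrow>
      rs \<in> reads (ntapes M) \<and> x = (if rs ! r \<noteq> 0 then a + 1 else a + 2 + csize d, stay rs)"
    and "c = While r d \<Longrightarrow> ((a + 1 + csize d, rs), x) \<in> trans M \<longleftrightarrow>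
      rs \<in> reads (ntapes M) \<and> x = (a, stay rs)"
  using assms[unfolded block_def, rule_format, of a rs x]
    assms[unfolded block_def, rule_format, of "Suc a" rs x]
    assms[unfolded block_def, rule_format, of "a + 1 + csize d" rs x]
  by (auto simp: instr_iff dest: compile_source)

lemma block_sub:
  assumes "block M c a"
  shows "c = d ;; e \<Longrightarrow> block M d a \<and> block M e (a + csize d)"
    and "c = If r v d e \<or> c = AskIf d e \<Longrightarrow> block M d (a + 1) \<and> block M e (a + 2 + csize d)"
    and "c = While r d \<Longrightarrow> block M d (a + 1)"
  using assms by (auto simp: block_def instr_iff)

subsection \<open>Stacks as tapes\<close>

text \<open>The stack on tape 0 has its top on the left, so that the input is a stack with the first
  bit on top; the other stacks grow to the right, so that the query word is the reversed stack.\<close>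

definition dir :: "nat \<Rightarrow> int" where
  "dir r = (if r = 0 then -1 else 1)"

text \<open>The head of an empty stack stands one cell before its origin. Fresh tapes have their
  head at cell 0, hence the origin 1; the query word must start in cell 0, hence the origin 0 of
  stack 1, whose head is moved left once at the beginning. With \<open>z\<close> the input length,
  the first input bit, on top of stack 0, lies in cell 0.\<close>

definition org :: "int \<Rightarrow> nat \<Rightarrow> int" where
  "org z r = (if r = 0 then z - 1 else if r = 1 then 0 else 1)"

definition tape_of :: "int \<Rightarrow> nat \<Rightarrow> bool list \<Rightarrow> tape" where
  "tape_of z r xs =
     ((\<lambda>p. let i = (p - org z r) * dir r in
        if 0 \<le> i \<and> i < int (length xs) then bit_sym (rev xs ! nat i) else 0),
      org z r + dir r * (int (length xs) - 1))"

definition tapes :: "nat \<Rightarrow> int \<Rightarrow> st \<Rightarrow> tape list" where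
  "tapes K z s = map (\<lambda>r. tape_of z r (s r)) [0..<K]"

lemma dir_simps [simp]: "dir r * dir r = 1" "dir r \<noteq> 0" "offset (forward r) = dir r"
  "offset (backward r) = - dir r"
  by (auto simp: dir_def forward_def backward_def)

lemma dir_mult: "dir r * (dir r * x) = x"
  by (auto simp: dir_def)

lemma read_tape_of [simp]: "read (tape_of z r xs) = top_sym xs"
proof (cases xs)
  case Nil
  then show ?thesis by (simp add: tape_of_def)
next
  case (Cons b ys)
  then show ?thesis
    by (simp add: tape_of_def mult.commute dir_mult nth_append)
qed

lemma read_moved [simp]: "read (act (tape_of z r xs) (v, forward r)) = 0"
  by (auto simp: tape_of_def Let_def algebra_simps dir_mult)

definition cells :: "int \<Rightarrow> nat \<Rightarrow> bool list \<Rightarrow> int \<Rightarrow> nat" where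
  "cells z r xs p = (let i = (p - org z r) * dir r in
     if 0 \<le> i \<and> i < int (length xs) then bit_sym (rev xs ! nat i) else 0)"

lemma tape_of_cells: "tape_of z r xs = (cells z r xs, org z r + dir r * (int (length xs) - 1))"
  by (simp add: tape_of_def cells_def[abs_def])

lemma cells_Cons:
  "cells z r (b # xs) = (cells z r xs)(org z r + dir r * int (length xs) := bit_sym b)"
proof
  fix p
  define i where "i = (p - org z r) * dir r"
  have p: "p = org z r + dir r * i"
    by (simp add: i_def mult.commute[of "p - org z r"] dir_mult)
  show "cells z r (b # xs) p = ((cells z r xs)(org z r + dir r * int (length xs) := bit_sym b)) p"
    unfolding p by (auto simp: cells_def mult.commute[of "dir r * i"] dir_mult nth_append)
qed

lemma cells_end: "cells z r xs (org z r + dir r * int (length xs)) = 0"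
  by (simp add: cells_def mult.commute[of "dir r * int (length xs)"] dir_mult)

text \<open>The first action writes back the symbol just read, so that only the head moves; the
  second one fills the blank cell next to the top.\<close>

lemma tape_of_push:
  "act (act (tape_of z r xs) (top_sym xs, forward r)) (bit_sym b, Stay) = tape_of z r (b # xs)"
proof -
  have "(cells z r xs)(org z r + dir r * (int (length xs) - 1) := top_sym xs) = cells z r xs"
    using read_tape_of[of z r xs] by (simp add: tape_of_cells fun_upd_idem)
  moreover have "org z r + dir r * (int (length xs) - 1) + dir r = org z r + dir r * int (length xs)"
    by (simp add: algebra_simps)
  ultimately show ?thesis
    by (simp only: tape_of_cells cells_Cons act.simps dir_simps) simp
qed

lemma tape_of_pop:
  assumes "xs \<noteq> []"
  shows "act (tape_of z r xs) (0, backward r) = tape_of z r (tl xs)"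
proof -
  obtain b ys where xs: "xs = b # ys"
    using assms by (cases xs) auto
  have "(cells z r ys)(org z r + dir r * int (length ys) := 0) = cells z r ys"
    using cells_end by (simp add: fun_upd_idem)
  moreover have "org z r + dir r * int (length ys) - dir r = org z r + dir r * (int (length ys) - 1)"
    by (simp add: algebra_simps)
  ultimately show ?thesis
    by (simp add: tape_of_cells cells_Cons xs)
qed

text \<open>The top symbol can be read off the tape, and popping acts on the tape, so the stack is
  recovered bit by bit.\<close>

lemma tape_of_inj: "tape_of z r xs = tape_of z r ys \<Longrightarrow> xs = ys"
proof (induction xs arbitrary: ys)
  case Nil
  have "top_sym [] = top_sym ys"
    using Nil read_tape_of by metis
  then show ?case by (cases ys) auto
next
  case (Cons b xs)
  have "top_sym (b # xs) = top_sym ys"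
    using Cons.prems read_tape_of by metis
  then obtain ys' where ys: "ys = b # ys'"
    by (cases ys) auto
  then have "tape_of z r xs = tape_of z r ys'"
    using Cons.prems tape_of_pop[of "b # xs" z r] tape_of_pop[of ys z r] by simp
  then show ?case
    using Cons.IH ys by simp
qed

lemma holds_word_tape_of: "holds_word (tape_of z 1 xs) w \<longleftrightarrow> w = rev xs"
proof -
  have cell: "fst (tape_of z (Suc 0) xs) (int i) = (if i < length xs then bit_sym (rev xs ! i) else 0)" for i
    by (simp add: tape_of_def org_def dir_def)
  have r: "range bit_sym = {1, 2}"
    by (simp add: UNIV_bool insert_commute)
  show ?thesis
  proof
    assume h: "holds_word (tape_of z 1 xs) w"
    have "\<not> length w < length xs"
      using h by (auto simp: holds_word_def cell)
    moreover have "\<not> length xs < length w"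
    proof
      assume "length xs < length w"
      then have "fst (tape_of z 1 xs) (int (length xs)) = bit_sym (w ! length xs)"
        using h by (simp add: holds_word_def)
      then show False by (simp add: cell)
    qed
    ultimately have "length w = length xs" by simp
    then show "w = rev xs"
      using h by (auto simp: holds_word_def cell intro!: nth_equalityI)
  next
    assume "w = rev xs"
    then show "holds_word (tape_of z 1 xs) w"
      by (simp add: holds_word_def cell r)
  qed
qed

lemma length_tapes [simp]: "length (tapes K z s) = K"
  by (simp add: tapes_def)

lemma nth_tapes [simp]: "r < K \<Longrightarrow> tapes K z s ! r = tape_of z r (s r)"
  by (simp add: tapes_def)

lemma tapes_upd: "r < K \<Longrightarrow> (tapes K z s)[r := tape_of z r xs] = tapes K z (s(r := xs))"
  by (rule nth_equalityI) (auto simp: nth_list_update)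

lemma act_read_Stay: "act tp (read tp, Stay) = tp"
  by (cases tp) (simp add: fun_upd_idem)

lemma act_stay: "map2 act tps (stay (map read tps)) = tps"
  by (rule nth_equalityI) (auto simp: stay_def act_read_Stay)

lemma act_upd:
  assumes "r < length tps"
  shows "map2 act tps (upd r v m (map read tps)) = tps[r := act (tps ! r) (v, m)]"
proof (rule nth_equalityI)
  fix i
  assume "i < length (map2 act tps (upd r v m (map read tps)))"
  then have i: "i < length tps"
    by (simp add: upd_def stay_def)
  show "map2 act tps (upd r v m (map read tps)) ! i = tps[r := act (tps ! r) (v, m)] ! i"
    using i by (cases "i = r") (auto simp: upd_def stay_def act_read_Stay)
qed (simp add: upd_def stay_def)

lemma map_read_tapes: "map read (tapes K z s) \<in> reads K"
  by (auto simp: reads_def tapes_def)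

lemma map_read_upd: 
  "map read tps \<in> reads K \<Longrightarrow> read tp \<le> 2 \<Longrightarrow> map read (tps[r := tp]) \<in> reads K"
  unfolding reads_def map_update using set_update_subset_insert[of "map read tps" r "read tp"] by auto

section \<open>Simulation of programs by machines\<close>

lemma step_ordinary:
  assumes "q \<noteq> query_st M"
  shows "step M B (q, tps) c' \<longleftrightarrow>
    (\<exists>q' acts. ((q, map read tps), (q', acts)) \<in> trans M \<and> c' = (q', map2 act tps acts))"
  using assms by (auto simp: step.simps)

lemma outs_ordinary:
  assumes "q \<noteq> query_st M" and "\<And>x. ((q, map read tps), x) \<in> trans M \<longleftrightarrow> x = (q', acts)"
    and "outs M B (q', map2 act tps acts) n k S"
  shows "outs M B (q, tps) (Suc n) k S"
proof -
  have st: "step M B (q, tps) c' \<longleftrightarrow> c' = (q', map2 act tps acts)" for c'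
    unfolding step_ordinary[OF assms(1)] assms(2) by simp
  have "outs M B (q, tps) (Suc n) (k + of_bool (fst (q, tps) = query_st M))
      (\<Union>c'\<in>{c'. step M B (q, tps) c'}. (\<lambda>_. S) c')"
  proof (rule outs_step)
    show "step M B (q, tps) (q', map2 act tps acts)"
      unfolding st by (rule refl)
    show "outs M B c' n k S" if "step M B (q, tps) c'" for c'
      using that assms(3) unfolding st by simp
  qed
  moreover have "{c'. step M B (q, tps) c'} = {(q', map2 act tps acts)}"
    unfolding st by simp
  ultimately show ?thesis
    using assms(1) by simp
qed

lemma exec_support:
  "exec B c s n k S \<Longrightarrow> r \<notin> regs c \<Longrightarrow> s' \<in> S \<Longrightarrow> s' r = s r"
  by (induction arbitrary: s' rule: exec.induct) (fastforce split: if_splits)+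

lemma tapes_inj:
  assumes "tapes K z s = tapes K z s'" and "\<And>r. K \<le> r \<Longrightarrow> s r = s' r"
  shows "s = s'"
proof
  fix r
  show "s r = s' r"
  proof (cases "r < K")
    case True
    then have "tape_of z r (s r) = tape_of z r (s' r)"
      using assms(1) nth_tapes[of r K z] by metis
    then show ?thesis by (rule tape_of_inj)
  qed (use assms(2) in simp)
qed

text \<open>Trees continue from configurations, executions from stack states. The two match because
  a program changes only stacks that have a tape, and a tape determines its stack.\<close>

lemma inj_on_tapes:
  assumes "exec B c s n k S" "regs c \<subseteq> {..<K}"
  shows "inj_on (\<lambda>s'. (b, tapes K z s')) S"
proof (rule inj_onI)
  fix x y
  assume xy: "x \<in> S" "y \<in> S" "(b, tapes K z x) = (b, tapes K z y)"
  have "x r = y r" if "K \<le> r" for r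
  proof -
    have "r \<notin> regs c" using assms(2) that by auto
    then show ?thesis using exec_support[OF assms(1)] xy by metis
  qed
  then show "x = y"
    using xy tapes_inj[of K z x y] by simp
qed

lemma outs_trans_image:
  assumes "outs M B c n k (f ` S)" "inj_on f S" "\<And>s. s \<in> S \<Longrightarrow> outs M B (f s) n' k' (h ` G s)"
  shows "outs M B c (n + n') (k + k') (h ` (\<Union>s\<in>S. G s))"
proof -
  have "outs M B c (n + n') (k + k') (\<Union>c'\<in>f ` S. h ` G (inv_into S f c'))"
    using assms by (intro outs_trans[OF assms(1)]) auto
  also have "(\<Union>c'\<in>f ` S. h ` G (inv_into S f c')) = h ` (\<Union>s\<in>S. G s)"
    using assms(2) by auto
  finally show ?thesis .
qed

text \<open>Induction on the execution: basic commands are traced through their table entries, and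
  composite commands graft the trees of their parts.\<close>

theorem compile_correct:
  assumes "exec B c s n k S" "block M c a" "asks M c a" "regs c \<subseteq> {..<ntapes M}" "2 \<le> ntapes M"
  shows "outs M B (a, tapes (ntapes M) z s) n k ((\<lambda>s'. (a + csize c, tapes (ntapes M) z s')) ` S)"
  using assms
proof (induction arbitrary: a rule: exec.induct)
  case (exec_Skip s n k)
  then show ?case by (simp add: outs_refl)
next
  case (exec_Push n r b s k)
  let ?K = "ntapes M" and ?tp = "act (tape_of z r (s r)) (top_sym (s r), forward r)"
  let ?tps = "(tapes ?K z s)[r := ?tp]"
  have r: "r < ?K" using exec_Push by simp
  have rd: "map read ?tps \<in> reads ?K"
    by (rule map_read_upd[OF map_read_tapes]) simp
  let ?S = "{(a + 2, tapes ?K z (s(r := b # s r)))}"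
  have "outs M B (a + 2, map2 act ?tps (upd r (bit_sym b) Stay (map read ?tps))) (n - 2) k
      {(a + 2, tapes ?K z (s(r := b # s r)))}"
    using r by (simp add: act_upd tape_of_push tapes_upd outs_refl)
  then have "outs M B (Suc a, ?tps) (Suc (n - 2)) k ?S"
    using exec_Push rd
    by - (rule outs_ordinary[where q' = "a + 2" and acts = "upd r (bit_sym b) Stay (map read ?tps)"],
        auto simp: block_instr(2))
  then have "outs M B (a, tapes ?K z s) (Suc (Suc (n - 2))) k ?S"
    using exec_Push r
    by - (rule outs_ordinary[where q' = "Suc a" and
          acts = "upd r (top_sym (s r)) (forward r) (map read (tapes ?K z s))"],
        auto simp: block_instr(1) map_read_tapes act_upd)
  moreover have "Suc (Suc (n - 2)) = n"
    using exec_Push.hyps by simp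
  ultimately show ?case
    by (simp add: fun_upd_def)
next
  case (exec_Pop n s r k)
  let ?K = "ntapes M"
  have r: "r < ?K" using exec_Pop by simp
  have "outs M B (a, tapes ?K z s) (Suc 0) k {(a + 1, tapes ?K z (s(r := tl (s r))))}"
    using exec_Pop r
    by - (rule outs_ordinary[where q' = "a + 1" and
          acts = "upd r 0 (backward r) (map read (tapes ?K z s))"],
        auto simp: block_instr(3) map_read_tapes act_upd tape_of_pop tapes_upd outs_refl)
  from outs_mono[OF this exec_Pop.hyps(1)[simplified One_nat_def] order.refl]
  show ?case by (simp add: fun_upd_def)
next
  case (exec_Guess n r s k)
  let ?K = "ntapes M" and ?tp = "act (tape_of z r (s r)) (top_sym (s r), forward r)"
  let ?tps = "(tapes ?K z s)[r := ?tp]"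
  let ?c = "\<lambda>b. (a + 2, tapes ?K z (s(r := b # s r)))"
  have r: "r < ?K" using exec_Guess by simp
  have rd: "map read ?tps \<in> reads ?K"
    by (rule map_read_upd[OF map_read_tapes]) simp
  have e: "map2 act ?tps (upd r (bit_sym b) Stay (map read ?tps)) = tapes ?K z (s(r := b # s r))" for b
    using r by (simp add: act_upd tape_of_push tapes_upd)
  have st: "step M B (Suc a, ?tps) c' \<longleftrightarrow> c' \<in> {?c False, ?c True}" for c'
  proof -
    have "((Suc a, map read ?tps), x) \<in> trans M \<longleftrightarrow>
      x = (a + 2, upd r (bit_sym False) Stay (map read ?tps)) \<or>
      x = (a + 2, upd r (bit_sym True) Stay (map read ?tps))" for x
      using block_instr(5)[OF exec_Guess.prems(1) refl, of "map read ?tps" x] rd by auto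
    moreover have "Suc a \<noteq> query_st M"
      using exec_Guess.prems(2) by simp
    ultimately show ?thesis
      by (simp add: step_ordinary e conj_disj_distribR ex_disj_distrib del: bit_sym.simps map_update)
  qed
  have "outs M B (Suc a, ?tps) (Suc (n - 2)) (k + of_bool (fst (Suc a, ?tps) = query_st M))
      (\<Union>c'\<in>{c'. step M B (Suc a, ?tps) c'}. {c'})"
  proof (rule outs_step)
    show "step M B (Suc a, ?tps) (?c False)"
      unfolding st by simp
  qed (rule outs_refl)
  also have "(\<Union>c'\<in>{c'. step M B (Suc a, ?tps) c'}. {c'}) = {?c False, ?c True}"
    unfolding st by blast
  finally have "outs M B (Suc a, ?tps) (Suc (n - 2)) k {?c False, ?c True}"
    using exec_Guess by simp
  then have "outs M B (a, tapes ?K z s) (Suc (Suc (n - 2))) k {?c False, ?c True}"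
    using exec_Guess r
    by - (rule outs_ordinary[where q' = "Suc a" and
          acts = "upd r (top_sym (s r)) (forward r) (map read (tapes ?K z s))"],
        auto simp: block_instr(4) map_read_tapes act_upd)
  moreover have "Suc (Suc (n - 2)) = n"
    using exec_Guess.hyps by simp
  ultimately show ?case
    by (simp add: fun_upd_def)
next
  case (exec_Seq c s n k S d n' k' G N K a)
  let ?c = "\<lambda>b s'. (b, tapes (ntapes M) z s')"
  note b = block_sub(1)[OF exec_Seq.prems(1) refl]
  have 1: "outs M B (?c a s) n k (?c (a + csize c) ` S)"
    using exec_Seq b by auto
  have 2: "outs M B (?c (a + csize c) s') n' k' (?c (a + csize c + csize d) ` G s')" if "s' \<in> S" for s'
    using exec_Seq b that by auto
  have "inj_on (?c (a + csize c)) S"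
    by (rule inj_on_tapes[OF exec_Seq.hyps(1)]) (use exec_Seq.prems(3) in simp)
  from outs_trans_image[OF 1 this 2]
  have "outs M B (?c a s) (n + n') (k + k') (?c (a + csize (c ;; d)) ` (\<Union>s'\<in>S. G s'))"
    by (simp add: add.assoc)
  then show ?case
    using exec_Seq.hyps by (auto elim: outs_mono)
next
  case (exec_If s r v c d n k S N)
  let ?c = "\<lambda>b s'. (b, tapes (ntapes M) z s')"
  let ?e = "if top_sym (s r) = v then c else d" 
  let ?b = "if top_sym (s r) = v then a + 1 else a + 2 + csize c"
  let ?f = "a + 2 + csize c + csize d"
  have r: "r < ntapes M" using exec_If by simp
  note b = block_sub(2)[OF exec_If.prems(1) disjI1[OF refl]]
  have 1: "outs M B (?c ?b s) n k (?c (?b + csize ?e) ` S)"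
    using exec_If b by (auto split: if_splits)
  \<comment> \<open>A then-branch ends before the jump over the else-branch, an else-branch already
    at the exit; one step covers both cases.\<close>
  have 2: "outs M B (?c (?b + csize ?e) s') 1 0 {?c ?f s'}" for s'
  proof (cases "top_sym (s r) = v")
    case True
    have "outs M B (?c (a + 1 + csize c) s') (Suc 0) 0 {?c ?f s'}"
      using exec_If.prems
      by - (rule outs_ordinary[where q' = ?f and acts = "stay (map read (tapes (ntapes M) z s'))"],
        auto simp: block_instr(7)[OF exec_If.prems(1), simplified] map_read_tapes act_stay outs_refl)
    then show ?thesis using True by simp
  qed (auto simp: add_ac intro: outs_refl)
  have "outs M B (?c ?b s) (n + 1) (k + 0) (\<Union>c'\<in>?c (?b + csize ?e) ` S. {(?f, snd c')})"
    using 2 by (intro outs_trans[OF 1]) auto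
  also have "(\<Union>c'\<in>?c (?b + csize ?e) ` S. {(?f, snd c')}) = ?c ?f ` S"
    by auto
  finally have "outs M B (?c a s) (Suc (n + 1)) k (?c ?f ` S)"
    using exec_If.prems r
    by - (rule outs_ordinary[where q' = ?b and acts = "stay (map read (tapes (ntapes M) z s))"],
        auto simp: block_instr(6)[OF exec_If.prems(1) refl] map_read_tapes act_stay)
  then show ?case
    using exec_If.hyps by (auto elim!: outs_mono simp: add_ac)
next
  case (exec_While_end s r n c k)
  let ?c = "\<lambda>b s'. (b, tapes (ntapes M) z s')"
  have r: "r < ntapes M" using exec_While_end by simp
  have "outs M B (?c a s) (Suc (n - 1)) k {?c (a + csize (While r c)) s}"
    using exec_While_end r
    by - (rule outs_ordinary[where q' = "a + csize (While r c)" and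
          acts = "stay (map read (tapes (ntapes M) z s))"],
        auto simp: block_instr(8)[OF exec_While_end.prems(1) refl] map_read_tapes act_stay outs_refl)
  then show ?case
    using exec_While_end.hyps by simp
next
  case (exec_While_step s r c n k S n' k' G N K)
  let ?c = "\<lambda>b s'. (b, tapes (ntapes M) z s')"
  let ?f = "a + csize (While r c)"
  have r: "r < ntapes M" using exec_While_step by simp
  note b = block_sub(3)[OF exec_While_step.prems(1) refl]
  have 1: "outs M B (?c (Suc a) s) n k (?c (a + 1 + csize c) ` S)"
    using exec_While_step.IH(1)[of "Suc a"] exec_While_step.prems b by simp
  have 2: "outs M B (?c (a + 1 + csize c) s') (Suc n') k' (?c ?f ` G s')" if "s' \<in> S" for s'
    using exec_While_step.prems exec_While_step.IH(2)[OF that]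
    by - (rule outs_ordinary[where q' = a and acts = "stay (map read (tapes (ntapes M) z s'))"],
        auto simp: block_instr(9)[OF exec_While_step.prems(1) refl, simplified] map_read_tapes act_stay)
  have "inj_on (?c (a + 1 + csize c)) S"
    by (rule inj_on_tapes[OF exec_While_step.hyps(2)]) (use exec_While_step.prems(3) in simp)
  from outs_trans_image[OF 1 this 2]
  have "outs M B (?c a s) (Suc (n + Suc n')) (k + k') (?c ?f ` (\<Union>s'\<in>S. G s'))"
    using exec_While_step.prems exec_While_step.hyps(1) r
    by - (rule outs_ordinary[where q' = "Suc a" and acts = "stay (map read (tapes (ntapes M) z s))"],
        auto simp: block_instr(8)[OF exec_While_step.prems(1) refl] map_read_tapes act_stay)
  then show ?case
    using exec_While_step.hyps by (auto elim!: outs_mono simp: add_ac)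
next
  case (exec_AskIf s c d n k S N K)
  let ?c = "\<lambda>b s'. (b, tapes (ntapes M) z s')"
  let ?q = "rev (s 1) \<in> B"
  let ?e = "if ?q then c else d" 
  let ?b = "if ?q then a + 1 else a + 2 + csize c"
  let ?f = "a + 2 + csize c + csize d"
  note b = block_sub(2)[OF exec_AskIf.prems(1) disjI2[OF refl]]
  have 1: "outs M B (?c ?b s) n k (?c (?b + csize ?e) ` S)"
    using exec_AskIf b by (auto split: if_splits)
  have 2: "outs M B (?c (?b + csize ?e) s') 1 0 {?c ?f s'}" for s'
  proof (cases ?q)
    case True
    have "outs M B (?c (a + 1 + csize c) s') (Suc 0) 0 {?c ?f s'}"
      using exec_AskIf.prems
      by - (rule outs_ordinary[where q' = ?f and acts = "stay (map read (tapes (ntapes M) z s'))"],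
        auto simp: block_instr(7)[OF exec_AskIf.prems(1), simplified] map_read_tapes act_stay outs_refl)
    then show ?thesis using True by simp
  qed (auto simp: add_ac intro: outs_refl)
  have "outs M B (?c ?b s) (n + 1) (k + 0) (\<Union>c'\<in>?c (?b + csize ?e) ` S. {(?f, snd c')})"
    using 2 by (intro outs_trans[OF 1]) auto
  also have "(\<Union>c'\<in>?c (?b + csize ?e) ` S. {(?f, snd c')}) = ?c ?f ` S"
    by auto
  finally have 3: "outs M B (?c ?b s) (n + 1) k (?c ?f ` S)"
    by simp
  have st: "step M B (?c a s) c' \<longleftrightarrow> c' = ?c ?b s" for c'
    using exec_AskIf.prems(2,4) by (auto simp: step.simps holds_word_tape_of[simplified])
  have "outs M B (?c a s) (Suc (n + 1)) (k + 1) (?c ?f ` S)"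
    using outs_step[of M B "?c a s" "?c ?b s" "n + 1" k "\<lambda>_. ?c ?f ` S"] 3 exec_AskIf.prems(2)
    by (simp add: st)
  then show ?case
    using exec_AskIf.hyps by (auto elim!: outs_mono simp: add_ac)
qed

subsection \<open>Machines from programs\<close>

text \<open>The query state has fixed successors, so the program text may contain one
  \<open>AskIf\<close>, which a loop may still execute repeatedly.\<close>

fun single_ask :: "cmd \<Rightarrow> bool" where
  "single_ask (AskIf c d) = (ask_free c \<and> ask_free d)"
| "single_ask (c ;; d) = (single_ask c \<and> ask_free d \<or> ask_free c \<and> single_ask d)"
| "single_ask (If r v c d) = (single_ask c \<and> ask_free d \<or> ask_free c \<and> single_ask d)"
| "single_ask (While r c) = single_ask c"
| "single_ask c = False"

text \<open>The states depend only on the layout of the program. They are chosen before the machine,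
  which is then built around them.\<close>

lemma single_ask_asks:
  "single_ask c \<Longrightarrow> \<exists>q n. a \<le> q \<and> q < a + csize c \<and>
     (\<forall>M. query_st M = q \<longrightarrow> yes_st M = Suc q \<longrightarrow> no_st M = n \<longrightarrow> asks M c a)"
proof (induction c arbitrary: a)
  case (Seq c d)
  then consider "single_ask c" "ask_free d" | "ask_free c" "single_ask d" by auto
  then show ?case
  proof cases
    case 1
    from Seq.IH(1)[OF 1(1), of a] obtain q n where q: "a \<le> q" "q < a + csize c"
      "\<forall>M. query_st M = q \<longrightarrow> yes_st M = Suc q \<longrightarrow> no_st M = n \<longrightarrow> asks M c a" by blast
    then show ?thesis
      using asks_ask_free[OF 1(2)] by (intro exI[of _ q] exI[of _ n]) auto
  next
    case 2
    from Seq.IH(2)[OF 2(2), of "a + csize c"] obtain q n where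
      "a + csize c \<le> q" "q < a + csize c + csize d"
      "\<forall>M. query_st M = q \<longrightarrow> yes_st M = Suc q \<longrightarrow> no_st M = n \<longrightarrow> asks M d (a + csize c)"
      by blast
    then show ?thesis
      using asks_ask_free[OF 2(1)] by (intro exI[of _ q] exI[of _ n]) auto
  qed
next
  case (If r v c d)
  then consider "single_ask c" "ask_free d" | "ask_free c" "single_ask d" by auto
  then show ?case
  proof cases
    case 1
    from If.IH(1)[OF 1(1), of "a + 1"] obtain q n where "a + 1 \<le> q" "q < a + 1 + csize c"
      "\<forall>M. query_st M = q \<longrightarrow> yes_st M = Suc q \<longrightarrow> no_st M = n \<longrightarrow> asks M c (a + 1)" by blast
    then show ?thesis
      using asks_ask_free[OF 1(2)] by (intro exI[of _ q] exI[of _ n]) auto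
  next
    case 2
    from If.IH(2)[OF 2(2), of "a + 2 + csize c"] obtain q n where
      "a + 2 + csize c \<le> q" "q < a + 2 + csize c + csize d"
      "\<forall>M. query_st M = q \<longrightarrow> yes_st M = Suc q \<longrightarrow> no_st M = n \<longrightarrow> asks M d (a + 2 + csize c)"
      by blast
    then show ?thesis
      using asks_ask_free[OF 2(1)] by (intro exI[of _ q] exI[of _ n]) auto
  qed
next
  case (While r c)
  then have "single_ask c" by simp
  from While.IH[OF this, of "a + 1"] obtain q n where "a + 1 \<le> q" "q < a + 1 + csize c"
    "\<forall>M. query_st M = q \<longrightarrow> yes_st M = Suc q \<longrightarrow> no_st M = n \<longrightarrow> asks M c (a + 1)" by blast
  then show ?case
    by (intro exI[of _ q] exI[of _ n]) auto
next
  case (AskIf c d)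
  then show ?case
    by (intro exI[of _ a] exI[of _ "a + 2 + csize c"]) (auto intro!: asks_ask_free)
qed auto

text \<open>State 0 puts the head of tape 1 where the empty stack has it. After the program, the
  accepting state is entered if the top of stack \<open>r\<close> is \<open>True\<close>; otherwise
  the machine is stuck one state before it.\<close>

definition machine :: "nat \<Rightarrow> cmd \<Rightarrow> nat \<Rightarrow> nat \<Rightarrow> nat \<Rightarrow> otm" where
  "machine K c r q n = \<lparr>ntapes = K, start_st = 0, accept_st = csize c + 2, query_st = q,
     yes_st = Suc q, no_st = n,
     trans = instr K 0 (\<lambda>rs. {(1, upd 1 (rs ! 1) GoLeft rs)}) \<union> compile K c 1 \<union>
       instr K (csize c + 1) (\<lambda>rs. if rs ! r = 2 then {(csize c + 2, stay rs)} else {})\<rparr>"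

lemma machine_simps [simp]:
  "ntapes (machine K c r q n) = K" "start_st (machine K c r q n) = 0"
  "accept_st (machine K c r q n) = csize c + 2" "query_st (machine K c r q n) = q"
  "yes_st (machine K c r q n) = Suc q" "no_st (machine K c r q n) = n"
  by (simp_all add: machine_def)

lemma machine_trans:
  "((p, rs), x) \<in> trans (machine K c r q n) \<longleftrightarrow>
     p = 0 \<and> rs \<in> reads K \<and> x = (1, upd 1 (rs ! 1) GoLeft rs) \<or>
     ((p, rs), x) \<in> compile K c 1 \<or>
     p = csize c + 1 \<and> rs \<in> reads K \<and> rs ! r = 2 \<and> x = (csize c + 2, stay rs)"
  by (auto simp: machine_def instr_iff)

lemma compile_lengths: "((q, rs), (q', acts)) \<in> compile K c a \<Longrightarrow> length rs = K \<and> length acts = K"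
  by (auto dest: compile_source compile_length simp: reads_def)

lemma wf_machine: "2 \<le> K \<Longrightarrow> wf_otm (machine K c r q n)"
  unfolding wf_otm_def
proof (intro conjI)
  show "finite (trans (machine K c r q n))"
    by (auto simp: machine_def finite_compile instr_def finite_reads)
  show "\<forall>((p, rs), (p', acts))\<in>trans (machine K c r q n).
     length rs = ntapes (machine K c r q n) \<and> length acts = ntapes (machine K c r q n)"
    by (auto simp: machine_trans reads_def upd_def stay_def dest: compile_lengths)
qed simp

lemma deterministic_machine: "guess_free c \<Longrightarrow> deterministic (machine K c r q n)"
  unfolding deterministic_def single_valued_def
  by (auto simp: machine_trans dest: compile_single_valued)

definition ini :: "bool list \<Rightarrow> st" where
  "ini x = (\<lambda>_. [])(0 := x)"

lemma ini_simps [simp]: "ini x 0 = x" "0 < r \<Longrightarrow> ini x r = []"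
  by (simp_all add: ini_def)

lemma input_tape_tape_of: "input_tape x = tape_of (int (length x)) 0 x"
  by (auto simp: input_tape_def tape_of_def org_def dir_def rev_nth Let_def nat_diff_distrib
      intro!: ext arg_cong[where f = "\<lambda>i. bit_sym (x ! i)"])

lemma tape_of_Nil: "tape_of z r [] = ((\<lambda>_. 0), if r = 0 then z else if r = 1 then -1 else 0)"
  by (auto simp: tape_of_def org_def dir_def)

lemma init_step:
  fixes x :: "bool list"
  assumes "2 \<le> K"
  defines "tps \<equiv> input_tape x # replicate (K - 1) blank_tape"
  shows "map read tps \<in> reads K"
    and "map2 act tps (upd 1 (map read tps ! 1) GoLeft (map read tps)) = tapes K (int (length x)) (ini x)"
proof -
  have l: "length tps = K" using assms by simp
  have n: "tps ! i = (if i = 0 then input_tape x else blank_tape)" if "i < K" for i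
    using that by (auto simp: tps_def nth_Cons split: nat.split)
  show "map read tps \<in> reads K"
    using assms by (auto simp: reads_def input_tape_tape_of blank_tape_def)
  show "map2 act tps (upd 1 (map read tps ! 1) GoLeft (map read tps)) =
      tapes K (int (length x)) (ini x)"
  proof (rule nth_equalityI)
    fix i
    assume "i < length (map2 act tps (upd 1 (map read tps ! 1) GoLeft (map read tps)))"
    then have i: "i < K" using l by (simp add: upd_def stay_def)
    show "map2 act tps (upd 1 (map read tps ! 1) GoLeft (map read tps)) ! i =
        tapes K (int (length x)) (ini x) ! i"
      using assms(1) i l n[of 1]
      by (subst act_upd) (auto simp: nth_list_update n input_tape_tape_of tape_of_Nil blank_tape_def)
  qed (use l assms in \<open>simp add: upd_def stay_def\<close>)
qed

definition final_config :: "nat \<Rightarrow> cmd \<Rightarrow> nat \<Rightarrow> int \<Rightarrow> st \<Rightarrow> config" where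
  "final_config K c r z s =
     (if top_sym (s r) = 2 then csize c + 2 else csize c + 1, tapes K z s)"

text \<open>The two extra steps are the initial one and the test of stack \<open>r\<close>.\<close>

lemma machine_outs:
  fixes B :: lang
  assumes "2 \<le> K" "r < K" "regs c \<subseteq> {..<K}" "asks M c 1" 
    and q: "q \<noteq> 0" "q \<noteq> csize c + 1" "q \<noteq> csize c + 2"
    and ex: "exec B c (ini x) n k S"
    and M: "M = machine K c r q n'"
  shows "outs M B (init M x) (n + 2) k (final_config K c r (int (length x)) ` S)"
    and "s \<in> S \<Longrightarrow> halted M B (final_config K c r z s)"
proof -
  let ?z = "int (length x)"
  have "block M c 1"
    by (auto simp: block_def M machine_trans)
  then have "outs M B (1, tapes K ?z (ini x)) n k ((\<lambda>s'. (csize c + 1, tapes K ?z s')) ` S)"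
    using compile_correct[OF ex, of M 1 ?z] assms by simp
  moreover have "inj_on (\<lambda>s'. (csize c + 1, tapes K ?z s')) S"
    by (rule inj_on_tapes[OF ex assms(3)])
  moreover have "outs M B (csize c + 1, tapes K ?z s) 1 0 (final_config K c r ?z ` {s})" for s
  proof (cases "top_sym (s r) = 2")
    case True
    have "outs M B (csize c + 1, tapes K ?z s) (Suc 0) 0 {final_config K c r ?z s}"
    proof (rule outs_ordinary)
      show "((csize c + 1, map read (tapes K ?z s)), x) \<in> trans M \<longleftrightarrow>
          x = (csize c + 2, stay (map read (tapes K ?z s)))" for x
        using True assms(2) by (auto simp: M machine_trans map_read_tapes)
    qed (use q True in \<open>auto simp: M act_stay final_config_def intro: outs_refl\<close>)
    then show ?thesis by simp
  qed (auto simp: final_config_def intro: outs_refl)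
  ultimately have "outs M B (1, tapes K ?z (ini x)) (n + 1) (k + 0)
      (final_config K c r ?z ` (\<Union>s\<in>S. {s}))"
    by (rule outs_trans_image)
  then have *: "outs M B (1, tapes K ?z (ini x)) (n + 1) k (final_config K c r ?z ` S)"
    by simp
  have "outs M B (init M x) (Suc (n + 1)) k (final_config K c r ?z ` S)"
    unfolding init_def
  proof (rule outs_ordinary)
    let ?tps = "input_tape x # replicate (ntapes M - 1) blank_tape"
    show "((start_st M, map read ?tps), y) \<in> trans M \<longleftrightarrow>
        y = (1, upd 1 (map read ?tps ! 1) GoLeft (map read ?tps))" for y
      using init_step(1)[OF assms(1), of x] unfolding M machine_trans machine_simps by auto
    show "outs M B (1, map2 act ?tps (upd 1 (map read ?tps ! 1) GoLeft (map read ?tps))) (n + 1) k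
        (final_config K c r ?z ` S)"
      using * unfolding M machine_simps init_step(2)[OF assms(1)] .
  qed (use q in \<open>simp add: M\<close>)
  then show "outs M B (init M x) (n + 2) k (final_config K c r ?z ` S)"
    by simp
  show "halted M B (final_config K c r z s)"
    using q assms(2) by (auto simp: halted_def final_config_def step_ordinary M machine_trans)
qed

text \<open>The interface through which all machines below are obtained: stack \<open>r\<close>
  holds the verdict, and stack 1 the output or query word in reverse.\<close>

theorem machine_exists:
  assumes "single_ask c \<or> ask_free c"
  obtains M where "wf_otm M" "guess_free c \<Longrightarrow> deterministic M"
    "\<And>B x n k S t j c'. exec B c (ini x) n k S \<Longrightarrow> run M B (init M x) t j c' \<Longrightarrow> t \<le> n + 2 \<and> j \<le> k"
    "\<And>B x n k S. exec B c (ini x) n k S \<Longrightarrow> x \<in> language M B \<longleftrightarrow> (\<exists>s\<in>S. top_sym (s r) = 2)"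
    "\<And>B x n k s. exec B c (ini x) n k {s} \<Longrightarrow>
      \<exists>t j c'. run M B (init M x) t j c' \<and> halted M B c' \<and> holds_word (snd c' ! 1) (rev (s 1))"
proof -
  obtain K where K: "2 \<le> K" "r < K" "regs c \<subseteq> {..<K}"
  proof
    let ?K = "Suc (Max (insert 2 (insert r (regs c))))"
    have "x \<in> insert 2 (insert r (regs c)) \<Longrightarrow> x < ?K" for x
      using Max_ge[of "insert 2 (insert r (regs c))" x] finite_regs[of c] by simp
    from this[of 2] this[of r] this show "2 \<le> ?K" "r < ?K" "regs c \<subseteq> {..<?K}"
      by (simp_all add: subset_iff)
  qed
  obtain q n where q: "q \<noteq> 0" "q \<noteq> csize c + 1" "q \<noteq> csize c + 2"
    and asks: "\<And>K. asks (machine K c r q n) c 1"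
  proof (cases "ask_free c")
    \<comment> \<open>Without queries, a query state beyond all states of the table is never
      reached.\<close>
    case True
    then show ?thesis
      using that[of "csize c + 3" 0] by (simp add: asks_ask_free)
  next
    case False
    then obtain q n where "1 \<le> q" "q < 1 + csize c"
      "\<forall>M. query_st M = q \<longrightarrow> yes_st M = Suc q \<longrightarrow> no_st M = n \<longrightarrow> asks M c 1"
      using single_ask_asks[of c 1] assms by blast
    then show ?thesis
      using that[of q n] by simp
  qed
  define M where "M = machine K c r q n"
  have outs1: "outs M B (init M x) (n + 2) k (final_config K c r (int (length x)) ` S)"
    if "exec B c (ini x) n k S" for B x n k S
    using machine_outs(1)[OF K _ q that M_def] asks M_def by simp
  have halt: "halted M B (final_config K c r z s)" if "exec B c (ini x) n k S" "s \<in> S" for B x n k S z s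
    using machine_outs(2)[OF K _ q that(1) M_def that(2)] asks M_def by simp
  show thesis
  proof
    show "wf_otm M" unfolding M_def by (rule wf_machine[OF K(1)])
    show "guess_free c \<Longrightarrow> deterministic M" unfolding M_def by (rule deterministic_machine)
    show "t \<le> n + 2 \<and> j \<le> k" if "exec B c (ini x) n k S" "run M B (init M x) t j c'" for B x n k S t j c'
      using outs_run[OF outs1[OF that(1)] _ that(2)] halt[OF that(1)] by blast
    show "x \<in> language M B \<longleftrightarrow> (\<exists>s\<in>S. top_sym (s r) = 2)" if h: "exec B c (ini x) n k S" for B x n k S
    proof
      assume "x \<in> language M B"
      then obtain t k' c' where "run M B (init M x) t k' c'" "halted M B c'" "fst c' = accept_st M"
        by (auto simp: language_def)
      moreover from this have "c' \<in> final_config K c r (int (length x)) ` S"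
        using outs_run[OF outs1[OF h]] halt[OF h] by blast
      ultimately show "\<exists>s\<in>S. top_sym (s r) = 2"
        by (auto simp: final_config_def M_def split: if_splits)
    next
      assume "\<exists>s\<in>S. top_sym (s r) = 2"
      then obtain s where s: "s \<in> S" "top_sym (s r) = 2" by blast
      then obtain t j where "run M B (init M x) t j (final_config K c r (int (length x)) s)"
        using outs_reach[OF outs1[OF h]] by blast
      then show "x \<in> language M B"
        using halt[OF h s(1)] s(2) by (force simp: language_def final_config_def M_def)
    qed
    show "\<exists>t j c'. run M B (init M x) t j c' \<and> halted M B c' \<and> holds_word (snd c' ! 1) (rev (s 1))"
      if h: "exec B c (ini x) n k {s}" for B x n k s
    proof -
      obtain t j where "run M B (init M x) t j (final_config K c r (int (length x)) s)"
        using outs_reach[OF outs1[OF h], of "final_config K c r (int (length x)) s"] by blast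
      moreover have "holds_word (snd (final_config K c r (int (length x)) s) ! 1) (rev (s 1))"
        using K by (simp add: final_config_def holds_word_tape_of[simplified])
      ultimately show ?thesis
        using halt[OF h] by blast
    qed
  qed
qed

subsection \<open>Derived execution rules\<close>

lemma exec_mono: "exec B c s n k S \<Longrightarrow> n \<le> n' \<Longrightarrow> k \<le> k' \<Longrightarrow> exec B c s n' k' S"
  by (induction arbitrary: n' k' rule: exec.induct) (fastforce intro: exec.intros)+

lemma exec_Seq1:
  assumes "exec B c s n k {s'}" "exec B d s' n' k' S"
  shows "exec B (c ;; d) s (n + n') (k + k') S"
  using exec_Seq[of B c s n k "{s'}" d n' k' "\<lambda>_. S"] assms by simp

text \<open>\<open>f i\<close> is the state before round \<open>i\<close>. The induction runs over
  the number of remaining rounds because \<open>While\<close> unfolds at its first round.\<close>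

lemma exec_loop:
  assumes "\<And>i. i < N \<Longrightarrow> f i r \<noteq> []" "\<And>i. i < N \<Longrightarrow> exec B c (f i) n k {f (Suc i)}" "f N r = []"
  shows "exec B (While r c) (f 0) (N * (n + 2) + 1) (N * k) {f N}"
proof -
  have "exec B (While r c) (f (N - j)) (j * (n + 2) + 1) (j * k) {f N}" if "j \<le> N" for j
    using that
  proof (induction j)
    case 0
    then show ?case using assms(3) by (simp add: exec_While_end)
  next
    case (Suc j)
    have e: "Suc (N - Suc j) = N - j" using Suc.prems by simp
    have "exec B c (f (N - Suc j)) n k {f (N - j)}"
      using assms(2)[of "N - Suc j"] Suc.prems e by simp
    moreover have "exec B (While r c) (f (N - j)) (j * (n + 2) + 1) (j * k) {f N}"
      using Suc by simp
    ultimately show ?case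
      using exec_While_step[of "f (N - Suc j)" r B c n k "{f (N - j)}" "j * (n + 2) + 1" "j * k"
          "\<lambda>_. {f N}"] assms(1)[of "N - Suc j"] Suc.prems by simp
  qed
  from this[of N] show ?thesis by simp
qed

lemma exec_loop0:
  assumes "\<And>i. i < N \<Longrightarrow> f i r \<noteq> []" "\<And>i. i < N \<Longrightarrow> exec B c (f i) n 0 {f (Suc i)}" "f N r = []"
    and "f 0 = s" "f N = s'" "N * (n + 2) + 1 \<le> T"
  shows "exec B (While r c) s T 0 {s'}"
  using exec_mono[OF exec_loop[of N f r B c n 0, OF assms(1-3)], of T 0] assms(4-6) by simp

abbreviation un :: "nat \<Rightarrow> bool list" where
  "un n \<equiv> replicate n True"

lemma un_simps [simp]: "un n = [] \<longleftrightarrow> n = 0" "top_sym (un n) = (if n = 0 then 0 else 2)"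
  "tl (un n) = un (n - 1)"
  by (cases n; simp)+

fun pushn :: "nat \<Rightarrow> nat \<Rightarrow> cmd" where
  "pushn r 0 = Skip"
| "pushn r (Suc n) = Push r True ;; pushn r n"

lemma exec_pushn: "exec B (pushn r n) s (2 * n) 0 {s(r := un n @ s r)}"
proof (induction n arbitrary: s)
  case 0
  then show ?case by (auto simp: fun_upd_idem intro: exec_Skip)
next
  case (Suc n)
  have "exec B (Push r True ;; pushn r n) s (2 + 2 * n) (0 + 0)
      {(s(r := True # s r))(r := un n @ (s(r := True # s r)) r)}"
    by (rule exec_Seq1[OF exec_Push Suc.IH]) simp
  then have "exec B (pushn r (Suc n)) s (2 * Suc n) 0 {s(r := un (Suc n) @ s r)}"
    by (simp add: replicate_app_Cons_same)
  then show ?case .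
qed

definition clear :: "nat \<Rightarrow> cmd" where
  "clear r = While r (Pop r)"

lemma exec_clear: "exec B (clear r) s (3 * length (s r) + 1) 0 {s(r := [])}"
  unfolding clear_def
proof (rule exec_loop0[where f = "\<lambda>i. s(r := drop i (s r))" and n = 1])
  fix i
  assume "i < length (s r)"
  then show "exec B (Pop r) (s(r := drop i (s r))) 1 0 {s(r := drop (Suc i) (s r))}"
    using exec_Pop[of 1 "s(r := drop i (s r))" r B 0] by (simp add: drop_Suc tl_drop)
qed auto

definition pass :: "nat \<Rightarrow> nat \<Rightarrow> cmd" where
  "pass a t = If a 2 (Pop a ;; Push t True) (Pop a ;; Push t False)"

lemma exec_pass:
  assumes "a \<noteq> t" "s a = b # xs"
  shows "exec B (pass a t) s 5 0 {s(a := xs, t := b # s t)}"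
proof -
  have "exec B (Pop a ;; Push t b) s (1 + 2) (0 + 0) {s(a := xs, t := b # s t)}"
    using assms exec_Push[of 2 B t b "s(a := xs)" 0] exec_Pop[of 1 s a B 0]
    by (intro exec_Seq1[where s' = "s(a := xs)"]) auto
  then have "exec B (if top_sym (s a) = 2 then Pop a ;; Push t True else Pop a ;; Push t False) s 3 0
      {s(a := xs, t := b # s t)}"
    using assms(2) by (cases b) (simp_all add: numeral_3_eq_3)
  then show ?thesis
    unfolding pass_def by (rule exec_If) simp
qed

definition move :: "nat \<Rightarrow> nat \<Rightarrow> cmd" where
  "move a t = While a (pass a t)"

lemma exec_move:
  assumes "a \<noteq> t"
  shows "exec B (move a t) s (7 * length (s a) + 1) 0 {s(a := [], t := rev (s a) @ s t)}"
  unfolding move_def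
proof (rule exec_loop0[where f = "\<lambda>i. s(a := drop i (s a), t := rev (take i (s a)) @ s t)" and n = 5])
  fix i
  assume i: "i < length (s a)"
  let ?f = "\<lambda>i. s(a := drop i (s a), t := rev (take i (s a)) @ s t)"
  have "(?f i)(a := drop (Suc i) (s a), t := s a ! i # (?f i) t) = ?f (Suc i)"
    using i assms by (auto simp: fun_eq_iff take_Suc_conv_app_nth)
  then show "exec B (pass a t) (?f i) 5 0 {?f (Suc i)}"
    using exec_pass[OF assms, of "?f i" "s a ! i" "drop (Suc i) (s a)" B] assms i
    by (simp add: Cons_nth_drop_Suc)
qed (use assms in auto)

text \<open>The bits are parked on \<open>t\<close> during the counting and moved back, so that
  stack \<open>a\<close> survives.\<close>

definition count :: "nat \<Rightarrow> nat \<Rightarrow> nat \<Rightarrow> cmd" where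
  "count a t r = While a (pass a t ;; Push r True) ;; move t a"

lemma exec_count:
  assumes "a \<noteq> t" "r \<noteq> a" "r \<noteq> t" "s t = []"
  shows "exec B (count a t r) s (16 * length (s a) + 2) 0 {s(r := un (length (s a)) @ s r)}"
proof -
  let ?f = "\<lambda>i. s(a := drop i (s a), t := rev (take i (s a)), r := un i @ s r)"
  let ?s = "s(a := [], t := rev (s a), r := un (length (s a)) @ s r)"
  have 1: "exec B (While a (pass a t ;; Push r True)) s (9 * length (s a) + 1) 0 {?s}"
  proof (rule exec_loop0[where f = ?f and n = "5 + 2"])
    fix i
    assume i: "i < length (s a)"
    let ?s' = "(?f i)(a := drop (Suc i) (s a), t := (s a ! i) # rev (take i (s a)))"
    have "exec B (pass a t) (?f i) 5 0 {?s'}"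
      using exec_pass[OF assms(1), of "?f i" "s a ! i" "drop (Suc i) (s a)" B] assms i
      by (simp add: Cons_nth_drop_Suc)
    moreover have "exec B (Push r True) ?s' 2 0 {?f (Suc i)}"
    proof -
      have "?s'(r := True # ?s' r) = ?f (Suc i)"
        using assms i by (auto simp: fun_eq_iff take_Suc_conv_app_nth)
      then show ?thesis using exec_Push[of 2 B r True ?s' 0] by simp
    qed
    ultimately show "exec B (pass a t ;; Push r True) (?f i) (5 + 2) 0 {?f (Suc i)}"
      using exec_Seq1[of B "pass a t" "?f i" 5 0 ?s' "Push r True" 2 0 "{?f (Suc i)}"] by simp
  qed (use assms in \<open>auto simp: fun_eq_iff\<close>)
  have "?s(t := [], a := rev (?s t) @ ?s a) = s(r := un (length (s a)) @ s r)"
    using assms by (auto simp: fun_eq_iff)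
  with exec_move[OF not_sym[OF assms(1)], of B ?s]
  have 2: "exec B (move t a) ?s (7 * length (?s t) + 1) 0 {s(r := un (length (s a)) @ s r)}"
    by (simp only:)
  show ?thesis
    unfolding count_def by (rule exec_mono[OF exec_Seq1[OF 1 2]]) (use assms in auto)
qed

subsection \<open>Polynomial bounds\<close>

text \<open>Polynomial boundedness by a single exponent. The base is at least 2, so constants and
  sums are absorbed by a larger exponent, and compositions keep this form.\<close>

definition pb :: "(nat \<Rightarrow> nat) \<Rightarrow> bool" where
  "pb f \<longleftrightarrow> (\<exists>k. \<forall>m. f m \<le> (m + 2) ^ k)"

lemma pb_mono: "pb g \<Longrightarrow> (\<And>m. f m \<le> g m) \<Longrightarrow> pb f"
  unfolding pb_def by (meson order_trans)

lemma pb_const: "pb (\<lambda>_. c)"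
  unfolding pb_def
proof (intro exI allI)
  fix m :: nat
  have "c \<le> 2 ^ c" by (simp add: less_imp_le)
  also have "\<dots> \<le> (m + 2) ^ c" by (rule power_mono) auto
  finally show "c \<le> (m + 2) ^ c" .
qed

lemma pb_id: "pb (\<lambda>m. m)"
  unfolding pb_def by (rule exI[of _ 1]) simp

lemma pb_mult: "pb f \<Longrightarrow> pb g \<Longrightarrow> pb (\<lambda>m. f m * g m)"
  unfolding pb_def
proof (elim exE)
  fix a b
  assume "\<forall>m. f m \<le> (m + 2) ^ a" "\<forall>m. g m \<le> (m + 2) ^ b"
  then have "f m * g m \<le> (m + 2) ^ (a + b)" for m
    by (simp add: power_add mult_mono)
  then show "\<exists>k. \<forall>m. f m * g m \<le> (m + 2) ^ k" by blast
qed

lemma pb_add: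
  assumes "pb f" "pb g"
  shows "pb (\<lambda>m. f m + g m)"
proof (rule pb_mono)
  show "pb (\<lambda>m. 2 * ((f m + 1) * (g m + 1)))"
  proof -
    have *: "pb (\<lambda>m. h m + 1)" if "pb h" for h
    proof -
      from that obtain a where a: "\<And>m. h m \<le> (m + 2) ^ a" unfolding pb_def by blast
      have "h m + 1 \<le> (m + 2) ^ Suc a" for m
      proof -
        have "1 \<le> (m + 2) ^ a" by simp
        then have "h m + 1 \<le> 2 * (m + 2) ^ a" using a[of m] by linarith
        also have "\<dots> \<le> (m + 2) * (m + 2) ^ a" by (intro mult_right_mono) auto
        finally show ?thesis by simp
      qed
      then show ?thesis unfolding pb_def by blast
    qed
    show ?thesis
      by (intro pb_mult pb_const * assms)
  qed
qed simp

lemma pb_comp: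
  assumes "pb f" "pb g"
  shows "pb (\<lambda>m. f (g m))"
proof -
  obtain a where a: "\<And>m. f m \<le> (m + 2) ^ a" using assms(1) unfolding pb_def by blast
  obtain b where b: "\<And>m. g m + 2 \<le> (m + 2) ^ b"
    using pb_add[OF assms(2) pb_const[of 2]] unfolding pb_def by blast
  have "f (g m) \<le> (m + 2) ^ (b * a)" for m
    using order_trans[OF a power_mono[OF b]] by (simp add: power_mult)
  then show ?thesis unfolding pb_def by blast
qed

lemmas pb_intros = pb_const pb_id pb_mult pb_add

section \<open>Arithmetic expressions\<close>

text \<open>Variables are de Bruijn indices, with \<open>Sum\<close> binding variable 0.
  \<open>Len\<close> and \<open>Bit\<close> refer to the input or, for \<open>True\<close>, to a
  second word that holds a guess. As bounded sums are the only iteration, values stay polynomial and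
  can be kept in unary.\<close>

datatype ex = Con nat | Var nat | Len bool | Bit bool ex | Add ex ex | Sub ex ex | Sum ex ex

definition bit :: "bool list \<Rightarrow> nat \<Rightarrow> bool" where
  "bit x i \<longleftrightarrow> i < length x \<and> x ! i"

fun val :: "ex \<Rightarrow> bool list \<Rightarrow> bool list \<Rightarrow> (nat \<Rightarrow> nat) \<Rightarrow> nat" where
  "val (Con c) x y e = c"
| "val (Var i) x y e = e i"
| "val (Len b) x y e = length (if b then y else x)"
| "val (Bit b a) x y e = of_bool (bit (if b then y else x) (val a x y e))"
| "val (Add a b) x y e = val a x y e + val b x y e"
| "val (Sub a b) x y e = val a x y e - val b x y e"
| "val (Sum a b) x y e = (\<Sum>i<val a x y e. val b x y (case_nat i e))"

section \<open>Evaluation of expressions with unary registers\<close>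

definition dreg :: "bool \<Rightarrow> nat" where
  "dreg b = (if b then 2 else 0)"

definition subc :: "nat \<Rightarrow> nat \<Rightarrow> cmd" where
  "subc a t = While t (Pop t ;; If a 0 Skip (Pop a))"

definition dropc :: "nat \<Rightarrow> nat \<Rightarrow> nat \<Rightarrow> cmd" where
  "dropc a t d = While t (Pop t ;; If a 0 Skip (pass a d))"

text \<open>The value is pushed in unary on stack \<open>r\<close>. The list \<rho> gives the
  registers of the variables, and all registers from \<open>f\<close> on are free; scratch registers
  are left empty. Under a \<open>Sum\<close>, register \<open>f\<close> is the bound variable and
  also counts the rounds.\<close>

fun ce :: "ex \<Rightarrow> nat list \<Rightarrow> nat \<Rightarrow> nat \<Rightarrow> cmd" where
  "ce (Con n) \<rho> f r = pushn r n"
| "ce (Var i) \<rho> f r = (if i < length \<rho> then count (\<rho> ! i) f r else Skip)"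
| "ce (Len b) \<rho> f r = count (dreg b) f r"
| "ce (Bit b a) \<rho> f r = ce a \<rho> (f + 2) f ;; dropc (dreg b) f (f + 1) ;;
     If (dreg b) 2 (Push r True) Skip ;; move (f + 1) (dreg b)"
| "ce (Add a b) \<rho> f r = ce a \<rho> f r ;; ce b \<rho> f r"
| "ce (Sub a b) \<rho> f r =
     ce a \<rho> (f + 2) f ;; ce b \<rho> (f + 2) (f + 1) ;; subc f (f + 1) ;; move f r"
| "ce (Sum a b) \<rho> f r = ce a \<rho> (f + 2) (f + 1) ;;
     While (f + 1) (Pop (f + 1) ;; ce b (f # \<rho>) (f + 2) r ;; Push f True) ;; clear f"

lemma ask_free_ce: "ask_free (ce a \<rho> f r)"
proof -
  have "ask_free (pushn r n)" for r n by (induction n) auto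
  then show ?thesis
    by (induction a arbitrary: \<rho> f r) (auto simp: count_def move_def pass_def subc_def dropc_def clear_def)
qed

lemma guess_free_ce: "guess_free (ce a \<rho> f r)"
proof -
  have "guess_free (pushn r n)" for r n by (induction n) auto
  then show ?thesis
    by (induction a arbitrary: \<rho> f r) (auto simp: count_def move_def pass_def subc_def dropc_def clear_def)
qed

definition env :: "nat list \<Rightarrow> nat \<Rightarrow> nat" where
  "env vs i = (if i < length vs then vs ! i else 0)"

lemma env_Cons: "env (v # vs) = case_nat v (env vs)"
  by (auto simp: env_def fun_eq_iff split: nat.split)

lemma env_le: "set vs \<subseteq> {..m} \<Longrightarrow> env vs i \<le> m"
  by (auto simp: env_def dest: nth_mem)

text \<open>Stack 1 is left to the output. Emptiness from \<open>f\<close> on is what makes these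
  registers free.\<close>

definition represents :: "st \<Rightarrow> bool list \<Rightarrow> bool list \<Rightarrow> nat list \<Rightarrow> nat list \<Rightarrow> nat \<Rightarrow> bool" where
  "represents s x y \<rho> vs f \<longleftrightarrow> s 0 = x \<and> s 2 = y \<and> length vs = length \<rho> \<and> 2 < f \<and>
     (\<forall>i<length \<rho>. s (\<rho> ! i) = un (vs ! i) \<and> 2 < \<rho> ! i \<and> \<rho> ! i < f) \<and> (\<forall>j\<ge>f. s j = [])"

lemma represents_upd:
  "represents s x y \<rho> vs f \<Longrightarrow> r \<noteq> 0 \<Longrightarrow> r \<noteq> 2 \<Longrightarrow> r \<notin> set \<rho> \<Longrightarrow> r < f' \<Longrightarrow> f \<le> f' \<Longrightarrow>
    represents (s(r := w)) x y \<rho> vs f'"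
  by (fastforce simp: represents_def)

lemma exec_subc:
  assumes "a \<noteq> t" "s a = un v" "s t = un w"
  shows "exec B (subc a t) s (6 * w + 1) 0 {s(a := un (v - w), t := [])}"
  unfolding subc_def
proof (rule exec_loop0[where f = "\<lambda>i. s(a := un (v - i), t := un (w - i))" and n = "1 + 3"])
  fix i
  assume i: "i < w"
  let ?f = "\<lambda>i. s(a := un (v - i), t := un (w - i))"
  let ?s = "s(a := un (v - i), t := un (w - Suc i))"
  have "(?f i)(t := tl (?f i t)) = ?s"
    using assms i by (auto simp: fun_eq_iff)
  then have 1: "exec B (Pop t) (?f i) 1 0 {?s}"
    using exec_Pop[of 1 "?f i" t B 0] i assms by simp
  have 2: "exec B (If a 0 Skip (Pop a)) ?s 3 0 {?f (Suc i)}"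
  proof (rule exec_If[where n = 1])
    show "exec B (if top_sym (?s a) = 0 then Skip else Pop a) ?s 1 0 {?f (Suc i)}"
    proof (cases "i < v")
      case True
      have "?s(a := tl (?s a)) = ?f (Suc i)"
        using assms by (auto simp: fun_eq_iff)
      then show ?thesis
        using exec_Pop[of 1 ?s a B 0] True assms by simp
    next
      case False
      then have "?s = ?f (Suc i)" by simp
      then show ?thesis
        using exec_Skip[of B ?s 1 0] False assms by simp
    qed
  qed simp
  show "exec B (Pop t ;; If a 0 Skip (Pop a)) (?f i) (1 + 3) 0 {?f (Suc i)}"
    using exec_Seq1[OF 1 2] by simp
qed (use assms in \<open>auto simp: fun_eq_iff\<close>)

lemma exec_dropc:
  assumes "a \<noteq> t" "a \<noteq> d" "t \<noteq> d" "s t = un w" "s d = []"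
  shows "exec B (dropc a t d) s (10 * w + 1) 0
    {s(a := drop w (s a), t := [], d := rev (take w (s a)))}"
  unfolding dropc_def
proof (rule exec_loop0[where n = "1 + 7" and
    f = "\<lambda>i. s(a := drop i (s a), t := un (w - i), d := rev (take i (s a)))"])
  fix i
  assume i: "i < w"
  let ?f = "\<lambda>i. s(a := drop i (s a), t := un (w - i), d := rev (take i (s a)))"
  let ?s = "s(a := drop i (s a), t := un (w - Suc i), d := rev (take i (s a)))"
  have "(?f i)(t := tl (?f i t)) = ?s"
    using assms i by (auto simp: fun_eq_iff)
  then have 1: "exec B (Pop t) (?f i) 1 0 {?s}"
    using exec_Pop[of 1 "?f i" t B 0] i assms by simp
  have 2: "exec B (If a 0 Skip (pass a d)) ?s 7 0 {?f (Suc i)}"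
  proof (rule exec_If[where n = 5])
    show "exec B (if top_sym (?s a) = 0 then Skip else pass a d) ?s 5 0 {?f (Suc i)}"
    proof (cases "i < length (s a)")
      case True
      then have "?s a = s a ! i # drop (Suc i) (s a)"
        using assms by (simp add: Cons_nth_drop_Suc)
      moreover have "?s(a := drop (Suc i) (s a), d := s a ! i # ?s d) = ?f (Suc i)"
        using True assms by (auto simp: fun_eq_iff take_Suc_conv_app_nth)
      ultimately show ?thesis
        using exec_pass[OF assms(2), of ?s "s a ! i" "drop (Suc i) (s a)" B] True assms by simp
    next
      case False
      then have "?s = ?f (Suc i)" by simp
      then show ?thesis
        using exec_Skip[of B ?s 5 0] False assms by simp
    qed
  qed simp
  show "exec B (Pop t ;; If a 0 Skip (pass a d)) (?f i) (1 + 7) 0 {?f (Suc i)}"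
    using exec_Seq1[OF 1 2] by simp
qed (use assms in \<open>auto simp: fun_eq_iff\<close>)

text \<open>Uniform in words and variables of size at most \<open>m\<close>; these bounds give the
  running times of the loops that consume the values.\<close>

definition bounds :: "ex \<Rightarrow> (nat \<Rightarrow> nat) \<Rightarrow> bool" where
  "bounds a q \<longleftrightarrow> pb q \<and>
     (\<forall>m x y e. length x \<le> m \<longrightarrow> length y \<le> m \<longrightarrow> (\<forall>i. e i \<le> m) \<longrightarrow> val a x y e \<le> q m)"

lemma boundsD:
  "bounds a q \<Longrightarrow> length x \<le> m \<Longrightarrow> length y \<le> m \<Longrightarrow> (\<And>i. e i \<le> m) \<Longrightarrow> val a x y e \<le> q m"
  by (simp add: bounds_def)

lemma bounds_exist: "\<exists>q. bounds a q"
proof (induction a)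
  case (Con c)
  have "bounds (Con c) (\<lambda>_. c)" by (simp add: bounds_def pb_const)
  then show ?case by blast
next
  case (Var i)
  have "bounds (Var i) (\<lambda>m. m)" by (simp add: bounds_def pb_id)
  then show ?case by blast
next
  case (Len b)
  have "bounds (Len b) (\<lambda>m. m)" by (simp add: bounds_def pb_id)
  then show ?case by blast
next
  case (Bit b a)
  have "bounds (Bit b a) (\<lambda>_. 1)" by (simp add: bounds_def pb_const)
  then show ?case by blast
next
  case (Add a b)
  then obtain p q where "bounds a p" "bounds b q" by blast
  then have "bounds (Add a b) (\<lambda>m. p m + q m)" by (simp add: bounds_def pb_add add_mono)
  then show ?case by blast
next
  case (Sub a b)
  then obtain p where "bounds a p" by blast
  then have "bounds (Sub a b) p" unfolding bounds_def by (auto intro: order_trans[OF diff_le_self])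
  then show ?case by blast
next
  case (Sum a b)
  then obtain p q where pq: "bounds a p" "bounds b q" by blast
  \<comment> \<open>The bound variable may approach \<open>p m\<close>, so the body is estimated at
    \<open>m + p m\<close>.\<close>
  have "bounds (Sum a b) (\<lambda>m. p m * q (m + p m))"
    unfolding bounds_def
  proof (intro conjI allI impI)
    show "pb (\<lambda>m. p m * q (m + p m))"
      using pb_mult[OF _ pb_comp[OF _ pb_add[OF pb_id]], of p q p] pq unfolding bounds_def by simp
    fix m and x y :: "bool list" and e :: "nat \<Rightarrow> nat"
    assume a: "length x \<le> m" "length y \<le> m" "\<forall>i. e i \<le> m"
    have p: "val a x y e \<le> p m"
      using boundsD[OF pq(1)] a by simp
    have "val b x y (case_nat i e) \<le> q (m + p m)" if "i < val a x y e" for i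
    proof (rule boundsD[OF pq(2)])
      fix j
      show "case_nat i e j \<le> m + p m"
        using a(3)[rule_format, of "j - 1"] p that by (cases j) auto
    qed (use a in auto)
    then have "(\<Sum>i<val a x y e. val b x y (case_nat i e)) \<le> val a x y e * q (m + p m)"
      using sum_bounded_above[of "{..<val a x y e}" "\<lambda>i. val b x y (case_nat i e)" "q (m + p m)"] by simp
    also have "\<dots> \<le> p m * q (m + p m)"
      using p by simp
    finally show "val (Sum a b) x y e \<le> p m * q (m + p m)" by simp
  qed
  then show ?case by blast
qed

definition runs :: "(nat list \<Rightarrow> nat \<Rightarrow> nat \<Rightarrow> cmd) \<Rightarrow> ex \<Rightarrow> (nat \<Rightarrow> nat) \<Rightarrow> bool" where
  "runs c a p \<longleftrightarrow> pb p \<and> (\<forall>B m x y \<rho> vs f r s. represents s x y \<rho> vs f \<longrightarrow>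
     length x \<le> m \<longrightarrow> length y \<le> m \<longrightarrow> set vs \<subseteq> {..m} \<longrightarrow> r < f \<longrightarrow> r \<notin> set \<rho> \<longrightarrow> r \<noteq> 0 \<longrightarrow> r \<noteq> 2 \<longrightarrow>
     exec B (c \<rho> f r) s (p m) 0 {s(r := un (val a x y (env vs)) @ s r)})"

lemma runsD:
  "runs c a p \<Longrightarrow> represents s x y \<rho> vs f \<Longrightarrow>
     length x \<le> m \<Longrightarrow> length y \<le> m \<Longrightarrow> set vs \<subseteq> {..m} \<Longrightarrow> r < f \<Longrightarrow> r \<notin> set \<rho> \<Longrightarrow> r \<noteq> 0 \<Longrightarrow> r \<noteq> 2 \<Longrightarrow>
     exec B (c \<rho> f r) s (p m) 0 {s(r := un (val a x y (env vs)) @ s r)}"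
  by (simp add: runs_def)

lemma runs_pb: "runs c a p \<Longrightarrow> pb p" and bounds_pb: "bounds a q \<Longrightarrow> pb q"
  by (simp_all add: runs_def bounds_def)

lemma runsI:
  assumes "pb p" "\<And>B m x y \<rho> vs f r s. represents s x y \<rho> vs f \<Longrightarrow>
     length x \<le> m \<Longrightarrow> length y \<le> m \<Longrightarrow> set vs \<subseteq> {..m} \<Longrightarrow> r < f \<Longrightarrow> r \<notin> set \<rho> \<Longrightarrow> r \<noteq> 0 \<Longrightarrow> r \<noteq> 2 \<Longrightarrow>
     exec B (c \<rho> f r) s (p m) 0 {s(r := un (val a x y (env vs)) @ s r)}"
  shows "\<exists>p. runs c a p"
  using assms unfolding runs_def by blast

lemma representsD:
  assumes "represents s x y \<rho> vs f"
  shows "s (dreg b) = (if b then y else x)" "length vs = length \<rho>" "2 < f"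
    "i < length \<rho> \<Longrightarrow> s (\<rho> ! i) = un (vs ! i) \<and> 2 < \<rho> ! i \<and> \<rho> ! i < f"
    "f \<le> j \<Longrightarrow> s j = []" "f \<le> j \<Longrightarrow> j \<notin> set \<rho>" "dreg b \<notin> set \<rho>" "dreg b < f" "1 \<notin> set \<rho>"
proof -
  have \<rho>: "2 < j \<and> j < f" if "j \<in> set \<rho>" for j
    using assms that by (auto simp: represents_def in_set_conv_nth)
  show "s (dreg b) = (if b then y else x)" "length vs = length \<rho>" "2 < f"
    "i < length \<rho> \<Longrightarrow> s (\<rho> ! i) = un (vs ! i) \<and> 2 < \<rho> ! i \<and> \<rho> ! i < f"
    "f \<le> j \<Longrightarrow> s j = []"
    using assms by (auto simp: represents_def dreg_def)
  show "f \<le> j \<Longrightarrow> j \<notin> set \<rho>" "dreg b \<notin> set \<rho>" "1 \<notin> set \<rho>"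
    using \<rho>[of j] \<rho>[of "dreg b"] \<rho>[of 1] by (auto simp: dreg_def)
  show "dreg b < f"
    using \<open>2 < f\<close> by (simp add: dreg_def)
qed

lemma represents_mono: "represents s x y \<rho> vs f \<Longrightarrow> f \<le> f' \<Longrightarrow> represents s x y \<rho> vs f'"
  by (fastforce simp: represents_def)

lemma represents_extend:
  assumes "represents s x y \<rho> vs f" "s' = s(f := un v, f + 1 := w, r := u)"
    "r < f" "r \<notin> set \<rho>" "r \<noteq> 0" "r \<noteq> 2"
  shows "represents s' x y (f # \<rho>) (v # vs) (f + 2)"
  unfolding represents_def
proof (intro conjI allI impI)
  note h = assms(1)[unfolded represents_def]
  show "s' 0 = x" "s' 2 = y" "length (v # vs) = length (f # \<rho>)" "2 < f + 2"
    using h assms by auto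
  show "s' j = []" if "f + 2 \<le> j" for j
    using h assms that by auto
  fix i
  assume i: "i < length (f # \<rho>)"
  show "s' ((f # \<rho>) ! i) = un ((v # vs) ! i)" "2 < (f # \<rho>) ! i" "(f # \<rho>) ! i < f + 2"
    using h assms i by (cases i; force simp: in_set_conv_nth)+
qed

theorem ce_runs: "\<exists>p. runs (ce a) a p"
proof (induction a)
  case (Con n)
  show ?case
    by (rule runsI[OF pb_const[of "2 * n"]]) (simp add: exec_pushn)
next
  case (Var i)
  show ?case
  proof (rule runsI)
    show "pb (\<lambda>m. 16 * m + 2)" by (intro pb_intros)
    fix B m x y \<rho> vs f r s
    assume a: "represents s x y \<rho> vs f" "length x \<le> m" "length y \<le> m" "set vs \<subseteq> {..m}"
      "r < f" "r \<notin> set \<rho>" "r \<noteq> 0" "r \<noteq> 2"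
    show "exec B (ce (Var i) \<rho> f r) s (16 * m + 2) 0 {s(r := un (val (Var i) x y (env vs)) @ s r)}"
    proof (cases "i < length \<rho>")
      case True
      note h = representsD(4)[OF a(1) True] representsD(2,5)[OF a(1)]
      have "vs ! i \<le> m" using a(4) True h(2) by (auto simp: subset_iff)
      moreover have "exec B (count (\<rho> ! i) f r) s (16 * length (s (\<rho> ! i)) + 2) 0
          {s(r := un (length (s (\<rho> ! i))) @ s r)}"
        using h True a by (intro exec_count) auto
      ultimately show ?thesis
        using True h by (auto simp: env_def elim!: exec_mono)
    qed (use representsD(2)[OF a(1)] in \<open>simp add: env_def exec_Skip\<close>)
  qed
next
  case (Len b)
  show ?case
  proof (rule runsI)
    show "pb (\<lambda>m. 16 * m + 2)" by (intro pb_intros)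
    fix B m x y \<rho> vs f r s
    assume a: "represents s x y \<rho> vs f" "length x \<le> m" "length y \<le> m" "set vs \<subseteq> {..m}"
      "r < f" "r \<notin> set \<rho>" "r \<noteq> 0" "r \<noteq> 2"
    note h = representsD[OF a(1)]
    have "exec B (count (dreg b) f r) s (16 * length (s (dreg b)) + 2) 0
        {s(r := un (length (s (dreg b))) @ s r)}"
      using h(3) h(5)[of f] h(8)[of b] a by (intro exec_count) (auto simp: dreg_def split: if_splits)
    then show "exec B (ce (Len b) \<rho> f r) s (16 * m + 2) 0 {s(r := un (val (Len b) x y (env vs)) @ s r)}"
      using h(1)[of b] a(2,3) by (auto elim!: exec_mono)
  qed
next
  case (Bit b a)
  then obtain p q where p: "runs (ce a) a p" and q: "bounds a q"
    using bounds_exist by blast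
  show ?case
  proof (rule runsI)
    show "pb (\<lambda>m. p m + (10 * q m + (7 * m + 6)))"
      by (intro pb_intros runs_pb[OF p] bounds_pb[OF q])
    fix B m x y \<rho> vs f r s
    assume a: "represents s x y \<rho> vs f" "length x \<le> m" "length y \<le> m" "set vs \<subseteq> {..m}"
      "r < f" "r \<notin> set \<rho>" "r \<noteq> 0" "r \<noteq> 2"
    note h = representsD[OF a(1)]
    let ?d = "dreg b" and ?z = "if b then y else x"
    define v where "v = val a x y (env vs)"
    have v: "v \<le> q m"
      unfolding v_def by (rule boundsD[OF q]) (use a env_le in auto)
    have d: "?d \<noteq> f" "?d \<noteq> f + 1" "?d \<noteq> r" "s ?d = ?z" "f \<noteq> r" "f + 1 \<noteq> r" "s f = []" "s (Suc f) = []"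
      using h(1,3,5,8) a by (auto simp: dreg_def)
    let ?s1 = "s(f := un v)"
    let ?s2 = "?s1(?d := drop v ?z, f := [], f + 1 := rev (take v ?z))"
    let ?s3 = "?s2(r := un (of_bool (bit ?z v)) @ s r)"
    let ?s4 = "s(r := un (of_bool (bit ?z v)) @ s r)"
    have 1: "exec B (ce a \<rho> (f + 2) f) s (p m) 0 {?s1}"
      using runsD[OF p, of s x y \<rho> vs "f + 2" m f B] a h(3,5,6) d represents_mono[OF a(1), of "f + 2"]
      by (simp add: v_def)
    \<comment> \<open>Dropping \<open>v\<close> bits exposes bit \<open>v\<close>, or the empty
      stack if there is none; the dropped bits wait on \<open>f + 1\<close> to be moved
      back.\<close>
    have 2: "exec B (dropc ?d f (f + 1)) ?s1 (10 * v + 1) 0 {?s2}"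
      using exec_dropc[of ?d f "f + 1" ?s1 v B] d by simp
    have 3: "exec B (If ?d 2 (Push r True) Skip) ?s2 4 0 {?s3}"
    proof (rule exec_If[where n = 2])
      have t: "top_sym (?s2 ?d) = 2 \<longleftrightarrow> bit ?z v"
        using d by (cases "v < length ?z") (auto simp: bit_def Cons_nth_drop_Suc[symmetric])
      have s2: "?s2 r = s r" using d by simp
      show "exec B (if top_sym (?s2 ?d) = 2 then Push r True else Skip) ?s2 2 0 {?s3}"
      proof (cases "bit ?z v")
        case True
        then show ?thesis
          using exec_Push[of 2 B r True ?s2 0] t s2 by simp
      next
        case False
        then have "?s3 = ?s2" using s2 by (auto simp: fun_eq_iff)
        then show ?thesis
          using exec_Skip[of B ?s2 2 0] False t by simp
      qed
    qed simp
    have e: "?s3(f + 1 := [], ?d := rev (?s3 (f + 1)) @ ?s3 ?d) = ?s4"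
      using d by (auto simp: fun_eq_iff)
    have 4: "exec B (move (f + 1) ?d) ?s3 (7 * length (?s3 (f + 1)) + 1) 0 {?s4}"
      using exec_move[of "f + 1" ?d B ?s3] d unfolding e by simp
    have "length (?s3 (f + 1)) \<le> m"
      using d a(2,3) by auto
    moreover have "exec B (ce (Bit b a) \<rho> f r) s
        (p m + ((10 * v + 1) + (4 + (7 * length (?s3 (f + 1)) + 1)))) (0 + (0 + (0 + 0))) {?s4}"
      unfolding ce.simps by (intro exec_Seq1[OF 1] exec_Seq1[OF 2] exec_Seq1[OF 3] 4)
    ultimately have "exec B (ce (Bit b a) \<rho> f r) s (p m + (10 * q m + (7 * m + 6))) 0 {?s4}"
      by (elim exec_mono) (use v in auto)
    then show "exec B (ce (Bit b a) \<rho> f r) s (p m + (10 * q m + (7 * m + 6))) 0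
        {s(r := un (val (Bit b a) x y (env vs)) @ s r)}"
      by (simp add: v_def)
  qed
next
  case (Add a b)
  then obtain p q where p: "runs (ce a) a p" and q: "runs (ce b) b q" by blast
  show ?case
  proof (rule runsI)
    show "pb (\<lambda>m. p m + q m)"
      by (intro pb_intros runs_pb[OF p] runs_pb[OF q])
    fix B m x y \<rho> vs f r s
    assume a: "represents s x y \<rho> vs f" "length x \<le> m" "length y \<le> m" "set vs \<subseteq> {..m}"
      "r < f" "r \<notin> set \<rho>" "r \<noteq> 0" "r \<noteq> 2"
    let ?v = "val a x y (env vs)" and ?w = "val b x y (env vs)"
    have 1: "exec B (ce a \<rho> f r) s (p m) 0 {s(r := un ?v @ s r)}"
      by (rule runsD[OF p]) (use a in auto)
    have "exec B (ce b \<rho> f r) (s(r := un ?v @ s r)) (q m) 0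
        {(s(r := un ?v @ s r))(r := un ?w @ (s(r := un ?v @ s r)) r)}"
      by (rule runsD[OF q represents_upd[OF a(1)]]) (use a in auto)
    moreover have "un ?w @ un ?v @ s r = un (?v + ?w) @ s r"
      by (simp only: replicate_add[symmetric] append_assoc[symmetric] add.commute)
    ultimately have 2: "exec B (ce b \<rho> f r) (s(r := un ?v @ s r)) (q m) 0 {s(r := un (?v + ?w) @ s r)}"
      by simp
    show "exec B (ce (Add a b) \<rho> f r) s (p m + q m) 0 {s(r := un (val (Add a b) x y (env vs)) @ s r)}"
      using exec_Seq1[OF 1 2] by simp
  qed
next
  case (Sub a b)
  then obtain p q p' q' where p: "runs (ce a) a p" and q: "runs (ce b) b q"
    and p': "bounds a p'" and q': "bounds b q'" using bounds_exist by blast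
  show ?case
  proof (rule runsI)
    show "pb (\<lambda>m. p m + (q m + (6 * q' m + (7 * p' m + 2))))"
      by (intro pb_intros runs_pb[OF p] runs_pb[OF q] bounds_pb[OF p'] bounds_pb[OF q'])
    fix B m x y \<rho> vs f r s
    assume a: "represents s x y \<rho> vs f" "length x \<le> m" "length y \<le> m" "set vs \<subseteq> {..m}"
      "r < f" "r \<notin> set \<rho>" "r \<noteq> 0" "r \<noteq> 2"
    note h = representsD[OF a(1)]
    define v w where "v = val a x y (env vs)" and "w = val b x y (env vs)"
    have vw: "v \<le> p' m" "w \<le> q' m"
      unfolding v_def w_def by (rule boundsD[OF p'] boundsD[OF q']; use a env_le in auto)+
    have d: "f \<noteq> r" "f + 1 \<noteq> r" "s f = []" "s (Suc f) = []" "0 < f" "2 < f" "f \<notin> set \<rho>" "Suc f \<notin> set \<rho>"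
      using h(3,5,6) a by auto
    let ?s1 = "s(f := un v)" let ?s2 = "?s1(f + 1 := un w)"
    let ?s3 = "s(f := un (v - w))" let ?s4 = "s(r := un (v - w) @ s r)"
    have 1: "exec B (ce a \<rho> (f + 2) f) s (p m) 0 {?s1}"
      using runsD[OF p, of s x y \<rho> vs "f + 2" m f B] a d represents_mono[OF a(1), of "f + 2"]
      by (simp add: v_def)
    have "represents ?s1 x y \<rho> vs (f + 2)"
      using d by (intro represents_upd[OF a(1)]) auto
    then have 2: "exec B (ce b \<rho> (f + 2) (f + 1)) ?s1 (q m) 0 {?s2}"
      using runsD[OF q, of ?s1 x y \<rho> vs "f + 2" m "f + 1" B] a d by (simp add: w_def)
    have e3: "?s2(f := un (v - w), f + 1 := []) = ?s3"
      using d by (auto simp: fun_eq_iff)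
    have 3: "exec B (subc f (f + 1)) ?s2 (6 * w + 1) 0 {?s3}"
      using exec_subc[of f "f + 1" ?s2 v w B] unfolding e3 by simp
    have e4: "?s3(f := [], r := rev (?s3 f) @ ?s3 r) = ?s4"
      using d by (auto simp: fun_eq_iff)
    have 4: "exec B (move f r) ?s3 (7 * length (?s3 f) + 1) 0 {?s4}"
      using exec_move[of f r B ?s3] d unfolding e4 by simp
    have "exec B (ce (Sub a b) \<rho> f r) s
        (p m + (q m + ((6 * w + 1) + (7 * length (?s3 f) + 1)))) (0 + (0 + (0 + 0))) {?s4}"
      unfolding ce.simps by (intro exec_Seq1[OF 1] exec_Seq1[OF 2] exec_Seq1[OF 3] 4)
    then have "exec B (ce (Sub a b) \<rho> f r) s (p m + (q m + (6 * q' m + (7 * p' m + 2)))) 0 {?s4}"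
      by (elim exec_mono) (use vw in auto)
    then show "exec B (ce (Sub a b) \<rho> f r) s (p m + (q m + (6 * q' m + (7 * p' m + 2)))) 0
        {s(r := un (val (Sub a b) x y (env vs)) @ s r)}"
      by (simp add: v_def w_def)
  qed
next
  case (Sum a b)
  then obtain p q p' where p: "runs (ce a) a p" and q: "runs (ce b) b q"
    and p': "bounds a p'" using bounds_exist by blast
  show ?case
  proof (rule runsI)
    show "pb (\<lambda>m. p m + (p' m * (q (m + p' m) + 5) + 1 + (3 * p' m + 1)))"
      by (intro pb_intros runs_pb[OF p] bounds_pb[OF p']
          pb_comp[OF runs_pb[OF q] pb_add[OF pb_id bounds_pb[OF p']]])
    fix B m x y \<rho> vs f r s
    assume a: "represents s x y \<rho> vs f" "length x \<le> m" "length y \<le> m" "set vs \<subseteq> {..m}"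
      "r < f" "r \<notin> set \<rho>" "r \<noteq> 0" "r \<noteq> 2"
    note h = representsD[OF a(1)]
    define v where "v = val a x y (env vs)"
    define w where "w j = (\<Sum>i<j. val b x y (case_nat i (env vs)))" for j
    have v: "v \<le> p' m"
      unfolding v_def by (rule boundsD[OF p']; use a env_le in auto)
    have d: "f \<noteq> r" "f + 1 \<noteq> r" "s f = []" "s (Suc f) = []" "0 < f" "2 < f" "f \<notin> set \<rho>" "Suc f \<notin> set \<rho>"
      using h(3,5,6) a by auto
    \<comment> \<open>Loop invariant: \<open>f\<close> counts the finished rounds,
      \<open>f + 1\<close> the remaining ones, and the partial sum lies on top of
      \<open>r\<close>.\<close>
    let ?f = "\<lambda>i. s(f := un i, f + 1 := un (v - i), r := un (w i) @ s r)"
    have f0: "?f 0 = s(f + 1 := un v)"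
      using d by (auto simp: fun_eq_iff w_def)
    have "represents s x y \<rho> vs (f + 2)"
      using represents_mono[OF a(1), of "f + 2"] by simp
    then have 1: "exec B (ce a \<rho> (f + 2) (f + 1)) s (p m) 0 {?f 0}"
      using runsD[OF p, of s x y \<rho> vs "f + 2" m "f + 1" B] a d unfolding f0 by (simp add: v_def)
    let ?body = "Pop (f + 1) ;; ce b (f # \<rho>) (f + 2) r ;; Push f True"
    have 2: "exec B (While (f + 1) ?body) (?f 0) (p' m * (q (m + p' m) + 5) + 1) 0 {?f v}"
    proof (rule exec_loop0[where f = ?f and N = v and n = "1 + (q (m + p' m) + 2)"])
      fix i
      assume i: "i < v"
      let ?s1 = "s(f := un i, f + 1 := un (v - Suc i), r := un (w i) @ s r)"
      let ?s2 = "s(f := un i, f + 1 := un (v - Suc i), r := un (w (Suc i)) @ s r)"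
      have e1: "(?f i)(f + 1 := tl (?f i (f + 1))) = ?s1"
        using d by (auto simp: fun_eq_iff)
      have 3: "exec B (Pop (f + 1)) (?f i) 1 0 {?s1}"
        using exec_Pop[of 1 "?f i" "f + 1" B 0] i d unfolding e1 by simp
      have "represents ?s1 x y (f # \<rho>) (i # vs) (f + 2)"
        by (rule represents_extend[OF a(1) refl]) (use a in auto)
      then have "exec B (ce b (f # \<rho>) (f + 2) r) ?s1 (q (m + p' m)) 0
          {?s1(r := un (val b x y (env (i # vs))) @ ?s1 r)}"
        by (rule runsD[OF q]) (use a d i v in auto)
      moreover have "?s1(r := un (val b x y (env (i # vs))) @ ?s1 r) = ?s2"
      proof -
        have "un (val b x y (env (i # vs))) @ un (w i) @ s r = un (w (Suc i)) @ s r"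
          unfolding append_assoc[symmetric] replicate_add[symmetric] by (simp add: w_def env_Cons)
        then show ?thesis using d by (auto simp: fun_eq_iff)
      qed
      ultimately have 4: "exec B (ce b (f # \<rho>) (f + 2) r) ?s1 (q (m + p' m)) 0 {?s2}"
        by (simp only:)
      have e5: "?s2(f := True # ?s2 f) = ?f (Suc i)"
        using d by (auto simp: fun_eq_iff)
      have 5: "exec B (Push f True) ?s2 2 0 {?f (Suc i)}"
        using exec_Push[of 2 B f True ?s2 0] unfolding e5 by simp
      show "exec B ?body (?f i) (1 + (q (m + p' m) + 2)) 0 {?f (Suc i)}"
        using exec_Seq1[OF 3 exec_Seq1[OF 4 5]] by simp
      show "?f i (f + 1) \<noteq> []"
        using i d by simp
    next
      show "v * (1 + (q (m + p' m) + 2) + 2) + 1 \<le> p' m * (q (m + p' m) + 5) + 1"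
        using mult_right_mono[OF v, of "q (m + p' m) + 5"] by (simp add: algebra_simps)
    qed (use d in auto)
    have e3: "(?f v)(f := []) = s(r := un (w v) @ s r)"
      using d by (auto simp: fun_eq_iff)
    have 3: "exec B (clear f) (?f v) (3 * p' m + 1) 0 {s(r := un (w v) @ s r)}"
      using exec_mono[OF exec_clear[of B f "?f v"], of "3 * p' m + 1" 0] d v unfolding e3 by simp
    show "exec B (ce (Sum a b) \<rho> f r) s (p m + (p' m * (q (m + p' m) + 5) + 1 + (3 * p' m + 1))) 0
        {s(r := un (val (Sum a b) x y (env vs)) @ s r)}"
      using exec_Seq1[OF 1 exec_Seq1[OF 2 3]] by (simp add: w_def v_def)
  qed
qed

subsection \<open>Writing words\<close>

text \<open>A loop as for \<open>Sum\<close> whose body pushes one bit on stack 1. The last bit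
  comes to lie on top, which the reversal in reading stack 1 undoes.\<close>

definition outw :: "ex \<Rightarrow> ex \<Rightarrow> nat list \<Rightarrow> nat \<Rightarrow> cmd" where
  "outw l b \<rho> f = ce l \<rho> (f + 2) (f + 1) ;;
     While (f + 1) (Pop (f + 1) ;; ce b (f # \<rho>) (f + 3) (f + 2) ;;
       If (f + 2) 0 (Push 1 False) (Push 1 True) ;; clear (f + 2) ;; Push f True) ;; clear f"

definition word :: "ex \<Rightarrow> ex \<Rightarrow> bool list \<Rightarrow> bool list \<Rightarrow> (nat \<Rightarrow> nat) \<Rightarrow> bool list" where
  "word l b x y e = map (\<lambda>i. val b x y (case_nat i e) \<noteq> 0) [0..<val l x y e]"

lemma ask_free_outw: "ask_free (outw l b \<rho> f)"
  by (simp add: outw_def ask_free_ce clear_def)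

lemma guess_free_outw: "guess_free (outw l b \<rho> f)"
  by (simp add: outw_def guess_free_ce clear_def)

theorem outw_runs:
  "\<exists>p. pb p \<and> (\<forall>B m x y \<rho> vs f s. represents s x y \<rho> vs f \<longrightarrow>
     length x \<le> m \<longrightarrow> length y \<le> m \<longrightarrow> set vs \<subseteq> {..m} \<longrightarrow>
     exec B (outw l b \<rho> f) s (p m) 0 {s(1 := rev (word l b x y (env vs)) @ s 1)})"
proof -
  obtain p q p' q' where p: "runs (ce l) l p" and q: "runs (ce b) b q"
    and p': "bounds l p'" and q': "bounds b q'"
    using bounds_exist ce_runs by blast
  define R where "R m = 1 + (q (m + p' m) + (4 + ((3 * q' (m + p' m) + 1) + 2)))" for m
  have "pb (\<lambda>m. p m + (p' m * (R m + 2) + 1 + (3 * p' m + 1)))"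
    unfolding R_def
    by (intro pb_intros runs_pb[OF p] bounds_pb[OF p']
          pb_comp[OF runs_pb[OF q] pb_add[OF pb_id bounds_pb[OF p']]]
          pb_comp[OF bounds_pb[OF q'] pb_add[OF pb_id bounds_pb[OF p']]])
  moreover have "exec B (outw l b \<rho> f) s (p m + (p' m * (R m + 2) + 1 + (3 * p' m + 1))) 0
      {s(1 := rev (word l b x y (env vs)) @ s 1)}"
    if a: "represents s x y \<rho> vs f" "length x \<le> m" "length y \<le> m" "set vs \<subseteq> {..m}"
    for B m x y \<rho> vs f s
  proof -
    note h = representsD[OF a(1)]
    define v where "v = val l x y (env vs)"
    define w where "w j = map (\<lambda>i. val b x y (case_nat i (env vs)) \<noteq> 0) [0..<j]" for j
    have v: "v \<le> p' m"
      unfolding v_def by (rule boundsD[OF p']; use a env_le in auto)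
    have d: "f \<noteq> 1" "s f = []" "s (Suc f) = []" "s (Suc (Suc f)) = []" "0 < f" "2 < f" "f \<notin> set \<rho>"
      "Suc f \<notin> set \<rho>" "Suc (Suc f) \<notin> set \<rho>"
      using h(3,5,6) a by auto
    let ?f = "\<lambda>i. s(f := un i, f + 1 := un (v - i), 1 := rev (w i) @ s 1)"
    have f0: "?f 0 = s(f + 1 := un v)"
      using d by (auto simp: fun_eq_iff w_def)
    have "represents s x y \<rho> vs (f + 2)"
      using represents_mono[OF a(1), of "f + 2"] by simp
    then have 1: "exec B (ce l \<rho> (f + 2) (f + 1)) s (p m) 0 {?f 0}"
      using runsD[OF p, of s x y \<rho> vs "f + 2" m "f + 1" B] a d unfolding f0 by (simp add: v_def)
    let ?body = "Pop (f + 1) ;; ce b (f # \<rho>) (f + 3) (f + 2) ;;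
       If (f + 2) 0 (Push 1 False) (Push 1 True) ;; clear (f + 2) ;; Push f True"
    have 2: "exec B (While (f + 1) ?body) (?f 0) (p' m * (R m + 2) + 1) 0 {?f v}"
    proof (rule exec_loop0[where f = ?f and N = v and n = "R m"])
      fix i
      assume i: "i < v"
      define c where "c = val b x y (case_nat i (env vs))"
      have "set (i # vs) \<subseteq> {..m + p' m}"
        using a(4) i v by auto
      then have "c \<le> q' (m + p' m)"
        unfolding c_def env_Cons[symmetric] by (intro boundsD[OF q'] env_le) (use a in auto)
      let ?s1 = "s(f := un i, f + 1 := un (v - Suc i), 1 := rev (w i) @ s 1)"
      let ?s2 = "?s1(f + 2 := un c)"
      let ?s3 = "?s2(1 := (c \<noteq> 0) # ?s2 1)"
      let ?s4 = "?s1(1 := rev (w (Suc i)) @ s 1)"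
      have e1: "(?f i)(f + 1 := tl (?f i (f + 1))) = ?s1"
        using d by (auto simp: fun_eq_iff)
      have 3: "exec B (Pop (f + 1)) (?f i) 1 0 {?s1}"
        using exec_Pop[of 1 "?f i" "f + 1" B 0] i d unfolding e1 by simp
      have r: "represents ?s1 x y (f # \<rho>) (i # vs) (f + 2)"
        by (rule represents_extend[OF a(1) refl]) (use h(9) d in auto)
      have "?s1 (f + 2) = []" using d by simp
      then have "represents ?s1 x y (f # \<rho>) (i # vs) (f + 3)"
        using represents_mono[OF r, of "f + 3"] by simp
      then have "exec B (ce b (f # \<rho>) (f + 3) (f + 2)) ?s1 (q (m + p' m)) 0
          {?s1(f + 2 := un (val b x y (env (i # vs))) @ ?s1 (f + 2))}"
        by (rule runsD[OF q]) (use a d i v in auto)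
      then have 4: "exec B (ce b (f # \<rho>) (f + 3) (f + 2)) ?s1 (q (m + p' m)) 0 {?s2}"
        using d by (simp add: c_def env_Cons)
      have 5: "exec B (If (f + 2) 0 (Push 1 False) (Push 1 True)) ?s2 4 0 {?s3}"
      proof (rule exec_If[where n = 2])
        show "exec B (if top_sym (?s2 (f + 2)) = 0 then Push 1 False else Push 1 True) ?s2 2 0 {?s3}"
          using exec_Push[of 2 B 1 "c \<noteq> 0" ?s2 0] by (cases "c = 0") simp_all
      qed simp
      have e6: "?s3(f + 2 := []) = ?s4"
        using d by (auto simp: fun_eq_iff w_def c_def)
      have 6: "exec B (clear (f + 2)) ?s3 (3 * q' (m + p' m) + 1) 0 {?s4}"
        using exec_mono[OF exec_clear[of B "f + 2" ?s3], of "3 * q' (m + p' m) + 1" 0]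
          \<open>c \<le> q' (m + p' m)\<close> d unfolding e6 by simp
      have e7: "?s4(f := True # ?s4 f) = ?f (Suc i)"
        using d by (auto simp: fun_eq_iff)
      have 7: "exec B (Push f True) ?s4 2 0 {?f (Suc i)}"
        using exec_Push[of 2 B f True ?s4 0] unfolding e7 by simp
      show "exec B ?body (?f i) (R m) 0 {?f (Suc i)}"
        using exec_Seq1[OF 3 exec_Seq1[OF 4 exec_Seq1[OF 5 exec_Seq1[OF 6 7]]]] by (simp add: R_def)
      show "?f i (f + 1) \<noteq> []"
        using i d by simp
    next
      show "v * (R m + 2) + 1 \<le> p' m * (R m + 2) + 1"
        by (intro add_right_mono mult_right_mono v) simp
    qed (use d in auto)
    have e3: "(?f v)(f := []) = s(1 := rev (w v) @ s 1)"
      using d by (auto simp: fun_eq_iff)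
    have 3: "exec B (clear f) (?f v) (3 * p' m + 1) 0 {s(1 := rev (w v) @ s 1)}"
      using exec_mono[OF exec_clear[of B f "?f v"], of "3 * p' m + 1" 0] d v unfolding e3 by simp
    show ?thesis
      using exec_Seq1[OF 1 exec_Seq1[OF 2 3]] by (simp add: w_def v_def outw_def word_def)
  qed
  ultimately show ?thesis by blast
qed

section \<open>Definable functions\<close>

text \<open>The notion of polynomial-time computability used from here on: closure rules establish
  it by following the form of a definition.\<close>

definition definable :: "(bool list \<Rightarrow> bool list \<Rightarrow> (nat \<Rightarrow> nat) \<Rightarrow> nat) \<Rightarrow> bool" where
  "definable f \<longleftrightarrow> (\<exists>a. \<forall>x y e. f x y e = val a x y e)"

abbreviation decidable :: "(bool list \<Rightarrow> bool list \<Rightarrow> (nat \<Rightarrow> nat) \<Rightarrow> bool) \<Rightarrow> bool" where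
  "decidable p \<equiv> definable (\<lambda>x y e. of_bool (p x y e))"

fun ren :: "(nat \<Rightarrow> nat) \<Rightarrow> ex \<Rightarrow> ex" where
  "ren h (Con c) = Con c"
| "ren h (Var i) = Var (h i)"
| "ren h (Len b) = Len b"
| "ren h (Bit b a) = Bit b (ren h a)"
| "ren h (Add a b) = Add (ren h a) (ren h b)"
| "ren h (Sub a b) = Sub (ren h a) (ren h b)"
| "ren h (Sum a b) = Sum (ren h a) (ren (case_nat 0 (\<lambda>i. Suc (h i))) b)"

lemma val_ren: "val (ren h a) x y e = val a x y (\<lambda>i. e (h i))"
proof (induction a arbitrary: h e)
  case (Sum a b)
  have "(\<lambda>i. case_nat j e (case_nat 0 (\<lambda>i. Suc (h i)) i)) = case_nat j (\<lambda>i. e (h i))" for j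
    by (auto simp: fun_eq_iff split: nat.split)
  then show ?case by (simp add: Sum)
qed auto

text \<open>Below the binder of \<open>Sum\<close>, variable 0 is kept and the inserted expressions
  are shifted by \<open>ren Suc\<close>.\<close>

fun sub :: "(nat \<Rightarrow> ex) \<Rightarrow> ex \<Rightarrow> ex" where
  "sub h (Con c) = Con c"
| "sub h (Var i) = h i"
| "sub h (Len b) = Len b"
| "sub h (Bit b a) = Bit b (sub h a)"
| "sub h (Add a b) = Add (sub h a) (sub h b)"
| "sub h (Sub a b) = Sub (sub h a) (sub h b)"
| "sub h (Sum a b) = Sum (sub h a) (sub (case_nat (Var 0) (\<lambda>i. ren Suc (h i))) b)"

lemma val_sub: "val (sub h a) x y e = val a x y (\<lambda>i. val (h i) x y e)"
proof (induction a arbitrary: h e)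
  case (Sum a b)
  have "(\<lambda>i. val (case_nat (Var 0) (\<lambda>i. ren Suc (h i)) i) x y (case_nat j e)) =
      case_nat j (\<lambda>i. val (h i) x y e)" for j
    by (auto simp: fun_eq_iff val_ren split: nat.split)
  then show ?case by (simp add: Sum)
qed auto

lemma definable_val: "definable (\<lambda>x y e. val a x y e)"
  unfolding definable_def by blast

lemma definable_sub:
  assumes "definable f" "\<And>k. definable (h k)"
  shows "definable (\<lambda>x y e. f x y (\<lambda>k. h k x y e))"
proof -
  obtain a where a: "\<And>x y e. f x y e = val a x y e"
    using assms(1) unfolding definable_def by blast
  obtain g where g: "\<And>k x y e. h k x y e = val (g k) x y e"
    using assms(2) unfolding definable_def by metis
  show ?thesis
    using definable_val[of "sub g a"] by (simp add: val_sub a g)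
qed

section \<open>Closure properties of definable functions\<close>

lemma definable_const: "definable (\<lambda>x y e. c)"
  using definable_val[of "Con c"] by simp

lemma definable_var: "definable (\<lambda>x y e. e i)"
  using definable_val[of "Var i"] by simp

lemma definable_length: "definable (\<lambda>x y e. length x)" "definable (\<lambda>x y e. length y)"
  using definable_val[of "Len False"] definable_val[of "Len True"] by simp_all

lemma definable_ren: "definable f \<Longrightarrow> definable (\<lambda>x y e. f x y (\<lambda>i. e (h i)))"
  by (rule definable_sub[where h = "\<lambda>k x y e. e (h k)"]) (auto intro: definable_var)

lemma decidable_bit:
  assumes "definable f"
  shows "decidable (\<lambda>x y e. bit x (f x y e))" "decidable (\<lambda>x y e. bit y (f x y e))"
proof -
  obtain a where a: "\<And>x y e. f x y e = val a x y e"
    using assms unfolding definable_def by blast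
  show "decidable (\<lambda>x y e. bit x (f x y e))" "decidable (\<lambda>x y e. bit y (f x y e))"
    using definable_val[of "Bit False a"] definable_val[of "Bit True a"] by (simp_all add: a)
qed

lemma definable_add:
  assumes "definable f" "definable g"
  shows "definable (\<lambda>x y e. f x y e + g x y e)"
proof -
  obtain a b where "\<And>x y e. f x y e = val a x y e" "\<And>x y e. g x y e = val b x y e"
    using assms unfolding definable_def by blast
  then show ?thesis using definable_val[of "Add a b"] by simp
qed

lemma definable_diff:
  assumes "definable f" "definable g"
  shows "definable (\<lambda>x y e. f x y e - g x y e)"
proof -
  obtain a b where "\<And>x y e. f x y e = val a x y e" "\<And>x y e. g x y e = val b x y e"
    using assms unfolding definable_def by blast
  then show ?thesis using definable_val[of "Sub a b"] by simp
qed

text \<open>The function \<open>g\<close> receives the bound variable separately; in the expression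
  it becomes variable 0 and the others move up by one.\<close>

lemma definable_sum:
  assumes "definable f" "definable (\<lambda>x y e. g x y (\<lambda>i. e (Suc i)) (e 0))"
  shows "definable (\<lambda>x y e. \<Sum>i<f x y e. g x y e i)"
proof -
  obtain a b where a: "\<And>x y e. f x y e = val a x y e"
    and b: "\<And>x y e. g x y (\<lambda>i. e (Suc i)) (e 0) = val b x y e"
    using assms unfolding definable_def by blast
  have "g x y e i = val b x y (case_nat i e)" for x y e i
    unfolding b[symmetric] by simp
  then show ?thesis
    using definable_val[of "Sum a b"] by (simp add: a)
qed

lemma definable_mult:
  assumes "definable f" "definable g"
  shows "definable (\<lambda>x y e. f x y e * g x y e)"
  using definable_sum[OF assms(1), of "\<lambda>x y e i. g x y e"] definable_ren[OF assms(2)] by simp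

lemma definable_Suc: "definable f \<Longrightarrow> definable (\<lambda>x y e. Suc (f x y e))"
  using definable_add[OF _ definable_const[of 1], of f] by simp

lemma definable_power: "definable f \<Longrightarrow> definable (\<lambda>x y e. f x y e ^ k)"
  by (induction k) (simp_all add: definable_const definable_mult)

lemma decidable_const: "decidable (\<lambda>x y e. b)"
  by (rule definable_const)

lemma decidable_le:
  assumes "definable f" "definable g"
  shows "decidable (\<lambda>x y e. f x y e \<le> g x y e)"
proof -
  have e: "of_bool (a \<le> b) = 1 - (a - b)" for a b :: nat
    by (cases "a \<le> b") auto
  show ?thesis unfolding e by (intro definable_diff definable_const assms)
qed

lemma decidable_less: "definable f \<Longrightarrow> definable g \<Longrightarrow> decidable (\<lambda>x y e. f x y e < g x y e)"
  unfolding Suc_le_eq[symmetric] by (intro decidable_le definable_Suc)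

lemma decidable_conj:
  "decidable p \<Longrightarrow> decidable q \<Longrightarrow> decidable (\<lambda>x y e. p x y e \<and> q x y e)"
  unfolding of_bool_conj by (rule definable_mult)

lemma decidable_not: "decidable p \<Longrightarrow> decidable (\<lambda>x y e. \<not> p x y e)"
proof -
  have e: "of_bool (\<not> a) = (1 :: nat) - of_bool a" for a by simp
  show "decidable p \<Longrightarrow> ?thesis" unfolding e by (intro definable_diff definable_const)
qed

lemma decidable_disj:
  "decidable p \<Longrightarrow> decidable q \<Longrightarrow> decidable (\<lambda>x y e. p x y e \<or> q x y e)"
  using decidable_not[OF decidable_conj[OF decidable_not decidable_not], of p q] by simp

lemma decidable_imp:
  "decidable p \<Longrightarrow> decidable q \<Longrightarrow> decidable (\<lambda>x y e. p x y e \<longrightarrow> q x y e)"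
  unfolding imp_conv_disj by (intro decidable_disj decidable_not)

lemma decidable_eq:
  "definable f \<Longrightarrow> definable g \<Longrightarrow> decidable (\<lambda>x y e. f x y e = g x y e)"
  unfolding order_eq_iff by (intro decidable_conj decidable_le)

lemma decidable_iff:
  "decidable p \<Longrightarrow> decidable q \<Longrightarrow> decidable (\<lambda>x y e. p x y e \<longleftrightarrow> q x y e)"
  unfolding iff_conv_conj_imp by (intro decidable_conj decidable_imp)

lemma decidable_ex:
  assumes "definable f" "decidable (\<lambda>x y e. p x y (\<lambda>i. e (Suc i)) (e 0))"
  shows "decidable (\<lambda>x y e. \<exists>i<f x y e. p x y e i)"
proof -
  have "(\<exists>i<f x y e. p x y e i) \<longleftrightarrow> (0 :: nat) < (\<Sum>i<f x y e. of_bool (p x y e i))" for x y e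
    unfolding neq0_conv[symmetric] by auto
  then show ?thesis
    using decidable_less[OF definable_const[of 0] definable_sum[OF assms]] by simp
qed

lemma decidable_all:
  assumes "definable f" "decidable (\<lambda>x y e. p x y (\<lambda>i. e (Suc i)) (e 0))"
  shows "decidable (\<lambda>x y e. \<forall>i<f x y e. p x y e i)"
  using decidable_not[OF decidable_ex[OF assms(1) decidable_not[OF assms(2)]]] by simp

lemma definable_card:
  assumes "definable f" "decidable (\<lambda>x y e. p x y (\<lambda>i. e (Suc i)) (e 0))"
  shows "definable (\<lambda>x y e. card {i. i < f x y e \<and> p x y e i})"
proof -
  have "card {i. i < n \<and> q i} = (\<Sum>i<n. of_bool (q i))" for n :: nat and q
    by (simp add: lessThan_def Collect_conj_eq)
  then show ?thesis
    using definable_sum[OF assms] by simp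
qed

text \<open>The quotient is the number of positive multiples of the divisor up to the dividend, a
  bounded count.\<close>

lemma definable_div:
  assumes "definable f" "definable g" "\<And>x y e. 0 < g x y e"
  shows "definable (\<lambda>x y e. f x y e div g x y e)"
proof -
  have "a div b = card {i. i < a \<and> Suc i * b \<le> a}" if "0 < b" for a b :: nat
  proof -
    have "{i. i < a \<and> Suc i * b \<le> a} = {..<a div b}"
    proof (intro set_eqI iffI)
      fix i
      assume "i \<in> {..<a div b}"
      then have "Suc i \<le> a div b" by simp
      then have "Suc i * b \<le> a" "Suc i \<le> a"
        using that order_trans[OF _ div_le_dividend[of a b]]
        by (simp_all add: less_eq_div_iff_mult_less_eq)
      then show "i \<in> {i. i < a \<and> Suc i * b \<le> a}" by simp
    next
      fix i
      assume "i \<in> {i. i < a \<and> Suc i * b \<le> a}"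
      then have "Suc i \<le> a div b"
        using that by (auto simp: less_eq_div_iff_mult_less_eq)
      then show "i \<in> {..<a div b}" by simp
    qed
    then show ?thesis by simp
  qed
  then have "f x y e div g x y e = card {i. i < f x y e \<and> Suc i * g x y e \<le> f x y e}" for x y e
    using assms(3) by blast
  then show ?thesis
    by (simp only:) (intro definable_card assms(1) decidable_le definable_mult definable_Suc definable_var
        definable_ren[OF assms(1), of Suc] definable_ren[OF assms(2), of Suc])
qed

lemma definable_mod:
  assumes "definable f" "definable g" "\<And>x y e. 0 < g x y e"
  shows "definable (\<lambda>x y e. f x y e mod g x y e)"
  unfolding minus_div_mult_eq_mod[symmetric]
  by (intro definable_diff definable_mult definable_div assms)

lemma definable_if:
  assumes "decidable p" "definable f" "definable g"
  shows "definable (\<lambda>x y e. if p x y e then f x y e else g x y e)"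
proof -
  have "(if p x y e then f x y e else g x y e) =
      of_bool (p x y e) * f x y e + of_bool (\<not> p x y e) * g x y e" for x y e
    by simp
  then show ?thesis
    by (simp only:) (intro definable_add definable_mult decidable_not assms)
qed

lemma decidable_if:
  assumes "decidable p" "decidable q" "decidable r"
  shows "decidable (\<lambda>x y e. if p x y e then q x y e else r x y e)"
  unfolding if_bool_eq_conj by (intro decidable_conj decidable_imp decidable_not assms)

lemma decidable_list_ex:
  assumes "\<And>a. a \<in> set as \<Longrightarrow> decidable (p a)"
  shows "decidable (\<lambda>x y e. \<exists>a\<in>set as. p a x y e)"
  using assms
proof (induction as)
  case (Cons a as)
  have e: "(\<exists>b\<in>set (a # as). q b) \<longleftrightarrow> q a \<or> (\<exists>b\<in>set as. q b)" for q
    by simp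
  show ?case
    unfolding e by (rule decidable_disj) (use Cons in auto)
qed (simp add: definable_const)

lemma decidable_list_all:
  assumes "\<And>a. a \<in> set as \<Longrightarrow> decidable (p a)"
  shows "decidable (\<lambda>x y e. \<forall>a\<in>set as. p a x y e)"
  using assms
proof (induction as)
  case (Cons a as)
  have e: "(\<forall>b\<in>set (a # as). q b) \<longleftrightarrow> q a \<and> (\<forall>b\<in>set as. q b)" for q
    by simp
  show ?case
    unfolding e by (rule decidable_conj) (use Cons in auto)
qed (use definable_const[of 1] in simp)

lemmas definable_intros = definable_const definable_var definable_length definable_add definable_diff
  definable_mult definable_Suc definable_power definable_sum definable_card definable_if
  decidable_bit decidable_le decidable_less decidable_eq
  decidable_conj decidable_disj decidable_not decidable_imp decidable_iff decidable_ex decidable_all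
  decidable_if decidable_const

subsection \<open>Polynomial-time reductions\<close>

lemma pb_poly: "pb f \<Longrightarrow> \<exists>p :: nat poly. \<forall>m. f m \<le> poly p m"
  unfolding pb_def
proof (elim exE)
  fix k
  assume "\<forall>m. f m \<le> (m + 2) ^ k"
  then show "\<exists>p :: nat poly. \<forall>m. f m \<le> poly p m"
    by (intro exI[of _ "[:2, 1:] ^ k"]) (simp add: poly_power add.commute)
qed

lemma represents_ini: "represents (ini x) x [] [] [] 3"
  by (auto simp: represents_def ini_def)

abbreviation zeros :: "nat \<Rightarrow> nat" where
  "zeros \<equiv> \<lambda>_. 0"

lemma env_Nil: "env [] = zeros"
  by (simp add: env_def fun_eq_iff)

text \<open>It suffices to define the length and the bits of the output; variable 0 is the position,
  and the second word stays empty.\<close>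

theorem FP_I:
  assumes "definable l" "decidable b"
    and "\<And>x. f x = map (\<lambda>i. b x [] (case_nat i zeros)) [0..<l x [] zeros]"
  shows "f \<in> FP"
proof -
  obtain la ba where la: "\<And>x y e. l x y e = val la x y e"
    and ba: "\<And>x y e. of_bool (b x y e) = val ba x y e"
    using assms(1,2) unfolding definable_def by blast
  have f: "f x = word la ba x [] zeros" for x
    unfolding assms(3) word_def la[symmetric] ba[symmetric] by simp
  obtain p where p: "pb p" and run: "\<And>B m x y \<rho> vs f s. represents s x y \<rho> vs f \<Longrightarrow>
      length x \<le> m \<Longrightarrow> length y \<le> m \<Longrightarrow> set vs \<subseteq> {..m} \<Longrightarrow>
      exec B (outw la ba \<rho> f) s (p m) 0 {s(1 := rev (word la ba x y (env vs)) @ s 1)}"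
    using outw_runs[of la ba] by blast
  let ?c = "outw la ba [] 3"
  have ex: "exec {} ?c (ini x) (p (length x)) 0 {(ini x)(1 := rev (f x))}" for x
    using run[OF represents_ini, of x "length x" "{}"] by (simp add: f env_Nil)
  obtain M where M: "wf_otm M" "guess_free ?c \<Longrightarrow> deterministic M"
    "\<And>B x n k S t j c'. exec B ?c (ini x) n k S \<Longrightarrow> run M B (init M x) t j c' \<Longrightarrow> t \<le> n + 2 \<and> j \<le> k"
    "\<And>B x n k s. exec B ?c (ini x) n k {s} \<Longrightarrow>
      \<exists>t j c'. run M B (init M x) t j c' \<and> halted M B c' \<and> holds_word (snd c' ! 1) (rev (s 1))"
    using machine_exists[of ?c 0] ask_free_outw by metis
  obtain q :: "nat poly" where q: "\<And>m. p m + 2 \<le> poly q m"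
    using pb_poly[of "\<lambda>m. p m + 2"] pb_add[OF p pb_const] by blast
  have "poly_time M {}"
    unfolding poly_time_def
    by (rule exI[of _ q]) (use M(3)[OF ex] q in \<open>blast intro: order_trans\<close>)
  moreover have "\<exists>t k c. run M {} (init M x) t k c \<and> halted M {} c \<and> holds_word (snd c ! 1) (f x)" for x
    using M(4)[OF ex[of x]] by simp
  ultimately show ?thesis
    unfolding FP_def using M(1) M(2)[OF guess_free_outw] by blast
qed

subsection \<open>Guess and check\<close>

text \<open>One bit is guessed for each input bit, which is meanwhile passed to stack 3 and can be
  moved back from there.\<close>

lemma exec_guess:
  "s 0 = xs \<Longrightarrow> exec B (While 0 (pass 0 3 ;; Guess 2)) s (9 * length xs + 1) 0
     {s(0 := [], 3 := rev xs @ s 3, 2 := y @ s 2) | y. length y = length xs}"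
proof (induction xs arbitrary: s)
  case Nil
  then have e: "{s(0 := [], 3 := rev [] @ s 3, 2 := y @ s 2) | y. length y = length []} = {s}"
    by (auto simp: fun_upd_idem)
  show ?case
    unfolding e by (rule exec_While_end) (use Nil in auto)
next
  case (Cons a xs)
  let ?s = "s(0 := xs, 3 := a # s 3)"
  let ?S = "{?s(2 := False # ?s 2), ?s(2 := True # ?s 2)}"
  let ?G = "\<lambda>s'. {s'(0 := [], 3 := rev xs @ s' 3, 2 := y @ s' 2) | y. length y = length xs}"
  have 1: "exec B (pass 0 3 ;; Guess 2) s (5 + 2) (0 + 0) ?S"
    by (rule exec_Seq1[OF exec_pass exec_Guess]) (use Cons.prems in auto)
  have "exec B (While 0 (pass 0 3 ;; Guess 2)) s (9 * length (a # xs) + 1) 0 (\<Union>s'\<in>?S. ?G s')"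
    by (rule exec_While_step[OF _ 1 Cons.IH]) (use Cons.prems in auto)
  \<comment> \<open>The bit guessed in this round lies below those of the later rounds, hence
    \<open>y @ [b]\<close>.\<close>
  moreover have "(\<Union>s'\<in>?S. ?G s') =
      {s(0 := [], 3 := rev (a # xs) @ s 3, 2 := y @ s 2) | y. length y = length (a # xs)}" (is "?l = ?r")
  proof (intro set_eqI iffI)
    fix t
    assume "t \<in> ?l"
    then obtain b y where "length y = length xs"
      "t = (?s(2 := b # ?s 2))(0 := [], 3 := rev xs @ (?s(2 := b # ?s 2)) 3, 2 := y @ (?s(2 := b # ?s 2)) 2)"
      by blast
    then show "t \<in> ?r"
      by (intro CollectI exI[of _ "y @ [b]"]) (auto simp: fun_eq_iff)
  next
    fix t
    assume "t \<in> ?r"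
    then obtain z where z: "length z = Suc (length xs)"
      "t = s(0 := [], 3 := rev (a # xs) @ s 3, 2 := z @ s 2)" by auto
    then obtain y b where y: "z = y @ [b]" "length y = length xs"
      by (cases z rule: rev_cases) auto
    have "t \<in> ?G (?s(2 := b # ?s 2))"
      using y z by (intro CollectI exI[of _ y]) (auto simp: fun_eq_iff)
    then show "t \<in> ?l"
      by (cases b) (auto simp del: fun_upd_apply)
  qed
  ultimately show ?case by (simp only:)
qed

text \<open>Guess, check, and ask one query that must be answered by no. This form suits maximality,
  which fails by a single NP witness.\<close>

theorem NP_rel_I:
  assumes "decidable p" "definable l" "decidable b"
    and L: "\<And>x. x \<in> L \<longleftrightarrow> (\<exists>y. length y = length x \<and> p x y zeros \<and>
      map (\<lambda>i. b x y (case_nat i zeros)) [0..<l x y zeros] \<notin> A)"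
  shows "L \<in> NP_rel A"
proof -
  obtain pa la ba where pa: "\<And>x y e. of_bool (p x y e) = val pa x y e"
    and la: "\<And>x y e. l x y e = val la x y e"
    and ba: "\<And>x y e. of_bool (b x y e) = val ba x y e"
    using assms(1-3) unfolding definable_def by blast
  have w: "word la ba x y zeros = map (\<lambda>i. b x y (case_nat i zeros)) [0..<l x y zeros]" for x y
    unfolding word_def la[symmetric] ba[symmetric] by simp
  obtain q where q: "pb q" and runq: "\<And>B m x y \<rho> vs f s. represents s x y \<rho> vs f \<Longrightarrow>
      length x \<le> m \<Longrightarrow> length y \<le> m \<Longrightarrow> set vs \<subseteq> {..m} \<Longrightarrow>
      exec B (outw la ba \<rho> f) s (q m) 0 {s(1 := rev (word la ba x y (env vs)) @ s 1)}"
    using outw_runs[of la ba] by blast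
  obtain r where r: "runs (ce pa) pa r" using ce_runs by blast
  let ?g = "While 0 (pass 0 3 ;; Guess 2)"
  let ?d = "move 3 0 ;; outw la ba [] 3 ;; ce pa [] 4 3 ;; AskIf (Push 3 False) Skip"
  let ?c = "?g ;; ?d"
  let ?w = "\<lambda>x y. word la ba x y zeros"
  \<comment> \<open>The check leaves \<open>True\<close> or nothing on stack 3, and an answer yes
    covers it by \<open>False\<close>; so the top is \<open>True\<close> iff the check succeeds and
    the answer is no.\<close>
  define fin where "fin x y = (ini x)(2 := y, 1 := rev (?w x y),
     3 := (if ?w x y \<in> A then [False] else []) @ un (of_bool (p x y zeros)))" for x y
  define T where "T m = (9 * m + 1) + ((7 * m + 1) + (q m + (r m + 4)))" for m
  have ex: "exec A ?c (ini x) (T (length x)) 1 {fin x y | y. length y = length x}" for x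
  proof -
    let ?m = "length x"
    let ?S = "{(ini x)(0 := [], 3 := rev x @ ini x 3, 2 := y @ ini x 2) | y. length y = length x}"
    have 1: "exec A ?g (ini x) (9 * ?m + 1) 0 ?S"
      by (rule exec_guess) simp
    have 2: "exec A ?d s ((7 * ?m + 1) + (q ?m + (r ?m + 4))) 1 {fin x (s 2)}" if s: "s \<in> ?S" for s
    proof -
      obtain y where y: "length y = length x" "s = (ini x)(0 := [], 3 := rev x, 2 := y)"
        using s by auto
      let ?s1 = "(ini x)(2 := y)" let ?s2 = "?s1(1 := rev (?w x y))"
      let ?s3 = "?s2(3 := un (of_bool (p x y zeros)))"
      have e1: "s(3 := [], 0 := rev (s 3) @ s 0) = ?s1"
        using y by (auto simp: fun_eq_iff ini_def)
      have 1: "exec A (move 3 0) s (7 * ?m + 1) 0 {?s1}"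
        using exec_move[of 3 0 A s] y unfolding e1 by simp
      have rep: "represents ?s1 x y [] [] 3"
        by (auto simp: represents_def ini_def)
      then have 2: "exec A (outw la ba [] 3) ?s1 (q ?m) 0 {?s2}"
        using runq[OF rep, of ?m A] y by (simp add: env_Nil)
      have rep: "represents ?s2 x y [] [] 4"
        by (auto simp: represents_def ini_def)
      have 3: "exec A (ce pa [] 4 3) ?s2 (r ?m) 0 {?s3}"
        using runsD[OF r rep, of ?m 3 A] y by (simp add: env_Nil pa[symmetric])
      have e4: "?s3(3 := False # ?s3 3) = fin x y" if "?w x y \<in> A"
        using that by (simp add: fin_def)
      have "exec A (if rev (?s3 1) \<in> A then Push 3 False else Skip) ?s3 2 0 {fin x y}"
      proof (cases "?w x y \<in> A")
        case True
        then show ?thesis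
          using exec_Push[of 2 A 3 False ?s3 0] unfolding e4[OF True] by simp
      next
        case False
        then have "?s3 = fin x y" by (simp add: fin_def)
        moreover have "rev (?s3 1) = ?w x y" by simp
        ultimately show ?thesis using False exec_Skip[of A ?s3 2 0] by (simp only: if_False)
      qed
      then have 4: "exec A (AskIf (Push 3 False) Skip) ?s3 4 1 {fin x y}"
        by (rule exec_AskIf) auto
      have "s 2 = y" using y by simp
      then show ?thesis
        using exec_Seq1[OF 1 exec_Seq1[OF 2 exec_Seq1[OF 3 4]]] by simp
    qed
    have "exec A ?c (ini x) (T ?m) 1 (\<Union>s\<in>?S. {fin x (s 2)})"
      by (rule exec_Seq[OF 1 2]) (auto simp: T_def)
    moreover have "(\<Union>s\<in>?S. {fin x (s 2)}) =
        {fin x (((ini x)(0 := [], 3 := rev x @ ini x 3, 2 := y @ ini x 2)) 2) | y. length y = length x}"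
      by blast
    ultimately show ?thesis by simp
  qed
  have "single_ask ?c"
    by (simp add: ask_free_outw ask_free_ce pass_def move_def)
  then obtain M where M: "wf_otm M"
    "\<And>B x n k S t j c'. exec B ?c (ini x) n k S \<Longrightarrow> run M B (init M x) t j c' \<Longrightarrow> t \<le> n + 2 \<and> j \<le> k"
    "\<And>B x n k S. exec B ?c (ini x) n k S \<Longrightarrow> x \<in> language M B \<longleftrightarrow> (\<exists>s\<in>S. top_sym (s 3) = 2)"
    using machine_exists[of ?c 3] by metis
  have "pb T"
    unfolding T_def by (intro pb_intros q runs_pb[OF r])
  then obtain P :: "nat poly" where P: "\<And>m. T m + 2 \<le> poly P m"
    using pb_poly[of "\<lambda>m. T m + 2"] pb_add[OF _ pb_const] by blast
  have "poly_time M A"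
    unfolding poly_time_def
    by (rule exI[of _ P]) (use M(2)[OF ex] P in \<open>blast intro: order_trans\<close>)
  moreover have "language M A = L"
  proof (rule set_eqI)
    fix x
    have "x \<in> language M A \<longleftrightarrow> (\<exists>y. length y = length x \<and> top_sym (fin x y 3) = 2)"
      unfolding M(3)[OF ex] by blast
    also have "\<dots> \<longleftrightarrow> x \<in> L"
      unfolding L w[symmetric] by (auto simp: fin_def)
    finally show "x \<in> language M A \<longleftrightarrow> x \<in> L" .
  qed
  ultimately show ?thesis
    unfolding NP_rel_def using M(1) by blast
qed

subsection \<open>Binary search\<close>

text \<open>The candidates are \<theta>, ..., \<theta> + n - 1 with \<theta> in register 3 and n in
  register 4; register 6 holds n - 1 at the loop test, so the loop ends with one candidate left. The
  half n div 2 is computed into register 5, and the query tests \<theta> + n div 2.\<close>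

definition search :: "ex \<Rightarrow> ex \<Rightarrow> cmd" where
  "search l b = clear 6 ;; ce (Sum (Var 0) (Sub (Con 1) (Sub (Add (Var 0) (Add (Var 0) (Con 2))) (Var 1)))) [4] 8 5 ;;
     ce (Add (Var 0) (Var 1)) [3, 5] 8 6 ;; outw l b [6] 8 ;;
     AskIf (clear 3 ;; move 6 3 ;; subc 4 5) (clear 4 ;; move 5 4 ;; clear 6) ;;
     clear 1 ;; ce (Sub (Var 0) (Con 1)) [4] 8 6"

text \<open>The summand is 1 iff 2 i + 2 \<le> n, that is, iff i < n div 2.\<close>

lemma half_sum: "(\<Sum>i<n. 1 - (i + (i + 2) - n)) = n div (2 :: nat)"
proof -
  have "(\<Sum>i<n. 1 - (i + (i + 2) - n)) = (\<Sum>i<n. of_bool (i < n div 2))"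
    by (intro sum.cong) auto
  also have "\<dots> = card ({..<n} \<inter> {i. i < n div 2})"
    by simp
  also have "{..<n} \<inter> {i. i < n div 2} = {..<n div 2}"
    by auto
  finally show ?thesis by simp
qed

definition search_state :: "bool list \<Rightarrow> nat \<Rightarrow> nat \<Rightarrow> st" where
  "search_state x \<theta> n = (ini x)(3 := un \<theta>, 4 := un n, 6 := un (n - 1))"

lemma exec_search:
  assumes out: "\<And>B m x y \<rho> vs f s. represents s x y \<rho> vs f \<Longrightarrow>
      length x \<le> m \<Longrightarrow> length y \<le> m \<Longrightarrow> set vs \<subseteq> {..m} \<Longrightarrow>
      exec B (outw l b \<rho> f) s (p m) 0 {s(1 := rev (word l b x y (env vs)) @ s 1)}"
    and p: "pb p"
  shows "\<exists>T. pb T \<and> (\<forall>B x m \<theta> n. 2 \<le> n \<longrightarrow> \<theta> + n \<le> m \<longrightarrow> length x \<le> m \<longrightarrow>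
    exec B (search l b) (search_state x \<theta> n) (T m) 1 
     {if word l b x [] (env [\<theta> + n div 2]) \<in> B then search_state x (\<theta> + n div 2) (n - n div 2)
      else search_state x \<theta> (n div 2)})"
proof -
  let ?h = "Sum (Var 0) (Sub (Con 1) (Sub (Add (Var 0) (Add (Var 0) (Con 2))) (Var 1)))"
  obtain q1 q2 q3 where q: "runs (ce ?h) ?h q1" "runs (ce (Add (Var 0) (Var 1))) (Add (Var 0) (Var 1)) q2"
    "runs (ce (Sub (Var 0) (Con 1))) (Sub (Var 0) (Con 1)) q3"
    using ce_runs by blast
  obtain q4 where q4: "bounds l q4" using bounds_exist by blast
  define T where "T m = (3 * m + 1) + (q1 m + (q2 m + (p m + ((16 * m + 5) + ((3 * q4 m + 1) + q3 m)))))" for m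
  have "pb T"
    unfolding T_def by (intro pb_intros p runs_pb[OF q(1)] runs_pb[OF q(2)] runs_pb[OF q(3)] bounds_pb[OF q4])
  moreover have "exec B (search l b) (search_state x \<theta> n) (T m) 1 
     {if word l b x [] (env [\<theta> + n div 2]) \<in> B then search_state x (\<theta> + n div 2) (n - n div 2)
      else search_state x \<theta> (n div 2)}" if a: "2 \<le> n" "\<theta> + n \<le> m" "length x \<le> m" for B x m \<theta> n
  proof -
    define h where "h = n div 2"
    have h: "h \<le> n" "\<theta> + h \<le> m" "h \<le> m" "\<theta> \<le> m" "n \<le> m"
      using a by (auto simp: h_def)
    define w where "w = word l b x [] (env [\<theta> + h])"
    have w: "length w \<le> q4 m"
    proof -
      have "val l x [] (env [\<theta> + h]) \<le> q4 m"
        by (rule boundsD[OF q4 _ _ env_le]) (use a h in auto)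
      then show ?thesis by (simp add: w_def word_def)
    qed
    let ?s0 = "search_state x \<theta> n"
    let ?s1 = "(ini x)(3 := un \<theta>, 4 := un n)"
    let ?s2 = "(ini x)(3 := un \<theta>, 4 := un n, 5 := un h)"
    let ?s3 = "(ini x)(3 := un \<theta>, 4 := un n, 5 := un h, 6 := un (\<theta> + h))"
    let ?s4 = "(ini x)(1 := rev w, 3 := un \<theta>, 4 := un n, 5 := un h, 6 := un (\<theta> + h))"
    define s5 where "s5 \<theta> n = (ini x)(1 := rev w, 3 := un \<theta>, 4 := un n)" for \<theta> n
    let ?s6 = "\<lambda>\<theta> n. (ini x)(3 := un \<theta>, 4 := un n)"
    define \<theta>' n' where "\<theta>' = (if w \<in> B then \<theta> + h else \<theta>)" and "n' = (if w \<in> B then n - h else h)"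
    have n': "n' \<le> m" using h by (auto simp: n'_def)
    have e1: "?s0(6 := []) = ?s1"
      by (auto simp: fun_eq_iff search_state_def)
    have 1: "exec B (clear 6) ?s0 (3 * m + 1) 0 {?s1}"
      using exec_mono[OF exec_clear[of B 6 ?s0], of "3 * m + 1" 0] h unfolding e1
      by (simp add: search_state_def)
    have rep: "represents ?s1 x [] [4] [n] 8"
      by (auto simp: represents_def ini_def)
    have e2: "?s1(5 := un h @ ?s1 5) = ?s2"
      by (auto simp: fun_eq_iff)
    have "val ?h x [] (env [n]) = h"
      unfolding h_def half_sum[of n, symmetric] by (simp add: env_def)
    then have 2: "exec B (ce ?h [4] 8 5) ?s1 (q1 m) 0 {?s2}"
      using runsD[OF q(1) rep, of m 5 B] a h unfolding e2[symmetric] by (simp del: val.simps fun_upd_apply)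
    have rep: "represents ?s2 x [] [3, 5] [\<theta>, h] 8"
      by (auto simp: represents_def ini_def less_Suc_eq)
    have e3: "?s2(6 := un (\<theta> + h) @ ?s2 6) = ?s3"
      by (auto simp: fun_eq_iff)
    have "val (Add (Var 0) (Var 1)) x [] (env [\<theta>, h]) = \<theta> + h"
      by (simp add: env_def)
    then have 3: "exec B (ce (Add (Var 0) (Var 1)) [3, 5] 8 6) ?s2 (q2 m) 0 {?s3}"
      using runsD[OF q(2) rep, of m 6 B] a h unfolding e3[symmetric] by (simp del: val.simps fun_upd_apply)
    have rep: "represents ?s3 x [] [6] [\<theta> + h] 8"
      by (auto simp: represents_def ini_def)
    have e4: "?s3(1 := rev w @ ?s3 1) = ?s4"
      by (auto simp: fun_eq_iff)
    have 4: "exec B (outw l b [6] 8) ?s3 (p m) 0 {?s4}"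
      using out[OF rep, of m B] a h unfolding w_def[symmetric] e4[symmetric] by (simp del: fun_upd_apply)
    have 5: "exec B (AskIf (clear 3 ;; move 6 3 ;; subc 4 5) (clear 4 ;; move 5 4 ;; clear 6)) ?s4 (16 * m + 5) 1
        {s5 \<theta>' n'}"
    proof (rule exec_AskIf[where n = "16 * m + 3" and k = 0])
      have r: "rev (?s4 1) = w" by simp
      show "exec B (if rev (?s4 1) \<in> B then clear 3 ;; move 6 3 ;; subc 4 5 else clear 4 ;; move 5 4 ;; clear 6)
         ?s4 (16 * m + 3) 0 {s5 \<theta>' n'}"
      proof (cases "w \<in> B")
        case True
        let ?t1 = "?s4(3 := [])" let ?t2 = "?s4(3 := un (\<theta> + h), 6 := [])"
        have 1: "exec B (clear 3) ?s4 (3 * \<theta> + 1) 0 {?t1}"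
          using exec_clear[of B 3 ?s4] by simp
        have e: "?t1(6 := [], 3 := rev (?t1 6) @ ?t1 3) = ?t2"
          by (auto simp: fun_eq_iff)
        have 2: "exec B (move 6 3) ?t1 (7 * (\<theta> + h) + 1) 0 {?t2}"
          using exec_move[of 6 3 B ?t1] unfolding e by simp
        have e: "?t2(4 := un (n - h), 5 := []) = s5 \<theta>' n'"
          using True by (auto simp: fun_eq_iff s5_def \<theta>'_def n'_def)
        have 3: "exec B (subc 4 5) ?t2 (6 * h + 1) 0 {s5 \<theta>' n'}"
          using exec_subc[of 4 5 ?t2 n h B] unfolding e by simp
        from exec_Seq1[OF 1 exec_Seq1[OF 2 3]]
        have "exec B (clear 3 ;; move 6 3 ;; subc 4 5) ?s4 (16 * m + 3) 0 {s5 \<theta>' n'}"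
          by (rule exec_mono) (use h in auto)
        then show ?thesis unfolding r using True by (simp only: if_True)
      next
        case False
        let ?t1 = "?s4(4 := [])" let ?t2 = "?s4(4 := un h, 5 := [])"
        have 1: "exec B (clear 4) ?s4 (3 * n + 1) 0 {?t1}"
          using exec_clear[of B 4 ?s4] by simp
        have e: "?t1(5 := [], 4 := rev (?t1 5) @ ?t1 4) = ?t2"
          by (auto simp: fun_eq_iff)
        have 2: "exec B (move 5 4) ?t1 (7 * h + 1) 0 {?t2}"
          using exec_move[of 5 4 B ?t1] unfolding e by simp
        have e: "?t2(6 := []) = s5 \<theta>' n'"
          using False by (auto simp: fun_eq_iff s5_def \<theta>'_def n'_def)
        have 3: "exec B (clear 6) ?t2 (3 * (\<theta> + h) + 1) 0 {s5 \<theta>' n'}"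
          using exec_clear[of B 6 ?t2] unfolding e by simp
        from exec_Seq1[OF 1 exec_Seq1[OF 2 3]]
        have "exec B (clear 4 ;; move 5 4 ;; clear 6) ?s4 (16 * m + 3) 0 {s5 \<theta>' n'}"
          by (rule exec_mono) (use h in auto)
        then show ?thesis unfolding r using False by (simp only: if_False)
      qed
    qed auto
    have e6: "(s5 \<theta>' n')(1 := []) = ?s6 \<theta>' n'"
      by (auto simp: fun_eq_iff s5_def)
    have 6: "exec B (clear 1) (s5 \<theta>' n') (3 * q4 m + 1) 0 {?s6 \<theta>' n'}"
      using exec_mono[OF exec_clear[of B 1 "s5 \<theta>' n'"], of "3 * q4 m + 1" 0] w unfolding e6
      by (simp add: s5_def)
    have rep: "represents (?s6 \<theta>' n') x [] [4] [n'] 8"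
      by (auto simp: represents_def ini_def)
    have e7: "(?s6 \<theta>' n')(6 := un (n' - 1) @ ?s6 \<theta>' n' 6) = search_state x \<theta>' n'"
      by (auto simp: fun_eq_iff search_state_def)
    have "val (Sub (Var 0) (Con 1)) x [] (env [n']) = n' - 1"
      by (simp add: env_def)
    then have 7: "exec B (ce (Sub (Var 0) (Con 1)) [4] 8 6) (?s6 \<theta>' n') (q3 m) 0 {search_state x \<theta>' n'}"
      using runsD[OF q(3) rep, of m 6 B] a n' unfolding e7[symmetric] by (simp del: val.simps fun_upd_apply)
    have "{if word l b x [] (env [\<theta> + n div 2]) \<in> B then search_state x (\<theta> + n div 2) (n - n div 2)
      else search_state x \<theta> (n div 2)} = {search_state x \<theta>' n'}"
      by (simp add: \<theta>'_def n'_def h_def w_def)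
    then show ?thesis
      using exec_Seq1[OF 1 exec_Seq1[OF 2 exec_Seq1[OF 3 exec_Seq1[OF 4 exec_Seq1[OF 5 exec_Seq1[OF 6 7]]]]]]
      unfolding search_def T_def by simp
  qed
  ultimately show ?thesis by blast
qed

text \<open>From at most 2^(j + 1) candidates at most 2^j remain, even if the half is rounded up, so
  the exponent bounds the number of queries.\<close>

lemma exec_search_loop:
  assumes step: "\<And>\<theta> n. 2 \<le> n \<Longrightarrow> \<theta> + n \<le> m \<Longrightarrow>
      exec B c (search_state x \<theta> n) T 1
        {if \<theta> + n div 2 \<le> v then search_state x (\<theta> + n div 2) (n - n div 2)
         else search_state x \<theta> (n div 2)}"
  shows "n \<le> 2 ^ j \<Longrightarrow> 1 \<le> n \<Longrightarrow> \<theta> + n \<le> m \<Longrightarrow> \<theta> \<le> v \<Longrightarrow> v < \<theta> + n \<Longrightarrow>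
    exec B (While 6 c) (search_state x \<theta> n) (j * (T + 2) + 1) j {search_state x v 1}"
proof (induction j arbitrary: \<theta> n)
  case 0
  then have "n = 1" "v = \<theta>" by auto
  then show ?case
    by (auto intro!: exec_While_end simp: search_state_def)
next
  case (Suc j)
  show ?case
  proof (cases "n = 1")
    case True
    then have "v = \<theta>" using Suc.prems by simp
    then show ?thesis
      using True by (auto intro!: exec_While_end simp: search_state_def)
  next
    case False
    then have n: "2 \<le> n" using Suc.prems by simp
    let ?n = "if \<theta> + n div 2 \<le> v then n - n div 2 else n div 2"
    let ?\<theta> = "if \<theta> + n div 2 \<le> v then \<theta> + n div 2 else \<theta>"
    have "n \<le> 2 * 2 ^ j" using Suc.prems(1) by simp
    then have 1: "?n \<le> 2 ^ j" "1 \<le> ?n" "?\<theta> + ?n \<le> m" "?\<theta> \<le> v" "v < ?\<theta> + ?n"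
      using n Suc.prems by (auto split: if_splits)
    have 2: "exec B c (search_state x \<theta> n) T 1 {search_state x ?\<theta> ?n}"
      using step[OF n Suc.prems(3)] by (auto split: if_splits)
    have "exec B (While 6 c) (search_state x \<theta> n) (Suc j * (T + 2) + 1) (Suc j)
        (\<Union>s\<in>{search_state x ?\<theta> ?n}. {search_state x v 1})"
    proof (rule exec_While_step[OF _ 2])
      show "search_state x \<theta> n 6 \<noteq> []"
        using n by (simp add: search_state_def)
      show "exec B (While 6 c) s (j * (T + 2) + 1) j {search_state x v 1}"
        if "s \<in> {search_state x ?\<theta> ?n}" for s
        using Suc.IH[OF 1] that by simp
    qed auto
    then show ?thesis by simp
  qed
qed

text \<open>The rounds needed for the n + 1 candidates 0, ..., n with which the search
  starts.\<close>

definition ceil_log :: "nat \<Rightarrow> nat" where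
  "ceil_log n = (LEAST j. n + 1 \<le> 2 ^ j)"

lemma ceil_log: "n + 1 \<le> 2 ^ ceil_log n"
  unfolding ceil_log_def by (rule LeastI[of _ "n + 1"]) (use less_exp[of "n + 1"] in simp)

lemma ceil_log_le: "ceil_log n \<le> n + 1"
  unfolding ceil_log_def by (rule Least_le) (use less_exp[of "n + 1"] in simp)

lemma ceil_log_bigo: "(\<lambda>n. real (ceil_log n)) \<in> O(\<lambda>n. ln (real n))"
proof (rule bigoI[where c = "3 / ln 2"])
  show "\<forall>\<^sub>F n in sequentially. norm (real (ceil_log n)) \<le> 3 / ln 2 * norm (ln (real n))"
    unfolding eventually_sequentially
  proof (intro exI allI impI)
    fix n :: nat
    assume n: "2 \<le> n"
    have "ceil_log n \<noteq> 0"
      using ceil_log[of n] n by (intro notI) simp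
    then obtain j where j: "ceil_log n = Suc j" by (cases "ceil_log n") auto
    \<comment> \<open>By minimality 2^j \<le> n. Together with 2 \<le> n this gives (j + 1) ln 2
      \<le> 2 ln n, within the constant 3 / ln 2.\<close>
    have "\<not> n + 1 \<le> 2 ^ j"
      using not_less_Least[of j "\<lambda>j. n + 1 \<le> 2 ^ j"] j unfolding ceil_log_def[symmetric] by simp
    then have "real (2 ^ j) \<le> real n" by (simp only: of_nat_le_iff)
    then have "ln (2 ^ j) \<le> ln (real n)"
      using n by (subst ln_le_cancel_iff) auto
    then have "real j * ln 2 \<le> ln (real n)"
      by (simp add: ln_realpow)
    moreover have "ln 2 \<le> ln (real n)"
      using n by (subst ln_le_cancel_iff) auto
    ultimately have "real (Suc j) * ln 2 \<le> 3 * ln (real n)"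
      by (simp add: algebra_simps) (use ln_gt_zero[of 2] in linarith)
    then show "norm (real (ceil_log n)) \<le> 3 / ln 2 * norm (ln (real n))"
      using n by (simp add: j field_simps)
  qed
qed

text \<open>The search determines \<open>v x\<close>, and register 7 receives its parity. Only
  thresholds from 1 to \<open>length x\<close> are queried: the tested value \<theta> + n div 2 has
  n \<ge> 2, and \<theta> + n never exceeds \<open>length x + 1\<close>.\<close>

theorem Theta_p_I:
  assumes A: "A \<in> Sigma_p (h - 1)" and "definable l" "decidable b"
    and v: "\<And>x. v x \<le> length x"
    and Q: "\<And>x \<theta>. 1 \<le> \<theta> \<Longrightarrow> \<theta> \<le> length x \<Longrightarrow>
      map (\<lambda>i. b x [] (case_nat i (env [\<theta>]))) [0..<l x [] (env [\<theta>])] \<in> A \<longleftrightarrow> \<theta> \<le> v x"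
    and L: "\<And>x. x \<in> L \<longleftrightarrow> odd (v x)"
  shows "L \<in> Theta_p h"
proof -
  obtain la ba where la: "\<And>x y e. l x y e = val la x y e"
    and ba: "\<And>x y e. of_bool (b x y e) = val ba x y e"
    using assms(2,3) unfolding definable_def by blast
  have w: "word la ba x [] (env [\<theta>]) = map (\<lambda>i. b x [] (case_nat i (env [\<theta>]))) [0..<l x [] (env [\<theta>])]" for x \<theta>
    unfolding word_def la[symmetric] ba[symmetric] by simp
  obtain p where p: "pb p" "\<And>B m x y \<rho> vs f s. represents s x y \<rho> vs f \<Longrightarrow>
      length x \<le> m \<Longrightarrow> length y \<le> m \<Longrightarrow> set vs \<subseteq> {..m} \<Longrightarrow>
      exec B (outw la ba \<rho> f) s (p m) 0 {s(1 := rev (word la ba x y (env vs)) @ s 1)}"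
    using outw_runs[of la ba] by blast
  obtain T where T: "pb T" "\<And>B x m \<theta> n. 2 \<le> n \<Longrightarrow> \<theta> + n \<le> m \<Longrightarrow> length x \<le> m \<Longrightarrow>
    exec B (search la ba) (search_state x \<theta> n) (T m) 1 
     {if word la ba x [] (env [\<theta> + n div 2]) \<in> B then search_state x (\<theta> + n div 2) (n - n div 2)
      else search_state x \<theta> (n div 2)}"
    using exec_search[OF p(2,1)] by blast
  have "definable (\<lambda>x y e. e 0 mod 2)"
    by (intro definable_mod definable_intros) simp
  then obtain a where a: "\<And>x y e. e 0 mod 2 = val a x y e"
    unfolding definable_def by blast
  let ?l1 = "Add (Len False) (Con 1)"
  obtain q1 q2 q3 where q: "runs (ce ?l1) ?l1 q1" "runs (ce (Len False)) (Len False) q2" "runs (ce a) a q3"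
    using ce_runs by blast
  let ?c = "ce ?l1 [] 8 4 ;; ce (Len False) [] 8 6 ;; While 6 (search la ba) ;; ce a [3] 8 7"
  define R where "R n = q1 n + (q2 n + (((n + 1) * (T (n + 1) + 2) + 1) + q3 n))" for n
  have ex: "exec A ?c (ini x) (R (length x)) (ceil_log (length x))
      {(search_state x (v x) 1)(7 := un (v x mod 2))}" for x
  proof -
    let ?n = "length x"
    have rep: "represents (ini x) x [] [] [] 8"
      by (auto simp: represents_def ini_def)
    let ?s1 = "(ini x)(4 := un (?n + 1))"
    have 1: "exec A (ce ?l1 [] 8 4) (ini x) (q1 ?n) 0 {?s1}"
      using runsD[OF q(1) rep, of ?n 4 A] by simp
    have rep: "represents ?s1 x [] [] [] 8"
      by (auto simp: represents_def ini_def)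
    have e: "?s1(6 := un ?n @ ?s1 6) = search_state x 0 (?n + 1)"
      by (auto simp: search_state_def fun_eq_iff)
    have 2: "exec A (ce (Len False) [] 8 6) ?s1 (q2 ?n) 0 {search_state x 0 (?n + 1)}"
      using runsD[OF q(2) rep, of ?n 6 A] unfolding e[symmetric] by (simp del: fun_upd_apply)
    have "exec A (While 6 (search la ba)) (search_state x 0 (?n + 1))
        (ceil_log ?n * (T (?n + 1) + 2) + 1) (ceil_log ?n) {search_state x (v x) 1}"
    proof (rule exec_search_loop[where m = "?n + 1"])
      fix \<theta> n :: nat
      assume "2 \<le> n" "\<theta> + n \<le> ?n + 1"
      moreover from this have "word la ba x [] (env [\<theta> + n div 2]) \<in> A \<longleftrightarrow> \<theta> + n div 2 \<le> v x"
        unfolding w by (intro Q) auto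
      ultimately show "exec A (search la ba) (search_state x \<theta> n) (T (?n + 1)) 1
          {if \<theta> + n div 2 \<le> v x then search_state x (\<theta> + n div 2) (n - n div 2)
           else search_state x \<theta> (n div 2)}"
        using T(2)[of n \<theta> "?n + 1" x A] by simp
    qed (use ceil_log[of ?n] v[of x] in auto)
    then have 3: "exec A (While 6 (search la ba)) (search_state x 0 (?n + 1))
        ((?n + 1) * (T (?n + 1) + 2) + 1) (ceil_log ?n) {search_state x (v x) 1}"
      by (rule exec_mono) (use mult_right_mono[OF ceil_log_le, of "T (?n + 1) + 2" ?n] in simp_all)
    have rep: "represents (search_state x (v x) 1) x [] [3] [v x] 8"
      by (auto simp: represents_def search_state_def ini_def)
    have "search_state x (v x) 1 7 = []" by (simp add: search_state_def)
    then have 4: "exec A (ce a [3] 8 7) (search_state x (v x) 1) (q3 ?n) 0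
        {(search_state x (v x) 1)(7 := un (v x mod 2))}"
      using runsD[OF q(3) rep, of ?n 7 A] v[of x] by (simp add: a[symmetric] env_def)
    show ?thesis
      using exec_Seq1[OF 1 exec_Seq1[OF 2 exec_Seq1[OF 3 4]]] unfolding R_def by simp
  qed
  have "single_ask ?c" "guess_free ?c"
    by (simp_all add: search_def ask_free_ce ask_free_outw guess_free_ce guess_free_outw
        clear_def move_def subc_def pass_def del: ce.simps)
  then obtain M where M: "wf_otm M" "deterministic M"
    "\<And>B x n k S t j c'. exec B ?c (ini x) n k S \<Longrightarrow> run M B (init M x) t j c' \<Longrightarrow> t \<le> n + 2 \<and> j \<le> k"
    "\<And>B x n k S. exec B ?c (ini x) n k S \<Longrightarrow> x \<in> language M B \<longleftrightarrow> (\<exists>s\<in>S. top_sym (s 7) = 2)"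
    using machine_exists[of ?c 7] by metis
  have "pb R"
    unfolding R_def
    by (intro pb_intros runs_pb[OF q(1)] runs_pb[OF q(2)] runs_pb[OF q(3)] pb_comp[OF T(1) pb_add[OF pb_id pb_const]])
  then obtain P :: "nat poly" where P: "\<And>m. R m + 2 \<le> poly P m"
    using pb_poly[of "\<lambda>m. R m + 2"] pb_add[OF _ pb_const] by blast
  have "poly_time M A"
    unfolding poly_time_def
    by (rule exI[of _ P]) (use M(3)[OF ex] P in \<open>blast intro: order_trans\<close>)
  moreover have "log_queries M A"
    unfolding log_queries_def
    by (rule exI[of _ ceil_log]) (use M(3)[OF ex] ceil_log_bigo in blast)
  moreover have "language M A = L"
  proof (rule set_eqI)
    fix x
    show "x \<in> language M A \<longleftrightarrow> x \<in> L"
      unfolding M(4)[OF ex] L by (auto simp: odd_iff_mod_2_eq_one)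
  qed
  ultimately show ?thesis
    unfolding Theta_p_def using M(1,2) A by blast
qed

section \<open>Extensions and labellings\<close>

lemma Def_mono: "S \<subseteq> T \<Longrightarrow> Def F S \<subseteq> Def F T"
  by (auto simp: Def_def)

lemma Acc_mono: "S \<subseteq> T \<Longrightarrow> Acc F S \<subseteq> Acc F T"
  using Def_mono[of S T F] by (auto simp: Acc_def)

lemma admissible_args: "admissible F S \<Longrightarrow> S \<subseteq> args F"
  by (auto simp: admissible_def Acc_def)

lemma complete_admissible: "complete_ext F S \<Longrightarrow> admissible F S"
  by (simp add: complete_ext_def)

text \<open>Dung's fundamental lemma: by the defence of \<open>a\<close> and of \<open>S\<close>, an
  attack between \<open>a\<close> and \<open>S\<close>, or of \<open>a\<close> on itself, would lead
  to an attack of \<open>S\<close> on itself.\<close>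

lemma admissible_insert:
  assumes "wf_af F" "admissible F S" "a \<in> Acc F S"
  shows "admissible F (insert a S)"
proof -
  have S: "S \<inter> Def F S = {}" "S \<subseteq> Acc F S"
    using assms(2) by (auto simp: admissible_def conflict_free_def)
  have att: "(b, c) \<in> atts F \<Longrightarrow> b \<in> args F \<and> c \<in> args F" for b c
    using assms(1) by (auto simp: wf_af_def)
  have 1: "a \<notin> Def F S"
  proof
    assume "a \<in> Def F S"
    then obtain b where b: "b \<in> S" "(b, a) \<in> atts F" by (auto simp: Def_def)
    then have "b \<in> Def F S" using assms(3) by (auto simp: Acc_def)
    then show False using b S by auto
  qed
  have 2: "(a, c) \<notin> atts F" if "c \<in> S" for c
  proof
    assume "(a, c) \<in> atts F"
    then have "a \<in> Def F S" using S(2) that by (auto simp: Acc_def)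
    then show False using 1 by simp
  qed
  have 3: "(a, a) \<notin> atts F"
  proof
    assume "(a, a) \<in> atts F"
    then have "a \<in> Def F S" using assms(3) by (auto simp: Acc_def)
    then show False using 1 by simp
  qed
  have "insert a S \<inter> Def F (insert a S) = {}"
    using S(1) 1 2 3 by (auto simp: Def_def)
  moreover have "insert a S \<subseteq> Acc F (insert a S)"
    using S(2) assms(3) Acc_mono[of S "insert a S" F] by auto
  ultimately show ?thesis
    by (simp add: admissible_def conflict_free_def)
qed

text \<open>A maximal admissible set contains whatever it defends, as this could be added; so it is
  complete.\<close>

lemma maximal_admissible:
  assumes "wf_af F" "admissible F S" "\<And>T. admissible F T \<Longrightarrow> S \<subseteq> T \<Longrightarrow> T = S"
  shows "preferred_ext F S"
proof -
  have "Acc F S \<subseteq> S"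
    using admissible_insert[OF assms(1,2)] assms(3) by blast
  then have "complete_ext F S"
    using assms(2) admissible_args[OF assms(2)] by (auto simp: complete_ext_def admissible_def)
  then show ?thesis
    using assms(3) complete_admissible by (auto simp: preferred_ext_def)
qed

lemma admissible_extends:
  assumes "wf_af F" "admissible F S"
  obtains T where "preferred_ext F T" "S \<subseteq> T"
proof -
  let ?A = "{T. admissible F T \<and> S \<subseteq> T}"
  have "finite ?A"
    by (rule finite_subset[of _ "Pow (args F)"]) (use assms admissible_args in \<open>auto simp: wf_af_def\<close>)
  moreover have "S \<in> ?A" using assms(2) by simp
  ultimately obtain T where T: "T \<in> ?A" "\<forall>U\<in>?A. T \<subseteq> U \<longrightarrow> T = U"
    using finite_has_maximal2[of ?A S] by meson
  have "U = T" if "admissible F U" "T \<subseteq> U" for U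
  proof -
    have "U \<in> ?A" using T(1) that by auto
    then show ?thesis using T(2) that(2) by blast
  qed
  then have "preferred_ext F T"
    using T(1) by (intro maximal_admissible[OF assms(1)]) simp_all
  then show thesis using that T(1) by simp
qed

lemma preferred_iff:
  assumes "wf_af F"
  shows "preferred_ext F S \<longleftrightarrow> admissible F S \<and> (\<forall>T. admissible F T \<longrightarrow> S \<subseteq> T \<longrightarrow> T = S)"
proof
  assume S: "preferred_ext F S"
  have "T = S" if T: "admissible F T" "S \<subseteq> T" for T
  proof -
    obtain U where "preferred_ext F U" "T \<subseteq> U"
      using admissible_extends[OF assms T(1)] by blast
    moreover from this have "S = U"
      using S T(2) unfolding preferred_ext_def by blast
    ultimately show ?thesis using T(2) by blast
  qed
  then show "admissible F S \<and> (\<forall>T. admissible F T \<longrightarrow> S \<subseteq> T \<longrightarrow> T = S)"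
    using S by (auto simp: preferred_ext_def complete_admissible)
qed (use maximal_admissible[OF assms] in blast)

text \<open>An argument of \<open>T\<close> outside \<open>S\<close> is not attacked by
  \<open>S\<close>, because \<open>T\<close> is conflict-free and contains \<open>S\<close>; so it
  enlarges the range.\<close>

lemma subset_range:
  assumes "conflict_free F T" "S \<subset> T" "S \<subseteq> args F"
  shows "S \<union> Def F S \<subset> T \<union> Def F T"
proof -
  obtain t where t: "t \<in> T" "t \<notin> S" using assms by blast
  have "t \<notin> Def F S"
    using assms(1) t Def_mono[of S T F] assms(2) by (auto simp: conflict_free_def)
  then show ?thesis
    using t Def_mono[of S T F] assms(2) by blast
qed

text \<open>All semantics are brought into one form: a condition checkable in polynomial time, and
  the absence of a better set satisfying it. For \<open>CO\<close> and \<open>ST\<close> no set is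
  better, which accounts for their lower level.\<close>

definition base :: "semantics \<Rightarrow> 'a af \<Rightarrow> 'a set \<Rightarrow> bool" where
  "base \<sigma> F S \<longleftrightarrow> complete_ext F S \<and> (\<sigma> = ST \<longrightarrow> args F \<subseteq> S \<union> Def F S)"

definition better :: "semantics \<Rightarrow> 'a af \<Rightarrow> 'a set \<Rightarrow> 'a set \<Rightarrow> bool" where
  "better \<sigma> F T S \<longleftrightarrow>
     \<sigma> = PR \<and> S \<subset> T \<or> \<sigma> = SST \<and> S \<union> Def F S \<subset> T \<union> Def F T"

text \<open>For \<open>SST\<close> the comparison may run over complete instead of preferred sets,
  since a complete set extends to a preferred one whose range is at least as large.\<close>

lemma extension_iff:
  assumes "wf_af F"
  shows "extension \<sigma> F S \<longleftrightarrow> base \<sigma> F S \<and> \<not> (\<exists>T. base \<sigma> F T \<and> better \<sigma> F T S)"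
proof (cases \<sigma>)
  case CO
  then show ?thesis by (simp add: base_def better_def)
next
  case PR
  then show ?thesis by (auto simp: base_def better_def preferred_ext_def)
next
  case ST
  have "preferred_ext F S" if S: "complete_ext F S" "args F \<subseteq> S \<union> Def F S"
    unfolding preferred_ext_def
  proof (intro conjI S(1) notI)
    assume "\<exists>T. complete_ext F T \<and> S \<subset> T"
    then obtain T where T: "complete_ext F T" "S \<subset> T" by blast
    then have "S \<union> Def F S \<subset> T \<union> Def F T"
      using S(1) by (intro subset_range) (auto simp: complete_ext_def admissible_def)
    moreover have "T \<union> Def F T \<subseteq> args F"
      using T by (auto simp: complete_ext_def Def_def)
    ultimately show False using S(2) by blast
  qed
  moreover have "S \<union> Def F S \<subseteq> args F" if "complete_ext F S"
    using that by (auto simp: complete_ext_def Def_def)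
  ultimately show ?thesis
    using ST by (auto simp: base_def better_def stable_ext_def preferred_ext_def)
next
  case SST
  have "\<not> (S \<union> Def F S \<subset> T \<union> Def F T)" if S: "semi_stable_ext F S" and T: "complete_ext F T" for T
  proof
    assume less: "S \<union> Def F S \<subset> T \<union> Def F T"
    obtain U where "preferred_ext F U" "T \<subseteq> U"
      using admissible_extends[OF assms complete_admissible[OF T]] by blast
    moreover from this have "S \<union> Def F S \<subset> U \<union> Def F U"
      using less Def_mono[of T U F] by blast
    ultimately show False
      using S by (simp add: semi_stable_ext_def)
  qed
  moreover have "semi_stable_ext F S" if S: "complete_ext F S"
    and max: "\<And>T. complete_ext F T \<Longrightarrow> \<not> (S \<union> Def F S \<subset> T \<union> Def F T)"
  proof -
    have "\<not> S \<subset> T" if "complete_ext F T" for T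
      using subset_range[of F T S] max[OF that] that S by (auto simp: complete_ext_def admissible_def)
    then show ?thesis
      using S max by (auto simp: semi_stable_ext_def preferred_ext_def)
  qed
  moreover have "complete_ext F S" if "semi_stable_ext F S"
    using that by (simp add: semi_stable_ext_def preferred_ext_def)
  ultimately show ?thesis
    using SST by (auto simp: base_def better_def)
qed

lemma extension_complete: "extension \<sigma> F S \<Longrightarrow> complete_ext F S"
  by (cases \<sigma>) (auto simp: preferred_ext_def stable_ext_def semi_stable_ext_def)

text \<open>A conflict-free set that attacks everything outside attacks all attackers of its
  members, and it cannot defend an argument that it attacks.\<close>

lemma stable_iff:
  assumes "wf_af F" "S \<subseteq> args F"
  shows "stable_ext F S \<longleftrightarrow> conflict_free F S \<and> args F \<subseteq> S \<union> Def F S"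
proof
  assume "stable_ext F S"
  then show "conflict_free F S \<and> args F \<subseteq> S \<union> Def F S"
    by (auto simp: stable_ext_def preferred_ext_def complete_ext_def admissible_def)
next
  assume S: "conflict_free F S \<and> args F \<subseteq> S \<union> Def F S"
  have "a \<in> Acc F S \<longleftrightarrow> a \<in> S" for a
  proof
    assume a: "a \<in> Acc F S"
    have "a \<notin> Def F S"
    proof
      assume "a \<in> Def F S"
      then obtain b where "b \<in> S" "(b, a) \<in> atts F" by (auto simp: Def_def)
      moreover from this have "b \<in> Def F S" using a by (auto simp: Acc_def)
      ultimately show False using S by (auto simp: conflict_free_def)
    qed
    then show "a \<in> S" using a S by (auto simp: Acc_def)
  next
    assume a: "a \<in> S"
    have "b \<in> Def F S" if "(b, a) \<in> atts F" for b
    proof -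
      have "b \<in> args F" "a \<in> args F" using that assms by (auto simp: wf_af_def)
      moreover have "b \<notin> S"
        using that a S \<open>a \<in> args F\<close> by (auto simp: conflict_free_def Def_def)
      ultimately show ?thesis using S by blast
    qed
    then show "a \<in> Acc F S" using a assms by (auto simp: Acc_def)
  qed
  then have "Acc F S = S" by auto
  then have "complete_ext F S" using S assms by (auto simp: complete_ext_def admissible_def)
  then show "stable_ext F S"
    using extension_iff[OF assms(1), of ST S] S by (simp add: base_def better_def)
qed

section \<open>Scores and closest labellings\<close>

definition score :: "'a af \<Rightarrow> ('a \<Rightarrow> label) \<Rightarrow> 'a \<Rightarrow> ('a \<Rightarrow> label) \<Rightarrow> nat" where
  "score F L g' L' = 2 * (card (args F) - label_dist F L L') + of_bool (L' g' = In)"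

text \<open>The inserted 0 is the value if no labelling changes \<open>g\<close>; it is even, which
  means rejection, and reaches no threshold from 1 on.\<close>

definition best :: "semantics \<Rightarrow> 'a af \<Rightarrow> 'a \<Rightarrow> ('a \<Rightarrow> label) \<Rightarrow> 'a \<Rightarrow> nat" where
  "best \<sigma> F g L g' = Max (insert 0 (score F L g' ` {L' \<in> labellings \<sigma> F. L g \<noteq> L' g}))"

lemma label_dist_le: "finite (args F) \<Longrightarrow> label_dist F L L' \<le> card (args F)"
  unfolding label_dist_def by (rule card_mono) auto

lemma score_le: "score F L g' L' \<le> 2 * card (args F) + 1"
  by (auto simp: score_def)

lemma finite_scores: "finite (insert 0 (score F L g' ` X))"
proof -
  have "score F L g' ` X \<subseteq> {..2 * card (args F) + 1}"
    using score_le[of F L g'] by auto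
  then show ?thesis
    using finite_subset by blast
qed

lemma best_le: "best \<sigma> F g L g' \<le> 2 * card (args F) + 1"
  unfolding best_def using finite_scores score_le by (subst Max_le_iff) auto

lemma le_best_iff:
  "1 \<le> \<theta> \<Longrightarrow> \<theta> \<le> best \<sigma> F g L g' \<longleftrightarrow> (\<exists>L'\<in>labellings \<sigma> F. L g \<noteq> L' g \<and> \<theta> \<le> score F L g' L')"
  unfolding best_def using finite_scores by (subst Max_ge_iff) auto

text \<open>Doubling the agreement leaves the lowest bit for the acceptance of \<open>g'\<close>, so that the
  best score is odd iff some closest labelling accepts \<open>g'\<close>.\<close>

lemma odd_best_iff:
  assumes "finite (args F)"
  shows "odd (best \<sigma> F g L g') \<longleftrightarrow> (\<exists>L'\<in>counterfactuals \<sigma> F g L. L' g' = In)"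
proof
  let ?V = "{L' \<in> labellings \<sigma> F. L g \<noteq> L' g}"
  assume odd: "odd (best \<sigma> F g L g')"
  have "best \<sigma> F g L g' \<in> insert 0 (score F L g' ` ?V)"
    unfolding best_def by (rule Max_in[OF finite_scores]) simp
  then obtain L' where L': "L' \<in> ?V" "best \<sigma> F g L g' = score F L g' L'"
    using odd by auto
  have "\<not> label_dist F L L'' < label_dist F L L'" if "L'' \<in> ?V" for L''
  proof
    assume "label_dist F L L'' < label_dist F L L'"
    then have "score F L g' L' < score F L g' L''"
      using label_dist_le[OF assms, of L L'] by (auto simp: score_def)
    moreover have "score F L g' L'' \<le> best \<sigma> F g L g'"
      unfolding best_def by (rule Max_ge[OF finite_scores]) (use that in auto)
    ultimately show False using L'(2) by simp
  qed
  moreover have "L' g' = In"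
    using odd L'(2) by (auto simp: score_def split: if_splits)
  ultimately show "\<exists>L'\<in>counterfactuals \<sigma> F g L. L' g' = In"
    using L' by (auto simp: counterfactuals_def)
next
  let ?V = "{L' \<in> labellings \<sigma> F. L g \<noteq> L' g}"
  assume "\<exists>L'\<in>counterfactuals \<sigma> F g L. L' g' = In"
  then obtain L' where L': "L' \<in> ?V" "L' g' = In"
    "\<And>L''. L'' \<in> ?V \<Longrightarrow> label_dist F L L' \<le> label_dist F L L''"
    by (auto simp: counterfactuals_def not_less)
  have "best \<sigma> F g L g' = score F L g' L'"
    unfolding best_def
  proof (rule Max_eqI[OF finite_scores])
    show "s \<le> score F L g' L'" if "s \<in> insert 0 (score F L g' ` ?V)" for s
    proof -
      have "score F L g' L'' \<le> score F L g' L'" if "L'' \<in> ?V" for L''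
        using diff_le_mono2[OF L'(3)[OF that], of "card (args F)"] L'(2) by (simp add: score_def)
      then show ?thesis using that by auto
    qed
  qed (use L' in auto)
  then show "odd (best \<sigma> F g L g')"
    using L'(2) by (simp add: score_def)
qed

text \<open>If all labellings that change \<open>g\<close> accept \<open>g'\<close>, so does a
  closest one, which exists as soon as there is any.\<close>

lemma ex_counterfactual:
  assumes "finite (args F)" "\<And>L'. L' \<in> labellings \<sigma> F \<Longrightarrow> L g \<noteq> L' g \<Longrightarrow> L' g' = In"
  shows "(\<exists>L'\<in>counterfactuals \<sigma> F g L. L' g' = In) \<longleftrightarrow> (\<exists>L'\<in>labellings \<sigma> F. L g \<noteq> L' g)"
proof
  assume "\<exists>L'\<in>labellings \<sigma> F. L g \<noteq> L' g"
  then obtain L' where "L' \<in> labellings \<sigma> F \<and> L g \<noteq> L' g" by blast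
  from exE[OF ex_has_least_nat[of "\<lambda>L'. L' \<in> labellings \<sigma> F \<and> L g \<noteq> L' g", OF this, of "label_dist F L"]]
  obtain L'' where "L'' \<in> labellings \<sigma> F" "L g \<noteq> L'' g"
    "\<forall>L'. L' \<in> labellings \<sigma> F \<and> L g \<noteq> L' g \<longrightarrow> label_dist F L L'' \<le> label_dist F L L'"
    by blast
  then show "\<exists>L'\<in>counterfactuals \<sigma> F g L. L' g' = In"
    using assms(2) by (intro bexI[of _ L'']) (auto simp: counterfactuals_def not_less)
qed (auto simp: counterfactuals_def)

subsection \<open>Isomorphic frameworks\<close>

text \<open>Codes do not record the names of arguments; isomorphisms carry labellings and scores
  over to the framework decoded from a code.\<close>

locale af_iso =
  fixes F :: "'a af" and G :: "'b af" and f :: "'a \<Rightarrow> 'b"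
  assumes wfF: "wf_af F" and wfG: "wf_af G" and bij: "bij_betw f (args F) (args G)"
    and att: "\<And>a b. a \<in> args F \<Longrightarrow> b \<in> args F \<Longrightarrow> (a, b) \<in> atts F \<longleftrightarrow> (f a, f b) \<in> atts G"
begin

lemma inj: "inj_on f (args F)" and img: "f ` args F = args G"
  using bij by (auto simp: bij_betw_def)

lemma mem: "S \<subseteq> args F \<Longrightarrow> a \<in> args F \<Longrightarrow> f a \<in> f ` S \<longleftrightarrow> a \<in> S"
  using inj by (auto simp: inj_on_def)

lemma sub: "X \<subseteq> args F \<Longrightarrow> Y \<subseteq> args F \<Longrightarrow> f ` X \<subseteq> f ` Y \<longleftrightarrow> X \<subseteq> Y"
proof (intro iffI subsetI)
  fix a
  assume a: "X \<subseteq> args F" "Y \<subseteq> args F" "f ` X \<subseteq> f ` Y" "a \<in> X"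
  then have "f a \<in> f ` Y" "a \<in> args F" by auto
  then show "a \<in> Y" using mem[OF a(2)] by simp
qed auto

lemma Def_img:
  assumes "S \<subseteq> args F"
  shows "Def G (f ` S) = f ` Def F S"
proof -
  have "f a \<in> Def G (f ` S) \<longleftrightarrow> a \<in> Def F S" if a: "a \<in> args F" for a
  proof -
    have "(f b, f a) \<in> atts G \<longleftrightarrow> (b, a) \<in> atts F" if "b \<in> S" for b
      using att[of b a] a that assms by blast
    moreover have "f a \<in> args G" using a img by blast
    ultimately show ?thesis using a by (simp add: Def_def)
  qed
  moreover have "Def G (f ` S) \<subseteq> f ` args F" "Def F S \<subseteq> args F"
    using img by (auto simp: Def_def)
  ultimately show ?thesis by blast
qed

lemma Acc_img: 
  assumes "S \<subseteq> args F"
  shows "Acc G (f ` S) = f ` Acc F S"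
proof -
  have D: "Def F S \<subseteq> args F" by (auto simp: Def_def)
  have "f a \<in> Acc G (f ` S) \<longleftrightarrow> a \<in> Acc F S" if a: "a \<in> args F" for a
  proof -
    have "(\<forall>b. (b, f a) \<in> atts G \<longrightarrow> b \<in> Def G (f ` S)) \<longleftrightarrow>
        (\<forall>b\<in>args G. (b, f a) \<in> atts G \<longrightarrow> b \<in> f ` Def F S)"
      using wfG Def_img[OF assms] by (auto simp: wf_af_def)
    also have "\<dots> \<longleftrightarrow> (\<forall>b\<in>args F. (b, a) \<in> atts F \<longrightarrow> b \<in> Def F S)"
      using a att mem[OF D] by (simp add: img[symmetric])
    also have "\<dots> \<longleftrightarrow> (\<forall>b. (b, a) \<in> atts F \<longrightarrow> b \<in> Def F S)"
      using wfF by (auto simp: wf_af_def)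
    finally show ?thesis using a img by (auto simp: Acc_def)
  qed
  moreover have "Acc G (f ` S) \<subseteq> f ` args F" "Acc F S \<subseteq> args F"
    using img by (auto simp: Acc_def)
  ultimately show ?thesis by blast
qed

lemma complete_img: "S \<subseteq> args F \<Longrightarrow> complete_ext G (f ` S) \<longleftrightarrow> complete_ext F S"
proof -
  assume S: "S \<subseteq> args F"
  have D: "Def F S \<subseteq> args F" "Acc F S \<subseteq> args F" by (auto simp: Def_def Acc_def)
  have "f ` S \<inter> f ` Def F S = {} \<longleftrightarrow> S \<inter> Def F S = {}"
    using inj_on_image_Int[OF inj S D(1)] by (metis image_is_empty)
  moreover have "f ` S \<subseteq> args G" using S img by blast
  ultimately show ?thesis
    using S D by (simp add: complete_ext_def admissible_def conflict_free_def Def_img Acc_img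
        inj_on_image_eq_iff[OF inj] sub)
qed

lemma base_img: "S \<subseteq> args F \<Longrightarrow> base \<sigma> G (f ` S) \<longleftrightarrow> base \<sigma> F S"
proof -
  assume S: "S \<subseteq> args F"
  then have D: "S \<union> Def F S \<subseteq> args F" by (auto simp: Def_def)
  have "args G \<subseteq> f ` S \<union> Def G (f ` S) \<longleftrightarrow> args F \<subseteq> S \<union> Def F S"
    unfolding Def_img[OF S] image_Un[symmetric] img[symmetric]
    using D by (simp add: sub)
  then show ?thesis by (simp add: base_def complete_img[OF S])
qed

lemma better_img: "S \<subseteq> args F \<Longrightarrow> T \<subseteq> args F \<Longrightarrow> better \<sigma> G (f ` T) (f ` S) \<longleftrightarrow> better \<sigma> F T S"
proof -
  assume S: "S \<subseteq> args F" "T \<subseteq> args F"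
  have *: "f ` X \<subset> f ` Y \<longleftrightarrow> X \<subset> Y" if "X \<subseteq> args F" "Y \<subseteq> args F" for X Y
    using that by (simp add: psubset_eq sub inj_on_image_eq_iff[OF inj])
  have "S \<union> Def F S \<subseteq> args F" "T \<union> Def F T \<subseteq> args F" using S by (auto simp: Def_def)
  then show ?thesis
    unfolding better_def Def_img[OF S(1)] Def_img[OF S(2)] image_Un[symmetric] using S *
    by (simp del: image_Un)
qed

lemma extension_img:
  assumes "S \<subseteq> args F"
  shows "extension \<sigma> G (f ` S) \<longleftrightarrow> extension \<sigma> F S"
proof -
  have "(\<exists>T. base \<sigma> G T \<and> better \<sigma> G T (f ` S)) \<longleftrightarrow> (\<exists>T. base \<sigma> F T \<and> better \<sigma> F T S)"
  proof
    assume "\<exists>T. base \<sigma> G T \<and> better \<sigma> G T (f ` S)"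
    then obtain T where T: "base \<sigma> G T" "better \<sigma> G T (f ` S)" by blast
    then have "T \<subseteq> f ` args F" using img by (auto simp: base_def complete_ext_def)
    then obtain U where U: "T = f ` U" "U \<subseteq> args F" by (auto simp: subset_image_iff)
    then show "\<exists>T. base \<sigma> F T \<and> better \<sigma> F T S"
      using T base_img[OF U(2)] better_img[OF assms U(2)] by blast
  next
    assume "\<exists>T. base \<sigma> F T \<and> better \<sigma> F T S"
    then obtain T where T: "base \<sigma> F T" "better \<sigma> F T S" by blast
    moreover from this have "T \<subseteq> args F" by (auto simp: base_def complete_ext_def)
    ultimately show "\<exists>T. base \<sigma> G T \<and> better \<sigma> G T (f ` S)"
      using base_img better_img[OF assms] by blast
  qed
  then show ?thesis
    by (simp add: extension_iff[OF wfF] extension_iff[OF wfG] base_img[OF assms])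
qed

lemma labelling_of_img:
  "S \<subseteq> args F \<Longrightarrow> a \<in> args F \<Longrightarrow> labelling_of G (f ` S) (f a) = labelling_of F S a"
proof -
  assume a: "S \<subseteq> args F" "a \<in> args F"
  moreover have "Def F S \<subseteq> args F" by (auto simp: Def_def)
  ultimately show ?thesis by (simp add: labelling_of_def Def_img mem)
qed

lemma labellings_img: "(\<lambda>L a. if a \<in> args F then L (f a) else Und) ` labellings \<sigma> G = labellings \<sigma> F"
proof -
  let ?h = "\<lambda>L a. if a \<in> args F then L (f a) else Und"
  have *: "?h (labelling_of G (f ` S)) = labelling_of F S" if "S \<subseteq> args F" for S
    using that labelling_of_img[OF that] by (auto simp: fun_eq_iff labelling_of_def[of F] Def_def)
  show ?thesis
  proof (intro set_eqI iffI)
    fix L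
    assume "L \<in> ?h ` labellings \<sigma> G"
    then obtain T where T: "extension \<sigma> G T" "L = ?h (labelling_of G T)"
      by (auto simp: labellings_def)
    then have "T \<subseteq> f ` args F" using extension_complete[OF T(1)] img by (auto simp: complete_ext_def)
    then obtain U where U: "T = f ` U" "U \<subseteq> args F" by (auto simp: subset_image_iff)
    then show "L \<in> labellings \<sigma> F"
      using T * extension_img[OF U(2)] by (auto simp: labellings_def)
  next
    fix L
    assume "L \<in> labellings \<sigma> F"
    then obtain S where S: "extension \<sigma> F S" "L = labelling_of F S"
      by (auto simp: labellings_def)
    then have "S \<subseteq> args F" using extension_complete[OF S(1)] by (auto simp: complete_ext_def)
    then have "extension \<sigma> G (f ` S)" "L = ?h (labelling_of G (f ` S))"
      using S extension_img * by auto
    then show "L \<in> ?h ` labellings \<sigma> G"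
      by (auto simp: labellings_def)
  qed
qed

lemma label_dist_img:
  assumes "\<And>a. a \<in> args F \<Longrightarrow> L a = L2 (f a)" "\<And>a. a \<in> args F \<Longrightarrow> L' a = L2' (f a)"
  shows "label_dist F L L' = label_dist G L2 L2'"
proof -
  have "{a \<in> args G. L2 a \<noteq> L2' a} = f ` {a \<in> args F. L a \<noteq> L' a}"
    using assms by (auto simp: img[symmetric])
  moreover have "inj_on f {a \<in> args F. L a \<noteq> L' a}"
    by (rule inj_on_subset[OF inj]) auto
  ultimately show ?thesis by (simp add: label_dist_def card_image)
qed

lemma best_img:
  assumes "\<And>a. a \<in> args F \<Longrightarrow> L a = L2 (f a)" "g \<in> args F" "g' \<in> args F"
  shows "best \<sigma> F g L g' = best \<sigma> G (f g) L2 (f g')"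
proof -
  let ?h = "\<lambda>L a. if a \<in> args F then L (f a) else Und"
  have "card (args F) = card (args G)"
    using bij by (rule bij_betw_same_card)
  then have sc: "score F L g' (?h L') = score G L2 (f g') L'" for L'
    using label_dist_img[of L L2 "?h L'" L'] assms by (simp add: score_def)
  have ne: "L g \<noteq> ?h L' g \<longleftrightarrow> L2 (f g) \<noteq> L' (f g)" for L'
    using assms by simp
  have "{L' \<in> ?h ` labellings \<sigma> G. L g \<noteq> L' g} = ?h ` {L' \<in> labellings \<sigma> G. L g \<noteq> ?h L' g}"
    by blast
  then have "score F L g' ` {L' \<in> ?h ` labellings \<sigma> G. L g \<noteq> L' g} =
      score G L2 (f g') ` {L' \<in> labellings \<sigma> G. L2 (f g) \<noteq> L' (f g)}"
    by (simp only: image_image sc ne)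
  then show ?thesis
    unfolding best_def labellings_img by simp
qed

lemma labelling_img_iff:
  assumes "\<And>a. L a = (if a \<in> args F then L2 (f a) else Und)" "\<And>b. b \<notin> args G \<Longrightarrow> L2 b = Und"
  shows "L \<in> labellings \<sigma> F \<longleftrightarrow> L2 \<in> labellings \<sigma> G"
proof
  assume "L2 \<in> labellings \<sigma> G"
  moreover have "L = (\<lambda>a. if a \<in> args F then L2 (f a) else Und)"
    using assms(1) by (simp add: fun_eq_iff)
  ultimately show "L \<in> labellings \<sigma> F" using labellings_img by blast
next
  assume "L \<in> labellings \<sigma> F"
  then obtain L3 where L3: "L3 \<in> labellings \<sigma> G" "L = (\<lambda>a. if a \<in> args F then L3 (f a) else Und)"
    using labellings_img by blast
  have "L3 b = L2 b" for b
  proof (cases "b \<in> args G")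
    case True
    then obtain a where "a \<in> args F" "b = f a" using img by auto
    then show ?thesis using assms(1)[of a] L3(2) by simp
  next
    case False
    obtain S where S: "extension \<sigma> G S" "L3 = labelling_of G S"
      using L3(1) by (auto simp: labellings_def)
    then have "b \<notin> S" using False extension_complete[OF S(1)] by (auto simp: complete_ext_def)
    then show ?thesis
      using False assms(2) S(2) by (auto simp: labelling_of_def Def_def)
  qed
  then have "L3 = L2" by (rule ext)
  then show "L2 \<in> labellings \<sigma> G" using L3 by simp
qed

end

lemma labelling_Und:
  assumes "L \<in> labellings \<sigma> F" "a \<notin> args F"
  shows "L a = Und"
proof -
  obtain S where S: "extension \<sigma> F S" "L = labelling_of F S"
    using assms(1) by (auto simp: labellings_def)
  then have "a \<notin> S" using assms(2) extension_complete[OF S(1)] by (auto simp: complete_ext_def)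
  then show ?thesis using assms(2) S(2) by (auto simp: labelling_of_def Def_def)
qed

section \<open>Codes\<close>

lemma length_concat_blocks:
  "(\<And>a. a \<in> set xs \<Longrightarrow> length (f a) = k) \<Longrightarrow> length (concat (map f xs)) = length xs * k"
  by (induction xs) auto

lemma nth_concat_blocks:
  "(\<And>a. a \<in> set xs \<Longrightarrow> length (f a) = k) \<Longrightarrow> i < length xs \<Longrightarrow> j < k \<Longrightarrow>
    concat (map f xs) ! (i * k + j) = f (xs ! i) ! j"
proof (induction xs arbitrary: i)
  case (Cons a xs)
  then show ?case by (cases i) (auto simp: nth_append)
qed simp

lemma bit_append: "bit (xs @ ys) i \<longleftrightarrow> (if i < length xs then bit xs i else bit ys (i - length xs))"
  by (auto simp: bit_def nth_append)

lemma bit_append_right: "length xs = n \<Longrightarrow> bit (xs @ ys) (n + k) = bit ys k"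
  by (simp add: bit_append)

lemma bit_map: "bit (map f [0..<n]) i \<longleftrightarrow> i < n \<and> f i"
  by (auto simp: bit_def)

lemma matrix_index: "i < n \<Longrightarrow> j < n \<Longrightarrow> i * n + j < n * (n :: nat)"
proof -
  assume "i < n" "j < n"
  then have "i * n + j < Suc i * n" by simp
  also have "\<dots> \<le> n * n" using \<open>i < n\<close> by (intro mult_right_mono) auto
  finally show ?thesis .
qed

text \<open>The number of leading ones among the first \<open>l\<close> bits. The length is a
  separate parameter because query words carry a code as a prefix.\<close>

definition nargs :: "bool list \<Rightarrow> nat \<Rightarrow> nat" where
  "nargs w l = card {i. i < l \<and> (\<forall>j<Suc i. bit w j)}"

definition code_length :: "nat \<Rightarrow> nat" where
  "code_length n = Suc n + n * n + 4 * n"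

definition attb :: "bool list \<Rightarrow> nat \<Rightarrow> nat \<Rightarrow> nat \<Rightarrow> bool" where
  "attb w n i j = bit w (Suc n + (i * n + j))"

definition gb :: "bool list \<Rightarrow> nat \<Rightarrow> nat \<Rightarrow> bool" where
  "gb w n i = bit w (Suc n + (n * n + i))"

definition gb' :: "bool list \<Rightarrow> nat \<Rightarrow> nat \<Rightarrow> bool" where
  "gb' w n i = bit w (Suc n + (n * n + (n + i)))"

definition inb :: "bool list \<Rightarrow> nat \<Rightarrow> nat \<Rightarrow> bool" where
  "inb w n i = bit w (Suc n + (n * n + (n + (n + (i * 2 + 0)))))"

definition outb :: "bool list \<Rightarrow> nat \<Rightarrow> nat \<Rightarrow> bool" where
  "outb w n i = bit w (Suc n + (n * n + (n + (n + (i * 2 + 1)))))"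

lemmas code_defs = attb_def gb_def gb'_def inb_def outb_def

definition caf :: "bool list \<Rightarrow> nat \<Rightarrow> nat af" where
  "caf w n = \<lparr>args = {..<n}, atts = {(i, j). i < n \<and> j < n \<and> attb w n i j}\<rparr>"

definition clab :: "bool list \<Rightarrow> nat \<Rightarrow> nat \<Rightarrow> label" where
  "clab w n i = (if i < n then if inb w n i then In else if outb w n i then Out else Und else Und)"

definition cg :: "bool list \<Rightarrow> nat \<Rightarrow> nat" where
  "cg w n = (THE i. i < n \<and> gb w n i)"

definition cg' :: "bool list \<Rightarrow> nat \<Rightarrow> nat" where
  "cg' w n = (THE i. i < n \<and> gb' w n i)"

text \<open>Being the code of an input, up to the condition that the labelling belongs to the
  semantics.\<close>

definition valid :: "bool list \<Rightarrow> nat \<Rightarrow> bool" where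
  "valid w l \<longleftrightarrow> l = code_length (nargs w l) \<and>
     (\<exists>i<nargs w l. gb w (nargs w l) i \<and> (\<forall>j<nargs w l. gb w (nargs w l) j \<longrightarrow> j = i)) \<and>
     (\<exists>i<nargs w l. gb' w (nargs w l) i \<and> (\<forall>j<nargs w l. gb' w (nargs w l) j \<longrightarrow> j = i)) \<and>
     (\<forall>i<nargs w l. \<not> (inb w (nargs w l) i \<and> outb w (nargs w l) i))"

lemma wf_caf: "wf_af (caf w n)"
  by (auto simp: wf_af_def caf_def)

lemma args_caf [simp]: "args (caf w n) = {..<n}"
  by (simp add: caf_def)

lemma nargs_eqI:
  assumes "n < l" "\<And>i. i < n \<Longrightarrow> bit w i" "\<not> bit w n"
  shows "nargs w l = n"
proof -
  have "{i. i < l \<and> (\<forall>j<Suc i. bit w j)} = {..<n}"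
  proof (intro set_eqI iffI)
    fix i
    assume "i \<in> {i. i < l \<and> (\<forall>j<Suc i. bit w j)}"
    then show "i \<in> {..<n}" using assms(3) by (auto simp: not_less[symmetric] less_Suc_eq_le)
  qed (use assms in auto)
  then show ?thesis by (simp add: nargs_def)
qed

lemma nargs_bits:
  assumes "nargs w l < l"
  shows "i < nargs w l \<Longrightarrow> bit w i" "\<not> bit w (nargs w l)"
proof -
  define m where "m = (LEAST i. i = l \<or> \<not> bit w i)"
  have m: "m = l \<or> \<not> bit w m"
    unfolding m_def by (rule LeastI[of _ l]) simp
  have le: "m \<le> l"
    unfolding m_def by (rule Least_le) simp
  have bits: "bit w i" if "i < m" for i
    using not_less_Least[OF that[unfolded m_def]] by blast
  have "nargs w l = m"
  proof (cases "m = l")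
    case True
    have "bit w j" if "i < l" "j < Suc i" for i j
      using bits[of j] that True by simp
    then have "{i. i < l \<and> (\<forall>j<Suc i. bit w j)} = {..<l}"
      by blast
    then show ?thesis using True by (simp add: nargs_def)
  next
    case False
    then show ?thesis
      using m le bits by (intro nargs_eqI) simp_all
  qed
  moreover from this have "\<not> bit w m"
    using m assms by simp
  ultimately show "i < nargs w l \<Longrightarrow> bit w i" "\<not> bit w (nargs w l)"
    using bits[of i] by simp_all
qed

lemma encode_bits:
  assumes "n = length xs"
  shows "length (encode xs F g L g') = code_length n"
    and "i < n \<Longrightarrow> bit (encode xs F g L g') i"
    and "\<not> bit (encode xs F g L g') n"
    and "i < n \<Longrightarrow> j < n \<Longrightarrow> attb (encode xs F g L g') n i j \<longleftrightarrow> (xs ! i, xs ! j) \<in> atts F"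
    and "i < n \<Longrightarrow> gb (encode xs F g L g') n i \<longleftrightarrow> xs ! i = g"
    and "i < n \<Longrightarrow> gb' (encode xs F g L g') n i \<longleftrightarrow> xs ! i = g'"
    and "i < n \<Longrightarrow> inb (encode xs F g L g') n i \<longleftrightarrow> L (xs ! i) = In"
    and "i < n \<Longrightarrow> outb (encode xs F g L g') n i \<longleftrightarrow> L (xs ! i) = Out"
proof -
  let ?M = "concat (map (\<lambda>a. map (\<lambda>b. (a, b) \<in> atts F) xs) xs)"
  let ?g = "map (\<lambda>a. a = g) xs" and ?g' = "map (\<lambda>a. a = g') xs"
  let ?L = "concat (map (\<lambda>a. label_code (L a)) xs)"
  have lc: "length (label_code l) = 2" for l by (cases l) auto
  have lM: "length ?M = n * n"
    using length_concat_blocks[of xs "\<lambda>a. map (\<lambda>b. (a, b) \<in> atts F) xs" n] assms by simp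
  have lL: "length ?L = n * 2"
    using length_concat_blocks[of xs "\<lambda>a. label_code (L a)" 2] assms lc by simp
  have enc: "encode xs F g L g' = replicate n True @ [False] @ ?M @ ?g @ ?g' @ ?L"
    by (simp add: encode_def assms)
  have enc': "encode xs F g L g' = (replicate n True @ [False]) @ ?M @ ?g @ ?g' @ ?L"
    by (simp add: enc)
  have b: "bit (encode xs F g L g') (Suc n + k) = bit (?M @ ?g @ ?g' @ ?L) k"
    "bit (?M @ ?g @ ?g' @ ?L) (n * n + k) = bit (?g @ ?g' @ ?L) k"
    "bit (?g @ ?g' @ ?L) (n + k) = bit (?g' @ ?L) k"
    "bit (?g' @ ?L) (n + k) = bit ?L k" for k
    unfolding enc' by (rule bit_append_right; use assms lM in simp)+
  show "length (encode xs F g L g') = code_length n"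
    using assms lM lL by (simp add: enc code_length_def)
  show "i < n \<Longrightarrow> bit (encode xs F g L g') i" "\<not> bit (encode xs F g L g') n"
    by (simp_all add: enc bit_append bit_def[of "replicate n True"] bit_def[of "False # _"])
  show "attb (encode xs F g L g') n i j \<longleftrightarrow> (xs ! i, xs ! j) \<in> atts F" if ij: "i < n" "j < n"
  proof -
    have "attb (encode xs F g L g') n i j \<longleftrightarrow> ?M ! (i * n + j)"
      using matrix_index[OF ij] unfolding attb_def b bit_append lM by (simp add: bit_def lM)
    also have "?M ! (i * n + j) = map (\<lambda>b. (xs ! i, b) \<in> atts F) xs ! j"
      using ij assms by (intro nth_concat_blocks) auto
    finally show ?thesis using ij assms by simp
  qed
  show "i < n \<Longrightarrow> gb (encode xs F g L g') n i \<longleftrightarrow> xs ! i = g"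
    using assms unfolding gb_def b by (simp add: bit_append bit_def[of ?g])
  show "i < n \<Longrightarrow> gb' (encode xs F g L g') n i \<longleftrightarrow> xs ! i = g'"
    using assms unfolding gb'_def b by (simp add: bit_append bit_def[of ?g'])
  have L: "bit ?L (i * 2 + j) = label_code (L (xs ! i)) ! j" if "i < n" "j < 2" for i j
  proof -
    have "i * 2 + j < n * 2" using that by simp
    moreover have "?L ! (i * 2 + j) = label_code (L (xs ! i)) ! j"
      by (rule nth_concat_blocks) (use lc that assms in auto)
    ultimately show ?thesis using lL by (simp only: bit_def simp_thms)
  qed
  show "inb (encode xs F g L g') n i \<longleftrightarrow> L (xs ! i) = In"
    "outb (encode xs F g L g') n i \<longleftrightarrow> L (xs ! i) = Out" if i: "i < n"
    unfolding inb_def outb_def b using L[OF i, of 0] L[OF i, of 1]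
    by (cases "L (xs ! i)"; simp)+
qed

lemma less_code_length_cases:
  assumes "p < code_length n"
  obtains "p < n" | "p = n" | i j where "i < n" "j < n" "p = Suc n + (i * n + j)"
  | i where "i < n" "p = Suc n + (n * n + i)" | i where "i < n" "p = Suc n + (n * n + (n + i))"
  | i where "i < n" "p = Suc n + (n * n + (n + (n + (i * 2 + 0))))"
  | i where "i < n" "p = Suc n + (n * n + (n + (n + (i * 2 + 1))))"
proof -
  consider "p < n" | "p = n" | "n < p" by linarith
  then show thesis
  proof cases
    case 3
    define q where "q = p - Suc n"
    have q: "p = Suc n + q" using 3 by (simp add: q_def)
    consider "q < n * n" | "n * n \<le> q" "q < n * n + n" | "n * n + n \<le> q" "q < n * n + n + n"
      | "n * n + n + n \<le> q" by linarith
    then show thesis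
    proof cases
      case 1
      then have "0 < n" by (cases n) auto
      then have "q div n < n" "q mod n < n" "q = q div n * n + q mod n"
        using 1 by (auto simp: less_mult_imp_div_less)
      then show thesis using that(3)[of "q div n" "q mod n"] q by simp
    next
      case 2
      then show thesis using that(4)[of "q - n * n"] q by simp
    next
      case 3
      then show thesis using that(5)[of "q - n * n - n"] q by simp
    next
      case 4
      define r where "r = q - (n * n + n + n)"
      have r: "q = n * n + (n + (n + r))" using 4 by (simp add: r_def)
      then have "r < 2 * n" using assms q by (simp add: code_length_def)
      then have i: "r div 2 < n" by linarith
      show thesis
      proof (cases "even r")
        case True
        then have e: "r = r div 2 * 2 + 0" by simp
        show thesis by (rule that(6)[OF i]) (subst e[symmetric], simp only: q r)
      next
        case False
        then have e: "r = r div 2 * 2 + 1" by presburger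
        show thesis by (rule that(7)[OF i]) (subst e[symmetric], simp only: q r)
      qed
    qed
  qed (use that in blast)+
qed

lemma code_unique:
  assumes "length x = code_length n" "length y = code_length n"
    and "\<And>i. i < n \<Longrightarrow> bit x i = bit y i" "bit x n = bit y n"
    and "\<And>i j. i < n \<Longrightarrow> j < n \<Longrightarrow> attb x n i j = attb y n i j"
    and "\<And>i. i < n \<Longrightarrow> gb x n i = gb y n i" "\<And>i. i < n \<Longrightarrow> gb' x n i = gb' y n i"
    and "\<And>i. i < n \<Longrightarrow> inb x n i = inb y n i" "\<And>i. i < n \<Longrightarrow> outb x n i = outb y n i"
  shows "x = y"
proof (rule nth_equalityI)
  fix p
  assume "p < length x"
  then have p: "p < code_length n" using assms(1) by simp
  then have "bit x p = bit y p"
  proof (cases rule: less_code_length_cases)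
    case 1
    then show ?thesis by (rule assms(3))
  next
    case 2
    then show ?thesis using assms(4) by simp
  next
    case (3 i j)
    show ?thesis using assms(5)[OF 3(1,2)] unfolding attb_def 3(3) .
  next
    case (4 i)
    show ?thesis using assms(6)[OF 4(1)] unfolding gb_def 4(2) .
  next
    case (5 i)
    show ?thesis using assms(7)[OF 5(1)] unfolding gb'_def 5(2) .
  next
    case (6 i)
    show ?thesis using assms(8)[OF 6(1)] unfolding inb_def 6(2) .
  next
    case (7 i)
    show ?thesis using assms(9)[OF 7(1)] unfolding outb_def 7(2) .
  qed
  then show "x ! p = y ! p" using p assms(1,2) by (simp add: bit_def)
qed (use assms in simp)

lemma unique_THE:
  fixes n :: nat
  assumes "\<exists>i<n. P i \<and> (\<forall>j<n. P j \<longrightarrow> j = i)"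
  shows "(THE i. i < n \<and> P i) < n" "j < n \<Longrightarrow> P j \<longleftrightarrow> j = (THE i. i < n \<and> P i)"
proof -
  obtain i where i: "i < n" "P i" "\<forall>j<n. P j \<longrightarrow> j = i" using assms by blast
  then have e: "(THE i. i < n \<and> P i) = i" by (intro the_equality) blast+
  show "(THE i. i < n \<and> P i) < n" unfolding e by (fact i(1))
  show "j < n \<Longrightarrow> P j \<longleftrightarrow> j = (THE i. i < n \<and> P i)"
    unfolding e using i by blast
qed

lemma valid_encode:
  assumes "valid x (length x)"
  defines "n \<equiv> nargs x (length x)"
  shows "x = encode [0..<n] (caf x n) (cg x n) (clab x n) (cg' x n)" "cg x n < n" "cg' x n < n"
proof -
  have l: "length x = code_length n"
    and g: "\<exists>i<n. gb x n i \<and> (\<forall>j<n. gb x n j \<longrightarrow> j = i)"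
      "\<exists>i<n. gb' x n i \<and> (\<forall>j<n. gb' x n j \<longrightarrow> j = i)"
    and o: "\<forall>i<n. \<not> (inb x n i \<and> outb x n i)"
    using assms(1) unfolding valid_def n_def[symmetric] by blast+
  have "n < length x" unfolding l by (simp add: code_length_def)
  note nb = nargs_bits[OF this[unfolded n_def], folded n_def]
  note u = unique_THE[OF g(1), folded cg_def] unique_THE[OF g(2), folded cg'_def]
  show "cg x n < n" "cg' x n < n" by (fact u)+
  show "x = encode [0..<n] (caf x n) (cg x n) (clab x n) (cg' x n)" (is "x = ?y")
  proof (rule code_unique[OF l])
    have "n = length [0..<n]" by simp
    note e = encode_bits[OF this, where F = "caf x n" and g = "cg x n" and L = "clab x n" and g' = "cg' x n"]
    show "length ?y = code_length n" by (rule e)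
    show "bit x n = bit ?y n" using nb(2) e(3) by simp
    fix i assume i: "i < n"
    show "bit x i = bit ?y i" using nb(1)[OF i] e(2)[OF i] by simp
    show "attb x n i j = attb ?y n i j" if "j < n" for j
      using e(4)[OF i that] i that by (simp add: caf_def)
    show "gb x n i = gb ?y n i" using e(5)[OF i] u(2)[OF i] i by simp
    show "gb' x n i = gb' ?y n i" using e(6)[OF i] u(4)[OF i] i by simp
    show "inb x n i = inb ?y n i" using e(7)[OF i] i by (simp add: clab_def)
    show "outb x n i = outb ?y n i" using e(8)[OF i] i o by (simp add: clab_def)
  qed
qed

text \<open>The enumeration \<open>xs\<close> is an isomorphism from the decoded framework to
  \<open>F\<close>, along which labels and scores are transferred.\<close>

lemma encode_valid:
  fixes F :: "'a af"
  assumes xs: "distinct xs" "set xs = args F" and legal: "legal_input \<sigma> F g L g'"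
    and x: "x = encode xs F g L g'" and n: "n = length xs"
  shows "nargs x (length x) = n" "valid x (length x)"
    "legal_input \<sigma> (caf x n) (cg x n) (clab x n) (cg' x n)"
    "best \<sigma> (caf x n) (cg x n) (clab x n) (cg' x n) = best \<sigma> F g L g'"
proof -
  have e: "length x = code_length n" "i < n \<Longrightarrow> bit x i" "\<not> bit x n"
    "i < n \<Longrightarrow> j < n \<Longrightarrow> attb x n i j \<longleftrightarrow> (xs ! i, xs ! j) \<in> atts F"
    "i < n \<Longrightarrow> gb x n i \<longleftrightarrow> xs ! i = g" "i < n \<Longrightarrow> gb' x n i \<longleftrightarrow> xs ! i = g'"
    "i < n \<Longrightarrow> inb x n i \<longleftrightarrow> L (xs ! i) = In" "i < n \<Longrightarrow> outb x n i \<longleftrightarrow> L (xs ! i) = Out" for i j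
    unfolding x by (fact encode_bits[OF n])+
  show na: "nargs x (length x) = n"
    by (rule nargs_eqI) (use e(1-3) in \<open>simp_all add: code_length_def\<close>)
  have wf: "wf_af F" "g \<in> args F" "g' \<in> args F" and L: "L \<in> labellings \<sigma> F"
    using legal by (auto simp: legal_input_def)
  have un: "\<exists>i<n. xs ! i = a \<and> (\<forall>j<n. xs ! j = a \<longrightarrow> j = i)" if "a \<in> args F" for a
  proof -
    have "a \<in> set xs" using that xs(2) by simp
    then obtain i where "i < n" "xs ! i = a" unfolding in_set_conv_nth n by blast
    moreover from this have "j = i" if "j < n" "xs ! j = a" for j
      using that xs(1) n nth_eq_iff_index_eq[of xs j i] by simp
    ultimately show ?thesis by blast
  qed
  have g: "\<exists>i<n. gb x n i \<and> (\<forall>j<n. gb x n j \<longrightarrow> j = i)" "\<exists>i<n. gb' x n i \<and> (\<forall>j<n. gb' x n j \<longrightarrow> j = i)"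
  proof -
    obtain i where i: "i < n" "xs ! i = g" "\<forall>j<n. xs ! j = g \<longrightarrow> j = i" using un[OF wf(2)] by blast
    have "gb x n i" "\<And>j. j < n \<Longrightarrow> gb x n j \<Longrightarrow> j = i" using e(5) i by blast+
    then show "\<exists>i<n. gb x n i \<and> (\<forall>j<n. gb x n j \<longrightarrow> j = i)" using i(1) by blast
    obtain i where i: "i < n" "xs ! i = g'" "\<forall>j<n. xs ! j = g' \<longrightarrow> j = i" using un[OF wf(3)] by blast
    have "gb' x n i" "\<And>j. j < n \<Longrightarrow> gb' x n j \<Longrightarrow> j = i" using e(6) i by blast+
    then show "\<exists>i<n. gb' x n i \<and> (\<forall>j<n. gb' x n j \<longrightarrow> j = i)" using i(1) by blast
  qed
  show v: "valid x (length x)"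
    unfolding valid_def na by (intro conjI e(1) g allI impI) (simp add: e(7,8))
  note u = unique_THE[OF g(1), folded cg_def] unique_THE[OF g(2), folded cg'_def]
  have cg: "xs ! cg x n = g" "xs ! cg' x n = g'"
    using u(2)[OF u(1)] u(4)[OF u(3)] e(5)[OF u(1)] e(6)[OF u(3)] by simp_all
  interpret af_iso "caf x n" F "\<lambda>i. xs ! i"
  proof
    show "bij_betw (\<lambda>i. xs ! i) (args (caf x n)) (args F)"
      using xs n by (auto intro: bij_betw_nth)
    show "(a, b) \<in> atts (caf x n) \<longleftrightarrow> (xs ! a, xs ! b) \<in> atts F"
      if "a \<in> args (caf x n)" "b \<in> args (caf x n)" for a b
      using that e(4)[of a b] by (simp add: caf_def)
  qed (use wf wf_caf in auto)
  have cl: "clab x n a = L (xs ! a)" if "a < n" for a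
    using e(7,8)[OF that] that by (cases "L (xs ! a)") (auto simp: clab_def)
  have "clab x n \<in> labellings \<sigma> (caf x n)"
    using L labelling_img_iff[of "clab x n" L \<sigma>] cl labelling_Und[OF L] by (simp add: clab_def)
  then show "legal_input \<sigma> (caf x n) (cg x n) (clab x n) (cg' x n)"
    using u wf_caf by (simp add: legal_input_def)
  show "best \<sigma> (caf x n) (cg x n) (clab x n) (cg' x n) = best \<sigma> F g L g'"
    using best_img[of "clab x n" L "cg x n" "cg' x n" \<sigma>] cl u cg by simp
qed

definition legal_code :: "semantics \<Rightarrow> bool list \<Rightarrow> nat \<Rightarrow> bool" where
  "legal_code \<sigma> w l \<longleftrightarrow> valid w l \<and> clab w (nargs w l) \<in> labellings \<sigma> (caf w (nargs w l))"

text \<open>The value 0 of an illegal word is even, so such words are rejected.\<close>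

definition best_code :: "semantics \<Rightarrow> bool list \<Rightarrow> nat" where
  "best_code \<sigma> x = (if legal_code \<sigma> x (length x)
     then let n = nargs x (length x) in best \<sigma> (caf x n) (cg x n) (clab x n) (cg' x n) else 0)"

lemma best_code_encode:
  fixes F :: "'a af"
  assumes "distinct xs" "set xs = args F" "legal_input \<sigma> F g L g'"
  shows "best_code \<sigma> (encode xs F g L g') = best \<sigma> F g L g'"
    "legal_code \<sigma> (encode xs F g L g') (length (encode xs F g L g'))"
  using encode_valid[OF assms refl refl] by (auto simp: best_code_def legal_code_def legal_input_def)

lemma legal_code_encode:
  assumes "legal_code \<sigma> x (length x)"
  obtains xs and F :: "nat af" and g L g' where "distinct xs" "set xs = args F"
    "legal_input \<sigma> F g L g'" "x = encode xs F g L g'"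
proof -
  let ?n = "nargs x (length x)"
  have v: "valid x (length x)" and L: "clab x ?n \<in> labellings \<sigma> (caf x ?n)"
    using assms by (auto simp: legal_code_def)
  note e = valid_encode[OF v]
  have "legal_input \<sigma> (caf x ?n) (cg x ?n) (clab x ?n) (cg' x ?n)"
    using e L wf_caf by (simp add: legal_input_def)
  from that[OF _ _ this e(1)] show thesis
    by (simp add: lessThan_atLeast0)
qed

lemma inputs_iff: "x \<in> CF_CA_inputs \<sigma> \<longleftrightarrow> legal_code \<sigma> x (length x)"
proof
  assume "x \<in> CF_CA_inputs \<sigma>"
  then obtain xs and F :: "nat af" and g L g' where x: "x = encode xs F g L g'"
    "distinct xs" "set xs = args F" "legal_input \<sigma> F g L g'" unfolding CF_CA_inputs_def by blast
  show "legal_code \<sigma> x (length x)"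
    using best_code_encode(2)[OF x(2-4)] unfolding x(1) .
next
  assume "legal_code \<sigma> x (length x)"
  then obtain xs and F :: "nat af" and g L g' where "distinct xs" "set xs = args F"
    "legal_input \<sigma> F g L g'" "x = encode xs F g L g'" by (rule legal_code_encode)
  then show "x \<in> CF_CA_inputs \<sigma>"
    unfolding CF_CA_inputs_def by (intro CollectI exI conjI)
qed

lemma CF_CA_iff: "x \<in> CF_CA \<sigma> \<longleftrightarrow> odd (best_code \<sigma> x)"
proof
  assume "x \<in> CF_CA \<sigma>"
  then obtain xs and F :: "nat af" and g L g' where x: "x = encode xs F g L g'"
    "distinct xs" "set xs = args F" "legal_input \<sigma> F g L g'"
    "\<exists>L' \<in> counterfactuals \<sigma> F g L. L' g' = In" unfolding CF_CA_def by blast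
  moreover have "finite (args F)" using x(4) by (simp add: legal_input_def wf_af_def)
  ultimately show "odd (best_code \<sigma> x)"
    using best_code_encode(1)[OF x(2-4)] odd_best_iff[of F \<sigma> g L g'] by simp
next
  assume odd: "odd (best_code \<sigma> x)"
  then have "legal_code \<sigma> x (length x)" by (auto simp: best_code_def split: if_splits)
  then obtain xs and F :: "nat af" and g L g' where x: "distinct xs" "set xs = args F"
    "legal_input \<sigma> F g L g'" "x = encode xs F g L g'" by (rule legal_code_encode)
  moreover have "finite (args F)" using x(3) by (simp add: legal_input_def wf_af_def)
  ultimately have "\<exists>L' \<in> counterfactuals \<sigma> F g L. L' g' = In"
    using odd best_code_encode(1)[OF x(1-3)] odd_best_iff[of F \<sigma> g L g'] by simp
  with x show "x \<in> CF_CA \<sigma>"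
    unfolding CF_CA_def by (intro CollectI exI conjI)
qed

lemma encode_CF_CA:
  fixes F :: "'a af"
  assumes "distinct xs" "set xs = args F" "legal_input \<sigma> F g L g'"
  shows "encode xs F g L g' \<in> CF_CA_inputs \<sigma>"
    "encode xs F g L g' \<in> CF_CA \<sigma> \<longleftrightarrow> (\<exists>L' \<in> counterfactuals \<sigma> F g L. L' g' = In)"
proof -
  have "finite (args F)" using assms(3) by (simp add: legal_input_def wf_af_def)
  then show "encode xs F g L g' \<in> CF_CA \<sigma> \<longleftrightarrow> (\<exists>L' \<in> counterfactuals \<sigma> F g L. L' g' = In)"
    using best_code_encode(1)[OF assms] odd_best_iff[of F \<sigma> g L g'] by (simp add: CF_CA_iff)
  show "encode xs F g L g' \<in> CF_CA_inputs \<sigma>"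
    using best_code_encode(2)[OF assms] by (simp add: inputs_iff)
qed

section \<open>Membership\<close>

text \<open>This and the following definitions restate the notions on the bits of a code with
  bounded quantifiers, the form to which the closure rules for definable functions apply.\<close>

definition defb :: "bool list \<Rightarrow> nat \<Rightarrow> (nat \<Rightarrow> bool) \<Rightarrow> nat \<Rightarrow> bool" where
  "defb w n S a \<longleftrightarrow> (\<exists>b<n. S b \<and> attb w n b a)"

definition baseb :: "semantics \<Rightarrow> bool list \<Rightarrow> nat \<Rightarrow> (nat \<Rightarrow> bool) \<Rightarrow> bool" where
  "baseb \<sigma> w n S \<longleftrightarrow> (\<forall>a<n. S a \<longrightarrow> \<not> defb w n S a) \<and>
     (\<forall>a<n. S a \<longleftrightarrow> (\<forall>b<n. attb w n b a \<longrightarrow> defb w n S b)) \<and>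
     (\<sigma> = ST \<longrightarrow> (\<forall>a<n. S a \<or> defb w n S a))"

definition betterb :: "semantics \<Rightarrow> bool list \<Rightarrow> nat \<Rightarrow> (nat \<Rightarrow> bool) \<Rightarrow> (nat \<Rightarrow> bool) \<Rightarrow> bool" where
  "betterb \<sigma> w n T S \<longleftrightarrow>
     \<sigma> = PR \<and> (\<forall>a<n. S a \<longrightarrow> T a) \<and> (\<exists>a<n. T a \<and> \<not> S a) \<or>
     \<sigma> = SST \<and> (\<forall>a<n. S a \<or> defb w n S a \<longrightarrow> T a \<or> defb w n T a) \<and>
       (\<exists>a<n. (T a \<or> defb w n T a) \<and> \<not> (S a \<or> defb w n S a))"

definition differb :: "bool list \<Rightarrow> nat \<Rightarrow> (nat \<Rightarrow> bool) \<Rightarrow> nat \<Rightarrow> bool" where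
  "differb w n S a \<longleftrightarrow> \<not> ((S a \<longleftrightarrow> inb w n a) \<and> (defb w n S a \<longleftrightarrow> outb w n a))"

definition scoreb :: "bool list \<Rightarrow> nat \<Rightarrow> (nat \<Rightarrow> bool) \<Rightarrow> nat" where
  "scoreb w n S = 2 * (n - card {a. a < n \<and> differb w n S a}) + of_bool (\<exists>a<n. gb' w n a \<and> S a)"

abbreviation setb :: "nat \<Rightarrow> (nat \<Rightarrow> bool) \<Rightarrow> nat set" where
  "setb n S \<equiv> {a. a < n \<and> S a}"

lemma Def_caf: "Def (caf w n) (setb n S) = setb n (defb w n S)"
  by (auto simp: Def_def caf_def defb_def)

lemma Acc_caf: "Acc (caf w n) (setb n S) = setb n (\<lambda>a. \<forall>b<n. attb w n b a \<longrightarrow> defb w n S b)"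
  unfolding Acc_def Def_caf by (auto simp: caf_def)

lemma baseb_iff: "baseb \<sigma> w n S \<longleftrightarrow> base \<sigma> (caf w n) (setb n S)"
proof -
  have "complete_ext (caf w n) (setb n S) \<longleftrightarrow> (\<forall>a<n. S a \<longrightarrow> \<not> defb w n S a) \<and>
     (\<forall>a<n. S a \<longleftrightarrow> (\<forall>b<n. attb w n b a \<longrightarrow> defb w n S b))"
    unfolding complete_ext_def admissible_def conflict_free_def Def_caf Acc_caf by auto
  moreover have "args (caf w n) \<subseteq> setb n S \<union> Def (caf w n) (setb n S) \<longleftrightarrow> (\<forall>a<n. S a \<or> defb w n S a)"
    unfolding Def_caf by auto
  ultimately show ?thesis by (simp add: baseb_def base_def)
qed

lemma betterb_iff: "betterb \<sigma> w n T S \<longleftrightarrow> better \<sigma> (caf w n) (setb n T) (setb n S)"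
  unfolding betterb_def better_def Def_caf by (rule arg_cong2[of _ _ _ _ "(\<or>)"]) auto

lemma labelling_caf:
  assumes "baseb \<sigma> w n S"
  shows "labelling_of (caf w n) (setb n S) a =
    (if a < n then if S a then In else if defb w n S a then Out else Und else Und)"
  unfolding labelling_of_def Def_caf by simp

lemma clab_caf:
  assumes S: "baseb \<sigma> w n S" and v: "\<And>a. a < n \<Longrightarrow> \<not> (inb w n a \<and> outb w n a)" and a: "a < n"
  shows "clab w n a \<noteq> labelling_of (caf w n) (setb n S) a \<longleftrightarrow> differb w n S a"
proof -
  have "\<not> (S a \<and> defb w n S a)" using S a by (auto simp: baseb_def)
  then show ?thesis
    using v[OF a] a unfolding labelling_caf[OF S] by (auto simp: clab_def differb_def)
qed

lemma score_caf:
  assumes S: "baseb \<sigma> w n S" and v: "\<And>a. a < n \<Longrightarrow> \<not> (inb w n a \<and> outb w n a)"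
    and g: "\<exists>i<n. gb' w n i \<and> (\<forall>j<n. gb' w n j \<longrightarrow> j = i)"
  shows "score (caf w n) (clab w n) (cg' w n) (labelling_of (caf w n) (setb n S)) = scoreb w n S"
proof -
  note u = unique_THE[OF g, folded cg'_def]
  have 1: "{a \<in> args (caf w n). clab w n a \<noteq> labelling_of (caf w n) (setb n S) a} =
      {a. a < n \<and> differb w n S a}"
    using clab_caf[OF S v] by auto
  have 2: "labelling_of (caf w n) (setb n S) (cg' w n) = In \<longleftrightarrow> (\<exists>a<n. gb' w n a \<and> S a)"
    using u unfolding labelling_caf[OF S] by auto
  show ?thesis
    unfolding score_def scoreb_def label_dist_def 1 2 by simp
qed

text \<open>The intended words consist of \<open>l\<close> bits of code, \<open>l\<close> bits of
  threshold and \<open>2 * l\<close> bits for the chosen extension, whence the quarter and the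
  offset. A better set may refute the given labelling or the chosen one, so a single query covers
  both.\<close>

definition beaten :: "semantics \<Rightarrow> lang" where
  "beaten \<sigma> = {u. \<exists>z. length z = length u \<and> baseb \<sigma> u (nargs u (length u div 4)) (bit z) \<and>
     (betterb \<sigma> u (nargs u (length u div 4)) (bit z) (inb u (nargs u (length u div 4))) \<or>
      betterb \<sigma> u (nargs u (length u div 4)) (bit z) (\<lambda>i. bit u (2 * (length u div 4) + i)))}"

text \<open>The part of the test that is checkable in polynomial time. The threshold is the number
  of ones in the second half of the query.\<close>

definition check :: "semantics \<Rightarrow> bool list \<Rightarrow> nat \<Rightarrow> nat \<Rightarrow> (nat \<Rightarrow> bool) \<Rightarrow> bool" where
  "check \<sigma> w l n E \<longleftrightarrow> valid w l \<and> baseb \<sigma> w n (inb w n) \<and>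
     (\<forall>a<n. outb w n a \<longleftrightarrow> defb w n (inb w n) a) \<and> baseb \<sigma> w n E \<and>
     (\<exists>a<n. gb w n a \<and> differb w n E a) \<and> card {i. i < l \<and> bit w (l + i)} \<le> scoreb w n E"

definition threshold :: "semantics \<Rightarrow> lang" where
  "threshold \<sigma> = {w. \<exists>y. length y = length w \<and>
     check \<sigma> w (length w div 2) (nargs w (length w div 2)) (bit y) \<and> w @ y \<notin> beaten \<sigma>}"

text \<open>The threshold is appended in unary and padded to the length of the code, so that the two
  parts are found by halving.\<close>

definition query :: "bool list \<Rightarrow> nat \<Rightarrow> bool list" where
  "query x \<theta> = map (\<lambda>i. if i < length x then bit x i else i - length x < \<theta>) [0..<2 * length x]"

lemma nargs_cong: "\<forall>i<l. bit u i = bit w i \<Longrightarrow> nargs u l = nargs w l"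
  unfolding nargs_def by (rule arg_cong[where f = card]) (auto simp: less_Suc_eq_le)

text \<open>Decoding looks only at the bits of the code, hence not at what is appended to
  it.\<close>

lemma code_cong:
  assumes "\<forall>i<code_length n. bit u i = bit w i"
  shows "a < n \<Longrightarrow> gb u n a = gb w n a" "a < n \<Longrightarrow> gb' u n a = gb' w n a" "a < n \<Longrightarrow> inb u n a = inb w n a"
    "a < n \<Longrightarrow> outb u n a = outb w n a" "a < n \<Longrightarrow> b < n \<Longrightarrow> attb u n a b = attb w n a b"
proof -
  show "attb u n a b = attb w n a b" if "a < n" "b < n"
    unfolding attb_def by (rule assms[rule_format]) (use matrix_index[OF that] in \<open>simp add: code_length_def\<close>)
qed (unfold code_defs, (rule assms[rule_format]; simp add: code_length_def)+)

lemma caf_cong: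
  assumes "\<forall>i<code_length n. bit u i = bit w i"
  shows "caf u n = caf w n" "clab u n = clab w n" "setb n (inb u n) = setb n (inb w n)"
proof -
  note c = code_cong[OF assms]
  show "caf u n = caf w n" unfolding caf_def using c(5) by auto
  show "clab u n = clab w n" unfolding clab_def fun_eq_iff using c(3,4) by auto
  show "setb n (inb u n) = setb n (inb w n)" using c(3) by auto
qed

lemma valid_cong:
  assumes "\<forall>i<l. bit u i = bit w i"
  shows "valid u l = valid w l"
proof -
  define n where "n = nargs w l"
  have n: "nargs u l = n"
    unfolding n_def by (rule nargs_cong) (rule assms)
  show ?thesis
  proof (cases "l = code_length n")
    case True
    have "\<forall>i<code_length n. bit u i = bit w i"
      using assms True by simp
    note c = code_cong[OF this]
    show ?thesis
      unfolding valid_def n n_def[symmetric] by (simp add: c cong: conj_cong)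
  qed (simp add: valid_def n n_def[symmetric])
qed

lemma check_iff:
  assumes l: "length x = l" and w: "w = query x \<theta>" and n: "n = nargs x l" and v: "valid x l" and \<theta>: "\<theta> \<le> l"
  shows "check \<sigma> w l n E \<longleftrightarrow> base \<sigma> (caf x n) (setb n (inb x n)) \<and>
    clab x n = labelling_of (caf x n) (setb n (inb x n)) \<and> base \<sigma> (caf x n) (setb n E) \<and>
    clab x n (cg x n) \<noteq> labelling_of (caf x n) (setb n E) (cg x n) \<and>
    \<theta> \<le> score (caf x n) (clab x n) (cg' x n) (labelling_of (caf x n) (setb n E))"
proof -
  have ln: "l = code_length n" and g: "\<exists>i<n. gb x n i \<and> (\<forall>j<n. gb x n j \<longrightarrow> j = i)"
    and g': "\<exists>i<n. gb' x n i \<and> (\<forall>j<n. gb' x n j \<longrightarrow> j = i)"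
    and o: "\<And>a. a < n \<Longrightarrow> \<not> (inb x n a \<and> outb x n a)"
    using v unfolding valid_def n[symmetric] by blast+
  note u = unique_THE[OF g, folded cg_def]
  have b: "\<forall>i<l. bit w i = bit x i"
    using l unfolding w query_def bit_map by simp
  have b': "\<forall>i<code_length n. bit w i = bit x i"
    using b ln by simp
  note c = code_cong[OF b'] and c2 = caf_cong[OF b']
  have att: "defb w n S a = defb x n S a" if "a < n" for S a
    unfolding defb_def using c(5) that by auto
  have base: "baseb \<sigma> w n S = baseb \<sigma> x n S" for S
    unfolding baseb_iff c2 ..
  have base2: "baseb \<sigma> x n (inb w n) = baseb \<sigma> x n (inb x n)"
    unfolding baseb_iff c2 ..
  have diff: "differb w n S a = differb x n S a" if "a < n" for S a
    unfolding differb_def using that c(3,4) att by simp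
  have score: "scoreb w n E = scoreb x n E"
  proof -
    have "{a. a < n \<and> differb w n E a} = {a. a < n \<and> differb x n E a}"
      using diff by auto
    moreover have "(\<exists>a<n. gb' w n a \<and> E a) \<longleftrightarrow> (\<exists>a<n. gb' x n a \<and> E a)"
      using c(2) by auto
    ultimately show ?thesis by (simp only: scoreb_def)
  qed
  have "{i. i < l \<and> bit w (l + i)} = {..<\<theta>}"
    using \<theta> l unfolding w query_def bit_map by auto
  then have card: "card {i. i < l \<and> bit w (l + i)} = \<theta>" by simp
  have out: "(\<forall>a<n. outb w n a \<longleftrightarrow> defb w n (inb w n) a) \<longleftrightarrow>
      clab x n = labelling_of (caf x n) (setb n (inb x n))" if B: "baseb \<sigma> x n (inb x n)"
  proof -
    have "defb w n (inb w n) a = defb x n (inb x n) a" if "a < n" for a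
      using c(3,5) that unfolding defb_def by (simp cong: conj_cong)
    then have "(\<forall>a<n. outb w n a \<longleftrightarrow> defb w n (inb w n) a) \<longleftrightarrow> (\<forall>a<n. \<not> differb x n (inb x n) a)"
      using c(4) unfolding differb_def by auto
    also have "\<dots> \<longleftrightarrow> clab x n = labelling_of (caf x n) (setb n (inb x n))"
    proof
      assume h: "\<forall>a<n. \<not> differb x n (inb x n) a"
      show "clab x n = labelling_of (caf x n) (setb n (inb x n))"
      proof
        fix a
        show "clab x n a = labelling_of (caf x n) (setb n (inb x n)) a"
          using h clab_caf[OF B o, of a] by (cases "a < n") (auto simp: clab_def labelling_caf[OF B])
      qed
    next
      assume "clab x n = labelling_of (caf x n) (setb n (inb x n))"
      then show "\<forall>a<n. \<not> differb x n (inb x n) a"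
        using clab_caf[OF B o] by metis
    qed
    finally show ?thesis .
  qed
  have gd: "(\<exists>a<n. gb w n a \<and> differb w n E a) \<longleftrightarrow>
      clab x n (cg x n) \<noteq> labelling_of (caf x n) (setb n E) (cg x n)" if B: "baseb \<sigma> x n E"
  proof -
    have "(\<exists>a<n. gb w n a \<and> differb w n E a) \<longleftrightarrow> (\<exists>a<n. a = cg x n \<and> differb x n E a)"
      using c(1) u(2) diff by (simp cong: conj_cong)
    then show ?thesis
      using u(1) clab_caf[OF B o u(1)] by blast
  qed
  have "check \<sigma> w l n E \<longleftrightarrow> baseb \<sigma> x n (inb x n) \<and> (\<forall>a<n. outb w n a \<longleftrightarrow> defb w n (inb w n) a) \<and>
    baseb \<sigma> x n E \<and> (\<exists>a<n. gb w n a \<and> differb w n E a) \<and> \<theta> \<le> scoreb x n E"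
    unfolding check_def base base2 score card using v valid_cong[OF b] by simp
  also have "\<dots> \<longleftrightarrow> baseb \<sigma> x n (inb x n) \<and> clab x n = labelling_of (caf x n) (setb n (inb x n)) \<and>
    baseb \<sigma> x n E \<and> clab x n (cg x n) \<noteq> labelling_of (caf x n) (setb n E) (cg x n) \<and>
    \<theta> \<le> score (caf x n) (clab x n) (cg' x n) (labelling_of (caf x n) (setb n E))"
    using out gd score_caf[OF _ o g'] by auto
  finally show ?thesis unfolding baseb_iff .
qed

lemma beaten_iff:
  assumes l: "length x = l" and w: "w = query x \<theta>" and n: "n = nargs x l" and v: "valid x l"
    and y: "length y = 2 * l"
  shows "w @ y \<in> beaten \<sigma> \<longleftrightarrow> (\<exists>T. base \<sigma> (caf x n) T \<and>
    (better \<sigma> (caf x n) T (setb n (inb x n)) \<or> better \<sigma> (caf x n) T (setb n (bit y))))"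
proof -
  let ?u = "w @ y"
  have ln: "l = code_length n"
    using v unfolding valid_def n[symmetric] by blast
  have lw: "length w = 2 * l" using w l by (simp add: query_def)
  have lu: "length ?u div 4 = l" using lw y by simp
  have b: "\<forall>i<l. bit ?u i = bit x i"
    using l lw unfolding bit_append unfolding w query_def bit_map by simp
  have b': "\<forall>i<code_length n. bit ?u i = bit x i"
    using b ln by simp
  note c = caf_cong[OF b']
  have na: "nargs ?u l = n" unfolding n by (rule nargs_cong[OF b])
  have by': "bit ?u (2 * l + i) = bit y i" for i
    using lw by (simp add: bit_append_right)
  have "n \<le> length ?u" using lw ln by (simp add: code_length_def)
  then have T: "\<exists>z. length z = length ?u \<and> setb n (bit z) = T" if "T \<subseteq> {..<n}" for T
    using that by (intro exI[of _ "map (\<lambda>i. i \<in> T) [0..<length ?u]"]) (auto simp: bit_map)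
  have "?u \<in> beaten \<sigma> \<longleftrightarrow> (\<exists>z. length z = length ?u \<and> base \<sigma> (caf x n) (setb n (bit z)) \<and>
    (better \<sigma> (caf x n) (setb n (bit z)) (setb n (inb x n)) \<or>
     better \<sigma> (caf x n) (setb n (bit z)) (setb n (bit y))))"
    unfolding beaten_def mem_Collect_eq lu na baseb_iff betterb_iff c by' ..
  also have "\<dots> \<longleftrightarrow> (\<exists>T. base \<sigma> (caf x n) T \<and>
    (better \<sigma> (caf x n) T (setb n (inb x n)) \<or> better \<sigma> (caf x n) T (setb n (bit y))))"
  proof
    assume "\<exists>T. base \<sigma> (caf x n) T \<and>
      (better \<sigma> (caf x n) T (setb n (inb x n)) \<or> better \<sigma> (caf x n) T (setb n (bit y)))"
    then obtain T where h: "base \<sigma> (caf x n) T"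
      "better \<sigma> (caf x n) T (setb n (inb x n)) \<or> better \<sigma> (caf x n) T (setb n (bit y))" by blast
    then have "T \<subseteq> {..<n}" by (auto simp: base_def complete_ext_def)
    then obtain z where "length z = length ?u" "setb n (bit z) = T" using T by blast
    then show "\<exists>z. length z = length ?u \<and> base \<sigma> (caf x n) (setb n (bit z)) \<and>
      (better \<sigma> (caf x n) (setb n (bit z)) (setb n (inb x n)) \<or>
       better \<sigma> (caf x n) (setb n (bit z)) (setb n (bit y)))"
      using h by blast
  qed blast
  finally show ?thesis .
qed

text \<open>A guessed set that passes \<open>check\<close> and is not beaten is an extension with
  score at least \<theta>; the same two tests establish that the given labelling is legal.\<close>

lemma query_threshold:
  assumes \<theta>: "1 \<le> \<theta>" "\<theta> \<le> length x"
  shows "query x \<theta> \<in> threshold \<sigma> \<longleftrightarrow> \<theta> \<le> best_code \<sigma> x"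
proof (cases "valid x (length x)")
  case False
  have b: "\<forall>i<length x. bit (query x \<theta>) i = bit x i"
    unfolding query_def bit_map by simp
  have "\<not> valid (query x \<theta>) (length x)"
    using False valid_cong[OF b] by simp
  then have "query x \<theta> \<notin> threshold \<sigma>"
    by (simp add: threshold_def check_def query_def)
  then show ?thesis
    using False \<theta> by (simp add: best_code_def legal_code_def)
next
  case v: True
  define l where "l = length x"
  define n where "n = nargs x l"
  let ?w = "query x \<theta>" and ?F = "caf x n" and ?E = "setb n (inb x n)"
  have lw: "length ?w = 2 * l" by (simp add: query_def l_def)
  have ln: "l = code_length n"
    using v unfolding valid_def n_def l_def by blast
  have b: "\<forall>i<l. bit ?w i = bit x i"
    unfolding query_def bit_map l_def by simp
  have na: "nargs ?w l = n" unfolding n_def by (rule nargs_cong[OF b])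
  have nl: "n \<le> 2 * l" using ln by (simp add: code_length_def)
  have T: "\<exists>y. length y = 2 * l \<and> setb n (bit y) = T" if "T \<subseteq> {..<n}" for T
    using that nl by (intro exI[of _ "map (\<lambda>i. i \<in> T) [0..<2 * l]"]) (auto simp: bit_map)
  have ext: "extension \<sigma> ?F S \<longleftrightarrow> base \<sigma> ?F S \<and> \<not> (\<exists>T. base \<sigma> ?F T \<and> better \<sigma> ?F T S)" for S
    by (rule extension_iff[OF wf_caf])
  have "?w \<in> threshold \<sigma> \<longleftrightarrow> (\<exists>y. length y = 2 * l \<and> check \<sigma> ?w l n (bit y) \<and> ?w @ y \<notin> beaten \<sigma>)"
    unfolding threshold_def mem_Collect_eq lw by (simp add: na)
  also have "\<dots> \<longleftrightarrow> (\<exists>y. length y = 2 * l \<and> extension \<sigma> ?F ?E \<and> clab x n = labelling_of ?F ?E \<and>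
      extension \<sigma> ?F (setb n (bit y)) \<and>
      clab x n (cg x n) \<noteq> labelling_of ?F (setb n (bit y)) (cg x n) \<and>
      \<theta> \<le> score ?F (clab x n) (cg' x n) (labelling_of ?F (setb n (bit y))))"
    using beaten_iff[OF l_def[symmetric] refl n_def v[folded l_def], of _ \<theta> \<sigma>]
      check_iff[OF l_def[symmetric] refl n_def v[folded l_def] \<theta>(2)[folded l_def], of \<sigma>] ext
    by (intro ex_cong1) blast
  also have "\<dots> \<longleftrightarrow> extension \<sigma> ?F ?E \<and> clab x n = labelling_of ?F ?E \<and>
      (\<exists>E. extension \<sigma> ?F E \<and> clab x n (cg x n) \<noteq> labelling_of ?F E (cg x n) \<and>
      \<theta> \<le> score ?F (clab x n) (cg' x n) (labelling_of ?F E))"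
  proof -
    have "extension \<sigma> ?F E \<Longrightarrow> E \<subseteq> {..<n}" for E
      using extension_complete[of \<sigma> ?F E] by (auto simp: complete_ext_def)
    then have "(\<exists>y. length y = 2 * l \<and> extension \<sigma> ?F (setb n (bit y)) \<and> Q (setb n (bit y))) \<longleftrightarrow>
        (\<exists>E. extension \<sigma> ?F E \<and> Q E)" for Q
      using T by metis
    from this[of "\<lambda>E. clab x n (cg x n) \<noteq> labelling_of ?F E (cg x n) \<and>
      \<theta> \<le> score ?F (clab x n) (cg' x n) (labelling_of ?F E)"] show ?thesis by blast
  qed
  finally have *: "?w \<in> threshold \<sigma> \<longleftrightarrow> extension \<sigma> ?F ?E \<and> clab x n = labelling_of ?F ?E \<and>
      (\<exists>E. extension \<sigma> ?F E \<and> clab x n (cg x n) \<noteq> labelling_of ?F E (cg x n) \<and>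
      \<theta> \<le> score ?F (clab x n) (cg' x n) (labelling_of ?F E))" .
  \<comment> \<open>A labelling determines its extension, as the set of arguments labelled
    \<open>In\<close>.\<close>
  have **: "extension \<sigma> ?F ?E \<and> clab x n = labelling_of ?F ?E \<longleftrightarrow> clab x n \<in> labellings \<sigma> ?F"
  proof
    assume "clab x n \<in> labellings \<sigma> ?F"
    then obtain S where S: "extension \<sigma> ?F S" "clab x n = labelling_of ?F S"
      by (auto simp: labellings_def)
    have "S \<subseteq> {..<n}"
      using extension_complete[OF S(1)] by (auto simp: complete_ext_def)
    have "a \<in> S \<longleftrightarrow> a \<in> ?E" for a
    proof -
      have "a \<in> S \<longleftrightarrow> labelling_of ?F S a = In" by (auto simp: labelling_of_def)
      also have "\<dots> \<longleftrightarrow> clab x n a = In" using S(2) by simp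
      also have "\<dots> \<longleftrightarrow> a \<in> ?E" by (auto simp: clab_def)
      finally show ?thesis .
    qed
    then have "S = ?E" by blast
    then show "extension \<sigma> ?F ?E \<and> clab x n = labelling_of ?F ?E" using S by simp
  qed (auto simp: labellings_def)
  have "?w \<in> threshold \<sigma> \<longleftrightarrow> clab x n \<in> labellings \<sigma> ?F \<and>
      (\<exists>L'\<in>labellings \<sigma> ?F. clab x n (cg x n) \<noteq> L' (cg x n) \<and> \<theta> \<le> score ?F (clab x n) (cg' x n) L')"
    unfolding * **[symmetric] by (auto simp: labellings_def)
  also have "\<dots> \<longleftrightarrow> \<theta> \<le> best_code \<sigma> x"
    using v \<theta> by (simp add: best_code_def legal_code_def le_best_iff l_def[symmetric] n_def[symmetric] Let_def)
  finally show ?thesis .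
qed

text \<open>For n arguments a score is at most 2 n + 1, which does not exceed the length of a code;
  so all relevant thresholds fit into the padding.\<close>

lemma best_code_le: "best_code \<sigma> x \<le> length x"
proof (cases "legal_code \<sigma> x (length x)")
  case True
  let ?n = "nargs x (length x)"
  have v: "valid x (length x)" using True by (simp add: legal_code_def)
  then have l: "length x = code_length ?n" and "\<exists>i. i < ?n" unfolding valid_def by blast+
  then have "1 \<le> ?n" by auto
  then have "2 * ?n + 1 \<le> code_length ?n" by (simp add: code_length_def)
  moreover have "best_code \<sigma> x \<le> 2 * ?n + 1"
    using True best_le[of \<sigma> "caf x ?n"] by (simp add: best_code_def Let_def)
  ultimately show ?thesis using l by simp
qed (simp add: best_code_def)

subsection \<open>Definability of the query language\<close>

lemma definable_nargs:
  "definable (\<lambda>x y e. l x y) \<Longrightarrow> definable (\<lambda>x y e. nargs x (l x y))"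
  unfolding nargs_def by (intro definable_intros)

lemma decidable_code:
  assumes "definable (\<lambda>x y e. n x y)" "definable a"
  shows "decidable (\<lambda>x y e. gb x (n x y) (a x y e))" "decidable (\<lambda>x y e. gb' x (n x y) (a x y e))"
    "decidable (\<lambda>x y e. inb x (n x y) (a x y e))" "decidable (\<lambda>x y e. outb x (n x y) (a x y e))"
    "definable b \<Longrightarrow> decidable (\<lambda>x y e. attb x (n x y) (a x y e) (b x y e))"
  unfolding code_defs by (intro definable_intros assms)+

lemma decidable_defb:
  assumes "definable (\<lambda>x y e. n x y)" "\<And>a. definable a \<Longrightarrow> decidable (\<lambda>x y e. S x y (a x y e))" "definable a"
  shows "decidable (\<lambda>x y e. defb x (n x y) (S x y) (a x y e))"
  unfolding defb_def by (intro definable_intros assms decidable_code definable_ren[OF assms(3)])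

lemma decidable_baseb:
  assumes "definable (\<lambda>x y e. n x y)" "\<And>a. definable a \<Longrightarrow> decidable (\<lambda>x y e. S x y (a x y e))"
  shows "decidable (\<lambda>x y e. baseb \<sigma> x (n x y) (S x y))"
  unfolding baseb_def by (intro definable_intros assms decidable_code decidable_defb)

lemma decidable_betterb:
  assumes "definable (\<lambda>x y e. n x y)" "\<And>a. definable a \<Longrightarrow> decidable (\<lambda>x y e. S x y (a x y e))"
    "\<And>a. definable a \<Longrightarrow> decidable (\<lambda>x y e. T x y (a x y e))"
  shows "decidable (\<lambda>x y e. betterb \<sigma> x (n x y) (T x y) (S x y))"
  unfolding betterb_def by (intro definable_intros assms decidable_code decidable_defb)

lemma decidable_differb:
  assumes "definable (\<lambda>x y e. n x y)" "\<And>a. definable a \<Longrightarrow> decidable (\<lambda>x y e. S x y (a x y e))" "definable a"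
  shows "decidable (\<lambda>x y e. differb x (n x y) (S x y) (a x y e))"
  unfolding differb_def by (intro definable_intros assms decidable_code decidable_defb)

lemma decidable_valid:
  assumes "definable (\<lambda>x y e. l x y)"
  shows "decidable (\<lambda>x y e. valid x (l x y))"
  unfolding valid_def code_length_def by (intro definable_intros assms decidable_code definable_nargs)

lemma decidable_check:
  assumes "definable (\<lambda>x y e. l x y)" "definable (\<lambda>x y e. n x y)"
    "\<And>a. definable a \<Longrightarrow> decidable (\<lambda>x y e. S x y (a x y e))"
  shows "decidable (\<lambda>x y e. check \<sigma> x (l x y) (n x y) (S x y))"
  unfolding check_def scoreb_def
  by (intro definable_intros assms decidable_code decidable_defb decidable_valid decidable_baseb decidable_differb)

lemma definable_length_div: "0 < c \<Longrightarrow> definable (\<lambda>x y e. length x div c)"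
  by (rule definable_div) (auto intro: definable_intros)

text \<open>The query is trivial here: the empty word is asked to the empty oracle, which answers
  no.\<close>

lemma beaten_NP: "beaten \<sigma> \<in> NP"
  unfolding NP_def
proof (rule NP_rel_I[where p = "\<lambda>u z e. baseb \<sigma> u (nargs u (length u div 4)) (bit z) \<and>
     (betterb \<sigma> u (nargs u (length u div 4)) (bit z) (inb u (nargs u (length u div 4))) \<or>
      betterb \<sigma> u (nargs u (length u div 4)) (bit z) (\<lambda>i. bit u (2 * (length u div 4) + i)))"
      and l = "\<lambda>_ _ _. 0" and b = "\<lambda>_ _ _. False"])
  show "decidable (\<lambda>u z e. baseb \<sigma> u (nargs u (length u div 4)) (bit z) \<and>
     (betterb \<sigma> u (nargs u (length u div 4)) (bit z) (inb u (nargs u (length u div 4))) \<or>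
      betterb \<sigma> u (nargs u (length u div 4)) (bit z) (\<lambda>i. bit u (2 * (length u div 4) + i))))"
    by (intro decidable_conj decidable_disj decidable_baseb decidable_betterb definable_nargs
        definable_length_div decidable_code decidable_bit definable_add definable_mult definable_const) simp_all
qed (auto simp: beaten_def intro: definable_const)

lemma threshold_NP_rel: 
  assumes A: "\<And>w. w \<in> threshold \<sigma> \<longleftrightarrow> (\<exists>y. length y = length w \<and>
     check \<sigma> w (length w div 2) (nargs w (length w div 2)) (bit y) \<and> w @ y \<notin> A)"
  shows "threshold \<sigma> \<in> NP_rel A"
proof (rule NP_rel_I[where p = "\<lambda>w y e. check \<sigma> w (length w div 2) (nargs w (length w div 2)) (bit y)"
      and l = "\<lambda>w y _. length w + length y"
      and b = "\<lambda>w y e. if e 0 < length w then bit w (e 0) else bit y (e 0 - length w)"])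
  show "decidable (\<lambda>w y e. check \<sigma> w (length w div 2) (nargs w (length w div 2)) (bit y))"
    by (intro decidable_check definable_nargs definable_length_div decidable_bit) simp_all
  show "definable (\<lambda>w y _. length w + length y)"
    "decidable (\<lambda>w y e. if e 0 < length w then bit w (e 0) else bit y (e 0 - length w))"
    by (intro definable_intros)+
  fix w
  have "map (\<lambda>i. if case_nat i zeros 0 < length w then bit w (case_nat i zeros 0)
      else bit y (case_nat i zeros 0 - length w)) [0..<length w + length y] = w @ y" for y
    by (rule nth_equalityI) (auto simp: bit_def nth_append)
  then show "w \<in> threshold \<sigma> \<longleftrightarrow> (\<exists>y. length y = length w \<and>
      check \<sigma> w (length w div 2) (nargs w (length w div 2)) (bit y) \<and>
      map (\<lambda>i. if case_nat i zeros 0 < length w then bit w (case_nat i zeros 0)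
        else bit y (case_nat i zeros 0 - length w)) [0..<length w + length y] \<notin> A)"
    unfolding A by simp
qed

text \<open>Nothing is better under these semantics, so the query would always be answered by no,
  and the empty oracle gives the same answers.\<close>

lemma threshold_NP:
  assumes "\<sigma> \<in> {CO, ST}"
  shows "threshold \<sigma> \<in> NP"
proof -
  have "beaten \<sigma> = {}"
    using assms by (auto simp: beaten_def betterb_def)
  then show ?thesis
    unfolding NP_def by (intro threshold_NP_rel) (simp add: threshold_def)
qed

lemma threshold_Sigma: "threshold \<sigma> \<in> Sigma_p (Suc (Suc 0))"
  using beaten_NP[of \<sigma>] threshold_NP_rel[of \<sigma> "beaten \<sigma>"] by (auto simp: threshold_def)

lemma CF_CA_Theta:
  assumes "threshold \<sigma> \<in> Sigma_p (h - 1)"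
  shows "CF_CA \<sigma> \<in> Theta_p h"
proof (rule Theta_p_I[OF assms, where v = "best_code \<sigma>" and l = "\<lambda>x _ _. 2 * length x"
      and b = "\<lambda>x _ e. if e 0 < length x then bit x (e 0) else e 0 - length x < e 1"])
  show "definable (\<lambda>x _ _. 2 * length x)"
    "decidable (\<lambda>x _ e. if e 0 < length x then bit x (e 0) else e 0 - length x < e 1)"
    by (intro definable_intros)+
  show "best_code \<sigma> x \<le> length x" for x by (rule best_code_le)
  show "x \<in> CF_CA \<sigma> \<longleftrightarrow> odd (best_code \<sigma> x)" for x by (rule CF_CA_iff)
  fix x :: "bool list" and \<theta> :: nat
  assume "1 \<le> \<theta>" "\<theta> \<le> length x"
  then show "map (\<lambda>i. if case_nat i (env [\<theta>]) 0 < length x then bit x (case_nat i (env [\<theta>]) 0)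
      else case_nat i (env [\<theta>]) 0 - length x < case_nat i (env [\<theta>]) 1) [0..<2 * length x] \<in> threshold \<sigma> \<longleftrightarrow>
      \<theta> \<le> best_code \<sigma> x"
    using query_threshold[of \<theta> x \<sigma>] by (simp add: query_def env_def cong: if_cong)
qed

section \<open>Frameworks from clauses\<close>

text \<open>Variables and clauses share one index set, and each of the eight kinds, counting signs,
  has one argument per index. So arguments can be numbered by block and index.\<close>

datatype 'v arg = Lit bool 'v | Prm bool 'v | Dcl 'v | Ccl 'v | Phi 'v | Bar 'v

fun idx :: "'v arg \<Rightarrow> 'v" where
  "idx (Lit b v) = v" | "idx (Prm b v) = v" | "idx (Dcl v) = v" | "idx (Ccl v) = v" | "idx (Phi v) = v"
| "idx (Bar v) = v"

lemma all_arg: "(\<forall>a. P a) \<longleftrightarrow> (\<forall>b v. P (Lit b v)) \<and> (\<forall>b v. P (Prm b v)) \<and> (\<forall>v. P (Dcl v)) \<and>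
    (\<forall>v. P (Ccl v)) \<and> (\<forall>v. P (Phi v)) \<and> (\<forall>v. P (Bar v))"
  by (metis arg.exhaust)

lemma ex_arg: "(\<exists>a. P a) \<longleftrightarrow> (\<exists>b v. P (Lit b v)) \<or> (\<exists>b v. P (Prm b v)) \<or> (\<exists>v. P (Dcl v)) \<or>
    (\<exists>v. P (Ccl v)) \<or> (\<exists>v. P (Phi v)) \<or> (\<exists>v. P (Bar v))"
  by (metis arg.exhaust)

text \<open>\<open>occD w b v\<close> says that the literal with variable \<open>v\<close> and sign
  \<open>b\<close> occurs in clause \<open>w\<close> of the outer formula, \<open>occC\<close>
  likewise for the inner one; \<open>isY\<close> marks the outer variables, and \<open>v0\<close> is
  the distinguished one.\<close>

locale cnf_af =
  fixes V :: "'v set" and isY :: "'v \<Rightarrow> bool" and occD occC :: "'v \<Rightarrow> bool \<Rightarrow> 'v \<Rightarrow> bool"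
    and fl :: bool and v0 :: 'v
  assumes finV: "finite V" and v0: "v0 \<in> V"
begin

text \<open>A conflict-free set contains no argument \<open>Prm\<close>, \<open>Ccl\<close> or \<open>Bar\<close>. In an extension,
  \<open>Dcl\<close> signals a violated clause of \<open>occD\<close>, which makes all \<open>Phi\<close> acceptable; the literals outside
  \<open>isY\<close> depend on \<open>Phi\<close> through \<open>Bar\<close>. Unless \<open>fl\<close> holds, the arguments \<open>Prm\<close> make the
  ranges of different assignments incomparable.\<close>

fun attack :: "'v arg \<Rightarrow> 'v arg \<Rightarrow> bool" where
  "attack (Lit b v) (Lit b' v') = (v = v' \<and> b \<noteq> b')"
| "attack (Lit b v) (Prm b' v') = (v = v' \<and> (b = b' \<or> fl))"
| "attack (Prm b v) (Prm b' v') = (v = v' \<and> b = b')"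
| "attack (Lit b v) (Dcl w) = occD w b v"
| "attack (Lit b v) (Ccl w) = occC w b v"
| "attack (Dcl d) (Ccl w) = True"
| "attack (Ccl w) (Ccl w') = (w = w')"
| "attack (Ccl w) (Phi z) = True"
| "attack (Phi z) (Bar z') = True"
| "attack (Bar z) (Bar z') = (z = z')"
| "attack (Bar z) (Lit b v) = (\<not> isY v)"
| "attack _ _ = False"

definition F :: "'v arg af" where
  "F = \<lparr>args = {a. idx a \<in> V}, atts = {(a, b). idx a \<in> V \<and> idx b \<in> V \<and> attack a b}\<rparr>"

lemma args_F [simp]: "a \<in> args F \<longleftrightarrow> idx a \<in> V"
  by (simp add: F_def)

lemma atts_F [simp]: "(a, b) \<in> atts F \<longleftrightarrow> idx a \<in> V \<and> idx b \<in> V \<and> attack a b"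
  by (simp add: F_def)

lemma wf_F: "wf_af F"
proof -
  have "args F \<subseteq> (\<Union>b. Lit b ` V) \<union> (\<Union>b. Prm b ` V) \<union> Dcl ` V \<union> Ccl ` V \<union> Phi ` V \<union> Bar ` V"
  proof
    fix a
    assume "a \<in> args F"
    then show "a \<in> (\<Union>b. Lit b ` V) \<union> (\<Union>b. Prm b ` V) \<union> Dcl ` V \<union> Ccl ` V \<union> Phi ` V \<union> Bar ` V"
      by (cases a) auto
  qed
  then have "finite (args F)"
    by (rule finite_subset) (use finV in simp)
  then show ?thesis by (auto simp: wf_af_def)
qed

lemma Def_F: "b \<in> Def F S \<longleftrightarrow> idx b \<in> V \<and> (\<exists>a. a \<in> S \<and> idx a \<in> V \<and> attack a b)"
  by (auto simp: Def_def)

lemma Acc_F: "a \<in> Acc F S \<longleftrightarrow> idx a \<in> V \<and> (\<forall>b. idx b \<in> V \<and> attack b a \<longrightarrow> b \<in> Def F S)"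
  by (auto simp: Acc_def)

section \<open>Admissible sets as partial assignments\<close>

definition good :: "'v arg set \<Rightarrow> bool" where
  "good S \<longleftrightarrow> (\<forall>a\<in>S. idx a \<in> V) \<and> (\<forall>b v. Prm b v \<notin> S) \<and> (\<forall>v. Ccl v \<notin> S) \<and> (\<forall>v. Bar v \<notin> S)"

definition hit :: "'v arg set \<Rightarrow> 'v \<Rightarrow> bool" where
  "hit S w \<longleftrightarrow> (\<exists>b v. occC w b v \<and> Lit b v \<in> S) \<or> (\<exists>d. Dcl d \<in> S)"

lemma cf_good:
  assumes "conflict_free F S" "S \<subseteq> args F"
  shows "good S" "Lit b v \<in> S \<Longrightarrow> Lit (\<not> b) v \<notin> S"
proof -
  have *: "\<not> attack a c" if "a \<in> S" "c \<in> S" for a c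
  proof -
    have "c \<notin> Def F S" "a \<in> args F" "c \<in> args F" using assms that by (auto simp: conflict_free_def simp del: args_F)
    then show ?thesis using that(1) unfolding Def_F args_F by blast
  qed
  show "good S"
  proof -
    have "Prm b v \<notin> S" "Ccl v \<notin> S" "Bar v \<notin> S" for b v
      using *[of "Prm b v" "Prm b v"] *[of "Ccl v" "Ccl v"] *[of "Bar v" "Bar v"] by auto
    moreover have "idx a \<in> V" if "a \<in> S" for a
      using assms(2) that unfolding args_F[symmetric] by blast
    ultimately show ?thesis by (simp add: good_def)
  qed
  show "Lit b v \<in> S \<Longrightarrow> Lit (\<not> b) v \<notin> S"
    using *[of "Lit b v" "Lit (\<not> b) v"] by auto
qed

lemma Def_good:
  assumes "good S"
  shows "Lit b v \<in> Def F S \<longleftrightarrow> Lit (\<not> b) v \<in> S"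
    "Prm b v \<in> Def F S \<longleftrightarrow> Lit b v \<in> S \<or> fl \<and> Lit (\<not> b) v \<in> S"
    "Dcl w \<in> Def F S \<longleftrightarrow> w \<in> V \<and> (\<exists>b v. occD w b v \<and> Lit b v \<in> S)"
    "Ccl w \<in> Def F S \<longleftrightarrow> w \<in> V \<and> hit S w"
    "Phi z \<notin> Def F S"
    "Bar z \<in> Def F S \<longleftrightarrow> z \<in> V \<and> (\<exists>z'. Phi z' \<in> S)"
proof -
  have V: "a \<in> S \<Longrightarrow> idx a \<in> V" and no: "Prm c u \<notin> S" "Ccl u \<notin> S" "Bar u \<notin> S" for a c u
    using assms by (auto simp: good_def)
  have VL: "Lit c u \<in> S \<Longrightarrow> u \<in> V" and VD: "Dcl u \<in> S \<Longrightarrow> u \<in> V" and VP: "Phi u \<in> S \<Longrightarrow> u \<in> V" for c u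
    using V[of "Lit c u"] V[of "Dcl u"] V[of "Phi u"] by auto
  have b: "b \<noteq> c \<longleftrightarrow> b = (\<not> c)" for b c :: bool by auto
  show "Lit b v \<in> Def F S \<longleftrightarrow> Lit (\<not> b) v \<in> S"
    unfolding Def_F ex_arg using no VL by (auto simp: b)
  show "Prm b v \<in> Def F S \<longleftrightarrow> Lit b v \<in> S \<or> fl \<and> Lit (\<not> b) v \<in> S"
    unfolding Def_F ex_arg using no VL by (cases b) (auto, (metis (full_types))+)
  show "Dcl w \<in> Def F S \<longleftrightarrow> w \<in> V \<and> (\<exists>b v. occD w b v \<and> Lit b v \<in> S)"
    unfolding Def_F ex_arg using no VL by simp blast
  show "Ccl w \<in> Def F S \<longleftrightarrow> w \<in> V \<and> hit S w"
    unfolding Def_F ex_arg hit_def using no VL VD by simp blast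
  show "Phi z \<notin> Def F S"
    unfolding Def_F ex_arg using no by auto
  show "Bar z \<in> Def F S \<longleftrightarrow> z \<in> V \<and> (\<exists>z'. Phi z' \<in> S)"
    unfolding Def_F ex_arg using no VP by auto
qed

text \<open>Acceptability with respect to a \<open>good\<close> set. Such a set can defend a literal
  against its negation only by the literal itself, and an inner literal against \<open>Bar\<close>
  only by some \<open>Phi\<close>.\<close>

definition supported :: "'v arg set \<Rightarrow> 'v arg \<Rightarrow> bool" where
  "supported S a = (case a of
     Lit b v \<Rightarrow> v \<in> V \<and> Lit b v \<in> S \<and> (isY v \<or> (\<exists>z. Phi z \<in> S))
   | Dcl w \<Rightarrow> w \<in> V \<and> (\<forall>b v. v \<in> V \<longrightarrow> occD w b v \<longrightarrow> Lit (\<not> b) v \<in> S)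
   | Phi z \<Rightarrow> z \<in> V \<and> (\<forall>w\<in>V. hit S w)
   | _ \<Rightarrow> False)"

lemma Acc_good:
  assumes "good S"
  shows "Lit b v \<in> Acc F S \<longleftrightarrow> supported S (Lit b v)" "Dcl w \<in> Acc F S \<longleftrightarrow> supported S (Dcl w)"
    "Phi z \<in> Acc F S \<longleftrightarrow> supported S (Phi z)"
proof -
  note D = Def_good[OF assms]
  show "Lit b v \<in> Acc F S \<longleftrightarrow> supported S (Lit b v)"
  proof -
    have "(\<forall>c. idx c \<in> V \<and> attack c (Lit b v) \<longrightarrow> c \<in> Def F S) \<longleftrightarrow>
        (v \<in> V \<longrightarrow> Lit b v \<in> S) \<and> (isY v \<or> (\<exists>z. Phi z \<in> S))"
      unfolding all_arg using v0 by (cases b) (auto simp: D)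
    then show ?thesis by (auto simp: Acc_F supported_def)
  qed
  show "Dcl w \<in> Acc F S \<longleftrightarrow> supported S (Dcl w)"
    unfolding Acc_F all_arg supported_def by (auto simp: D)
  show "Phi z \<in> Acc F S \<longleftrightarrow> supported S (Phi z)"
    unfolding Acc_F all_arg supported_def by (auto simp: D)
qed

text \<open>Conflict-freeness comes down to consistent literals: an attack on a \<open>Dcl\<close>
  would contradict its support, and nothing in a \<open>good\<close> set attacks
  \<open>Phi\<close>.\<close>

lemma adm_iff:
  assumes "good S"
  shows "admissible F S \<longleftrightarrow> (\<forall>b v. Lit b v \<in> S \<longrightarrow> Lit (\<not> b) v \<notin> S) \<and> (\<forall>a\<in>S. supported S a)"
proof
  assume a: "admissible F S"
  then have "conflict_free F S" "S \<subseteq> args F" using admissible_args[OF a] by (auto simp: admissible_def)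
  from cf_good(2)[OF this] have 1: "\<forall>b v. Lit b v \<in> S \<longrightarrow> Lit (\<not> b) v \<notin> S" by blast
  have "supported S c" if "c \<in> S" for c
  proof -
    have "c \<in> Acc F S" using a that by (auto simp: admissible_def)
    then show ?thesis using that assms Acc_good[OF assms] by (cases c) (auto simp: good_def)
  qed
  then show "(\<forall>b v. Lit b v \<in> S \<longrightarrow> Lit (\<not> b) v \<notin> S) \<and> (\<forall>a\<in>S. supported S a)" using 1 by blast
next
  assume h: "(\<forall>b v. Lit b v \<in> S \<longrightarrow> Lit (\<not> b) v \<notin> S) \<and> (\<forall>a\<in>S. supported S a)"
  have "c \<in> Acc F S \<and> c \<notin> Def F S" if c: "c \<in> S" for c
  proof (cases c)
    case (Lit b v)
    then show ?thesis using h c Acc_good(1)[OF assms] Def_good(1)[OF assms] by auto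
  next
    case (Dcl w)
    then have s: "supported S (Dcl w)" using h c by blast
    have "Lit b v \<notin> S" if "occD w b v" for b v
    proof
      assume l: "Lit b v \<in> S"
      then have "v \<in> V" using assms by (auto simp: good_def)
      then have "Lit (\<not> b) v \<in> S" using s that by (simp add: supported_def)
      then show False using h l by blast
    qed
    then show ?thesis using s Dcl Acc_good(2)[OF assms] Def_good(3)[OF assms] by auto
  next
    case (Phi z)
    then show ?thesis using h c Acc_good(3)[OF assms] Def_good(5)[OF assms] by auto
  qed (use c assms in \<open>auto simp: good_def\<close>)
  then show "admissible F S" by (auto simp: admissible_def conflict_free_def)
qed

lemma adm_lit:
  assumes "admissible F S"
  shows "Lit True v \<in> S \<Longrightarrow> Lit False v \<notin> S" "Lit b v \<in> S \<Longrightarrow> Lit c v \<in> S \<Longrightarrow> b = c"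
proof -
  have "conflict_free F S" "S \<subseteq> args F" using assms admissible_args[OF assms] by (auto simp: admissible_def)
  from cf_good(2)[OF this, of True v] show 1: "Lit True v \<in> S \<Longrightarrow> Lit False v \<notin> S" by simp
  show "Lit b v \<in> S \<Longrightarrow> Lit c v \<in> S \<Longrightarrow> b = c" using 1 by (cases b; cases c) auto
qed

definition satD :: "('v \<Rightarrow> bool) \<Rightarrow> bool" where
  "satD \<alpha> \<longleftrightarrow> (\<forall>w\<in>V. \<exists>v\<in>V. occD w (\<alpha> v) v)"

definition satC :: "('v \<Rightarrow> bool) \<Rightarrow> bool" where
  "satC \<alpha> \<longleftrightarrow> (\<forall>w\<in>V. \<exists>v\<in>V. occC w (\<alpha> v) v)"

definition full :: "('v \<Rightarrow> bool) \<Rightarrow> 'v arg set" where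
  "full \<alpha> = {Lit (\<alpha> v) v | v. v \<in> V} \<union> Phi ` V"

lemma full_simps [simp]: "Lit b v \<in> full \<alpha> \<longleftrightarrow> v \<in> V \<and> b = \<alpha> v" "Prm b v \<notin> full \<alpha>" "Dcl v \<notin> full \<alpha>"
  "Ccl v \<notin> full \<alpha>" "Phi v \<in> full \<alpha> \<longleftrightarrow> v \<in> V" "Bar v \<notin> full \<alpha>"
  by (auto simp: full_def)

lemma good_full: "good (full \<alpha>)"
  unfolding good_def full_def by auto

lemma full_admissible:
  assumes "satC \<alpha>"
  shows "admissible F (full \<alpha>)"
  unfolding adm_iff[OF good_full]
proof (intro conjI allI ballI impI)
  fix a
  assume "a \<in> full \<alpha>"
  then show "supported (full \<alpha>) a"
    using assms v0 by (cases a) (auto simp: supported_def hit_def satC_def)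
qed auto

lemma admissible_good: "admissible F S \<Longrightarrow> good S"
  using cf_good(1)[of S] admissible_args[of F S] by (simp add: admissible_def)

text \<open>Acceptability of \<open>Phi\<close> requires an attack on every \<open>Ccl\<close>. As
  no \<open>Dcl\<close> is present, literals of \<open>S\<close> must do this, and these are true
  under \<alpha>.\<close>

lemma admissible_Phi:
  assumes "admissible F S" "Phi z \<in> S" "\<And>d. Dcl d \<notin> S"
    and \<alpha>: "\<And>v. v \<in> V \<Longrightarrow> Lit (\<not> \<alpha> v) v \<notin> S"
  shows "satC \<alpha>"
  unfolding satC_def
proof
  fix w
  assume w: "w \<in> V"
  note good = admissible_good[OF assms(1)]
  have "hit S w"
    using assms(1,2) w unfolding adm_iff[OF good] by (auto simp: supported_def)
  then obtain b v where "occC w b v" "Lit b v \<in> S"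
    using assms(3) by (auto simp: hit_def)
  moreover from this have "v \<in> V" using good by (auto simp: good_def)
  ultimately show "\<exists>v\<in>V. occC w (\<alpha> v) v" using \<alpha>[of v] by (intro bexI[of _ v]) (cases b; cases "\<alpha> v"; auto)+
qed

subsection \<open>Complete extensions\<close>

text \<open>Every argument has an attacker: for \<open>Dcl\<close> it is the literal of
  \<open>v0\<close>, for the others it is the argument itself, its negation or a
  \<open>Ccl\<close>.\<close>

lemma complete_empty:
  assumes "\<And>w. occD w True v0"
  shows "complete_ext F {}"
proof -
  have "a \<notin> Acc F {}" for a
  proof
    assume a: "a \<in> Acc F {}"
    have "\<exists>b. idx b \<in> V \<and> attack b a"
      using a v0 assms
      by (cases a) (auto simp: Acc_F ex_arg intro: exI[of _ "\<not> _"])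
    then show False using a by (auto simp: Acc_F Def_def)
  qed
  then show ?thesis by (auto simp: complete_ext_def admissible_def conflict_free_def)
qed

text \<open>As \<open>v0\<close> occurs with both signs in every clause of \<open>occD\<close>, a
  \<open>Dcl\<close> would need both literals of \<open>v0\<close>; so only a satisfying assignment
  can support \<open>Phi\<close>.\<close>

lemma complete_Phi:
  assumes "\<And>w b. occD w b v0"
  shows "(\<exists>E. complete_ext F E \<and> Phi v0 \<in> E) \<longleftrightarrow> (\<exists>\<alpha>. satC \<alpha>)"
proof
  assume "\<exists>E. complete_ext F E \<and> Phi v0 \<in> E"
  then obtain E where E: "admissible F E" "Phi v0 \<in> E" using complete_admissible by blast
  note good = admissible_good[OF E(1)]
  have no: "Dcl d \<notin> E" for d
  proof
    assume "Dcl d \<in> E"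
    then have "supported E (Dcl d)" using E(1) unfolding adm_iff[OF good] by blast
    then have "Lit (\<not> b) v0 \<in> E" for b using assms v0 by (auto simp: supported_def)
    from this[of True] this[of False] show False
      using adm_lit(1)[OF E(1), of v0] by simp
  qed
  have "Lit (\<not> (Lit True v \<in> E)) v \<notin> E" for v
    using adm_lit(1)[OF E(1), of v] by (cases "Lit True v \<in> E") auto
  then have "satC (\<lambda>v. Lit True v \<in> E)"
    by (intro admissible_Phi[OF E no])
  then show "\<exists>\<alpha>. satC \<alpha>" by blast
next
  assume "\<exists>\<alpha>. satC \<alpha>"
  then obtain \<alpha> where "satC \<alpha>" ..
  from admissible_extends[OF wf_F full_admissible[OF this]] obtain T where "preferred_ext F T" "full \<alpha> \<subseteq> T" .
  moreover have "Phi v0 \<in> full \<alpha>" using v0 by simp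
  ultimately show "\<exists>E. complete_ext F E \<and> Phi v0 \<in> E"
    unfolding preferred_ext_def by blast
qed

text \<open>The empty extension labels everything \<open>Und\<close>. A \<open>good\<close> set
  never attacks \<open>Phi\<close>, so this argument changes its label only by being accepted and
  serves as both \<open>g\<close> and \<open>g'\<close>.\<close>

lemma CO_counterfactual:
  assumes "\<And>w b. occD w b v0"
  shows "legal_input CO F (Phi v0) (\<lambda>_. Und) (Phi v0)"
    and "(\<exists>L'\<in>counterfactuals CO F (Phi v0) (\<lambda>_. Und). L' (Phi v0) = In) \<longleftrightarrow> (\<exists>\<alpha>. satC \<alpha>)"
proof -
  have "labelling_of F {} = (\<lambda>_. Und)"
    by (auto simp: labelling_of_def Def_def fun_eq_iff)
  then show "legal_input CO F (Phi v0) (\<lambda>_. Und) (Phi v0)"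
    using complete_empty[OF assms] wf_F v0 by (force simp: legal_input_def labellings_def image_iff)
  have *: "labelling_of F E (Phi v0) = (if Phi v0 \<in> E then In else Und)" if "complete_ext F E" for E
    using Def_good(5)[OF admissible_good[OF complete_admissible[OF that]]] by (simp add: labelling_of_def)
  have "(\<exists>L'\<in>counterfactuals CO F (Phi v0) (\<lambda>_. Und). L' (Phi v0) = In) \<longleftrightarrow>
      (\<exists>L'\<in>labellings CO F. Und \<noteq> L' (Phi v0))"
    using * wf_F by (intro ex_counterfactual) (auto simp: labellings_def wf_af_def split: if_splits)
  also have "\<dots> \<longleftrightarrow> (\<exists>E. complete_ext F E \<and> Phi v0 \<in> E)"
    using * by (auto simp: labellings_def split: if_splits)
  finally show "(\<exists>L'\<in>counterfactuals CO F (Phi v0) (\<lambda>_. Und). L' (Phi v0) = In) \<longleftrightarrow> (\<exists>\<alpha>. satC \<alpha>)"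
    unfolding complete_Phi[OF assms] .
qed

subsection \<open>The known extension\<close>

text \<open>With the positive literal of \<open>v0\<close> in all clauses, the assignment that makes
  every variable true satisfies both formulas. Its labelling \<open>lab1\<close> can be written down
  without solving them.\<close>

abbreviation E1 :: "'v arg set" where
  "E1 \<equiv> full (\<lambda>_. True)"

fun lab1 :: "'v arg \<Rightarrow> label" where
  "lab1 (Lit b v) = (if v \<in> V then if b then In else Out else Und)"
| "lab1 (Prm b v) = (if v \<in> V \<and> (b \<or> fl) then Out else Und)"
| "lab1 (Phi v) = (if v \<in> V then In else Und)"
| "lab1 a = (if idx a \<in> V then Out else Und)"

lemma labelling_E1:
  assumes "\<And>w. occD w True v0" "\<And>w. occC w True v0"
  shows "labelling_of F E1 = lab1"
proof
  fix a
  note D = Def_good[OF good_full[of "\<lambda>_. True"]]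
  have "hit E1 w" for w using assms v0 by (auto simp: hit_def)
  moreover have "Dcl w \<in> Def F E1 \<longleftrightarrow> w \<in> V" for w
    unfolding D using assms(1) v0 by auto
  ultimately show "labelling_of F E1 a = lab1 a"
    by (cases a) (auto simp: labelling_of_def D(1,2,4-6))
qed

lemma E1_preferred:
  assumes D: "\<And>w. occD w True v0" and C: "\<And>w. occC w True v0"
  shows "preferred_ext F E1"
  unfolding preferred_iff[OF wf_F]
proof (intro conjI allI impI)
  show "admissible F E1"
    by (rule full_admissible) (use C v0 in \<open>auto simp: satC_def\<close>)
  fix T
  assume T: "admissible F T" "E1 \<subseteq> T"
  note good = admissible_good[OF T(1)]
  note adm = T(1)[unfolded adm_iff[OF good]]
  have l: "Lit True v \<in> T" if "v \<in> V" for v using T(2) that by auto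
  have "a \<in> E1" if a: "a \<in> T" for a
  proof (cases a)
    case (Lit b v)
    then have "v \<in> V" using good a by (auto simp: good_def)
    then show ?thesis using adm_lit(1)[OF T(1), of v] l[of v] a Lit by (cases b) auto
  next
    case (Dcl w)
    then have "supported T (Dcl w)" using adm a by blast
    then have "Lit False v0 \<in> T" using D v0 by (force simp: supported_def)
    then show ?thesis using adm_lit(1)[OF T(1)] l[OF v0] by blast
  next
    case (Phi z)
    then show ?thesis using good a by (auto simp: good_def)
  qed (use good a in \<open>auto simp: good_def\<close>)
  then show "T = E1" using T(2) by blast
qed

subsection \<open>Stable extensions\<close>

text \<open>Here \<open>fl\<close> lets either literal attack both of its \<open>Prm\<close>
  arguments, and every \<open>Dcl\<close> is attacked because \<open>v0\<close> occurs with both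
  signs; so the range covers all arguments.\<close>

lemma full_stable:
  assumes fl and D: "\<And>w b. occD w b v0" and "satC \<alpha>"
  shows "stable_ext F (full \<alpha>)"
proof -
  have "full \<alpha> \<subseteq> args F" using good_full[of \<alpha>] by (auto simp: good_def)
  moreover have "conflict_free F (full \<alpha>)" using full_admissible[OF assms(3)] by (simp add: admissible_def)
  moreover have "a \<in> full \<alpha> \<union> Def F (full \<alpha>)" if "a \<in> args F" for a
  proof -
    note D' = Def_good[OF good_full[of \<alpha>]]
    have "hit (full \<alpha>) w" if "w \<in> V" for w
      using assms(3) that by (auto simp: hit_def satC_def)
    moreover have "Prm b v \<in> Def F (full \<alpha>) \<longleftrightarrow> v \<in> V" for b v
      unfolding D' using assms(1) by auto
    moreover have "Dcl w \<in> Def F (full \<alpha>) \<longleftrightarrow> w \<in> V" for w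
      unfolding D' using D[of w] v0 by auto
    ultimately show ?thesis
      using that v0 by (cases a) (auto simp: D'(1,4-6))
  qed
  ultimately show ?thesis
    unfolding stable_iff[OF wf_F \<open>full \<alpha> \<subseteq> args F\<close>] by blast
qed

text \<open>Stability leaves no literal undecided. Hence a literal of \<open>v0\<close> attacks
  every \<open>Dcl\<close>, and the arguments \<open>Ccl\<close> must be attacked by
  literals.\<close>

lemma stable_sat:
  assumes E: "stable_ext F E" and D: "\<And>w b. occD w b v0"
  shows "satC (\<lambda>v. Lit True v \<in> E)" "v \<in> V \<Longrightarrow> Lit False v \<in> E \<longleftrightarrow> Lit True v \<notin> E"
proof -
  have sub: "E \<subseteq> args F"
    using E by (auto simp: stable_ext_def preferred_ext_def complete_ext_def simp del: args_F)
  have cf: "conflict_free F E" and cov: "args F \<subseteq> E \<union> Def F E"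
    using E stable_iff[OF wf_F sub] by auto
  note good = cf_good(1)[OF cf sub] and con = cf_good(2)[OF cf sub]
  have cov': "a \<in> E \<union> Def F E" if "idx a \<in> V" for a
    using cov that unfolding args_F[symmetric] by blast
  note D' = Def_good[OF good]
  have v: "Lit False v \<in> E \<longleftrightarrow> Lit True v \<notin> E" if "v \<in> V" for v
  proof -
    have "Lit True v \<in> E \<union> Def F E" using cov'[of "Lit True v"] that by simp
    then have "Lit True v \<in> E \<or> Lit False v \<in> E" by (simp add: D')
    then show ?thesis using con[of True v] by auto
  qed
  then show "v \<in> V \<Longrightarrow> Lit False v \<in> E \<longleftrightarrow> Lit True v \<notin> E" .
  have no: "Dcl d \<notin> E" for d
  proof
    assume d: "Dcl d \<in> E"
    then have "d \<in> V" using good by (auto simp: good_def)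
    moreover have "\<exists>b. Lit b v0 \<in> E" using v[OF v0] by blast
    ultimately have "Dcl d \<in> Def F E" using D D' by auto
    then show False using d cf by (auto simp: conflict_free_def)
  qed
  show "satC (\<lambda>v. Lit True v \<in> E)"
    unfolding satC_def
  proof
    fix w
    assume "w \<in> V"
    then have "Ccl w \<in> E \<union> Def F E" using cov'[of "Ccl w"] by simp
    then have "hit E w" using good by (auto simp: D' good_def)
    then obtain b u where u: "occC w b u" "Lit b u \<in> E" using no by (auto simp: hit_def)
    then have "u \<in> V" using good by (auto simp: good_def)
    moreover have "b = (Lit True u \<in> E)" using u v[OF \<open>u \<in> V\<close>] by (cases b) auto
    ultimately show "\<exists>v\<in>V. occC w (Lit True v \<in> E) v" using u by blast
  qed
qed

text \<open>In a stable extension, giving up the positive literal of \<open>v0\<close> means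
  accepting its negation, and then the clauses must be satisfied with \<open>v0\<close>
  false.\<close>

lemma ST_counterfactual:
  assumes fl and D: "\<And>w b. occD w b v0" and C: "\<And>w. occC w True v0"
  shows "legal_input ST F (Lit True v0) lab1 (Lit False v0)"
    and "(\<exists>L'\<in>counterfactuals ST F (Lit True v0) lab1. L' (Lit False v0) = In) \<longleftrightarrow>
      (\<exists>\<alpha>. \<not> \<alpha> v0 \<and> satC \<alpha>)"
proof -
  have "stable_ext F E1"
    by (rule full_stable[OF assms(1) D]) (use C v0 in \<open>auto simp: satC_def\<close>)
  then have "labelling_of F E1 \<in> labellings ST F" by (auto simp: labellings_def)
  then show "legal_input ST F (Lit True v0) lab1 (Lit False v0)"
    unfolding labelling_E1[OF D C] using wf_F v0 by (simp add: legal_input_def)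
  have lab: "labelling_of F E (Lit b v0) = In \<longleftrightarrow> Lit b v0 \<in> E" for E b
    by (simp add: labelling_of_def)
  have "(\<exists>L'\<in>counterfactuals ST F (Lit True v0) lab1. L' (Lit False v0) = In) \<longleftrightarrow>
      (\<exists>L'\<in>labellings ST F. lab1 (Lit True v0) \<noteq> L' (Lit True v0))"
  proof (rule ex_counterfactual)
    show "finite (args F)" using wf_F by (simp add: wf_af_def)
    fix L'
    assume "L' \<in> labellings ST F" and ne: "lab1 (Lit True v0) \<noteq> L' (Lit True v0)"
    then obtain E where E: "stable_ext F E" "L' = labelling_of F E" by (auto simp: labellings_def)
    have "Lit True v0 \<notin> E" using ne v0 lab[of E True] unfolding E(2) by auto
    then show "L' (Lit False v0) = In"
      using stable_sat(2)[OF E(1) D v0] lab[of E False] unfolding E(2) by simp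
  qed
  also have "\<dots> \<longleftrightarrow> (\<exists>E. stable_ext F E \<and> Lit True v0 \<notin> E)"
  proof -
    have "In \<noteq> labelling_of F E (Lit True v0) \<longleftrightarrow> Lit True v0 \<notin> E" for E
      using lab[of E True] by metis
    then show ?thesis using v0 by (simp add: labellings_def)
  qed
  also have "\<dots> \<longleftrightarrow> (\<exists>\<alpha>. \<not> \<alpha> v0 \<and> satC \<alpha>)"
  proof
    assume "\<exists>E. stable_ext F E \<and> Lit True v0 \<notin> E"
    then obtain E where E: "stable_ext F E" "Lit True v0 \<notin> E" by blast
    show "\<exists>\<alpha>. \<not> \<alpha> v0 \<and> satC \<alpha>"
      by (rule exI[of _ "\<lambda>v. Lit True v \<in> E"]) (use stable_sat(1)[OF E(1) D] E(2) in simp)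
  next
    assume "\<exists>\<alpha>. \<not> \<alpha> v0 \<and> satC \<alpha>"
    then obtain \<alpha> where "\<not> \<alpha> v0" "satC \<alpha>" by blast
    then show "\<exists>E. stable_ext F E \<and> Lit True v0 \<notin> E"
      using full_stable[OF assms(1) D] by (intro exI[of _ "full \<alpha>"]) auto
  qed
  finally show "(\<exists>L'\<in>counterfactuals ST F (Lit True v0) lab1. L' (Lit False v0) = In) \<longleftrightarrow>
      (\<exists>\<alpha>. \<not> \<alpha> v0 \<and> satC \<alpha>)" .
qed

subsection \<open>Preferred and semi-stable extensions\<close>

text \<open>The common use of maximality: an argument whose addition keeps the set admissible is
  already in it. It is applied to \<open>Phi\<close>, \<open>Dcl\<close> and undecided outer
  literals below.\<close>

lemma preferred_insert:
  assumes E: "preferred_ext F E" and "good (insert a E)" 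
    "\<And>b v. Lit b v \<in> insert a E \<Longrightarrow> Lit (\<not> b) v \<notin> insert a E" "\<And>c. c \<in> insert a E \<Longrightarrow> supported (insert a E) c"
  shows "a \<in> E"
proof -
  have "admissible F (insert a E)"
    unfolding adm_iff[OF assms(2)] using assms(3,4) by blast
  then have "insert a E = E" using E unfolding preferred_iff[OF wf_F] by blast
  then show ?thesis by blast
qed

lemma supported_mono:
  assumes "supported S c" "S \<subseteq> T"
  shows "supported T c"
proof -
  have "hit S w \<Longrightarrow> hit T w" for w using assms(2) unfolding hit_def by blast
  then show ?thesis using assms by (cases c) (auto simp: supported_def)
qed

lemma preferred_Phi:
  assumes E: "preferred_ext F E" and "z \<in> V" "\<And>w. w \<in> V \<Longrightarrow> hit E w"
  shows "Phi z \<in> E"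
proof (rule preferred_insert[OF E])
  have a: "admissible F E" using E unfolding preferred_iff[OF wf_F] by blast
  note good = admissible_good[OF a] and adm = a[unfolded adm_iff[OF admissible_good[OF a]]]
  show "good (insert (Phi z) E)" using good assms(2) by (auto simp: good_def)
  show "Lit (\<not> b) v \<notin> insert (Phi z) E" if "Lit b v \<in> insert (Phi z) E" for b v using adm that by auto
  show "supported (insert (Phi z) E) c" if "c \<in> insert (Phi z) E" for c
  proof (cases "c = Phi z")
    case True
    then show ?thesis using assms by (auto simp: supported_def hit_def)
  next
    case False
    then show ?thesis using adm that supported_mono[of E c "insert (Phi z) E"] by auto
  qed
qed

lemma preferred_Dcl:
  assumes E: "preferred_ext F E" and "w \<in> V" "\<And>b v. v \<in> V \<Longrightarrow> occD w b v \<Longrightarrow> Lit (\<not> b) v \<in> E"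
  shows "Dcl w \<in> E"
proof (rule preferred_insert[OF E])
  have a: "admissible F E" using E unfolding preferred_iff[OF wf_F] by blast
  note good = admissible_good[OF a] and adm = a[unfolded adm_iff[OF admissible_good[OF a]]]
  show "good (insert (Dcl w) E)" using good assms(2) by (auto simp: good_def)
  show "Lit (\<not> b) v \<notin> insert (Dcl w) E" if "Lit b v \<in> insert (Dcl w) E" for b v using adm that by auto
  show "supported (insert (Dcl w) E) c" if "c \<in> insert (Dcl w) E" for c
  proof (cases "c = Dcl w")
    case True
    then show ?thesis using assms by (auto simp: supported_def)
  next
    case False
    then show ?thesis using adm that supported_mono[of E c "insert (Dcl w) E"] by auto
  qed
qed

lemma preferred_Y:
  assumes E: "preferred_ext F E" and "v \<in> V" "isY v"
  shows "Lit True v \<in> E \<or> Lit False v \<in> E"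
proof (rule ccontr)
  assume no: "\<not> (Lit True v \<in> E \<or> Lit False v \<in> E)"
  have "Lit True v \<in> E"
  proof (rule preferred_insert[OF E])
    have a: "admissible F E" using E unfolding preferred_iff[OF wf_F] by blast
    note good = admissible_good[OF a] and adm = a[unfolded adm_iff[OF admissible_good[OF a]]]
    show "good (insert (Lit True v) E)" using good assms(2) by (auto simp: good_def)
    show "Lit (\<not> b) u \<notin> insert (Lit True v) E" if "Lit b u \<in> insert (Lit True v) E" for b u
      using adm that no by auto
    show "supported (insert (Lit True v) E) c" if "c \<in> insert (Lit True v) E" for c
    proof (cases "c = Lit True v")
      case True
      then show ?thesis using assms by (auto simp: supported_def)
    next
      case False
      then show ?thesis using adm that supported_mono[of E c "insert (Lit True v) E"] by auto
    qed
  qed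
  then show False using no by simp
qed

definition partial :: "('v \<Rightarrow> bool) \<Rightarrow> 'v arg set" where
  "partial \<alpha> = {Lit (\<alpha> v) v | v. v \<in> V \<and> isY v}"

lemma partial_simps [simp]: "Lit b v \<in> partial \<alpha> \<longleftrightarrow> v \<in> V \<and> isY v \<and> b = \<alpha> v" "Prm b v \<notin> partial \<alpha>"
  "Dcl v \<notin> partial \<alpha>" "Ccl v \<notin> partial \<alpha>" "Phi v \<notin> partial \<alpha>" "Bar v \<notin> partial \<alpha>"
  by (auto simp: partial_def)

lemma good_partial: "good (partial \<alpha>)"
  unfolding good_def partial_def by auto

text \<open>Nothing can be added: the satisfied clauses of \<open>occD\<close> exclude every
  \<open>Dcl\<close>, an accepted \<open>Phi\<close> would yield an assignment satisfying
  \<open>occC\<close> that extends \<alpha>, and inner literals need a \<open>Phi\<close>.\<close>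

lemma partial_preferred:
  assumes D: "satD \<alpha>" "\<And>w b v. occD w b v \<Longrightarrow> isY v"
    and C: "\<And>\<alpha>'. (\<And>v. v \<in> V \<Longrightarrow> isY v \<Longrightarrow> \<alpha>' v = \<alpha> v) \<Longrightarrow> \<not> satC \<alpha>'"
  shows "preferred_ext F (partial \<alpha>)"
  unfolding preferred_iff[OF wf_F]
proof (intro conjI allI impI)
  show "admissible F (partial \<alpha>)"
    unfolding adm_iff[OF good_partial]
  proof (intro conjI allI ballI impI)
    fix a
    assume "a \<in> partial \<alpha>"
    then show "supported (partial \<alpha>) a" by (cases a) (auto simp: supported_def)
  qed auto
  fix T
  assume T: "admissible F T" "partial \<alpha> \<subseteq> T"
  note good = admissible_good[OF T(1)]
  note adm = T(1)[unfolded adm_iff[OF good]]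
  have l: "Lit (\<alpha> v) v \<in> T" if "v \<in> V" "isY v" for v using T(2) that by auto
  have noD: "Dcl w \<notin> T" for w
  proof
    assume w: "Dcl w \<in> T"
    then have s: "supported T (Dcl w)" using adm by blast
    then have "w \<in> V" by (simp add: supported_def)
    then obtain v where v: "v \<in> V" "occD w (\<alpha> v) v" using D(1) by (auto simp: satD_def)
    then have "Lit (\<not> \<alpha> v) v \<in> T" using s by (simp add: supported_def)
    then show False using adm_lit(2)[OF T(1) l[OF v(1) D(2)[OF v(2)]], of "\<not> \<alpha> v"] by simp
  qed
  have noP: "Phi z \<notin> T" for z
  proof
    assume z: "Phi z \<in> T"
    define \<alpha>' where "\<alpha>' v = (Lit True v \<in> T)" for v
    have "Lit (\<not> \<alpha>' v) v \<notin> T" for v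
      using adm_lit(1)[OF T(1), of v] by (cases "Lit True v \<in> T") (auto simp: \<alpha>'_def)
    then have "satC \<alpha>'" by (intro admissible_Phi[OF T(1) z noD])
    moreover have "\<alpha>' v = \<alpha> v" if "v \<in> V" "isY v" for v
      using l[OF that] adm_lit(1)[OF T(1), of v] unfolding \<alpha>'_def by (cases "\<alpha> v") auto
    ultimately show False using C by blast
  qed
  have "a \<in> partial \<alpha>" if a: "a \<in> T" for a
  proof (cases a)
    case (Lit b v)
    then have "supported T (Lit b v)" using adm a by blast
    then have v: "v \<in> V" "isY v" using noP by (auto simp: supported_def)
    then show ?thesis using adm_lit(2)[OF T(1) l[OF v], of b] a Lit by simp
  qed (use good a noD noP in \<open>auto simp: good_def\<close>)
  then show "T = partial \<alpha>" using T(2) by blast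
qed

text \<open>By maximality the outer variables are decided. A violated clause of \<open>occD\<close>
  would bring in its \<open>Dcl\<close> and thereby \<open>Phi\<close>, and an extension of \<alpha>
  satisfying \<open>occC\<close> would give a larger admissible set with \<open>Phi\<close>.\<close>

lemma preferred_without_Phi:
  assumes E: "preferred_ext F E" "Phi v0 \<notin> E"
    and D: "\<And>w b v. occD w b v \<Longrightarrow> isY v" and C: "\<And>w. occC w True v0"
  shows "\<exists>\<alpha>. satD \<alpha> \<and> (\<forall>\<alpha>'. (\<forall>v\<in>V. isY v \<longrightarrow> \<alpha>' v = \<alpha> v) \<longrightarrow> \<not> satC \<alpha>')" "Lit True v0 \<notin> E"
proof -
  have a: "admissible F E" using E unfolding preferred_iff[OF wf_F] by blast
  note good = admissible_good[OF a] and adm = a[unfolded adm_iff[OF admissible_good[OF a]]]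
  have noP: "Phi z \<notin> E" for z
  proof
    assume "Phi z \<in> E"
    then have "hit E w" if "w \<in> V" for w using adm that by (auto simp: supported_def)
    then show False using preferred_Phi[OF E(1) v0] E(2) by blast
  qed
  have noD: "Dcl w \<notin> E" for w
    using preferred_Phi[OF E(1) v0] E(2) by (auto simp: hit_def)
  show "Lit True v0 \<notin> E"
    using preferred_Phi[OF E(1) v0] E(2) C by (auto simp: hit_def)
  define \<alpha> where "\<alpha> v = (Lit True v \<in> E)" for v
  have l: "Lit (\<alpha> v) v \<in> E" if "v \<in> V" "isY v" for v
    using preferred_Y[OF E(1) that] unfolding \<alpha>_def by (cases "Lit True v \<in> E") auto
  have "\<exists>v\<in>V. occD w (\<alpha> v) v" if w: "w \<in> V" for w
  proof (rule ccontr)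
    assume no: "\<not> (\<exists>v\<in>V. occD w (\<alpha> v) v)"
    have "Lit (\<not> b) v \<in> E" if "v \<in> V" "occD w b v" for b v
    proof -
      have "\<alpha> v = (\<not> b)" using no that by (cases "\<alpha> v"; cases b) auto
      then show ?thesis using l[OF that(1) D[OF that(2)]] by simp
    qed
    then show False using preferred_Dcl[OF E(1) w] noD by blast
  qed
  then have "satD \<alpha>" by (simp add: satD_def)
  moreover have "\<not> satC \<alpha>'" if \<alpha>': "\<forall>v\<in>V. isY v \<longrightarrow> \<alpha>' v = \<alpha> v" for \<alpha>'
  proof
    assume s: "satC \<alpha>'"
    have "a \<in> full \<alpha>'" if a: "a \<in> E" for a
    proof (cases a)
      case (Lit b v)
      then have "supported E (Lit b v)" using adm a by blast
      then have v: "v \<in> V" "isY v" using noP by (auto simp: supported_def)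
      then have "b = \<alpha> v" using adm_lit(2)[OF \<open>admissible F E\<close> l[OF v], of b] a Lit by simp
      then show ?thesis using v \<alpha>' Lit by simp
    qed (use good a noD noP in \<open>auto simp: good_def\<close>)
    then have "E \<subseteq> full \<alpha>'" by blast
    then have "full \<alpha>' = E"
      using E(1) full_admissible[OF s] unfolding preferred_iff[OF wf_F] by blast
    moreover have "Phi v0 \<in> full \<alpha>'" using v0 by simp
    ultimately show False using E(2) by simp
  qed
  ultimately show "\<exists>\<alpha>. satD \<alpha> \<and> (\<forall>\<alpha>'. (\<forall>v\<in>V. isY v \<longrightarrow> \<alpha>' v = \<alpha> v) \<longrightarrow> \<not> satC \<alpha>')" by blast
qed

text \<open>Without \<open>fl\<close>, \<open>Prm b v\<close> is in the range only if
  \<open>Lit b v\<close> is in the set; so the range remembers the literals.\<close>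

lemma range_Lit:
  assumes "\<not> fl" and T: "preferred_ext F T" and S: "good S" and sub: "S \<union> Def F S \<subseteq> T \<union> Def F T" and "Lit b v \<in> S"
  shows "Lit b v \<in> T"
proof -
  have "admissible F T" using T unfolding preferred_iff[OF wf_F] by blast
  then have gT: "good T" by (rule admissible_good)
  have "Prm b v \<in> Def F S" using assms(5) Def_good(2)[OF S] by blast
  then have "Prm b v \<in> Def F T" using sub gT by (auto simp: good_def)
  then show ?thesis using Def_good(2)[OF gT] assms(1) by blast
qed

text \<open>A preferred set of larger range contains the literals of \<open>S\<close>, and also its
  arguments \<open>Phi\<close>, which an admissible set never attacks; so it contains
  \<open>S\<close> and equals it by maximality.\<close>

lemma semi_stable_of_lits:
  assumes "\<not> fl" and S: "preferred_ext F S" and "\<And>a. a \<in> S \<Longrightarrow> (\<exists>b v. a = Lit b v) \<or> (\<exists>z. a = Phi z)"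
  shows "semi_stable_ext F S"
  unfolding semi_stable_ext_def
proof (intro conjI S notI)
  have aS: "admissible F S" using S unfolding preferred_iff[OF wf_F] by blast
  note gS = admissible_good[OF aS]
  assume "\<exists>T. preferred_ext F T \<and> S \<union> Def F S \<subset> T \<union> Def F T"
  then obtain T where T: "preferred_ext F T" "S \<union> Def F S \<subset> T \<union> Def F T" by blast
  have aT: "admissible F T" using T unfolding preferred_iff[OF wf_F] by blast
  note gT = admissible_good[OF aT]
  have "a \<in> T" if a: "a \<in> S" for a
    using assms(3)[OF a]
  proof (elim disjE exE)
    fix b v
    assume "a = Lit b v"
    then show ?thesis using range_Lit[OF assms(1) T(1) gS] T(2) a by blast
  next
    fix z
    assume z: "a = Phi z"
    then have "Phi z \<in> T \<union> Def F T" using T(2) a by blast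
    then show ?thesis using z Def_good(5)[OF gT] by blast
  qed
  then have "T = S" using S aT unfolding preferred_iff[OF wf_F] by blast
  then show False using T(2) by blast
qed

text \<open>An extension without \<open>Phi v0\<close> cannot contain the positive literal of
  \<open>v0\<close>, which attacks every \<open>Ccl\<close>. As \<open>v0\<close> is an outer
  variable, its negation is accepted instead; so changing \<open>g\<close> entails accepting
  \<open>g'\<close>.\<close>

lemma PR_counterfactual:
  assumes fl: "\<not> fl" and \<sigma>: "\<sigma> \<in> {PR, SST}" and Y: "isY v0"
    and D: "\<And>w. occD w True v0" "\<And>w b v. occD w b v \<Longrightarrow> isY v" and C: "\<And>w. occC w True v0"
  shows "legal_input \<sigma> F (Phi v0) lab1 (Lit False v0)"
    and "(\<exists>L'\<in>counterfactuals \<sigma> F (Phi v0) lab1. L' (Lit False v0) = In) \<longleftrightarrow>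
      (\<exists>\<alpha>. satD \<alpha> \<and> (\<forall>\<alpha>'. (\<forall>v\<in>V. isY v \<longrightarrow> \<alpha>' v = \<alpha> v) \<longrightarrow> \<not> satC \<alpha>'))"
proof -
  have sst: "extension \<sigma> F S" if S: "preferred_ext F S"
    "\<And>a. a \<in> S \<Longrightarrow> (\<exists>b v. a = Lit b v) \<or> (\<exists>z. a = Phi z)" for S
    using \<sigma> S(1) semi_stable_of_lits[OF fl S] by auto
  have pr: "preferred_ext F S" if "extension \<sigma> F S" for S
    using \<sigma> that by (auto simp: semi_stable_ext_def)
  have "extension \<sigma> F E1"
    by (rule sst[OF E1_preferred[OF D(1) C]]) (auto simp: full_def)
  then have "labelling_of F E1 \<in> labellings \<sigma> F" by (auto simp: labellings_def)
  then show "legal_input \<sigma> F (Phi v0) lab1 (Lit False v0)"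
    unfolding labelling_E1[OF D(1) C] using wf_F v0 by (simp add: legal_input_def)
  have lab: "labelling_of F E a = In \<longleftrightarrow> a \<in> E" for E a
    by (simp add: labelling_of_def)
  have "(\<exists>L'\<in>counterfactuals \<sigma> F (Phi v0) lab1. L' (Lit False v0) = In) \<longleftrightarrow>
      (\<exists>L'\<in>labellings \<sigma> F. lab1 (Phi v0) \<noteq> L' (Phi v0))"
  proof (rule ex_counterfactual)
    show "finite (args F)" using wf_F by (simp add: wf_af_def)
    fix L'
    assume "L' \<in> labellings \<sigma> F" and ne: "lab1 (Phi v0) \<noteq> L' (Phi v0)"
    then obtain E where E: "extension \<sigma> F E" "L' = labelling_of F E" by (auto simp: labellings_def)
    have P: "Phi v0 \<notin> E" using ne v0 lab[of E "Phi v0"] unfolding E(2) by auto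
    have "Lit True v0 \<notin> E"
      by (rule preferred_without_Phi(2)[OF pr[OF E(1)] P]) (fact D(2) C)+
    then have "Lit False v0 \<in> E" using preferred_Y[OF pr[OF E(1)] v0 Y] by blast
    then show "L' (Lit False v0) = In" using lab unfolding E(2) by blast
  qed
  also have "\<dots> \<longleftrightarrow> (\<exists>E. extension \<sigma> F E \<and> Phi v0 \<notin> E)"
  proof -
    have "In \<noteq> labelling_of F E (Phi v0) \<longleftrightarrow> Phi v0 \<notin> E" for E
      using lab[of E "Phi v0"] by metis
    then show ?thesis using v0 by (simp add: labellings_def)
  qed
  also have "\<dots> \<longleftrightarrow> (\<exists>\<alpha>. satD \<alpha> \<and> (\<forall>\<alpha>'. (\<forall>v\<in>V. isY v \<longrightarrow> \<alpha>' v = \<alpha> v) \<longrightarrow> \<not> satC \<alpha>'))"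
  proof
    assume "\<exists>E. extension \<sigma> F E \<and> Phi v0 \<notin> E"
    then obtain E where E: "extension \<sigma> F E" "Phi v0 \<notin> E" by blast
    show "\<exists>\<alpha>. satD \<alpha> \<and> (\<forall>\<alpha>'. (\<forall>v\<in>V. isY v \<longrightarrow> \<alpha>' v = \<alpha> v) \<longrightarrow> \<not> satC \<alpha>')"
      by (rule preferred_without_Phi(1)[OF pr[OF E(1)] E(2)]) (fact D(2) C)+
  next
    assume "\<exists>\<alpha>. satD \<alpha> \<and> (\<forall>\<alpha>'. (\<forall>v\<in>V. isY v \<longrightarrow> \<alpha>' v = \<alpha> v) \<longrightarrow> \<not> satC \<alpha>')"
    then obtain \<alpha> where \<alpha>: "satD \<alpha>" "\<forall>\<alpha>'. (\<forall>v\<in>V. isY v \<longrightarrow> \<alpha>' v = \<alpha> v) \<longrightarrow> \<not> satC \<alpha>'" by blast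
    have "preferred_ext F (partial \<alpha>)"
    proof (rule partial_preferred[OF \<alpha>(1)])
      show "isY v" if "occD w b v" for w b v using that by (rule D(2))
      show "\<not> satC \<alpha>'" if "\<And>v. v \<in> V \<Longrightarrow> isY v \<Longrightarrow> \<alpha>' v = \<alpha> v" for \<alpha>'
        using \<alpha>(2) that by blast
    qed
    then have "extension \<sigma> F (partial \<alpha>)"
      by (rule sst) (auto simp: partial_def)
    then show "\<exists>E. extension \<sigma> F E \<and> Phi v0 \<notin> E"
      by (intro exI[of _ "partial \<alpha>"]) simp
  qed
  finally show "(\<exists>L'\<in>counterfactuals \<sigma> F (Phi v0) lab1. L' (Lit False v0) = In) \<longleftrightarrow>
      (\<exists>\<alpha>. satD \<alpha> \<and> (\<forall>\<alpha>'. (\<forall>v\<in>V. isY v \<longrightarrow> \<alpha>' v = \<alpha> v) \<longrightarrow> \<not> satC \<alpha>'))" .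
qed

end

section \<open>Computation paths\<close>

type_synonym quad = "nat \<times> nat list \<times> nat \<times> (nat \<times> move) list \<times> nat"

text \<open>The blank and the bits are included because they occur on the initial tapes, whatever
  the table says.\<close>

definition symbols :: "otm \<Rightarrow> nat set" where
  "symbols M = {0, 1, 2} \<union> (\<Union>((q, rs), (q', acts))\<in>trans M. set rs \<union> fst ` set acts)"

definition bound :: "otm \<Rightarrow> nat" where
  "bound M = Suc (Max (symbols M))"

text \<open>Queries and idle steps are not taken from the table; their quadruples range over the
  vectors of symbols that can be read.\<close>

definition vectors :: "otm \<Rightarrow> nat list set" where
  "vectors M = {rs. set rs \<subseteq> {..<bound M} \<and> length rs = ntapes M}"

text \<open>The last component tells ordinary steps (0), queries answered by yes (1) and no (2),
  and idle steps in halted accepting configurations (3) apart.\<close>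

definition quads :: "otm \<Rightarrow> quad set" where
  "quads M = {(q, rs, q', acts, 0) | q rs q' acts. q \<noteq> query_st M \<and> ((q, rs), (q', acts)) \<in> trans M} \<union>
     (\<lambda>rs. (query_st M, rs, yes_st M, stay rs, 1)) ` vectors M \<union>
     (\<lambda>rs. (query_st M, rs, no_st M, stay rs, 2)) ` vectors M \<union>
     (\<lambda>rs. (accept_st M, rs, accept_st M, stay rs, 3)) `
       {rs \<in> vectors M. accept_st M \<noteq> query_st M \<and> (\<forall>x. ((accept_st M, rs), x) \<notin> trans M)}"

fun src :: "quad \<Rightarrow> nat" where "src (q, rs, q', acts, k) = q"
fun rd :: "quad \<Rightarrow> nat list" where "rd (q, rs, q', acts, k) = rs"
fun dst :: "quad \<Rightarrow> nat" where "dst (q, rs, q', acts, k) = q'"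
fun acts :: "quad \<Rightarrow> (nat \<times> move) list" where "acts (q, rs, q', as, k) = as"
fun kind :: "quad \<Rightarrow> nat" where "kind (q, rs, q', as, k) = k"

lemma finite_symbols: "wf_otm M \<Longrightarrow> finite (symbols M)"
  by (auto simp: symbols_def wf_otm_def)

lemma symbols_bound: "wf_otm M \<Longrightarrow> s \<in> symbols M \<Longrightarrow> s < bound M"
  using Max_ge[OF finite_symbols, of M s] by (simp add: bound_def)

lemma bound_ge: "wf_otm M \<Longrightarrow> 3 \<le> bound M"
  using symbols_bound[of M 2] by (simp add: symbols_def)

lemma finite_vectors: "finite (vectors M)"
  unfolding vectors_def by (rule finite_lists_length_eq) simp

lemma finite_quads:
  assumes "wf_otm M"
  shows "finite (quads M)"
proof -
  have "{(q, rs, q', as, 0 :: nat) | q rs q' as. q \<noteq> query_st M \<and> ((q, rs), (q', as)) \<in> trans M} \<subseteq>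
      (\<lambda>((q, rs), (q', as)). (q, rs, q', as, 0)) ` trans M"
    by force
  moreover have "finite (trans M)" using assms by (simp add: wf_otm_def)
  ultimately have "finite {(q, rs, q', as, 0 :: nat) | q rs q' as. q \<noteq> query_st M \<and> ((q, rs), (q', as)) \<in> trans M}"
    by (meson finite_imageI finite_subset)
  then show ?thesis unfolding quads_def using finite_vectors by simp
qed

lemma stay_simps [simp]: "length (stay rs) = length rs" "k < length rs \<Longrightarrow> stay rs ! k = (rs ! k, Stay)"
  by (simp_all add: stay_def)

lemma quads_wf:
  assumes M: "wf_otm M" and q: "q \<in> quads M"
  shows "length (rd q) = ntapes M" "length (acts q) = ntapes M" "k < ntapes M \<Longrightarrow> rd q ! k < bound M"
    "k < ntapes M \<Longrightarrow> fst (acts q ! k) < bound M"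
proof -
  have v: "length rs = ntapes M" "k < ntapes M \<Longrightarrow> rs ! k < bound M" if "rs \<in> vectors M" for rs k
    using that nth_mem[of k rs] by (auto simp: vectors_def subset_iff simp del: nth_mem)
  have t: "length rs = ntapes M" "length as = ntapes M" "k < ntapes M \<Longrightarrow> rs ! k < bound M"
    "k < ntapes M \<Longrightarrow> fst (as ! k) < bound M" if "((p, rs), (p', as)) \<in> trans M" for p rs p' as k
  proof -
    show l: "length rs = ntapes M" "length as = ntapes M"
      using M that by (auto simp: wf_otm_def)
    show "k < ntapes M \<Longrightarrow> rs ! k < bound M"
      using that l by (intro symbols_bound[OF M]) (force simp: symbols_def)
    show "k < ntapes M \<Longrightarrow> fst (as ! k) < bound M"
      using that l by (intro symbols_bound[OF M]) (force simp: symbols_def)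
  qed
  consider (ord) p rs p' as where "q = (p, rs, p', as, 0)" "((p, rs), (p', as)) \<in> trans M"
    | (vec) p rs p' c where "q = (p, rs, p', stay rs, c)" "rs \<in> vectors M"
    using q unfolding quads_def by blast
  then have "length (rd q) = ntapes M \<and> length (acts q) = ntapes M \<and>
      (k < ntapes M \<longrightarrow> rd q ! k < bound M) \<and> (k < ntapes M \<longrightarrow> fst (acts q ! k) < bound M)"
  proof cases
    case ord
    then show ?thesis using t(1,2)[OF ord(2)] t(3,4)[OF ord(2), of k] ord(1) by simp
  next
    case vec
    then show ?thesis using v(1)[OF vec(2)] v(2)[OF vec(2), of k] vec(1) by simp
  qed
  then show "length (rd q) = ntapes M" "length (acts q) = ntapes M" "k < ntapes M \<Longrightarrow> rd q ! k < bound M"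
    "k < ntapes M \<Longrightarrow> fst (acts q ! k) < bound M" by simp_all
qed

text \<open>\<open>\<tau> t\<close> is the quadruple applied at time \<open>t\<close>. The answers
  to queries are left open; up to their correctness, a path stands for an accepting computation of
  at most \<open>T\<close> steps, since it ends by idling.\<close>

definition path :: "otm \<Rightarrow> nat \<Rightarrow> (nat \<Rightarrow> quad) \<Rightarrow> (nat \<Rightarrow> tape list) \<Rightarrow> bool" where
  "path M T \<tau> c \<longleftrightarrow> (\<forall>t\<le>T. \<tau> t \<in> quads M \<and> map read (c t) = rd (\<tau> t)) \<and>
     (\<forall>t<T. dst (\<tau> t) = src (\<tau> (Suc t)) \<and> c (Suc t) = map2 act (c t) (acts (\<tau> t))) \<and>
     src (\<tau> 0) = start_st M \<and> kind (\<tau> T) = 3"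

definition asks_yes :: "lang \<Rightarrow> tape list \<Rightarrow> bool" where
  "asks_yes B tps \<longleftrightarrow> (\<exists>w\<in>B. holds_word (tps ! 1) w)"

definition init_tapes :: "otm \<Rightarrow> bool list \<Rightarrow> tape list" where
  "init_tapes M x = input_tape x # replicate (ntapes M - 1) blank_tape"

lemma run_configs:
  "run M B c t k c' \<Longrightarrow> \<exists>s. s 0 = c \<and> s t = c' \<and> (\<forall>i<t. step M B (s i) (s (Suc i)))"
proof (induction rule: run.induct)
  case run_refl
  then show ?case by (intro exI[of _ "\<lambda>_. c"]) simp
next
  case (run_step t k c' c'')
  then obtain s where s: "s 0 = c" "s t = c'" "\<forall>i<t. step M B (s i) (s (Suc i))" by blast
  then show ?case
    using run_step.hyps by (intro exI[of _ "s(Suc t := c'')"]) (auto simp: less_Suc_eq)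
qed

lemma configs_run:
  "(\<And>i. i < t \<Longrightarrow> step M B (s i) (s (Suc i))) \<Longrightarrow> \<exists>k. run M B (s 0) t k (s t)"
proof (induction t)
  case 0
  then show ?case using run_refl by blast
next
  case (Suc t)
  then obtain k where "run M B (s 0) t k (s t)" by force
  then show ?case using run_step[OF _ Suc.prems[of t]] by blast
qed

definition small :: "otm \<Rightarrow> tape list \<Rightarrow> bool" where
  "small M tps \<longleftrightarrow> length tps = ntapes M \<and> (\<forall>k<ntapes M. \<forall>p. fst (tps ! k) p < bound M)"

lemma small_init:
  assumes "wf_otm M"
  shows "small M (init_tapes M x)"
proof -
  have "fst (input_tape x) p < bound M" "fst blank_tape p < bound M" for p
    using bound_ge[OF assms] le_less_trans[OF bit_sym_simps(2), of "bound M"]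
    by (auto simp: input_tape_def blank_tape_def)
  moreover have "2 \<le> ntapes M" using assms by (simp add: wf_otm_def)
  ultimately show ?thesis
    by (auto simp: small_def init_tapes_def nth_Cons split: nat.split)
qed

lemma small_reads: "small M tps \<Longrightarrow> map read tps \<in> vectors M"
  by (auto simp: small_def vectors_def set_conv_nth) (metis prod.collapse read.simps)

lemma small_act:
  assumes "small M tps" "length as = ntapes M" "\<And>k. k < ntapes M \<Longrightarrow> fst (as ! k) < bound M"
  shows "small M (map2 act tps as)"
proof -
  have "fst (act tp a) p < bound M" if "\<And>p. fst tp p < bound M" "fst a < bound M" for tp a p
    using that by (cases tp; cases a) auto
  then show ?thesis
    using assms by (auto simp: small_def)
qed

lemma small_step:
  assumes M: "wf_otm M" and "step M B (q, tps) (q', tps')" "small M tps"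
  shows "small M tps'"
  using assms(2)
proof cases
  case (ordinary as)
  then have "((q, map read tps), (q', as)) \<in> trans M" "q \<noteq> query_st M" by auto
  then have "(q, map read tps, q', as, 0) \<in> quads M" by (auto simp: quads_def)
  from quads_wf(2,4)[OF M this] show ?thesis
    using ordinary small_act[OF assms(3)] by simp
qed (use assms(3) in simp)

lemma step_quad:
  assumes M: "wf_otm M" and st: "step M B (q, tps) (q', tps')" and "small M tps"
  shows "\<exists>\<tau>\<in>quads M. src \<tau> = q \<and> dst \<tau> = q' \<and> rd \<tau> = map read tps \<and> tps' = map2 act tps (acts \<tau>) \<and>
    (kind \<tau> = 1 \<longrightarrow> asks_yes B tps) \<and> (kind \<tau> = 2 \<longrightarrow> \<not> asks_yes B tps)"
  using st
proof cases
  case (ordinary as)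
  then show ?thesis
    by (intro bexI[of _ "(q, map read tps, q', as, 0)"]) (auto simp: quads_def)
next
  case ask
  note v = small_reads[OF assms(3)]
  show ?thesis
  proof (cases "asks_yes B tps")
    case True
    then show ?thesis
      using ask v by (intro bexI[of _ "(q, map read tps, q', stay (map read tps), 1)"])
        (auto simp: quads_def act_stay asks_yes_def)
  next
    case False
    then show ?thesis
      using ask v by (intro bexI[of _ "(q, map read tps, q', stay (map read tps), 2)"])
        (auto simp: quads_def act_stay asks_yes_def)
  qed
qed

lemma quad_step:
  assumes "\<tau> \<in> quads M" "rd \<tau> = map read tps" "kind \<tau> \<noteq> 3"
    "kind \<tau> = 1 \<Longrightarrow> asks_yes B tps" "kind \<tau> = 2 \<Longrightarrow> \<not> asks_yes B tps"
  shows "step M B (src \<tau>, tps) (dst \<tau>, map2 act tps (acts \<tau>))"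
proof -
  consider (ord) q rs q' as where "\<tau> = (q, rs, q', as, 0)" "q \<noteq> query_st M" "((q, rs), (q', as)) \<in> trans M"
    | (yes) rs where "\<tau> = (query_st M, rs, yes_st M, stay rs, 1)"
    | (no) rs where "\<tau> = (query_st M, rs, no_st M, stay rs, 2)"
    using assms(1,3) unfolding quads_def by auto
  then show ?thesis
  proof cases
    case ord
    then show ?thesis using assms(2) step.ordinary[of q M tps q' as B] by simp
  next
    case yes
    then show ?thesis
      using assms(2,4) step.ask[of M B tps] by (simp add: act_stay asks_yes_def)
  next
    case no
    then show ?thesis
      using assms(2,5) step.ask[of M B tps] by (simp add: act_stay asks_yes_def)
  qed
qed

lemma quad_final:
  assumes "\<tau> \<in> quads M" "rd \<tau> = map read tps" "kind \<tau> = 3"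
  shows "src \<tau> = accept_st M" "halted M B (src \<tau>, tps)"
proof -
  obtain rs where "\<tau> = (accept_st M, rs, accept_st M, stay rs, 3)" "accept_st M \<noteq> query_st M"
    "\<forall>x. ((accept_st M, rs), x) \<notin> trans M"
    using assms(1,3) unfolding quads_def by auto
  then show "src \<tau> = accept_st M" "halted M B (src \<tau>, tps)"
    using assms(2) by (auto simp: halted_def step_ordinary)
qed

lemma final_quad:
  assumes "halted M B (accept_st M, tps)" "small M tps"
  shows "(accept_st M, map read tps, accept_st M, stay (map read tps), 3) \<in> quads M"
proof -
  have "accept_st M \<noteq> query_st M"
    using assms(1) step.ask[of M B tps] unfolding halted_def by metis
  then show ?thesis
    using assms small_reads[OF assms(2)] by (auto simp: quads_def halted_def step_ordinary)
qed

text \<open>A run is stretched to the bound \<open>T\<close> by idle steps; conversely a path is cut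
  at its first idle step. Its quadruples carry the answers, which are compared with the oracle
  separately.\<close>

theorem language_path:
  assumes M: "wf_otm M" and T: "\<And>t k c. run M B (init M x) t k c \<Longrightarrow> t \<le> T"
  shows "x \<in> language M B \<longleftrightarrow> (\<exists>\<tau> c. path M T \<tau> c \<and> c 0 = init_tapes M x \<and>
    (\<forall>t\<le>T. (kind (\<tau> t) = 1 \<longrightarrow> asks_yes B (c t)) \<and> (kind (\<tau> t) = 2 \<longrightarrow> \<not> asks_yes B (c t))))"
proof
  assume "x \<in> language M B"
  then obtain t k c where r: "run M B (init M x) t k c" "halted M B c" "fst c = accept_st M"
    by (auto simp: language_def)
  have tT: "t \<le> T" by (rule T[OF r(1)])
  obtain s where s: "s 0 = init M x" "s t = c" "\<And>i. i < t \<Longrightarrow> step M B (s i) (s (Suc i))"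
    using run_configs[OF r(1)] by blast
  have s0: "s 0 = (start_st M, init_tapes M x)"
    unfolding s(1) by (simp add: init_def init_tapes_def)
  have sm: "i \<le> t \<Longrightarrow> small M (snd (s i))" for i
  proof (induction i)
    case 0
    then show ?case using small_init[OF M] s0 by simp
  next
    case (Suc i)
    then show ?case
      using small_step[OF M, of B "fst (s i)" "snd (s i)" "fst (s (Suc i))" "snd (s (Suc i))"] s(3)[of i] by simp
  qed
  \<comment> \<open>Beyond the end \<open>t\<close> of the run, \<open>min\<close> freezes the
    configuration and an idle quadruple is used.\<close>
  define P where "P i \<tau> \<longleftrightarrow> \<tau> \<in> quads M \<and> src \<tau> = fst (s (min i t)) \<and> dst \<tau> = fst (s (min (Suc i) t)) \<and>
    rd \<tau> = map read (snd (s (min i t))) \<and> snd (s (min (Suc i) t)) = map2 act (snd (s (min i t))) (acts \<tau>) \<and>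
    (kind \<tau> = 1 \<longrightarrow> asks_yes B (snd (s (min i t)))) \<and> (kind \<tau> = 2 \<longrightarrow> \<not> asks_yes B (snd (s (min i t)))) \<and>
    (t \<le> i \<longrightarrow> kind \<tau> = 3)" for i \<tau>
  have "\<exists>\<tau>. P i \<tau>" for i
  proof (cases "i < t")
    case True
    then have "step M B (fst (s i), snd (s i)) (fst (s (Suc i)), snd (s (Suc i)))" using s(3) by simp
    from step_quad[OF M this sm[OF less_imp_le[OF True]]] obtain \<tau> where "\<tau> \<in> quads M \<and> src \<tau> = fst (s i) \<and>
      dst \<tau> = fst (s (Suc i)) \<and> rd \<tau> = map read (snd (s i)) \<and> snd (s (Suc i)) = map2 act (snd (s i)) (acts \<tau>) \<and>
      (kind \<tau> = 1 \<longrightarrow> asks_yes B (snd (s i))) \<and> (kind \<tau> = 2 \<longrightarrow> \<not> asks_yes B (snd (s i)))" by blast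
    then have "P i \<tau>" unfolding P_def using True by simp
    then show ?thesis by blast
  next
    case False
    have "halted M B (accept_st M, snd c)" using r(2,3) by (metis prod.collapse)
    moreover have "small M (snd c)" using sm[of t] s(2) by simp
    ultimately have "P i (accept_st M, map read (snd c), accept_st M, stay (map read (snd c)), 3)"
      using False r(3) s(2) final_quad by (simp add: P_def act_stay)
    then show ?thesis by blast
  qed
  then obtain \<tau> where \<tau>: "\<And>i. P i (\<tau> i)" by metis
  have "path M T \<tau> (\<lambda>i. snd (s (min i t)))"
    unfolding path_def using \<tau> s0 tT by (auto simp: P_def)
  then show "\<exists>\<tau> c. path M T \<tau> c \<and> c 0 = init_tapes M x \<and>
    (\<forall>t\<le>T. (kind (\<tau> t) = 1 \<longrightarrow> asks_yes B (c t)) \<and> (kind (\<tau> t) = 2 \<longrightarrow> \<not> asks_yes B (c t)))"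
    using \<tau> s0 by (intro exI[of _ \<tau>] exI[of _ "\<lambda>i. snd (s (min i t))"]) (auto simp: P_def)
next
  assume "\<exists>\<tau> c. path M T \<tau> c \<and> c 0 = init_tapes M x \<and>
    (\<forall>t\<le>T. (kind (\<tau> t) = 1 \<longrightarrow> asks_yes B (c t)) \<and> (kind (\<tau> t) = 2 \<longrightarrow> \<not> asks_yes B (c t)))"
  then obtain \<tau> c where p: "path M T \<tau> c" "c 0 = init_tapes M x"
    "\<And>t. t \<le> T \<Longrightarrow> kind (\<tau> t) = 1 \<Longrightarrow> asks_yes B (c t)" "\<And>t. t \<le> T \<Longrightarrow> kind (\<tau> t) = 2 \<Longrightarrow> \<not> asks_yes B (c t)"
    by blast
  have q: "\<tau> t \<in> quads M" "rd (\<tau> t) = map read (c t)" if "t \<le> T" for t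
    using p(1) that by (simp_all add: path_def)
  \<comment> \<open>The first idle step marks the end of the actual computation.\<close>
  define t where "t = (LEAST t. kind (\<tau> t) = 3)"
  have k: "kind (\<tau> t) = 3" and tT: "t \<le> T"
    using p(1) unfolding t_def path_def by (auto intro: LeastI Least_le)
  have "step M B (src (\<tau> i), c i) (src (\<tau> (Suc i)), c (Suc i))" if "i < t" for i
  proof -
    have "kind (\<tau> i) \<noteq> 3" using not_less_Least[of i "\<lambda>t. kind (\<tau> t) = 3"] that by (simp add: t_def)
    moreover have i: "i \<le> T" "i < T" using that tT by auto
    ultimately have "step M B (src (\<tau> i), c i) (dst (\<tau> i), map2 act (c i) (acts (\<tau> i)))"
      using q[OF i(1)] p(3,4)[OF i(1)] by (intro quad_step) auto
    then show ?thesis using p(1) i by (simp add: path_def)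
  qed
  from configs_run[of t M B "\<lambda>i. (src (\<tau> i), c i)", OF this]
  obtain k' where "run M B (src (\<tau> 0), c 0) t k' (src (\<tau> t), c t)" by blast
  moreover have "(src (\<tau> 0), c 0) = init M x"
    using p(1,2) by (simp add: path_def init_def init_tapes_def)
  ultimately show "x \<in> language M B"
    using quad_final(1)[OF q[OF tT] k] quad_final(2)[OF q[OF tT] k, of B] by (force simp: language_def)
qed

subsection \<open>The word on a tape\<close>

text \<open>The first cell from 0 on that holds no bit; for query tapes it exists because they are
  blank at the cell numbered by the time bound.\<close>

definition word_end :: "(int \<Rightarrow> nat) \<Rightarrow> nat" where
  "word_end f = (LEAST j. f (int j) \<noteq> 1 \<and> f (int j) \<noteq> 2)"

definition word_of :: "(int \<Rightarrow> nat) \<Rightarrow> bool list" where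
  "word_of f = map (\<lambda>j. f (int j) = 2) [0..<word_end f]"

lemma word_end:
  assumes "f (int j) \<noteq> 1 \<and> f (int j) \<noteq> 2"
  shows "f (int (word_end f)) \<noteq> 1 \<and> f (int (word_end f)) \<noteq> 2" "word_end f \<le> j"
    "i < word_end f \<Longrightarrow> f (int i) = 1 \<or> f (int i) = 2"
  unfolding word_end_def using LeastI[of "\<lambda>j. f (int j) \<noteq> 1 \<and> f (int j) \<noteq> 2", OF assms]
    Least_le[of "\<lambda>j. f (int j) \<noteq> 1 \<and> f (int j) \<noteq> 2", OF assms]
    not_less_Least[of i "\<lambda>j. f (int j) \<noteq> 1 \<and> f (int j) \<noteq> 2"]
  by blast+

lemma holds_word_iff:
  assumes "f (int j) \<noteq> 1 \<and> f (int j) \<noteq> 2"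
  shows "holds_word (f, h) w \<longleftrightarrow> w = word_of f"
proof -
  have r: "range bit_sym = {1, 2}" by (simp add: UNIV_bool insert_commute)
  note e = word_end[of f j, OF assms]
  show ?thesis
  proof
    assume h: "holds_word (f, h) w"
    have b: "f (int i) = bit_sym (w ! i)" if "i < length w" for i
      using h that by (simp add: holds_word_def)
    have "\<not> length w < word_end f"
      using h e(3)[of "length w"] by (auto simp: holds_word_def r)
    moreover have "\<not> word_end f < length w"
    proof
      assume "word_end f < length w"
      then have "f (int (word_end f)) \<in> range bit_sym" using b by blast
      then show False using e(1) r by simp
    qed
    ultimately have l: "length w = word_end f" by simp
    show "w = word_of f"
      by (rule nth_equalityI) (use l b in \<open>simp_all add: word_of_def\<close>)
  next
    assume w: "w = word_of f"
    have "f (int i) = bit_sym (w ! i)" if "i < length w" for i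
      using e(3)[of i] that unfolding w word_of_def by auto
    then show "holds_word (f, h) w"
      using e(1) unfolding holds_word_def r by (auto simp: w word_of_def)
  qed
qed

lemma input_tape_word_of:
  assumes "f (int j) \<noteq> 1 \<and> f (int j) \<noteq> 2"
  shows "fst (input_tape (word_of f)) p = (if 0 \<le> p \<and> p < int (word_end f) then f p else 0)"
proof (cases "0 \<le> p \<and> p < int (word_end f)")
  case True
  then have "f p = 1 \<or> f p = 2" using word_end(3)[of f j "nat p", OF assms] by auto
  then show ?thesis using True by (auto simp: input_tape_def word_of_def)
qed (auto simp: input_tape_def word_of_def)

section \<open>Clause schemas\<close>

text \<open>Propositional variables are words of six digits. A schema stands for the clauses that it
  yields for all values below \<open>m\<close> of its four parameters for which its guard holds; literals with
  a digit that is too large are dropped.\<close>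

type_synonym lit = "bool \<times> (bool list \<Rightarrow> (nat \<Rightarrow> nat) \<Rightarrow> nat list)"
type_synonym schema = "(bool list \<Rightarrow> (nat \<Rightarrow> nat) \<Rightarrow> bool) \<times> lit list"

definition sat :: "nat \<Rightarrow> schema set \<Rightarrow> (nat list \<Rightarrow> bool) \<Rightarrow> bool list \<Rightarrow> bool" where
  "sat m S \<alpha> x \<longleftrightarrow> (\<forall>(G, ls)\<in>S. \<forall>vs. length vs = 4 \<and> set vs \<subseteq> {..<m} \<and> G x (env vs) \<longrightarrow>
    (\<exists>(b, f)\<in>set ls. set (f x (env vs)) \<subseteq> {..<m} \<and> \<alpha> (f x (env vs)) = b))"

lemma sat_Un: "sat m (S \<union> S') \<alpha> x \<longleftrightarrow> sat m S \<alpha> x \<and> sat m S' \<alpha> x"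
  unfolding sat_def by blast

lemma sat_UN: "sat m (\<Union>i\<in>I. S i) \<alpha> x \<longleftrightarrow> (\<forall>i\<in>I. sat m (S i) \<alpha> x)"
  unfolding sat_def by blast

lemma sat_at:
  assumes "sat m {(G, ls)} \<alpha> x" "a < m" "p < m" "q < m" "u < m" "G x (env [a, p, q, u])"
  shows "\<exists>(b, f)\<in>set ls. \<alpha> (f x (env [a, p, q, u])) = b"
proof -
  have "length [a, p, q, u] = 4 \<and> set [a, p, q, u] \<subseteq> {..<m} \<and> G x (env [a, p, q, u])"
    using assms(2-) by simp
  then have "\<exists>(b, f)\<in>set ls. set (f x (env [a, p, q, u])) \<subseteq> {..<m} \<and> \<alpha> (f x (env [a, p, q, u])) = b"
    using assms(1)[unfolded sat_def, THEN bspec, OF singletonI, unfolded prod.case, rule_format] by simp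
  then show ?thesis by auto
qed

lemma satI:
  assumes "\<And>e. (\<And>j. e j < m) \<Longrightarrow> G x e \<Longrightarrow> \<exists>(b, f)\<in>set ls. set (f x e) \<subseteq> {..<m} \<and> \<alpha> (f x e) = b" "0 < m"
  shows "sat m {(G, ls)} \<alpha> x"
proof -
  have "env vs j < m" if "set vs \<subseteq> {..<m}" for vs j
    using that assms(2) nth_mem[of j vs] by (auto simp: env_def subset_iff simp del: nth_mem)
  then show ?thesis unfolding sat_def using assms(1) by auto
qed

text \<open>Digit 0 is the class and digit 1 the copy; a tableau with base \<beta> uses the classes
  \<beta> to \<beta> + 5. Bases are 1, 11 and 21, and 31 serves an auxiliary chain; classes up to 20
  are the outer ones. Class 0 is avoided, as variable 0 is the distinguished one.\<close>

definition tr :: "nat \<Rightarrow> nat \<Rightarrow> nat \<Rightarrow> nat \<Rightarrow> nat list" where "tr \<beta> u t i = [\<beta>, u, t, i, 0, 0]"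
definition hp :: "nat \<Rightarrow> nat \<Rightarrow> nat \<Rightarrow> nat \<Rightarrow> nat \<Rightarrow> nat list" where "hp \<beta> u t k p = [\<beta> + 1, u, t, k, 0, p]"
definition cel :: "nat \<Rightarrow> nat \<Rightarrow> nat \<Rightarrow> nat \<Rightarrow> nat \<Rightarrow> nat \<Rightarrow> nat list" where "cel \<beta> u t k s p = [\<beta> + 2, u, t, k, s, p]"
definition iw :: "nat \<Rightarrow> nat \<Rightarrow> nat \<Rightarrow> nat list" where "iw \<beta> u p = [\<beta> + 3, u, 0, 0, 0, p]"
definition ew :: "nat \<Rightarrow> nat \<Rightarrow> nat \<Rightarrow> nat list" where "ew \<beta> u p = [\<beta> + 4, u, 0, 0, 0, p]"
definition sl :: "nat \<Rightarrow> nat \<Rightarrow> nat list" where "sl \<beta> u = [\<beta> + 5, u, 0, 0, 0, 0]"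

lemmas var_defs = tr_def hp_def cel_def iw_def ew_def sl_def

lemma nth_act_tape:
  assumes "k < length tps" "length as = length tps"
  shows "map2 act tps as ! k =
    ((fst (tps ! k))(snd (tps ! k) := fst (as ! k)), snd (tps ! k) + offset (snd (as ! k)))"
  using assms by (cases "tps ! k"; cases "as ! k") simp

lemma init_tapes_nth: "k < ntapes M \<Longrightarrow> init_tapes M w ! k = (if k = 0 then input_tape w else blank_tape)"
  by (auto simp: init_tapes_def nth_Cons split: nat.split)

section \<open>Computations as assignments\<close>

text \<open>Cell \<open>p\<close> of a tape is stored at position \<open>p + off\<close>. For each \<open>u\<close> up to \<open>U\<close> there is one
  copy of the tableau, which is in force if \<open>sl\<close> holds. The variable \<open>tr\<close> says which quadruple of
  \<open>os\<close> is applied at time \<open>t\<close>, \<open>hp\<close> where head \<open>k\<close> is, and \<open>cel\<close> which symbol \<open>s\<close> a cell of tape \<open>k\<close>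
  contains. The parameters of a schema are the time (0), two positions (1 and 2) and the copy (3).\<close>

locale tableau =
  fixes off m :: "bool list \<Rightarrow> nat"
begin

text \<open>Apart from excluding clashes, the clauses push truth from one time to the next: a model
  contains the computation that it chooses, and perhaps more. In the guard for moves, 1 is added on
  both sides to stay within the natural numbers.\<close>

definition tab :: "otm \<Rightarrow> quad list \<Rightarrow> nat \<Rightarrow> (bool list \<Rightarrow> nat) \<Rightarrow> (bool list \<Rightarrow> nat) \<Rightarrow> schema set" where
  "tab M os \<beta> U T =
    {(\<lambda>x e. e 3 \<le> U x \<and> e 0 \<le> T x,
      (False, \<lambda>x e. sl \<beta> (e 3)) # map (\<lambda>i. (True, \<lambda>x e. tr \<beta> (e 3) (e 0) i)) [0..<length os])} \<union>
    ((\<Union>i\<in>{..<length os}. \<Union>j\<in>{j. j < length os \<and> dst (os ! i) \<noteq> src (os ! j)}.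
      {(\<lambda>x e. e 3 \<le> U x \<and> e 0 < T x,
        [(False, \<lambda>x e. tr \<beta> (e 3) (e 0) i), (False, \<lambda>x e. tr \<beta> (e 3) (Suc (e 0)) j)])}) \<union>
    ((\<Union>i\<in>{i. i < length os \<and> src (os ! i) \<noteq> start_st M}.
      {(\<lambda>x e. e 3 \<le> U x, [(False, \<lambda>x e. tr \<beta> (e 3) 0 i)])}) \<union>
    ((\<Union>i\<in>{i. i < length os \<and> kind (os ! i) \<noteq> 3}.
      {(\<lambda>x e. e 3 \<le> U x, [(False, \<lambda>x e. tr \<beta> (e 3) (T x) i)])}) \<union>
    ((\<Union>i\<in>{..<length os}. \<Union>k\<in>{..<ntapes M}. \<Union>s\<in>{s. s < bound M \<and> rd (os ! i) ! k \<noteq> s}.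
      {(\<lambda>x e. e 3 \<le> U x \<and> e 0 \<le> T x, [(False, \<lambda>x e. tr \<beta> (e 3) (e 0) i),
        (False, \<lambda>x e. hp \<beta> (e 3) (e 0) k (e 1)), (False, \<lambda>x e. cel \<beta> (e 3) (e 0) k s (e 1))])}) \<union>
    ((\<Union>i\<in>{..<length os}. \<Union>k\<in>{..<ntapes M}.
      {(\<lambda>x e. e 3 \<le> U x \<and> e 0 < T x, [(False, \<lambda>x e. tr \<beta> (e 3) (e 0) i),
        (False, \<lambda>x e. hp \<beta> (e 3) (e 0) k (e 1)),
        (True, \<lambda>x e. cel \<beta> (e 3) (Suc (e 0)) k (fst (acts (os ! i) ! k)) (e 1))])}) \<union>
    ((\<Union>i\<in>{..<length os}. \<Union>k\<in>{..<ntapes M}.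
      {(\<lambda>x e. e 3 \<le> U x \<and> e 0 < T x \<and> e 2 + 1 = e 1 + nat (1 + offset (snd (acts (os ! i) ! k))),
        [(False, \<lambda>x e. tr \<beta> (e 3) (e 0) i), (False, \<lambda>x e. hp \<beta> (e 3) (e 0) k (e 1)),
        (True, \<lambda>x e. hp \<beta> (e 3) (Suc (e 0)) k (e 2))])}) \<union>
    ((\<Union>k\<in>{..<ntapes M}. \<Union>s\<in>{..<bound M}.
      {(\<lambda>x e. e 3 \<le> U x \<and> e 0 < T x \<and> e 1 \<noteq> e 2, [(False, \<lambda>x e. hp \<beta> (e 3) (e 0) k (e 2)),
        (False, \<lambda>x e. cel \<beta> (e 3) (e 0) k s (e 1)), (True, \<lambda>x e. cel \<beta> (e 3) (Suc (e 0)) k s (e 1))])}) \<union>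
    (\<Union>k\<in>{..<ntapes M}. {(\<lambda>x e. e 3 \<le> U x,
      [(False, \<lambda>x e. sl \<beta> (e 3)), (True, \<lambda>x e. hp \<beta> (e 3) 0 k (off x))])}))))))))"

lemma finite_tab: "finite (tab M os \<beta> U T)"
  unfolding tab_def by simp

lemma tab_sound:
  assumes M: "wf_otm M" and os: "set os \<subseteq> quads M"
    and S: "sat (m x) (tab M os \<beta> U T) \<alpha> x" and sel: "\<alpha> (sl \<beta> u)" and u: "u \<le> U x" "u < m x"
    and len: "T x < off x" "off x + T x < m x" "length os \<le> m x"
    and c0: "small M c0" "\<And>k. k < ntapes M \<Longrightarrow> snd (c0 ! k) = 0"
    and ce0: "\<And>k p. k < ntapes M \<Longrightarrow> p < m x \<Longrightarrow> \<alpha> (cel \<beta> u 0 k (fst (c0 ! k) (int p - int (off x))) p)"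
  shows "\<exists>\<tau> c. path M (T x) \<tau> c \<and> c 0 = c0 \<and>
    (\<forall>t\<le>T x. \<exists>i<length os. \<tau> t = os ! i \<and> \<alpha> (tr \<beta> u t i)) \<and>
    (\<forall>t k p. t \<le> T x \<and> k < ntapes M \<and> p < m x \<longrightarrow> \<alpha> (cel \<beta> u t k (fst (c t ! k) (int p - int (off x))) p))"
proof -
  note S' = S[unfolded tab_def sat_Un sat_UN, THEN conjunct2]
  note s1 = S[unfolded tab_def sat_Un sat_UN, THEN conjunct1]
  note s2 = S'[THEN conjunct1, rule_format]
  note S3 = S'[THEN conjunct2]
  note s3 = S3[THEN conjunct1, rule_format]
  note S4 = S3[THEN conjunct2]
  note s4 = S4[THEN conjunct1, rule_format]
  note S5 = S4[THEN conjunct2]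
  note s5 = S5[THEN conjunct1, rule_format]
  note S6 = S5[THEN conjunct2]
  note s6 = S6[THEN conjunct1, rule_format]
  note S7 = S6[THEN conjunct2]
  note s7 = S7[THEN conjunct1, rule_format]
  note S8 = S7[THEN conjunct2]
  note s8 = S8[THEN conjunct1, rule_format]
  note s9 = S8[THEN conjunct2, rule_format]
  have tm: "t \<le> T x \<Longrightarrow> t < m x" for t using len by simp
  have "\<exists>i<length os. \<alpha> (tr \<beta> u t i)" if "t \<le> T x" for t
    using sat_at[OF s1, of t 0 0 u] that tm[of t] u sel by (auto simp: env_def)
  then obtain ix where ix: "\<And>t. t \<le> T x \<Longrightarrow> ix t < length os \<and> \<alpha> (tr \<beta> u t (ix t))" by metis
  define \<tau> where "\<tau> t = os ! ix t" for t
  \<comment> \<open>The tapes are computed from the chosen quadruples; the clauses then make the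
    variables true that describe them.\<close>
  define c where "c = rec_nat c0 (\<lambda>t tps. map2 act tps (acts (\<tau> t)))"
  have c: "c 0 = c0" "c (Suc t) = map2 act (c t) (acts (\<tau> t))" for t by (simp_all add: c_def)
  have q: "\<tau> t \<in> quads M" if "t \<le> T x" for t
    using ix[OF that] os nth_mem[of "ix t" os] by (auto simp: \<tau>_def)
  note qw = quads_wf[OF M q]
  \<comment> \<open>A head moves by at most one cell per step, so positions shifted by
    \<open>off\<close> stay between 0 and \<open>m\<close>.\<close>
  have inv: "small M (c t) \<and> (\<forall>k<ntapes M. \<bar>snd (c t ! k)\<bar> \<le> int t \<and>
      \<alpha> (hp \<beta> u t k (nat (int (off x) + snd (c t ! k)))) \<and>
      (\<forall>p<m x. \<alpha> (cel \<beta> u t k (fst (c t ! k) (int p - int (off x))) p)))" if "t \<le> T x" for t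
    using that
  proof (induction t)
    case 0
    have "\<alpha> (hp \<beta> u 0 k (off x))" if "k < ntapes M" for k
      using sat_at[OF s9, of k 0 0 0 u] that tm[of 0] u sel by (auto simp: env_def)
    then show ?case using c0 ce0 by (simp add: c)
  next
    case (Suc t)
    then have t: "t \<le> T x" "t < T x" by auto
    have sm: "small M (c t)" and IH: "\<And>k. k < ntapes M \<Longrightarrow> \<bar>snd (c t ! k)\<bar> \<le> int t"
      "\<And>k. k < ntapes M \<Longrightarrow> \<alpha> (hp \<beta> u t k (nat (int (off x) + snd (c t ! k))))"
      "\<And>k p. k < ntapes M \<Longrightarrow> p < m x \<Longrightarrow> \<alpha> (cel \<beta> u t k (fst (c t ! k) (int p - int (off x))) p)"
      using Suc.IH[OF t(1)] by auto
    have n: "c (Suc t) ! k = ((fst (c t ! k))(snd (c t ! k) := fst (acts (\<tau> t) ! k)),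
        snd (c t ! k) + offset (snd (acts (\<tau> t) ! k)))" if "k < ntapes M" for k
      unfolding c(2) using sm that qw(2)[OF t(1)] by (intro nth_act_tape) (simp_all add: small_def)
    have "\<bar>snd (c (Suc t) ! k)\<bar> \<le> int (Suc t) \<and>
        \<alpha> (hp \<beta> u (Suc t) k (nat (int (off x) + snd (c (Suc t) ! k)))) \<and>
        (\<forall>p<m x. \<alpha> (cel \<beta> u (Suc t) k (fst (c (Suc t) ! k) (int p - int (off x))) p))" if k: "k < ntapes M" for k
    proof (intro conjI allI impI)
      let ?h = "snd (c t ! k)" and ?o = "offset (snd (acts (\<tau> t) ! k))"
      let ?p = "nat (int (off x) + ?h)"
      have o: "\<bar>?o\<bar> \<le> 1" by (cases "snd (acts (\<tau> t) ! k)") auto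
      have h: "\<bar>?h\<bar> \<le> int t" by (rule IH(1)[OF k])
      show "\<bar>snd (c (Suc t) ! k)\<bar> \<le> int (Suc t)" using n[OF k] o h by simp
      have p: "?p < m x" "int ?p = int (off x) + ?h" using h t len by auto
      let ?p' = "nat (int (off x) + (?h + ?o))"
      have p': "?p' < m x" "?p' + 1 = ?p + nat (1 + ?o)" using h o t len by auto
      from sat_at[OF s7, of "ix t" k t ?p ?p' u]
      have "\<alpha> (hp \<beta> u (Suc t) k ?p')"
        using ix[OF t(1)] k IH(2)[OF k] t tm[of t] p p' u by (auto simp: env_def \<tau>_def)
      then show "\<alpha> (hp \<beta> u (Suc t) k (nat (int (off x) + snd (c (Suc t) ! k))))"
        using n[OF k] by simp
      fix r
      assume r: "r < m x"
      show "\<alpha> (cel \<beta> u (Suc t) k (fst (c (Suc t) ! k) (int r - int (off x))) r)"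
      proof (cases "r = ?p")
        case True
        from sat_at[OF s6, of "ix t" k t ?p 0 u]
        have "\<alpha> (cel \<beta> u (Suc t) k (fst (acts (\<tau> t) ! k)) ?p)"
          using ix[OF t(1)] k IH(2)[OF k] t tm[of t] p u by (auto simp: env_def \<tau>_def)
        then show ?thesis using n[OF k] True p(2) by simp
      next
        case False
        have "fst (c t ! k) (int r - int (off x)) < bound M"
          using sm k by (simp add: small_def)
        with sat_at[OF s8, of k "fst (c t ! k) (int r - int (off x))" t r ?p u]
        have "\<alpha> (cel \<beta> u (Suc t) k (fst (c t ! k) (int r - int (off x))) r)"
          using k IH(2)[OF k] IH(3)[OF k r] t tm[of t] p r False u by (auto simp: env_def)
        moreover have "int r - int (off x) \<noteq> ?h" using False p(2) by auto
        ultimately show ?thesis using n[OF k] by simp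
      qed
    qed
    moreover have "small M (c (Suc t))"
      unfolding c(2) by (rule small_act[OF sm qw(2)[OF t(1)] qw(4)[OF t(1)]])
    ultimately show ?case by blast
  qed
  have rd: "map read (c t) = rd (\<tau> t)" if t: "t \<le> T x" for t
  proof (rule nth_equalityI)
    show "length (map read (c t)) = length (rd (\<tau> t))"
      using inv[OF t] qw(1)[OF t] by (simp add: small_def)
    fix k
    assume "k < length (map read (c t))"
    then have k: "k < ntapes M" "k < length (c t)" using inv[OF t] by (simp_all add: small_def)
    let ?h = "snd (c t ! k)"
    let ?p = "nat (int (off x) + ?h)"
    have h: "\<bar>?h\<bar> \<le> int t" using inv[OF t] k by blast
    then have p: "?p < m x" "int ?p = int (off x) + ?h" using t len by auto
    have s: "fst (c t ! k) ?h < bound M" using inv[OF t] k by (simp add: small_def)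
    have a: "\<alpha> (hp \<beta> u t k ?p)" "\<alpha> (cel \<beta> u t k (fst (c t ! k) ?h) ?p)"
      using inv[OF t] k p by fastforce+
    have "rd (\<tau> t) ! k = fst (c t ! k) ?h"
    proof (rule ccontr)
      assume "rd (\<tau> t) ! k \<noteq> fst (c t ! k) ?h"
      with sat_at[OF s5, of "ix t" k "fst (c t ! k) ?h" t ?p 0 u] show False
        using a ix[OF t] k s t tm[of t] p u by (auto simp: env_def \<tau>_def)
    qed
    then show "map read (c t) ! k = rd (\<tau> t) ! k"
      using k(2) by (cases "c t ! k") simp
  qed
  have "path M (T x) \<tau> c"
    unfolding path_def
  proof (intro conjI allI impI)
    fix t
    assume t: "t \<le> T x"
    show "\<tau> t \<in> quads M" "map read (c t) = rd (\<tau> t)" by (rule q[OF t], rule rd[OF t])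
  next
    fix t
    assume t: "t < T x"
    show "c (Suc t) = map2 act (c t) (acts (\<tau> t))" by (rule c)
    show "dst (\<tau> t) = src (\<tau> (Suc t))"
    proof (rule ccontr)
      assume "dst (\<tau> t) \<noteq> src (\<tau> (Suc t))"
      with sat_at[OF s2, of "ix t" "ix (Suc t)" t 0 0 u] show False
        using ix[of t] ix[of "Suc t"] t tm[of t] u by (auto simp: env_def \<tau>_def)
    qed
  next
    show "src (\<tau> 0) = start_st M"
      using sat_at[OF s3, of "ix 0" 0 0 0 u] ix[of 0] tm[of 0] u by (auto simp: env_def \<tau>_def)
    show "kind (\<tau> (T x)) = 3"
      using sat_at[OF s4, of "ix (T x)" 0 0 0 u] ix[of "T x"] tm[of 0] u by (auto simp: env_def \<tau>_def)
  qed
  moreover have "\<forall>t\<le>T x. \<exists>i<length os. \<tau> t = os ! i \<and> \<alpha> (tr \<beta> u t i)"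
    unfolding \<tau>_def using ix by blast
  moreover have "\<forall>t k p. t \<le> T x \<and> k < ntapes M \<and> p < m x \<longrightarrow>
      \<alpha> (cel \<beta> u t k (fst (c t ! k) (int p - int (off x))) p)"
    using inv by blast
  ultimately show ?thesis using c(1) by blast
qed

text \<open>The intended assignment. All clauses of \<open>tab\<close> and \<open>winit\<close>
  contain a negative literal of their copy, so a copy that is not selected is made false
  throughout.\<close>

definition asgn :: "nat \<Rightarrow> quad list \<Rightarrow> nat \<Rightarrow> (nat \<Rightarrow> bool) \<Rightarrow> (nat \<Rightarrow> nat \<Rightarrow> quad) \<Rightarrow>
    (nat \<Rightarrow> nat \<Rightarrow> tape list) \<Rightarrow> (nat \<Rightarrow> int \<Rightarrow> nat) \<Rightarrow> nat list \<Rightarrow> bool" where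
  "asgn d os \<beta> sel \<tau> c f v \<longleftrightarrow> (let u = v ! 1; p = int (v ! 5) - int d in sel u \<and>
    (if v ! 0 = \<beta> then v ! 3 < length os \<and> os ! (v ! 3) = \<tau> u (v ! 2)
     else if v ! 0 = \<beta> + 1 then p = snd (c u (v ! 2) ! (v ! 3))
     else if v ! 0 = \<beta> + 2 then v ! 4 = fst (c u (v ! 2) ! (v ! 3)) p
     else if v ! 0 = \<beta> + 3 then 0 \<le> p \<and> p \<le> int (word_end (f u))
     else if v ! 0 = \<beta> + 4 then int (word_end (f u)) \<le> p
     else True))"

lemma asgn_vars:
  assumes "\<And>v. \<beta> \<le> v ! 0 \<Longrightarrow> v ! 0 \<le> \<beta> + 5 \<Longrightarrow> \<alpha> v = asgn d os \<beta> sel \<tau> c f v"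
  shows "\<alpha> (tr \<beta> u t i) \<longleftrightarrow> sel u \<and> i < length os \<and> os ! i = \<tau> u t"
    "\<alpha> (hp \<beta> u t k p) \<longleftrightarrow> sel u \<and> int p - int d = snd (c u t ! k)"
    "\<alpha> (cel \<beta> u t k s p) \<longleftrightarrow> sel u \<and> s = fst (c u t ! k) (int p - int d)"
    "\<alpha> (iw \<beta> u p) \<longleftrightarrow> sel u \<and> d \<le> p \<and> int p - int d \<le> int (word_end (f u))"
    "\<alpha> (ew \<beta> u p) \<longleftrightarrow> sel u \<and> int (word_end (f u)) \<le> int p - int d"
    "\<alpha> (sl \<beta> u) \<longleftrightarrow> sel u"
  by (subst assms; auto simp: var_defs asgn_def Let_def)+

lemma range_vars:
  "set (tr \<beta> u t i) \<subseteq> {..<n} \<longleftrightarrow> 0 < n \<and> \<beta> < n \<and> u < n \<and> t < n \<and> i < n"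
  "set (hp \<beta> u t k p) \<subseteq> {..<n} \<longleftrightarrow> 0 < n \<and> \<beta> + 1 < n \<and> u < n \<and> t < n \<and> k < n \<and> p < n"
  "set (cel \<beta> u t k s p) \<subseteq> {..<n} \<longleftrightarrow> \<beta> + 2 < n \<and> u < n \<and> t < n \<and> k < n \<and> s < n \<and> p < n"
  "set (iw \<beta> u p) \<subseteq> {..<n} \<longleftrightarrow> 0 < n \<and> \<beta> + 3 < n \<and> u < n \<and> p < n"
  "set (ew \<beta> u p) \<subseteq> {..<n} \<longleftrightarrow> 0 < n \<and> \<beta> + 4 < n \<and> u < n \<and> p < n"
  "set (sl \<beta> u) \<subseteq> {..<n} \<longleftrightarrow> 0 < n \<and> \<beta> + 5 < n \<and> u < n"
  by (auto simp: var_defs)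

lemma tab_complete:
  assumes M: "wf_otm M" and os: "set os \<subseteq> quads M"
    and \<alpha>: "\<And>v. \<beta> \<le> v ! 0 \<Longrightarrow> v ! 0 \<le> \<beta> + 5 \<Longrightarrow> \<alpha> v = asgn (off x) os \<beta> sel \<tau> c f v"
    and P: "\<And>u. u \<le> U x \<Longrightarrow> sel u \<Longrightarrow> path M (T x) (\<tau> u) (c u)"
      "\<And>u t. u \<le> U x \<Longrightarrow> sel u \<Longrightarrow> t \<le> T x \<Longrightarrow> \<tau> u t \<in> set os"
      "\<And>u k. u \<le> U x \<Longrightarrow> sel u \<Longrightarrow> k < ntapes M \<Longrightarrow> snd (c u 0 ! k) = 0"
    and m: "off x < m x" "T x < m x" "\<beta> + 5 < m x" "length os \<le> m x" "ntapes M \<le> m x" "bound M \<le> m x"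
  shows "sat (m x) (tab M os \<beta> U T) \<alpha> x"
proof -
  note a = asgn_vars[of \<beta> \<alpha> "off x" os sel \<tau> c f, OF \<alpha>]
  have q: "os ! i \<in> quads M" if "i < length os" for i using os that by auto
  note qw = quads_wf[OF M q]
  have PR: "map read (c u t) = rd (\<tau> u t)" if "u \<le> U x" "sel u" "t \<le> T x" for u t
    using P(1)[OF that(1,2)] that(3) by (simp add: path_def)
  have L: "length (c u t) = ntapes M" if "u \<le> U x" "sel u" "t \<le> T x" for u t
  proof -
    have "\<tau> u t \<in> quads M" using P(2)[OF that] os by blast
    then show ?thesis using arg_cong[OF PR[OF that], of length] quads_wf(1)[OF M, of "\<tau> u t"] by simp
  qed
  have R: "rd (\<tau> u t) ! k = fst (c u t ! k) (snd (c u t ! k))" if "u \<le> U x" "sel u" "t \<le> T x" "k < ntapes M" for u t k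
    unfolding PR[OF that(1-3), symmetric] using L[OF that(1-3)] that(4) by (cases "c u t ! k") simp
  have N: "c u (Suc t) ! k = ((fst (c u t ! k))(snd (c u t ! k) := fst (acts (\<tau> u t) ! k)),
      snd (c u t ! k) + offset (snd (acts (\<tau> u t) ! k)))"
    if "u \<le> U x" "sel u" "t < T x" "k < ntapes M" for u t k
  proof -
    have "\<tau> u t \<in> quads M" using P(2)[OF that(1,2)] that(3) os by auto
    then have "length (acts (\<tau> u t)) = length (c u t)"
      using quads_wf(2)[OF M] L[OF that(1,2), of t] that(3) by simp
    moreover have "c u (Suc t) = map2 act (c u t) (acts (\<tau> u t))"
      using P(1)[OF that(1,2)] that(3) by (simp add: path_def)
    ultimately show ?thesis
      using L[OF that(1,2), of t] that(3,4) by (metis less_imp_le nth_act_tape)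
  qed
  have m0: "0 < m x" using m(1) by simp
  show ?thesis
    unfolding tab_def sat_Un sat_UN
  proof (intro conjI ballI satI[OF _ m0], goal_cases)
    case (1 e)
    show ?case
    proof (cases "sel (e 3)")
      case True
      then obtain i where i: "i < length os" "os ! i = \<tau> (e 3) (e 0)"
        using P(2)[of "e 3" "e 0"] 1(2) by (auto simp: in_set_conv_nth)
      have "e 0 < m x" "e 3 < m x" by (rule 1(1))+
      then show ?thesis using True i m 1(2) m0 by (force simp: a range_vars)
    qed (use m 1 m0 in \<open>simp add: a range_vars\<close>)
  next
    case (2 i j e)
    then have "dst (\<tau> u (e 0)) = src (\<tau> u (Suc (e 0)))" if "u \<le> U x" "sel u" for u
      using P(1)[OF that] by (simp add: path_def)
    moreover have "e 0 < m x" "e 3 < m x" by (rule 2(3))+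
    ultimately show ?case using 2 m m0 by (auto simp: a range_vars)
  next
    case (3 i e)
    then have "src (\<tau> u 0) = start_st M" if "u \<le> U x" "sel u" for u
      using P(1)[OF that] by (simp add: path_def)
    moreover have "e 3 < m x" by (rule 3(2))
    ultimately show ?case using 3 m m0 by (auto simp: a range_vars)
  next
    case (4 i e)
    then have "kind (\<tau> u (T x)) = 3" if "u \<le> U x" "sel u" for u
      using P(1)[OF that] by (simp add: path_def)
    moreover have "e 3 < m x" by (rule 4(2))
    ultimately show ?case using 4 m m0 by (auto simp: a range_vars)
  next
    case (5 i k s e)
    moreover have "e 0 < m x" "e 1 < m x" "e 3 < m x" by (rule 5(4))+
    ultimately show ?case using R[of "e 3" "e 0" k] m m0 by (auto simp: a range_vars)
  next
    case (6 i k e)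
    have "fst (acts (os ! i) ! k) < m x" using 6(1,2) qw(4)[of i k] m by simp
    moreover have "e 0 < m x" "e 1 < m x" "e 3 < m x" by (rule 6(3))+
    ultimately show ?case using 6 N[of "e 3" "e 0" k] m m0 by (auto simp: a range_vars)
  next
    case (7 i k e)
    have "\<bar>offset (snd (acts (os ! i) ! k))\<bar> \<le> 1" by (cases "snd (acts (os ! i) ! k)") auto
    moreover have "e 0 < m x" "e 1 < m x" "e 2 < m x" "e 3 < m x" by (rule 7(3))+
    ultimately show ?case using 7 N[of "e 3" "e 0" k] m m0 by (auto simp: a range_vars)
  next
    case (8 k s e)
    have "e 0 < m x" "e 1 < m x" "e 2 < m x" "e 3 < m x" by (rule 8(3))+
    then show ?case using 8 N[of "e 3" "e 0" k] m m0 by (auto simp: a range_vars)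
  next
    case (9 k e)
    have "e 3 < m x" by (rule 9(2))
    then show ?case using 9 P(3)[of "e 3" k] m m0 by (auto simp: a range_vars)
  qed
qed

text \<open>The initial tape 0, shifted by \<open>off\<close> and expressed by \<open>bit\<close>,
  hence definable as a guard.\<close>

definition input_sym :: "bool list \<Rightarrow> nat \<Rightarrow> nat" where
  "input_sym x p = (if p < off x then 0 else if bit x (p - off x) then 2
    else if p - off x < length x then 1 else 0)"

definition minit :: "otm \<Rightarrow> schema set" where
  "minit M = (\<Union>k\<in>{1..<ntapes M}. {(\<lambda>x e. True, [(True, \<lambda>x e. cel 1 0 0 k 0 (e 1))])}) \<union>
    ((\<Union>s\<in>{..<3}. {(\<lambda>x e. input_sym x (e 1) = s, [(True, \<lambda>x e. cel 1 0 0 0 s (e 1))])}) \<union>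
    {(\<lambda>x e. True, [(True, \<lambda>x e. sl 1 0)])})"

text \<open>The machine started by \<open>winit\<close> gets the word on tape 1 of the main computation at time \<open>u\<close>:
  \<open>iw\<close> marks the cells up to its end, \<open>ew\<close> those from its end on.\<close>

definition winit :: "nat \<Rightarrow> nat \<Rightarrow> nat \<Rightarrow> (bool list \<Rightarrow> nat) \<Rightarrow> schema set" where
  "winit K b \<beta> U =
    (\<Union>k\<in>{1..<K}. {(\<lambda>x e. e 3 \<le> U x, [(False, \<lambda>x e. sl \<beta> (e 3)), (True, \<lambda>x e. cel \<beta> (e 3) 0 k 0 (e 1))])}) \<union>
    ({(\<lambda>x e. e 3 \<le> U x \<and> e 1 < off x,
      [(False, \<lambda>x e. sl \<beta> (e 3)), (True, \<lambda>x e. cel \<beta> (e 3) 0 0 0 (e 1))])} \<union>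
    ({(\<lambda>x e. e 3 \<le> U x, [(False, \<lambda>x e. sl \<beta> (e 3)), (True, \<lambda>x e. iw \<beta> (e 3) (off x))])} \<union>
    ((\<Union>s\<in>{1, 2}. {(\<lambda>x e. e 3 \<le> U x, [(False, \<lambda>x e. iw \<beta> (e 3) (e 1)),
      (False, \<lambda>x e. cel 1 0 (e 3) 1 s (e 1)), (True, \<lambda>x e. cel \<beta> (e 3) 0 0 s (e 1))])}) \<union>
    ((\<Union>s\<in>{1, 2}. {(\<lambda>x e. e 3 \<le> U x \<and> e 2 = Suc (e 1), [(False, \<lambda>x e. iw \<beta> (e 3) (e 1)),
      (False, \<lambda>x e. cel 1 0 (e 3) 1 s (e 1)), (True, \<lambda>x e. iw \<beta> (e 3) (e 2))])}) \<union>
    ((\<Union>s\<in>{s. s < b \<and> s \<noteq> 1 \<and> s \<noteq> 2}. {(\<lambda>x e. e 3 \<le> U x, [(False, \<lambda>x e. iw \<beta> (e 3) (e 1)),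
      (False, \<lambda>x e. cel 1 0 (e 3) 1 s (e 1)), (True, \<lambda>x e. ew \<beta> (e 3) (e 1))])}) \<union>
    ({(\<lambda>x e. e 3 \<le> U x \<and> e 2 = Suc (e 1),
      [(False, \<lambda>x e. ew \<beta> (e 3) (e 1)), (True, \<lambda>x e. ew \<beta> (e 3) (e 2))])} \<union>
    {(\<lambda>x e. e 3 \<le> U x, [(False, \<lambda>x e. ew \<beta> (e 3) (e 1)), (True, \<lambda>x e. cel \<beta> (e 3) 0 0 0 (e 1))])}))))))"

lemma finite_init: "finite (minit M)" "finite (winit K b \<beta> U)"
  unfolding minit_def winit_def by simp_all

lemma input_sym: "fst (input_tape x) (int p - int (off x)) = input_sym x p"
proof (cases "off x \<le> p")
  case True
  then have "int p - int (off x) = int (p - off x)" by simp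
  then show ?thesis using True by (auto simp: input_tape_def input_sym_def bit_def nat_diff_distrib')
qed (simp add: input_tape_def input_sym_def)

lemma minit_sound:
  assumes M: "wf_otm M" and S: "sat (m x) (minit M) \<alpha> x"
  shows "k < ntapes M \<Longrightarrow> p < m x \<Longrightarrow> \<alpha> (cel 1 0 0 k (fst (init_tapes M x ! k) (int p - int (off x))) p)"
    "0 < m x \<Longrightarrow> \<alpha> (sl 1 0)"
proof -
  note s1 = S[unfolded minit_def sat_Un sat_UN, THEN conjunct1, rule_format]
  note S2 = S[unfolded minit_def sat_Un sat_UN, THEN conjunct2]
  note s2 = S2[THEN conjunct1, rule_format]
  note s3 = S2[THEN conjunct2]
  show "0 < m x \<Longrightarrow> \<alpha> (sl 1 0)" using sat_at[OF s3, of 0 0 0 0] by simp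
  assume p: "k < ntapes M" "p < m x"
  show "\<alpha> (cel 1 0 0 k (fst (init_tapes M x ! k) (int p - int (off x))) p)"
  proof (cases "k = 0")
    case True
    have "input_sym x p < 3" by (simp add: input_sym_def)
    then show ?thesis
      using sat_at[OF s2[of "input_sym x p"], of 0 p 0 0] p True
      by (simp add: init_tapes_nth input_sym env_def)
  next
    case False
    then show ?thesis
      using sat_at[OF s1[of k], of 0 p 0 0] p by (simp add: init_tapes_nth env_def blank_tape_def)
  qed
qed

lemma minit_complete:
  assumes \<alpha>: "\<And>v. 1 \<le> v ! 0 \<Longrightarrow> v ! 0 \<le> 1 + 5 \<Longrightarrow> \<alpha> v = asgn (off x) os 1 sel \<tau> c f v"
    and c: "c 0 0 = init_tapes M x" "sel 0" and M: "wf_otm M" and m: "6 < m x" "ntapes M \<le> m x"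
  shows "sat (m x) (minit M) \<alpha> x"
proof -
  note a = asgn_vars[of 1 \<alpha> "off x" os sel \<tau> c f, OF \<alpha>]
  have m0: "0 < m x" using m(1) by simp
  have K: "0 < ntapes M" using M by (simp add: wf_otm_def)
  show ?thesis
    unfolding minit_def sat_Un sat_UN
  proof (intro conjI ballI satI[OF _ m0], goal_cases)
    case (1 k e)
    moreover have "e 1 < m x" by (rule 1)
    ultimately show ?case
      using m m0 c by (simp add: a[simplified] range_vars init_tapes_nth blank_tape_def)
  next
    case (2 s e)
    moreover have "e 1 < m x" by (rule 2)
    ultimately show ?case
      using m m0 c K by (simp add: a[simplified] range_vars init_tapes_nth input_sym)
  qed (use m m0 c in \<open>simp add: a[simplified] range_vars\<close>)
qed

text \<open>The mark \<open>iw\<close> spreads from the origin over the bits of the word; the first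
  cell without a bit turns it into \<open>ew\<close>, which spreads to the right. Together with the
  clause for cells left of the origin, this fixes the initial symbols of tape 0.\<close>

lemma winit_sound:
  assumes S: "sat (m x) (winit (ntapes M) b \<beta> U) \<alpha> x" and sel: "\<alpha> (sl \<beta> u)" and u: "u \<le> U x" "u < m x"
    and f: "\<And>p. p < m x \<Longrightarrow> \<alpha> (cel 1 0 u 1 (f (int p - int (off x))) p)" "\<And>p. f p < b"
    and j: "f (int j) \<noteq> 1 \<and> f (int j) \<noteq> 2" "off x + j < m x"
    and p: "k < ntapes M" "p < m x"
  shows "\<alpha> (cel \<beta> u 0 k (fst (init_tapes M (word_of f) ! k) (int p - int (off x))) p)"
proof -
  note S' = S[unfolded winit_def sat_Un sat_UN, THEN conjunct2]
  note s1 = S[unfolded winit_def sat_Un sat_UN, THEN conjunct1, rule_format]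
  note s2 = S'[THEN conjunct1]
  note S3 = S'[THEN conjunct2]
  note s3 = S3[THEN conjunct1]
  note S4 = S3[THEN conjunct2]
  note s4 = S4[THEN conjunct1, rule_format]
  note S5 = S4[THEN conjunct2]
  note s5 = S5[THEN conjunct1, rule_format]
  note S6 = S5[THEN conjunct2]
  note s6 = S6[THEN conjunct1, rule_format]
  note S7 = S6[THEN conjunct2]
  note s7 = S7[THEN conjunct1]
  note s8 = S7[THEN conjunct2]
  note e = word_end[of f j, OF j(1)]
  have iw: "\<alpha> (iw \<beta> u (off x + q))" if "q \<le> word_end f" for q
    using that
  proof (induction q)
    case 0
    then show ?case using sat_at[OF s3, of 0 0 0 u] u sel by (simp add: env_def)
  next
    case (Suc q)
    then have q: "Suc (off x + q) < m x" using j(2) e(2) by simp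
    have "f (int q) \<in> {1, 2}" using e(3)[of q] Suc.prems by auto
    from sat_at[OF s5[OF this], of 0 "off x + q" "Suc (off x + q)" u] show ?case
      using u q Suc f(1)[of "off x + q"] by (auto simp: env_def)
  qed
  have ew: "\<alpha> (ew \<beta> u (off x + (word_end f + q)))" if "off x + (word_end f + q) < m x" for q
    using that
  proof (induction q)
    case 0
    have "f (int (word_end f)) \<in> {s. s < b \<and> s \<noteq> 1 \<and> s \<noteq> 2}" using e(1) f(2) by simp
    from sat_at[OF s6[OF this], of 0 "off x + word_end f" 0 u] show ?case
      using u 0 f(1)[of "off x + word_end f"] iw[of "word_end f"] by (auto simp: env_def)
  next
    case (Suc q)
    then show ?case
      using sat_at[OF s7, of 0 "off x + (word_end f + q)" "Suc (off x + (word_end f + q))" u] u by (auto simp: env_def)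
  qed
  show ?thesis
  proof (cases "k = 0")
    case False
    then show ?thesis
      using sat_at[OF s1[of k], of 0 p 0 u] p u sel by (simp add: init_tapes_nth env_def blank_tape_def)
  next
    case True
    have t: "fst (init_tapes M (word_of f) ! k) (int p - int (off x)) =
        (if off x \<le> p \<and> p < off x + word_end f then f (int (p - off x)) else 0)"
      using p True input_tape_word_of[of f j "int p - int (off x)", OF j(1)]
      by (auto simp: init_tapes_nth of_nat_diff)
    consider "p < off x" | "off x \<le> p" "p < off x + word_end f" | "off x + word_end f \<le> p" by linarith
    then show ?thesis
    proof cases
      case 1
      then show ?thesis
        unfolding t using sat_at[OF s2, of 0 p 0 u] True p u sel by (simp add: env_def)
    next
      case 2
      then have "f (int (p - off x)) \<in> {1, 2}" using e(3)[of "p - off x"] by auto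
      from sat_at[OF s4[OF this], of 0 p 0 u] show ?thesis
        unfolding t using 2 True p u f(1)[OF p(2)] iw[of "p - off x"] by (auto simp: env_def of_nat_diff)
    next
      case 3
      then show ?thesis
        unfolding t using sat_at[OF s8, of 0 p 0 u] True p u ew[of "p - (off x + word_end f)"]
        by (simp add: env_def)
    qed
  qed
qed

text \<open>Cells of the main computation occur negatively in these clauses. Hence the premise that
  a symbol made true on tape 1 at time \<open>u\<close> is the actual one.\<close>

lemma winit_complete:
  assumes \<alpha>: "\<And>v. \<beta> \<le> v ! 0 \<Longrightarrow> v ! 0 \<le> \<beta> + 5 \<Longrightarrow> \<alpha> v = asgn (off x) os \<beta> sel \<tau> c f v"
    and M: "wf_otm M"
    and c: "\<And>u. u \<le> U x \<Longrightarrow> sel u \<Longrightarrow> c u 0 = init_tapes M (word_of (f u))"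
    and f: "\<And>u s p. u \<le> U x \<Longrightarrow> sel u \<Longrightarrow> s < b \<Longrightarrow> p < m x \<Longrightarrow> \<alpha> (cel 1 0 u 1 s p) \<Longrightarrow> s = f u (int p - int (off x))"
      "\<And>u. u \<le> U x \<Longrightarrow> sel u \<Longrightarrow> \<exists>j. f u (int j) \<noteq> 1 \<and> f u (int j) \<noteq> 2"
    and m: "off x < m x" "\<beta> + 5 < m x" "ntapes M \<le> m x" "b \<le> m x" "3 \<le> b"
  shows "sat (m x) (winit (ntapes M) b \<beta> U) \<alpha> x"
proof -
  note a = asgn_vars[of \<beta> \<alpha> "off x" os sel \<tau> c f, OF \<alpha>]
  have m0: "0 < m x" using m(1) by simp
  have K: "0 < ntapes M" using M by (simp add: wf_otm_def)
  have W: "f u (int (word_end (f u))) \<noteq> 1 \<and> f u (int (word_end (f u))) \<noteq> 2"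
    "i < word_end (f u) \<Longrightarrow> f u (int i) = 1 \<or> f u (int i) = 2" if "u \<le> U x" "sel u" for u i
    using f(2)[OF that] word_end(1,3)[of "f u"] by blast+
  have C: "fst (c u 0 ! 0) z = (if 0 \<le> z \<and> z < int (word_end (f u)) then f u z else 0)" if su: "u \<le> U x" "sel u" for u z
  proof -
    obtain j where "f u (int j) \<noteq> 1 \<and> f u (int j) \<noteq> 2" using f(2)[OF su] by blast
    from input_tape_word_of[of "f u", OF this, of z] show ?thesis using K by (simp add: c[OF su] init_tapes_nth)
  qed
  have in_word: "int p - int (off x) < int (word_end (f u))"
    if "u \<le> U x" "sel u" "s < b" "p < m x" "\<alpha> (cel 1 0 u 1 s p)" "s = 1 \<or> s = 2"
      "int p - int (off x) \<le> int (word_end (f u))" for u s p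
    using f(1)[OF that(1-5)] W(1)[OF that(1,2)] that(6,7) by (cases "int p - int (off x) = int (word_end (f u))") auto
  have off_word: "int (word_end (f u)) \<le> int p - int (off x)"
    if "u \<le> U x" "sel u" "s < b" "p < m x" "\<alpha> (cel 1 0 u 1 s p)" "s \<noteq> 1 \<and> s \<noteq> 2" "off x \<le> p" for u s p
    using f(1)[OF that(1-5)] W(2)[OF that(1,2), of "p - off x"] that(6,7)
    by (cases "p - off x < word_end (f u)") (auto simp: of_nat_diff)
  show ?thesis
    unfolding winit_def sat_Un sat_UN
  proof (intro conjI ballI satI[OF _ m0], goal_cases)
    case (1 k e)
    moreover have "e 1 < m x" "e 3 < m x" by (rule 1)+
    ultimately show ?case
      using m m0 by (simp add: a range_vars c init_tapes_nth blank_tape_def)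
  next
    case (2 e)
    moreover have "e 1 < m x" "e 3 < m x" by (rule 2)+
    ultimately show ?case using m m0 K by (simp add: a range_vars C)
  next
    case (3 e)
    moreover have "e 3 < m x" by (rule 3)
    ultimately show ?case using m m0 by (simp add: a range_vars)
  next
    case (4 s e)
    have e: "e 1 < m x" "e 3 < m x" by (rule 4(2))+
    show ?case
    proof (cases "\<alpha> (iw \<beta> (e 3) (e 1)) \<and> \<alpha> (cel 1 0 (e 3) 1 s (e 1))")
      case True
      then have h: "sel (e 3)" "off x \<le> e 1" "int (e 1) - int (off x) \<le> int (word_end (f (e 3)))" by (simp_all add: a)
      have s: "s < b" "s = 1 \<or> s = 2" using 4(1) m by auto
      have "s = f (e 3) (int (e 1) - int (off x))" using f(1)[OF _ h(1) s(1) e(1)] 4 True by simp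
      moreover have "int (e 1) - int (off x) < int (word_end (f (e 3)))"
        using in_word[OF _ h(1) s(1) e(1) _ s(2) h(3)] 4 True by simp
      ultimately have "\<alpha> (cel \<beta> (e 3) 0 0 s (e 1))" using h 4 by (simp add: a C)
      then show ?thesis using e s m by (simp add: range_vars)
    qed (use e 4(1) m m0 in \<open>auto simp: range_vars\<close>)
  next
    case (5 s e)
    have e: "e 1 < m x" "e 2 < m x" "e 3 < m x" by (rule 5(2))+
    show ?case
    proof (cases "\<alpha> (iw \<beta> (e 3) (e 1)) \<and> \<alpha> (cel 1 0 (e 3) 1 s (e 1))")
      case True
      then have h: "sel (e 3)" "off x \<le> e 1" "int (e 1) - int (off x) \<le> int (word_end (f (e 3)))" by (simp_all add: a)
      have s: "s < b" "s = 1 \<or> s = 2" using 5(1) m by auto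
      have "int (e 1) - int (off x) < int (word_end (f (e 3)))"
        using in_word[OF _ h(1) s(1) e(1) _ s(2) h(3)] 5 True by simp
      then have "\<alpha> (iw \<beta> (e 3) (e 2))" using h 5(3) by (simp add: a)
      then show ?thesis using e 5(3) m m0 by (simp add: range_vars)
    qed (use e 5(1) m m0 in \<open>auto simp: range_vars\<close>)
  next
    case (6 s e)
    have e: "e 1 < m x" "e 3 < m x" by (rule 6(2))+
    show ?case
    proof (cases "\<alpha> (iw \<beta> (e 3) (e 1)) \<and> \<alpha> (cel 1 0 (e 3) 1 s (e 1))")
      case True
      then have h: "sel (e 3)" "off x \<le> e 1" by (simp_all add: a)
      have s: "s < b" "s \<noteq> 1 \<and> s \<noteq> 2" using 6(1) by auto
      have "int (word_end (f (e 3))) \<le> int (e 1) - int (off x)"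
        using off_word[OF _ h(1) s(1) e(1) _ s(2) h(2)] 6 True by simp
      then have "\<alpha> (ew \<beta> (e 3) (e 1))" using h by (simp add: a)
      then show ?thesis using e m m0 by (simp add: range_vars)
    qed (use e 6(1) m m0 in \<open>auto simp: range_vars\<close>)
  next
    case (7 e)
    moreover have "e 1 < m x" "e 2 < m x" "e 3 < m x" by (rule 7)+
    ultimately show ?case using m m0 by (auto simp: a range_vars)
  next
    case (8 e)
    moreover have "e 1 < m x" "e 3 < m x" by (rule 8)+
    ultimately show ?case using m m0 by (auto simp: a range_vars C)
  qed
qed

end

text \<open>A head moves by at most one cell per step, so \<open>t\<close> steps leave the cells at
  distance \<open>t\<close> or more unchanged. This bounds the length of query words.\<close>

lemma path_tapes:
  assumes M: "wf_otm M" and P: "path M T \<tau> c" and c: "small M (c 0)" "\<And>k. k < ntapes M \<Longrightarrow> snd (c 0 ! k) = 0"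
    and "t \<le> T"
  shows "small M (c t)" "k < ntapes M \<Longrightarrow> \<bar>p\<bar> \<ge> int t \<Longrightarrow> fst (c t ! k) p = fst (c 0 ! k) p"
proof -
  have "small M (c t) \<and> (\<forall>k<ntapes M. \<bar>snd (c t ! k)\<bar> \<le> int t \<and>
      (\<forall>p. \<bar>p\<bar> \<ge> int t \<longrightarrow> fst (c t ! k) p = fst (c 0 ! k) p))"
    using \<open>t \<le> T\<close>
  proof (induction t)
    case 0
    then show ?case using c by simp
  next
    case (Suc t)
    then have IH: "small M (c t)" "\<And>k. k < ntapes M \<Longrightarrow> \<bar>snd (c t ! k)\<bar> \<le> int t"
      "\<And>k p. k < ntapes M \<Longrightarrow> \<bar>p\<bar> \<ge> int t \<Longrightarrow> fst (c t ! k) p = fst (c 0 ! k) p" by simp_all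
    have q: "\<tau> t \<in> quads M" and n: "c (Suc t) = map2 act (c t) (acts (\<tau> t))"
      using P Suc.prems by (simp_all add: path_def)
    note qw = quads_wf[OF M q]
    have e: "c (Suc t) ! k = ((fst (c t ! k))(snd (c t ! k) := fst (acts (\<tau> t) ! k)),
        snd (c t ! k) + offset (snd (acts (\<tau> t) ! k)))" if "k < ntapes M" for k
      unfolding n using IH(1) that qw(2) by (intro nth_act_tape) (simp_all add: small_def)
    have d: "\<bar>offset d\<bar> \<le> 1" for d by (cases d) auto
    have "\<bar>snd (c (Suc t) ! k)\<bar> \<le> int (Suc t)" if "k < ntapes M" for k
      using e[OF that] IH(2)[OF that] d[of "snd (acts (\<tau> t) ! k)"] by simp
    moreover have "fst (c (Suc t) ! k) p = fst (c 0 ! k) p" if "k < ntapes M" "\<bar>p\<bar> \<ge> int (Suc t)" for k p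
      using e[OF that(1)] IH(2)[OF that(1)] IH(3)[OF that(1), of p] that(2) by auto
    moreover have "small M (c (Suc t))"
      unfolding n by (rule small_act[OF IH(1) qw(2,4)])
    ultimately show ?case by blast
  qed
  then show "small M (c t)" "k < ntapes M \<Longrightarrow> \<bar>p\<bar> \<ge> int t \<Longrightarrow> fst (c t ! k) p = fst (c 0 ! k) p"
    by simp_all
qed

text \<open>The empty oracle never answers yes, so dropping the quadruples of kind 1 expresses its
  answers.\<close>

lemma language_empty:
  assumes "wf_otm M" and "\<And>t k c. run M {} (init M x) t k c \<Longrightarrow> t \<le> T"
    and "set os = {q \<in> quads M. kind q \<noteq> 1}"
  shows "x \<in> language M {} \<longleftrightarrow> (\<exists>\<tau> c. path M T \<tau> c \<and> c 0 = init_tapes M x \<and> (\<forall>t\<le>T. \<tau> t \<in> set os))"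
proof -
  have "x \<in> language M {} \<longleftrightarrow> (\<exists>\<tau> c. path M T \<tau> c \<and> c 0 = init_tapes M x \<and>
    (\<forall>t\<le>T. (kind (\<tau> t) = 1 \<longrightarrow> asks_yes {} (c t)) \<and> (kind (\<tau> t) = 2 \<longrightarrow> \<not> asks_yes {} (c t))))"
    by (rule language_path) fact+
  also have "\<dots> \<longleftrightarrow> (\<exists>\<tau> c. path M T \<tau> c \<and> c 0 = init_tapes M x \<and> (\<forall>t\<le>T. \<tau> t \<in> set os))"
    unfolding assms(3) asks_yes_def path_def by (intro iff_exI) auto
  finally show ?thesis .
qed

lemma snd_init_tapes: "k < ntapes M \<Longrightarrow> snd (init_tapes M x ! k) = 0"
  by (simp add: init_tapes_nth input_tape_def blank_tape_def)

text \<open>\<open>T1\<close> bounds the main computation and \<open>T2\<close> those on query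
  words. Heads stay within \<open>T2\<close> of their origin: \<open>off\<close> keeps positions
  positive, the bound on \<open>m\<close> leaves room on the right. The number 40 exceeds all
  variable classes.\<close>

locale bounded_tableau = tableau off m for off m :: "bool list \<Rightarrow> nat" +
  fixes M :: otm and T1 T2 :: "bool list \<Rightarrow> nat" and x :: "bool list"
  assumes M: "wf_otm M" and T: "T1 x \<le> T2 x" and off: "off x = Suc (T2 x)" and m: "2 * T2 x + 2 < m x" "40 \<le> m x"
    "ntapes M \<le> m x" "bound M \<le> m x"
begin

lemma language_sat:
  assumes t: "\<And>t k c. run M {} (init M x) t k c \<Longrightarrow> t \<le> T1 x"
    and os: "set os = {q \<in> quads M. kind q \<noteq> 1}" "length os \<le> m x"
  shows "x \<in> language M {} \<longleftrightarrow> (\<exists>\<alpha>. sat (m x) (tab M os 1 (\<lambda>_. 0) T1 \<union> minit M) \<alpha> x)"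
proof -
  have e: "x \<in> language M {} \<longleftrightarrow> (\<exists>\<tau> c. path M (T1 x) \<tau> c \<and> c 0 = init_tapes M x \<and> (\<forall>t\<le>T1 x. \<tau> t \<in> set os))"
    by (rule language_empty[OF M]) fact+
  show ?thesis unfolding e
proof
  assume "\<exists>\<tau> c. path M (T1 x) \<tau> c \<and> c 0 = init_tapes M x \<and> (\<forall>t\<le>T1 x. \<tau> t \<in> set os)"
  then obtain \<tau> c where p: "path M (T1 x) \<tau> c" "c 0 = init_tapes M x" "\<And>t. t \<le> T1 x \<Longrightarrow> \<tau> t \<in> set os" by blast
  let ?\<alpha> = "asgn (off x) os 1 (\<lambda>_. True) (\<lambda>_. \<tau>) (\<lambda>_. c) (\<lambda>_ _. 0)"
  have "sat (m x) (tab M os 1 (\<lambda>_. 0) T1) ?\<alpha> x"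
    by (rule tab_complete[OF M _ refl]) (use os p T m off snd_init_tapes in auto)
  moreover have "sat (m x) (minit M) ?\<alpha> x"
    by (rule minit_complete[OF refl]) (use p M m in auto)
  ultimately show "\<exists>\<alpha>. sat (m x) (tab M os 1 (\<lambda>_. 0) T1 \<union> minit M) \<alpha> x" unfolding sat_Un by blast
next
  assume "\<exists>\<alpha>. sat (m x) (tab M os 1 (\<lambda>_. 0) T1 \<union> minit M) \<alpha> x"
  then obtain \<alpha> where s: "sat (m x) (tab M os 1 (\<lambda>_. 0) T1) \<alpha> x" "sat (m x) (minit M) \<alpha> x"
    unfolding sat_Un by blast
  have m0: "0 < m x" using m by simp
  have "\<exists>\<tau> c. path M (T1 x) \<tau> c \<and> c 0 = init_tapes M x \<and>
    (\<forall>t\<le>T1 x. \<exists>i<length os. \<tau> t = os ! i \<and> \<alpha> (tr 1 0 t i)) \<and>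
    (\<forall>t k p. t \<le> T1 x \<and> k < ntapes M \<and> p < m x \<longrightarrow> \<alpha> (cel 1 0 t k (fst (c t ! k) (int p - int (off x))) p))"
    by (rule tab_sound[where U = "\<lambda>_. 0", OF M _ s(1) minit_sound(2)[OF M s(2) m0]])
      (use os T m off m0 minit_sound(1)[OF M s(2)] small_init[OF M] snd_init_tapes in auto)
  then obtain \<tau> c where "path M (T1 x) \<tau> c" "c 0 = init_tapes M x" "\<forall>t\<le>T1 x. \<exists>i<length os. \<tau> t = os ! i"
    by blast
  moreover from this have "\<forall>t\<le>T1 x. \<tau> t \<in> set os" by (metis nth_mem)
  ultimately show "\<exists>\<tau> c. path M (T1 x) \<tau> c \<and> c 0 = init_tapes M x \<and> (\<forall>t\<le>T1 x. \<tau> t \<in> set os)" by blast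
qed
qed

end

context tableau
begin

definition "uniq" :: "otm \<Rightarrow> (bool list \<Rightarrow> nat) \<Rightarrow> schema set" where
  "uniq M T = (\<Union>s\<in>{..<bound M}. \<Union>s'\<in>{s'. s' < bound M \<and> s \<noteq> s'}.
    {(\<lambda>x e. e 3 \<le> T x, [(False, \<lambda>x e. cel 1 0 (e 3) 1 s (e 1)), (False, \<lambda>x e. cel 1 0 (e 3) 1 s' (e 1))])})"

text \<open>A query answered by yes at time \<open>u\<close> puts copy \<open>u\<close> of the tableau of class 11 in force. By
  \<open>chain\<close>, some copy of the tableau of class 21 is in force, by \<open>noq\<close> one for a query answered by no;
  so \<open>schemaC\<close> is satisfiable iff some query is wrongly answered by no. Such a copy can only be
  satisfied if the query tape is unambiguous, hence \<open>uniq\<close>.\<close>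

definition yesq :: "quad list \<Rightarrow> (bool list \<Rightarrow> nat) \<Rightarrow> schema set" where
  "yesq os T = (\<Union>i\<in>{i. i < length os \<and> kind (os ! i) = 1}.
    {(\<lambda>x e. e 3 \<le> T x, [(False, \<lambda>x e. tr 1 0 (e 3) i), (True, \<lambda>x e. sl 11 (e 3))])})"

definition noq :: "quad list \<Rightarrow> (bool list \<Rightarrow> nat) \<Rightarrow> schema set" where
  "noq os T = {(\<lambda>x e. e 3 \<le> T x, (False, \<lambda>x e. sl 21 (e 3)) #
    map (\<lambda>i. (True, \<lambda>x e. tr 1 0 (e 3) i)) (filter (\<lambda>i. kind (os ! i) = 2) [0..<length os]))}"

text \<open>A clause stating that some copy is selected would grow with the input, whereas a schema
  has a fixed number of literals. So it is split along auxiliary variables: truth passes from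
  \<open>u\<close> to \<open>u + 1\<close> unless copy \<open>u\<close> is selected, and it must not
  reach the end.\<close>

definition chain :: "(bool list \<Rightarrow> nat) \<Rightarrow> schema set" where
  "chain T = {(\<lambda>x e. True, [(True, \<lambda>x e. tr 31 0 0 0)])} \<union>
    ({(\<lambda>x e. e 3 \<le> T x, [(False, \<lambda>x e. tr 31 (e 3) 0 0), (True, \<lambda>x e. sl 21 (e 3)),
      (True, \<lambda>x e. tr 31 (Suc (e 3)) 0 0)])} \<union>
    {(\<lambda>x e. True, [(False, \<lambda>x e. tr 31 (Suc (T x)) 0 0)])})"

text \<open>\<open>schemaD\<close> uses the classes up to 20, chosen before the inner ones.
  \<open>schemaC\<close> refers back to the main computation and adds the classes from 21 on; its
  unsatisfiability for a fixed outer choice expresses that the answers no are right.\<close>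

definition schemaD :: "otm \<Rightarrow> quad list \<Rightarrow> otm \<Rightarrow> quad list \<Rightarrow> (bool list \<Rightarrow> nat) \<Rightarrow> (bool list \<Rightarrow> nat) \<Rightarrow> schema set" where
  "schemaD M os M' os' T1 T2 = tab M os 1 (\<lambda>_. 0) T1 \<union> (minit M \<union> (uniq M T1 \<union> (yesq os T1 \<union>
    (tab M' os' 11 T1 T2 \<union> winit (ntapes M') (bound M) 11 T1))))"

definition schemaC :: "otm \<Rightarrow> quad list \<Rightarrow> otm \<Rightarrow> quad list \<Rightarrow> (bool list \<Rightarrow> nat) \<Rightarrow> (bool list \<Rightarrow> nat) \<Rightarrow> schema set" where
  "schemaC M os M' os' T1 T2 = noq os T1 \<union> (chain T1 \<union>
    (tab M' os' 21 T1 T2 \<union> winit (ntapes M') (bound M) 21 T1))"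

lemma finite_schemas: "finite (schemaD M os M' os' T1 T2)" "finite (schemaC M os M' os' T1 T2)"
  unfolding schemaD_def schemaC_def uniq_def yesq_def noq_def chain_def
  using finite_tab finite_init by simp_all

end

context bounded_tableau
begin

lemma T2m: "T2 x < off x" "off x + T2 x < m x" "off x < m x" "T2 x < m x" "T1 x < m x" "0 < m x" "off x + T1 x < m x"
  using T off m by auto

lemma subcomputation_sound:
  assumes M': "wf_otm M'" "\<And>w t k c. length w \<le> T1 x \<Longrightarrow> run M' {} (init M' w) t k c \<Longrightarrow> t \<le> T2 x"
    and os: "set os = {q \<in> quads M'. kind q \<noteq> 1}" "length os \<le> m x"
    and S: "sat (m x) (tab M' os \<beta> T1 T2) \<alpha> x" "sat (m x) (winit (ntapes M') (bound M) \<beta> T1) \<alpha> x"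
    and u: "u \<le> T1 x" "\<alpha> (sl \<beta> u)"
    and f: "\<And>p. p < m x \<Longrightarrow> \<alpha> (cel 1 0 u 1 (f (int p - int (off x))) p)" "\<And>p. f p < bound M" "f (int (T1 x)) = 0"
  shows "word_of f \<in> language M' {}"
proof -
  have um: "u < m x" using u T2m by simp
  have j: "f (int (T1 x)) \<noteq> 1 \<and> f (int (T1 x)) \<noteq> 2" using f(3) by simp
  have "length (word_of f) \<le> T1 x" using word_end(2)[of f "T1 x", OF j] by (simp add: word_of_def)
  then have t: "\<And>t k c. run M' {} (init M' (word_of f)) t k c \<Longrightarrow> t \<le> T2 x" by (rule M'(2))
  have W: "k < ntapes M' \<Longrightarrow> p < m x \<Longrightarrow>
      \<alpha> (cel \<beta> u 0 k (fst (init_tapes M' (word_of f) ! k) (int p - int (off x))) p)" for k p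
    by (rule winit_sound[OF S(2) u(2,1) um f(1,2) j T2m(7)])
  have osq: "set os \<subseteq> quads M'" using os by auto
  have "\<exists>\<tau> c. path M' (T2 x) \<tau> c \<and> c 0 = init_tapes M' (word_of f) \<and>
    (\<forall>t\<le>T2 x. \<exists>i<length os. \<tau> t = os ! i \<and> \<alpha> (tr \<beta> u t i)) \<and>
    (\<forall>t k p. t \<le> T2 x \<and> k < ntapes M' \<and> p < m x \<longrightarrow> \<alpha> (cel \<beta> u t k (fst (c t ! k) (int p - int (off x))) p))"
    by (rule tab_sound[OF M'(1) osq S(1) u(2,1) um T2m(1,2) os(2) small_init[OF M'(1)] snd_init_tapes W])
  then obtain \<tau> c where p: "path M' (T2 x) \<tau> c" "c 0 = init_tapes M' (word_of f)" "\<forall>t\<le>T2 x. \<exists>i<length os. \<tau> t = os ! i"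
    by blast
  then have "\<forall>t\<le>T2 x. \<tau> t \<in> set os" by (metis nth_mem)
  moreover have "word_of f \<in> language M' {} \<longleftrightarrow>
      (\<exists>\<tau> c. path M' (T2 x) \<tau> c \<and> c 0 = init_tapes M' (word_of f) \<and> (\<forall>t\<le>T2 x. \<tau> t \<in> set os))"
    by (rule language_empty[OF M'(1)]) (use t os(1) in auto)
  ultimately show ?thesis using p(1,2) by blast
qed

text \<open>Stated for every assignment with the prescribed copies and the right query tapes, so
  that it serves the outer tableau as well as the inner one.\<close>

definition copies_ok :: "otm \<Rightarrow> quad list \<Rightarrow> nat \<Rightarrow> (nat \<Rightarrow> bool) \<Rightarrow> (nat \<Rightarrow> nat \<Rightarrow> quad) \<Rightarrow>
    (nat \<Rightarrow> nat \<Rightarrow> tape list) \<Rightarrow> (nat \<Rightarrow> int \<Rightarrow> nat) \<Rightarrow> bool" where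
  "copies_ok M' os \<beta> sel \<tau> c f \<longleftrightarrow>
    (\<forall>\<alpha>. (\<forall>v. \<beta> \<le> v ! 0 \<longrightarrow> v ! 0 \<le> \<beta> + 5 \<longrightarrow> \<alpha> v = asgn (off x) os \<beta> sel \<tau> c f v) \<longrightarrow>
    (\<forall>u s p. u \<le> T1 x \<longrightarrow> sel u \<longrightarrow> s < bound M \<longrightarrow> p < m x \<longrightarrow> \<alpha> (cel 1 0 u 1 s p) \<longrightarrow>
      s = f u (int p - int (off x))) \<longrightarrow>
    sat (m x) (tab M' os \<beta> T1 T2) \<alpha> x \<and> sat (m x) (winit (ntapes M') (bound M) \<beta> T1) \<alpha> x)"

lemma subcomputation_complete:
  assumes M': "wf_otm M'" "\<And>w t k c. length w \<le> T1 x \<Longrightarrow> run M' {} (init M' w) t k c \<Longrightarrow> t \<le> T2 x"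
    and os: "set os = {q \<in> quads M'. kind q \<noteq> 1}" "length os \<le> m x"
    and f: "\<And>u. u \<le> T1 x \<Longrightarrow> sel u \<Longrightarrow> f u (int (T1 x)) = 0" "\<And>u. u \<le> T1 x \<Longrightarrow> sel u \<Longrightarrow> word_of (f u) \<in> language M' {}"
    and m': "\<beta> + 5 < m x" "ntapes M' \<le> m x" "bound M' \<le> m x"
  shows "\<exists>\<tau> c. copies_ok M' os \<beta> sel \<tau> c f"
proof -
  have "\<exists>\<tau> c. path M' (T2 x) \<tau> c \<and> c 0 = init_tapes M' (word_of (f u)) \<and> (\<forall>t\<le>T2 x. \<tau> t \<in> set os)"
    if u: "u \<le> T1 x" "sel u" for u
  proof -
    have j: "f u (int (T1 x)) \<noteq> 1 \<and> f u (int (T1 x)) \<noteq> 2" using f(1)[OF u] by simp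
    have "length (word_of (f u)) \<le> T1 x" using word_end(2)[of "f u" "T1 x", OF j] by (simp add: word_of_def)
    then have t: "\<And>t k c. run M' {} (init M' (word_of (f u))) t k c \<Longrightarrow> t \<le> T2 x" by (rule M'(2))
    have "word_of (f u) \<in> language M' {} \<longleftrightarrow>
        (\<exists>\<tau> c. path M' (T2 x) \<tau> c \<and> c 0 = init_tapes M' (word_of (f u)) \<and> (\<forall>t\<le>T2 x. \<tau> t \<in> set os))"
      by (rule language_empty[OF M'(1)]) (use t os(1) in auto)
    then show ?thesis using f(2)[OF u] by blast
  qed
  then obtain \<tau> c where p: "\<And>u. u \<le> T1 x \<Longrightarrow> sel u \<Longrightarrow> path M' (T2 x) (\<tau> u) (c u) \<and>
      c u 0 = init_tapes M' (word_of (f u)) \<and> (\<forall>t\<le>T2 x. \<tau> u t \<in> set os)" by metis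
  have osq: "set os \<subseteq> quads M'" using os by auto
  show ?thesis
    unfolding copies_ok_def
  proof (intro exI[of _ \<tau>] exI[of _ c] allI impI conjI)
    fix \<alpha>
    assume a: "\<forall>v. \<beta> \<le> v ! 0 \<longrightarrow> v ! 0 \<le> \<beta> + 5 \<longrightarrow> \<alpha> v = asgn (off x) os \<beta> sel \<tau> c f v"
    then have a': "\<And>v. \<beta> \<le> v ! 0 \<Longrightarrow> v ! 0 \<le> \<beta> + 5 \<Longrightarrow> \<alpha> v = asgn (off x) os \<beta> sel \<tau> c f v" by blast
    assume b: "\<forall>u s p. u \<le> T1 x \<longrightarrow> sel u \<longrightarrow> s < bound M \<longrightarrow> p < m x \<longrightarrow> \<alpha> (cel 1 0 u 1 s p) \<longrightarrow>
      s = f u (int p - int (off x))"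
    show "sat (m x) (tab M' os \<beta> T1 T2) \<alpha> x"
    proof (rule tab_complete[OF M'(1) osq, where sel = sel and \<tau> = \<tau> and c = c and f = f])
      fix v :: "nat list"
      assume "\<beta> \<le> v ! 0" "v ! 0 \<le> \<beta> + 5"
      then show "\<alpha> v = asgn (off x) os \<beta> sel \<tau> c f v" by (rule a')
    qed (use p snd_init_tapes T2m m' os(2) in auto)
    show "sat (m x) (winit (ntapes M') (bound M) \<beta> T1) \<alpha> x"
    proof (rule winit_complete[OF _ M'(1), where sel = sel and \<tau> = \<tau> and c = c and f = f])
      fix v :: "nat list"
      assume "\<beta> \<le> v ! 0" "v ! 0 \<le> \<beta> + 5"
      then show "\<alpha> v = asgn (off x) os \<beta> sel \<tau> c f v" by (rule a')
    next
      show "\<exists>j. f u (int j) \<noteq> 1 \<and> f u (int j) \<noteq> 2" if "u \<le> T1 x" "sel u" for u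
        using f(1)[OF that] by (intro exI[of _ "T1 x"]) simp
    qed (use p b T2m m m' bound_ge[OF M] in auto)
  qed
qed

lemma asks_yes_iff:
  assumes "fst (tps ! 1) (int j) = 0"
  shows "asks_yes B tps \<longleftrightarrow> word_of (fst (tps ! 1)) \<in> B"
  using holds_word_iff[of "fst (tps ! 1)" j "snd (tps ! 1)"] assms by (simp add: asks_yes_def)

lemma query_tape:
  assumes "path M (T1 x) \<tau> c" "c 0 = init_tapes M x" "t \<le> T1 x"
  shows "fst (c t ! 1) p < bound M" "fst (c t ! 1) (int (T1 x)) = 0"
proof -
  have K: "1 < ntapes M" using M by (simp add: wf_otm_def)
  have c0: "small M (c 0)" "\<And>k. k < ntapes M \<Longrightarrow> snd (c 0 ! k) = 0"
    using assms(2) small_init[OF M] snd_init_tapes by simp_all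
  have "small M (c t)"
    by (rule path_tapes[OF M assms(1)]) (use c0 assms(3) in auto)
  then show "fst (c t ! 1) p < bound M" using K by (simp add: small_def)
  have "fst (c t ! 1) (int (T1 x)) = fst (c 0 ! 1) (int (T1 x))"
    by (rule path_tapes[OF M assms(1)]) (use c0 K assms(3) in auto)
  then show "fst (c t ! 1) (int (T1 x)) = 0"
    using assms(2) K by (simp add: init_tapes_nth blank_tape_def)
qed

text \<open>Given an accepting path, certificates for the answers yes complete the outer assignment,
  and a model of \<open>schemaC\<close> would certify a query answered by no. Conversely, the path
  is read off the outer assignment, and a wrong answer no would supply a model of
  \<open>schemaC\<close>.\<close>

lemma language_relative_sat:
  assumes t: "\<And>t k c. run M (language M' {}) (init M x) t k c \<Longrightarrow> t \<le> T1 x"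
    and M': "wf_otm M'" "\<And>w t k c. length w \<le> T1 x \<Longrightarrow> run M' {} (init M' w) t k c \<Longrightarrow> t \<le> T2 x"
    and os: "set os = quads M" "length os \<le> m x"
    and os': "set os' = {q \<in> quads M'. kind q \<noteq> 1}" "length os' \<le> m x"
    and m': "ntapes M' \<le> m x" "bound M' \<le> m x"
  shows "x \<in> language M (language M' {}) \<longleftrightarrow> (\<exists>\<alpha>. sat (m x) (schemaD M os M' os' T1 T2) \<alpha> x \<and>
    (\<forall>\<alpha>'. (\<forall>v. v ! 0 \<le> 20 \<longrightarrow> \<alpha>' v = \<alpha> v) \<longrightarrow> \<not> sat (m x) (schemaC M os M' os' T1 T2) \<alpha>' x))"
proof -
  let ?B = "language M' {}" and ?D = "schemaD M os M' os' T1 T2" and ?C = "schemaC M os M' os' T1 T2"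
  have K: "1 < ntapes M" using M by (simp add: wf_otm_def)
  have e: "x \<in> language M ?B \<longleftrightarrow> (\<exists>\<tau> c. path M (T1 x) \<tau> c \<and> c 0 = init_tapes M x \<and>
    (\<forall>t\<le>T1 x. (kind (\<tau> t) = 1 \<longrightarrow> asks_yes ?B (c t)) \<and> (kind (\<tau> t) = 2 \<longrightarrow> \<not> asks_yes ?B (c t))))"
    by (rule language_path[OF M]) fact
  show ?thesis
    unfolding e
  proof
    assume "\<exists>\<tau> c. path M (T1 x) \<tau> c \<and> c 0 = init_tapes M x \<and>
      (\<forall>t\<le>T1 x. (kind (\<tau> t) = 1 \<longrightarrow> asks_yes ?B (c t)) \<and> (kind (\<tau> t) = 2 \<longrightarrow> \<not> asks_yes ?B (c t)))"
    then obtain \<tau> c where p: "path M (T1 x) \<tau> c" "c 0 = init_tapes M x"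
      and a: "\<And>t. t \<le> T1 x \<Longrightarrow> kind (\<tau> t) = 1 \<Longrightarrow> asks_yes ?B (c t)"
        "\<And>t. t \<le> T1 x \<Longrightarrow> kind (\<tau> t) = 2 \<Longrightarrow> \<not> asks_yes ?B (c t)" by blast
    define f where "f t = fst (c t ! 1)" for t
    define sel where "sel t \<longleftrightarrow> kind (\<tau> t) = 1" for t
    have f0: "f t (int (T1 x)) = 0" "f t p < bound M" if "t \<le> T1 x" for t p
      using query_tape[OF p that] by (simp_all add: f_def)
    have ask: "asks_yes ?B (c t) \<longleftrightarrow> word_of (f t) \<in> ?B" if "t \<le> T1 x" for t
      using asks_yes_iff[of "c t" "T1 x"] f0[OF that] by (simp add: f_def)
    have osM: "\<tau> t \<in> set os" if "t \<le> T1 x" for t using p(1) that os by (simp add: path_def)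
    have "\<exists>\<tau>' c'. copies_ok M' os' 11 sel \<tau>' c' f"
      by (rule subcomputation_complete[OF M' os']) (use f0 m m' a(1) ask in \<open>auto simp: sel_def\<close>)
    then obtain \<tau>' c' where C: "copies_ok M' os' 11 sel \<tau>' c' f" by blast
    \<comment> \<open>Classes up to 10 describe the main path, the others the accepting computations
      for the queries answered by yes.\<close>
    define \<alpha> where "\<alpha> v = (if v ! 0 \<le> 10 then asgn (off x) os 1 (\<lambda>_. True) (\<lambda>_. \<tau>) (\<lambda>_. c) (\<lambda>_ _. 0) v
      else asgn (off x) os' 11 sel \<tau>' c' f v)" for v
    have a1: "\<And>v. 1 \<le> v ! 0 \<Longrightarrow> v ! 0 \<le> 1 + 5 \<Longrightarrow>
        \<alpha> v = asgn (off x) os 1 (\<lambda>_. True) (\<lambda>_. \<tau>) (\<lambda>_. c) (\<lambda>_ _. 0) v" by (simp add: \<alpha>_def)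
    note av = asgn_vars[of 1 \<alpha> "off x" os "\<lambda>_. True" "\<lambda>_. \<tau>" "\<lambda>_. c" "\<lambda>_ _. 0", OF a1, simplified]
    have a11: "\<And>v. 11 \<le> v ! 0 \<Longrightarrow> v ! 0 \<le> 11 + 5 \<Longrightarrow> \<alpha> v = asgn (off x) os' 11 sel \<tau>' c' f v" by (simp add: \<alpha>_def)
    note av' = asgn_vars[of 11 \<alpha> "off x" os' sel \<tau>' c' f, OF a11]
    have D: "sat (m x) ?D \<alpha> x"
      unfolding schemaD_def sat_Un
    proof (intro conjI)
      show "sat (m x) (tab M os 1 (\<lambda>_. 0) T1) \<alpha> x"
      proof (rule tab_complete[OF M])
        fix v :: "nat list"
        assume "1 \<le> v ! 0" "v ! 0 \<le> 1 + 5"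
        then show "\<alpha> v = asgn (off x) os 1 (\<lambda>_. True) (\<lambda>_. \<tau>) (\<lambda>_. c) (\<lambda>_ _. 0) v" by (rule a1)
      qed (use p osM os m T2m snd_init_tapes in auto)
      show "sat (m x) (minit M) \<alpha> x"
      proof (rule minit_complete)
        fix v :: "nat list"
        assume "1 \<le> v ! 0" "v ! 0 \<le> 1 + 5"
        then show "\<alpha> v = asgn (off x) os 1 (\<lambda>_. True) (\<lambda>_. \<tau>) (\<lambda>_. c) (\<lambda>_ _. 0) v" by (rule a1)
      qed (use p M m in auto)
      show "sat (m x) (uniq M T1) \<alpha> x"
        unfolding uniq_def sat_UN
      proof (intro ballI satI[OF _ T2m(6)], goal_cases)
        case (1 s s' e)
        moreover have "e 1 < m x" "e 3 < m x" by (rule 1)+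
        ultimately show ?case using m by (auto simp: av range_vars)
      qed
      show "sat (m x) (yesq os T1) \<alpha> x"
        unfolding yesq_def sat_UN
      proof (intro ballI satI[OF _ T2m(6)], goal_cases)
        case (1 i e)
        moreover have "e 1 < m x" "e 3 < m x" by (rule 1)+
        ultimately show ?case using m os by (auto simp: av av' range_vars sel_def)
      qed
      have "\<alpha> (cel 1 0 u 1 s p) \<Longrightarrow> s = f u (int p - int (off x))" for u s p
        by (simp add: av f_def)
      then show "sat (m x) (tab M' os' 11 T1 T2) \<alpha> x" "sat (m x) (winit (ntapes M') (bound M) 11 T1) \<alpha> x"
        using C a11 unfolding copies_ok_def by blast+
    qed
    have "\<not> sat (m x) ?C \<alpha>' x" if eq: "\<And>v. v ! 0 \<le> 20 \<Longrightarrow> \<alpha>' v = \<alpha> v" for \<alpha>'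
    proof
      assume "sat (m x) ?C \<alpha>' x"
      then have s: "sat (m x) (noq os T1) \<alpha>' x" "sat (m x) (chain T1) \<alpha>' x"
        "sat (m x) (tab M' os' 21 T1 T2) \<alpha>' x" "sat (m x) (winit (ntapes M') (bound M) 21 T1) \<alpha>' x"
        unfolding schemaC_def sat_Un by simp_all
      note ch = s(2)[unfolded chain_def sat_Un]
      have ch1: "\<alpha>' (tr 31 0 0 0)" using sat_at[OF ch[THEN conjunct1], of 0 0 0 0] m by simp
      have ch3: "\<not> \<alpha>' (tr 31 (Suc (T1 x)) 0 0)" using sat_at[OF ch[THEN conjunct2, THEN conjunct2], of 0 0 0 0] m by simp
      have ch2: "\<alpha>' (sl 21 u)" if "u \<le> T1 x" "\<alpha>' (tr 31 u 0 0)" "\<not> \<alpha>' (tr 31 (Suc u) 0 0)" for u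
        using sat_at[OF ch[THEN conjunct2, THEN conjunct1], of 0 0 0 u] that T2m by (auto simp: env_def)
      \<comment> \<open>Otherwise each link of the chain would pass truth on, against its last
        clause.\<close>
      have "\<exists>u\<le>T1 x. \<alpha>' (sl 21 u)"
      proof (rule ccontr)
        assume no: "\<not> (\<exists>u\<le>T1 x. \<alpha>' (sl 21 u))"
        have "u \<le> Suc (T1 x) \<Longrightarrow> \<alpha>' (tr 31 u 0 0)" for u
        proof (induction u)
          case (Suc u)
          then show ?case using ch2[of u] no by auto
        qed (use ch1 in simp)
        then show False using ch3 by blast
      qed
      then obtain u where u: "u \<le> T1 x" "\<alpha>' (sl 21 u)" by blast
      obtain i where i: "i < length os" "kind (os ! i) = 2" "\<alpha>' (tr 1 0 u i)"
        using sat_at[OF s(1)[unfolded noq_def], of 0 0 0 u] u T2m by (auto simp: env_def)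
      have "\<alpha> (tr 1 0 u i)" using i(3) eq[of "tr 1 0 u i"] by (simp add: tr_def)
      then have "\<not> asks_yes ?B (c u)" using i(2) u(1) a(2) by (simp add: av)
      moreover have "word_of (f u) \<in> ?B"
      proof (rule subcomputation_sound[OF M' os' s(3,4) u])
        show "\<alpha>' (cel 1 0 u 1 (f u (int p - int (off x))) p)" for p
          using eq[of "cel 1 0 u 1 (f u (int p - int (off x))) p"] by (simp add: av f_def) (simp add: cel_def)
      qed (use f0 u in auto)
      ultimately show False using ask u by simp
    qed
    then show "\<exists>\<alpha>. sat (m x) ?D \<alpha> x \<and> (\<forall>\<alpha>'. (\<forall>v. v ! 0 \<le> 20 \<longrightarrow> \<alpha>' v = \<alpha> v) \<longrightarrow> \<not> sat (m x) ?C \<alpha>' x)"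
      using D by blast
  next
    assume "\<exists>\<alpha>. sat (m x) ?D \<alpha> x \<and> (\<forall>\<alpha>'. (\<forall>v. v ! 0 \<le> 20 \<longrightarrow> \<alpha>' v = \<alpha> v) \<longrightarrow> \<not> sat (m x) ?C \<alpha>' x)"
    then obtain \<alpha> where D: "sat (m x) ?D \<alpha> x"
      and C: "\<And>\<alpha>'. (\<And>v. v ! 0 \<le> 20 \<Longrightarrow> \<alpha>' v = \<alpha> v) \<Longrightarrow> \<not> sat (m x) ?C \<alpha>' x" by metis
    from D have s: "sat (m x) (tab M os 1 (\<lambda>_. 0) T1) \<alpha> x" "sat (m x) (minit M) \<alpha> x" "sat (m x) (uniq M T1) \<alpha> x"
      "sat (m x) (yesq os T1) \<alpha> x" "sat (m x) (tab M' os' 11 T1 T2) \<alpha> x" "sat (m x) (winit (ntapes M') (bound M) 11 T1) \<alpha> x"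
      unfolding schemaD_def sat_Un by simp_all
    have "\<exists>\<tau> c. path M (T1 x) \<tau> c \<and> c 0 = init_tapes M x \<and>
      (\<forall>t\<le>T1 x. \<exists>i<length os. \<tau> t = os ! i \<and> \<alpha> (tr 1 0 t i)) \<and>
      (\<forall>t k p. t \<le> T1 x \<and> k < ntapes M \<and> p < m x \<longrightarrow> \<alpha> (cel 1 0 t k (fst (c t ! k) (int p - int (off x))) p))"
      by (rule tab_sound[where U = "\<lambda>_. 0", OF M _ s(1) minit_sound(2)[OF M s(2) T2m(6)]])
        (use os T m T2m minit_sound(1)[OF M s(2)] small_init[OF M] snd_init_tapes in auto)
    then obtain \<tau> c where p: "path M (T1 x) \<tau> c" "c 0 = init_tapes M x"
      and tr: "\<And>t. t \<le> T1 x \<Longrightarrow> \<exists>i<length os. \<tau> t = os ! i \<and> \<alpha> (tr 1 0 t i)"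
      and cel: "\<And>t k p. t \<le> T1 x \<Longrightarrow> k < ntapes M \<Longrightarrow> p < m x \<Longrightarrow> \<alpha> (cel 1 0 t k (fst (c t ! k) (int p - int (off x))) p)"
      by blast
    define f where "f t = fst (c t ! 1)" for t
    have f0: "f t (int (T1 x)) = 0" "f t p < bound M" if "t \<le> T1 x" for t p
      using query_tape[OF p that] by (simp_all add: f_def)
    have fc: "\<alpha> (cel 1 0 t 1 (f t (int p - int (off x))) p)" if "t \<le> T1 x" "p < m x" for t p
      using cel[OF that(1) K that(2)] by (simp add: f_def)
    \<comment> \<open>By \<open>uniq\<close> no second symbol is true on the query tape, so a clause
      triggered by a symbol is triggered by the actual one.\<close>
    have un: "s = f t (int p - int (off x))" if "t \<le> T1 x" "s < bound M" "p < m x" "\<alpha> (cel 1 0 t 1 s p)" for t s p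
    proof (rule ccontr)
      assume ne: "s \<noteq> f t (int p - int (off x))"
      note sat_at[OF s(3)[unfolded uniq_def sat_UN, rule_format, of s "f t (int p - int (off x))"], of 0 p 0 t]
      then show False using ne that f0(2)[OF that(1)] fc[OF that(1,3)] T2m by (auto simp: env_def)
    qed
    have ask: "asks_yes ?B (c t) \<longleftrightarrow> word_of (f t) \<in> ?B" if "t \<le> T1 x" for t
      using asks_yes_iff[of "c t" "T1 x"] f0[OF that] by (simp add: f_def)
    have "asks_yes ?B (c t)" if t: "t \<le> T1 x" "kind (\<tau> t) = 1" for t
    proof -
      obtain i where i: "i < length os" "\<tau> t = os ! i" "\<alpha> (tr 1 0 t i)" using tr[OF t(1)] by blast
      then have sl: "\<alpha> (sl 11 t)"
        using sat_at[OF s(4)[unfolded yesq_def sat_UN, rule_format, of i], of 0 0 0 t] t T2m by (auto simp: env_def)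
      have "word_of (f t) \<in> ?B"
        by (rule subcomputation_sound[OF M' os' s(5,6) t(1) sl]) (use fc f0 t in auto)
      then show ?thesis using t ask by blast
    qed
    moreover have "\<not> asks_yes ?B (c t)" if t: "t \<le> T1 x" "kind (\<tau> t) = 2" for t
    proof
      assume "asks_yes ?B (c t)"
      then have "word_of (f t) \<in> ?B" using ask t by simp
      then have "\<exists>\<tau>' c'. copies_ok M' os' 21 (\<lambda>u. u = t) \<tau>' c' f"
        by (intro subcomputation_complete[OF M' os']) (use f0 m m' t in auto)
      then obtain \<tau>' c' where sub: "copies_ok M' os' 21 (\<lambda>u. u = t) \<tau>' c' f" by blast
      \<comment> \<open>The wrong answer at time \<open>t\<close> selects the single copy
        \<open>t\<close>, and the chain is true up to \<open>t\<close>.\<close>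
      define \<alpha>' where "\<alpha>' v = (if v ! 0 \<le> 20 then \<alpha> v
        else if v ! 0 \<le> 30 then asgn (off x) os' 21 (\<lambda>u. u = t) \<tau>' c' f v else v ! 1 \<le> t)" for v
      have a21: "\<And>v. 21 \<le> v ! 0 \<Longrightarrow> v ! 0 \<le> 21 + 5 \<Longrightarrow> \<alpha>' v = asgn (off x) os' 21 (\<lambda>u. u = t) \<tau>' c' f v"
        by (simp add: \<alpha>'_def)
      note av = asgn_vars[of 21 \<alpha>' "off x" os' "\<lambda>u. u = t" \<tau>' c' f, OF a21]
      have c1: "\<alpha>' (cel 1 0 u k s p) = \<alpha> (cel 1 0 u k s p)" "\<alpha>' (tr 1 0 u i) = \<alpha> (tr 1 0 u i)"
        "\<alpha>' (tr 31 u 0 0) \<longleftrightarrow> u \<le> t" for u k s p i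
        by (simp_all add: \<alpha>'_def cel_def tr_def)
      have "sat (m x) ?C \<alpha>' x"
        unfolding schemaC_def sat_Un
      proof (intro conjI)
        show "sat (m x) (noq os T1) \<alpha>' x"
          unfolding noq_def
        proof (rule satI[OF _ T2m(6)], goal_cases)
          case (1 e)
          obtain i where i: "i < length os" "\<tau> t = os ! i" "\<alpha> (tr 1 0 t i)" using tr[OF t(1)] by blast
          have e: "e 3 < m x" by (rule 1)
          show ?case
          proof (cases "e 3 = t")
            case True
            then have "set (tr 1 0 (e 3) i) \<subseteq> {..<m x} \<and> \<alpha>' (tr 1 0 (e 3) i)"
              unfolding c1 range_vars using i e m os by simp
            then show ?thesis
              using i t(2) by (intro bexI[of _ "(True, \<lambda>x e. tr 1 0 (e 3) i)"]) auto
          qed (use e m in \<open>simp add: av range_vars\<close>)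
        qed
        show "sat (m x) (chain T1) \<alpha>' x"
          unfolding chain_def sat_Un
        proof (intro conjI satI[OF _ T2m(6)], goal_cases)
          case (2 e)
          moreover have "e 3 < m x" by (rule 2)
          ultimately show ?case using m T2m T by (auto simp: av c1 range_vars)
        qed (use m T t in \<open>auto simp: c1 range_vars\<close>)
        show "sat (m x) (tab M' os' 21 T1 T2) \<alpha>' x" "sat (m x) (winit (ntapes M') (bound M) 21 T1) \<alpha>' x"
          using sub[unfolded copies_ok_def, rule_format, of \<alpha>'] a21 un t by (simp_all add: c1[simplified])
      qed
      moreover have "\<And>v. v ! 0 \<le> 20 \<Longrightarrow> \<alpha>' v = \<alpha> v" by (simp add: \<alpha>'_def)
      ultimately show False using C by blast
    qed
    ultimately show "\<exists>\<tau> c. path M (T1 x) \<tau> c \<and> c 0 = init_tapes M x \<and>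
      (\<forall>t\<le>T1 x. (kind (\<tau> t) = 1 \<longrightarrow> asks_yes ?B (c t)) \<and> (kind (\<tau> t) = 2 \<longrightarrow> \<not> asks_yes ?B (c t)))"
      using p by blast
  qed
qed

end

section \<open>Reductions\<close>

text \<open>The digit of weight \<open>m ^ k\<close> in base \<open>m\<close>; numbers below
  \<open>m ^ 6\<close> stand for words of six digits.\<close>

definition dg :: "nat \<Rightarrow> nat \<Rightarrow> nat \<Rightarrow> nat" where
  "dg m w k = w div m ^ k mod m"

abbreviation digits :: "nat \<Rightarrow> nat \<Rightarrow> nat \<Rightarrow> nat list" where
  "digits m w n \<equiv> map (dg m w) [0..<n]"

lemma digits_Suc: "digits m w (Suc n) = w mod m # digits m (w div m) n"
proof -
  have "digits m w (Suc n) = map (dg m w) (0 # map Suc [0..<n])"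
    by (simp only: map_Suc_upt upt_conv_Cons[of 0 "Suc n"] zero_less_Suc if_True)
  also have "\<dots> = w mod m # digits m (w div m) n"
    by (simp add: dg_def div_mult2_eq)
  finally show ?thesis .
qed

lemma digits_surj: "set ds \<subseteq> {..<m} \<Longrightarrow> \<exists>w<m ^ length ds. digits m w (length ds) = ds"
proof (induction ds)
  case (Cons d ds)
  then obtain w where w: "w < m ^ length ds" "digits m w (length ds) = ds" and d: "d < m" by auto
  have "m * Suc w \<le> m * m ^ length ds" using w(1) by (intro mult_le_mono2) simp
  then have "d + m * w < m ^ length (d # ds)" using d by simp
  moreover have "digits m (d + m * w) (length (d # ds)) = d # ds"
    unfolding length_Cons digits_Suc using w(2) d by simp
  ultimately show ?case by (intro exI[of _ "d + m * w"] conjI)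
qed simp

lemma digits_inj: "w < m ^ n \<Longrightarrow> w' < m ^ n \<Longrightarrow> digits m w n = digits m w' n \<Longrightarrow> w = w'"
proof (induction n arbitrary: w w')
  case (Suc n)
  have "w div m < m ^ n" "w' div m < m ^ n"
    using Suc.prems(1,2) by (simp_all add: less_mult_imp_div_less mult.commute)
  moreover have "w mod m = w' mod m" "digits m (w div m) n = digits m (w' div m) n"
    using Suc.prems(3) unfolding digits_Suc by simp_all
  ultimately show ?case using Suc.IH[of "w div m" "w' div m"] by (metis div_mult_mod_eq)
qed simp

text \<open>Digit 5 of a clause selects a schema, digits 0 to 3 are its parameters. Clauses that do
  not exist are replaced by the tautology in variable 0. If \<open>yf\<close> holds, the literal variable 0 is
  added to all clauses.\<close>

definition active :: "schema list \<Rightarrow> nat \<Rightarrow> bool list \<Rightarrow> nat \<Rightarrow> nat \<Rightarrow> bool" where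
  "active S m x w j \<longleftrightarrow> dg m w 5 = j \<and> fst (S ! j) x (env (digits m w 4))"

definition occ :: "bool \<Rightarrow> schema list \<Rightarrow> nat \<Rightarrow> bool list \<Rightarrow> nat \<Rightarrow> bool \<Rightarrow> nat \<Rightarrow> bool" where
  "occ yf S m x w b v \<longleftrightarrow> (yf \<and> b \<and> v = 0) \<or>
    (\<exists>j\<in>set [0..<length S]. active S m x w j \<and> (\<exists>l\<in>set (snd (S ! j)). b = fst l \<and>
      (\<forall>k\<in>set [0..<6]. dg m v k = snd l x (env (digits m w 4)) ! k))) \<or>
    (\<not> (\<exists>j\<in>set [0..<length S]. active S m x w j) \<and> v = 0)"

text \<open>A nonzero class digit keeps the literals of a schema away from variable 0.\<close>

definition schema_ok :: "schema \<Rightarrow> bool" where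
  "schema_ok s \<longleftrightarrow> decidable (\<lambda>x y e. fst s x e) \<and> (\<forall>l\<in>set (snd s).
    (\<forall>k<6. definable (\<lambda>x y e. snd l x e ! k)) \<and> (\<forall>x e. length (snd l x e) = 6 \<and> snd l x e ! 0 \<noteq> 0))"

text \<open>Each clause number denotes an instance of a schema or a tautology, and literals with all
  digits in range denote variables below \<open>m ^ 6\<close>. Schemas never mention variable 0, so
  adding it to all clauses only offers the alternative of making it true.\<close>

lemma sat_occ:
  assumes m: "0 < m" "length S \<le> m" and S: "\<forall>s\<in>set S. schema_ok s"
    and \<alpha>: "\<And>v. v < m ^ 6 \<Longrightarrow> v \<noteq> 0 \<Longrightarrow> \<alpha> v = \<beta> (digits m v 6)"
  shows "(\<forall>w\<in>{..<m ^ 6}. \<exists>v\<in>{..<m ^ 6}. occ yf S m x w (\<alpha> v) v) \<longleftrightarrow> yf \<and> \<alpha> 0 \<or> sat m (set S) \<beta> x"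
proof (cases "yf \<and> \<alpha> 0")
  case True
  then show ?thesis using m(1) by (auto simp: occ_def)
next
  case False
  have lit: "length (snd l x e) = 6" "snd l x e ! 0 \<noteq> 0" if "j < length S" "l \<in> set (snd (S ! j))" for j l e
    using S that nth_mem[OF that(1)] unfolding schema_ok_def by blast+
  have dm: "dg m v k < m" for v k using m(1) by (simp add: dg_def)
  have z: "dg m 0 k = 0" for k by (simp add: dg_def)
  show ?thesis
  proof
    assume L: "\<forall>w\<in>{..<m ^ 6}. \<exists>v\<in>{..<m ^ 6}. occ yf S m x w (\<alpha> v) v"
    have "\<exists>(b, f)\<in>set ls. set (f x (env vs)) \<subseteq> {..<m} \<and> \<beta> (f x (env vs)) = b"
      if s: "(G, ls) \<in> set S" "length vs = 4" "set vs \<subseteq> {..<m}" "G x (env vs)" for G ls vs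
    proof -
      obtain j where j: "j < length S" "S ! j = (G, ls)" using s(1) by (auto simp: in_set_conv_nth)
      \<comment> \<open>The parameters become digits 0 to 3 and the schema number digit 5; digit 4
        is filled with 0.\<close>
      have "set (vs @ [0, j]) \<subseteq> {..<m}" using s(3) m j by auto
      then obtain w where w: "w < m ^ 6" "digits m w 6 = vs @ [0, j]"
        using digits_surj[of "vs @ [0, j]" m] s(2) by auto
      have w4: "digits m w 4 = vs"
      proof -
        have "take 4 (digits m w 6) = digits m w 4" by (simp add: take_map)
        then show ?thesis using w(2) s(2) by simp
      qed
      have "dg m w 5 = (vs @ [0, j]) ! 5" unfolding w(2)[symmetric] by simp
      then have w5: "dg m w 5 = j" using s(2) by (simp add: nth_append)
      obtain v where v: "v < m ^ 6" "occ yf S m x w (\<alpha> v) v" using L w(1) by auto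
      have a: "active S m x w j" unfolding active_def w5 w4 using j s(4) by simp
      have u: "i = j" if "active S m x w i" for i using that w5 by (simp add: active_def)
      have "\<not> (yf \<and> \<alpha> v \<and> v = 0)" using False by (cases "v = 0") simp_all
      moreover have "\<exists>j\<in>set [0..<length S]. active S m x w j" using a j(1) by auto
      ultimately obtain i where "active S m x w i"
        "\<exists>l\<in>set (snd (S ! i)). \<alpha> v = fst l \<and> (\<forall>k\<in>set [0..<6]. dg m v k = snd l x (env (digits m w 4)) ! k)"
        using v(2) unfolding occ_def by blast
      then obtain l where l: "l \<in> set ls" "\<alpha> v = fst l"
        "\<forall>k\<in>set [0..<6]. dg m v k = snd l x (env vs) ! k"
        unfolding w4 using u[of i] j(2) by auto
      have len: "length (snd l x (env vs)) = 6" "snd l x (env vs) ! 0 \<noteq> 0"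
        using lit[OF j(1), of l "env vs"] l(1) j(2) by simp_all
      have e: "digits m v 6 = snd l x (env vs)"
        by (rule nth_equalityI) (use len l(3) in simp_all)
      have "dg m v 0 = snd l x (env vs) ! 0" using l(3) by simp
      then have "v \<noteq> 0" using len(2) z[of 0] by (cases "v = 0") simp_all
      then have "\<beta> (snd l x (env vs)) = fst l" using \<alpha>[OF v(1)] l(2) e by simp
      moreover have "set (snd l x (env vs)) \<subseteq> {..<m}" unfolding e[symmetric] using dm by auto
      ultimately show ?thesis using l(1) by (intro bexI[of _ l]) auto
    qed
    then show "yf \<and> \<alpha> 0 \<or> sat m (set S) \<beta> x" unfolding sat_def by auto
  next
    assume "yf \<and> \<alpha> 0 \<or> sat m (set S) \<beta> x"
    then have sat: "sat m (set S) \<beta> x" using False by blast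
    show "\<forall>w\<in>{..<m ^ 6}. \<exists>v\<in>{..<m ^ 6}. occ yf S m x w (\<alpha> v) v"
    proof
      fix w
      assume "w \<in> {..<m ^ 6}"
      show "\<exists>v\<in>{..<m ^ 6}. occ yf S m x w (\<alpha> v) v"
      proof (cases "\<exists>j\<in>set [0..<length S]. active S m x w j")
        case True
        then obtain j where j: "j < length S" "active S m x w j" by auto
        let ?e = "env (digits m w 4)"
        have "length (digits m w 4) = 4 \<and> set (digits m w 4) \<subseteq> {..<m} \<and> fst (S ! j) x ?e"
          using j(2) dm by (auto simp: active_def)
        moreover have "(fst (S ! j), snd (S ! j)) \<in> set S" using j(1) by simp
        ultimately have "\<exists>(b, f)\<in>set (snd (S ! j)). set (f x ?e) \<subseteq> {..<m} \<and> \<beta> (f x ?e) = b"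
          using sat unfolding sat_def by blast
        then obtain l where l: "l \<in> set (snd (S ! j))" "set (snd l x ?e) \<subseteq> {..<m}" "\<beta> (snd l x ?e) = fst l"
          by auto
        note len = lit[OF j(1) l(1), of ?e]
        obtain v where v: "v < m ^ 6" "digits m v 6 = snd l x ?e"
          using digits_surj[OF l(2)] len(1) by auto
        have k: "dg m v k = snd l x ?e ! k" if "k < 6" for k
          unfolding v(2)[symmetric] using that by simp
        have "v \<noteq> 0" using k[of 0] len(2) z[of 0] by (cases "v = 0") simp_all
        then have "\<alpha> v = fst l" using \<alpha>[OF v(1)] v(2) l(3) by simp
        then have "occ yf S m x w (\<alpha> v) v" unfolding occ_def using j l(1) k by fastforce
        then show ?thesis using v(1) by blast
      next
        case no: False
        then have "occ yf S m x w (\<alpha> 0) 0" unfolding occ_def by blast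
        then show ?thesis using m(1) by (intro bexI[of _ 0]) simp_all
      qed
    qed
  qed
qed

lemma definable_dg:
  assumes "definable (\<lambda>x y e. m x)" "\<And>x. 0 < m x" "definable f"
  shows "definable (\<lambda>x y e. dg (m x) (f x y e) k)"
  unfolding dg_def by (intro definable_mod definable_div definable_intros assms) (use assms(2) in simp_all)

lemma definable_at_digits:
  assumes m: "definable (\<lambda>x y e. m x)" "\<And>x. 0 < m x" and f: "definable f" and g: "definable (\<lambda>x y e. g x e)"
  shows "definable (\<lambda>x y e. g x (env (digits (m x) (f x y e) 4)))"
proof -
  have "env (digits (m x) (f x y e) 4) = (\<lambda>k. if k < 4 then dg (m x) (f x y e) k else 0)" for x y e
    by (auto simp: env_def)
  moreover have "definable (\<lambda>x y e. if k < 4 then dg (m x) (f x y e) k else 0)" for k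
    using definable_dg[OF m f, of k] definable_const[of 0] by (cases "k < 4") simp_all
  ultimately show ?thesis
    using definable_sub[OF g, of "\<lambda>k x y e. if k < 4 then dg (m x) (f x y e) k else 0"] by simp
qed

lemma decidable_occ:
  assumes m: "definable (\<lambda>x y e. m x)" "\<And>x. 0 < m x" and S: "\<forall>s\<in>set S. schema_ok s"
    and f: "definable f" "decidable p" "definable g"
  shows "decidable (\<lambda>x y e. occ yf S (m x) x (f x y e) (p x y e) (g x y e))"
proof -
  have a: "decidable (\<lambda>x y e. active S (m x) x (f x y e) j)" if "j \<in> set [0..<length S]" for j
  proof -
    have "schema_ok (S ! j)" using S that by simp
    then have "decidable (\<lambda>x y e. fst (S ! j) x e)" by (simp add: schema_ok_def)
    from definable_at_digits[OF m f(1) this] show ?thesis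
      unfolding active_def by (intro decidable_conj decidable_eq definable_dg[OF m f(1)] definable_const)
  qed
  have l: "definable (\<lambda>x y e. snd l x (env (digits (m x) (f x y e) 4)) ! k)"
    if "j \<in> set [0..<length S]" "l \<in> set (snd (S ! j))" "k \<in> set [0..<6]" for j l k
  proof -
    have "schema_ok (S ! j)" using S that by simp
    then have "definable (\<lambda>x y e. snd l x e ! k)" using that by (simp add: schema_ok_def)
    from definable_at_digits[OF m f(1) this] show ?thesis .
  qed
  show ?thesis
    unfolding occ_def
    by (intro decidable_disj decidable_conj decidable_list_ex decidable_list_all decidable_not decidable_iff
        decidable_const decidable_eq definable_const definable_dg[OF m f(3)] f a l)
qed

text \<open>The bit at a position is described by bounded quantifiers over the entries that may be
  stored there, as the closure rules require.\<close>

lemma encode_eq: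
  assumes n: "n = length xs"
    and "\<And>i j. i < n \<Longrightarrow> j < n \<Longrightarrow> A i j \<longleftrightarrow> (xs ! i, xs ! j) \<in> atts F"
    and "\<And>i. i < n \<Longrightarrow> G i \<longleftrightarrow> xs ! i = g" "\<And>i. i < n \<Longrightarrow> G' i \<longleftrightarrow> xs ! i = g'"
    and "\<And>i. i < n \<Longrightarrow> I i \<longleftrightarrow> L (xs ! i) = In" "\<And>i. i < n \<Longrightarrow> O' i \<longleftrightarrow> L (xs ! i) = Out"
  shows "encode xs F g L g' = map (\<lambda>p. p < n \<or> (\<exists>i<n. \<exists>j<n. p = Suc n + (i * n + j) \<and> A i j) \<or>
    (\<exists>i<n. p = Suc n + (n * n + i) \<and> G i) \<or> (\<exists>i<n. p = Suc n + (n * n + (n + i)) \<and> G' i) \<or>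
    (\<exists>i<n. p = Suc n + (n * n + (n + (n + (i * 2 + 0)))) \<and> I i) \<or>
    (\<exists>i<n. p = Suc n + (n * n + (n + (n + (i * 2 + 1)))) \<and> O' i)) [0..<code_length n]"
    (is "?w = map ?b _")
proof -
  note e = encode_bits[OF n, where F = F and g = g and L = L and g' = g']
  note b = e(4-8)[unfolded code_defs]
  have bit: "bit ?w p \<longleftrightarrow> ?b p" if "p < code_length n" for p
  proof
    assume h: "bit ?w p"
    from \<open>p < code_length n\<close> show "?b p"
    proof (cases rule: less_code_length_cases)
      case 1
      then show ?thesis by simp
    next
      case 2
      then show ?thesis using h e(3) by simp
    next
      case (3 i j)
      then have "A i j" using h b(1)[OF 3(1,2)] assms(2) by simp
      then show ?thesis using 3 by blast
    next
      case (4 i)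
      then have "G i" using h b(2)[OF 4(1)] assms(3) by simp
      then show ?thesis using 4 by blast
    next
      case (5 i)
      then have "G' i" using h b(3)[OF 5(1)] assms(4) by simp
      then show ?thesis using 5 by blast
    next
      case (6 i)
      then have "I i" using h b(4)[OF 6(1)] assms(5) by simp
      then show ?thesis using 6 by blast
    next
      case (7 i)
      then have "O' i" using h b(5)[OF 7(1)] assms(6) by simp
      then show ?thesis using 7 by blast
    qed
  next
    assume "?b p"
    then show "bit ?w p"
      by (elim disjE exE conjE) (simp_all only: e(2) b assms(2-))
  qed
  show ?thesis
  proof (rule nth_equalityI)
    fix p
    assume "p < length ?w"
    then have "p < code_length n" using e(1) by simp
    then show "?w ! p = map ?b [0..<code_length n] ! p"
      using bit[of p] e(1) by (simp add: bit_def del: One_nat_def)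
  qed (use e(1) in simp)
qed

lemma encode_FP:
  assumes n: "definable (\<lambda>x y e. n x)" "\<And>x. n x = length (xs x)"
    and f: "\<And>x. f x = encode (xs x) (F x) g (L x) g'"
    and A: "decidable (\<lambda>x y e. A x (e 0) (e 1))"
      "\<And>x i j. i < n x \<Longrightarrow> j < n x \<Longrightarrow> A x i j \<longleftrightarrow> (xs x ! i, xs x ! j) \<in> atts (F x)"
    and G: "decidable (\<lambda>x y e. G x (e 0))" "\<And>x i. i < n x \<Longrightarrow> G x i \<longleftrightarrow> xs x ! i = g"
    and G': "decidable (\<lambda>x y e. G' x (e 0))" "\<And>x i. i < n x \<Longrightarrow> G' x i \<longleftrightarrow> xs x ! i = g'"
    and I: "decidable (\<lambda>x y e. I x (e 0))" "\<And>x i. i < n x \<Longrightarrow> I x i \<longleftrightarrow> L x (xs x ! i) = In"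
    and O': "decidable (\<lambda>x y e. O' x (e 0))" "\<And>x i. i < n x \<Longrightarrow> O' x i \<longleftrightarrow> L x (xs x ! i) = Out"
  shows "f \<in> FP"
proof -
  have A': "decidable (\<lambda>x y e. A x (e 1) (e 0))"
    using definable_ren[OF A(1), of "\<lambda>i. 1 - i"] by simp
  show ?thesis
  proof (rule FP_I)
    show "definable (\<lambda>x y e. code_length (n x))"
      unfolding code_length_def by (intro definable_intros n)
    show "decidable (\<lambda>x y e. e 0 < n x \<or> (\<exists>i<n x. \<exists>j<n x. e 0 = Suc (n x) + (i * n x + j) \<and> A x i j) \<or>
      (\<exists>i<n x. e 0 = Suc (n x) + (n x * n x + i) \<and> G x i) \<or> (\<exists>i<n x. e 0 = Suc (n x) + (n x * n x + (n x + i)) \<and> G' x i) \<or>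
      (\<exists>i<n x. e 0 = Suc (n x) + (n x * n x + (n x + (n x + (i * 2 + 0)))) \<and> I x i) \<or>
      (\<exists>i<n x. e 0 = Suc (n x) + (n x * n x + (n x + (n x + (i * 2 + 1)))) \<and> O' x i))"
      by (intro definable_intros n) (use A' G I O' G' in simp_all)
    show "f x = map (\<lambda>i. case_nat i zeros 0 < n x \<or>
        (\<exists>ia<n x. \<exists>j<n x. case_nat i zeros 0 = Suc (n x) + (ia * n x + j) \<and> A x ia j) \<or>
        (\<exists>ia<n x. case_nat i zeros 0 = Suc (n x) + (n x * n x + ia) \<and> G x ia) \<or>
        (\<exists>ia<n x. case_nat i zeros 0 = Suc (n x) + (n x * n x + (n x + ia)) \<and> G' x ia) \<or>
        (\<exists>ia<n x. case_nat i zeros 0 = Suc (n x) + (n x * n x + (n x + (n x + (ia * 2 + 0)))) \<and> I x ia) \<or>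
        (\<exists>ia<n x. case_nat i zeros 0 = Suc (n x) + (n x * n x + (n x + (n x + (ia * 2 + 1)))) \<and> O' x ia))
        [0..<code_length (n x)]" for x
      unfolding f nat.case
      by (rule encode_eq[where A = "A x" and G = "G x" and G' = "G' x" and I = "I x" and O' = "O' x"])
        (use n(2) A(2) G(2) G'(2) I(2) O'(2) in simp_all)
  qed
qed

text \<open>Eight blocks of length \<open>W\<close>, one for each kind of argument; the remainder is
  the index within a block.\<close>

definition dec :: "nat \<Rightarrow> nat \<Rightarrow> nat arg" where
  "dec W i = (let v = i mod W; r = i div W in
    if r = 0 then Lit True v else if r = 1 then Lit False v else if r = 2 then Prm True v
    else if r = 3 then Prm False v else if r = 4 then Dcl v else if r = 5 then Ccl v
    else if r = 6 then Phi v else Bar v)"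

lemma idx_dec: "idx (dec W i) = i mod W"
  by (simp add: dec_def Let_def)

lemma dec_eq:
  "dec W i = Lit b v \<longleftrightarrow> i mod W = v \<and> i div W = (if b then 0 else 1)"
  "dec W i = Phi v \<longleftrightarrow> i mod W = v \<and> i div W = 6"
  by (auto simp: dec_def Let_def)

lemma less_8: "(r :: nat) < 8 \<longleftrightarrow> r = 0 \<or> r = 1 \<or> r = 2 \<or> r = 3 \<or> r = 4 \<or> r = 5 \<or> r = 6 \<or> r = 7"
  by presburger

lemma dec_inj:
  assumes "i < 8 * W" "j < 8 * W" "dec W i = dec W j"
  shows "i = j"
proof -
  have r: "i div W < 8" "j div W < 8" using assms(1,2) by (simp_all add: less_mult_imp_div_less)
  have "i div W = j div W"
    using r assms(3) unfolding less_8 dec_def Let_def by (elim disjE) simp_all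
  moreover have "i mod W = j mod W" using idx_dec assms(3) by metis
  ultimately show ?thesis by (metis div_mult_mod_eq)
qed

lemma dec_surj:
  assumes "idx a < W"
  shows "\<exists>i<8 * W. dec W i = a"
proof -
  have *: "r * W + idx a < 8 * W \<and> (r * W + idx a) mod W = idx a \<and> (r * W + idx a) div W = r" if "r < 8" for r
  proof -
    have "Suc r * W \<le> 8 * W" using that by (intro mult_le_mono1) simp
    then have "r * W + idx a < 8 * W" using assms by (simp only: mult_Suc)
    then show ?thesis using assms by simp
  qed
  define r where "r = (case a of Lit b v \<Rightarrow> (if b then 0 else 1) | Prm b v \<Rightarrow> (if b then 2 else 3)
    | Dcl v \<Rightarrow> 4 | Ccl v \<Rightarrow> 5 | Phi v \<Rightarrow> 6 | Bar v \<Rightarrow> (7 :: nat))"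
  have r: "r < 8" by (cases a) (simp_all add: r_def)
  have "dec W (r * W + idx a) = a"
    using *[OF r] unfolding dec_def Let_def by (cases a) (auto simp: r_def)
  then show ?thesis using *[OF r] by blast
qed

lemma attack_dec:
  fixes V :: "nat set"
  assumes "cnf_af V v0" "i < 8 * W" "j < 8 * W"
  shows "cnf_af.attack isY occD occC fl (dec W i) (dec W j) \<longleftrightarrow>
    i div W \<le> 1 \<and> j div W \<le> 1 \<and> i mod W = j mod W \<and> i div W \<noteq> j div W \<or>
    i div W \<le> 1 \<and> (j div W = 2 \<or> j div W = 3) \<and> i mod W = j mod W \<and> (j div W = i div W + 2 \<or> fl) \<or>
    (i div W = 2 \<or> i div W = 3 \<or> i div W = 5 \<or> i div W = 7) \<and> i div W = j div W \<and> i mod W = j mod W \<or>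
    i div W \<le> 1 \<and> j div W = 4 \<and> occD (j mod W) (i div W = 0) (i mod W) \<or>
    i div W \<le> 1 \<and> j div W = 5 \<and> occC (j mod W) (i div W = 0) (i mod W) \<or>
    i div W = 4 \<and> j div W = 5 \<or> i div W = 5 \<and> j div W = 6 \<or> i div W = 6 \<and> j div W = 7 \<or>
    i div W = 7 \<and> j div W \<le> 1 \<and> \<not> isY (j mod W)"
proof -
  interpret cnf_af V isY occD occC fl v0 by fact
  have "i div W < 8" "j div W < 8"
    using less_mult_imp_div_less[OF assms(2)] less_mult_imp_div_less[OF assms(3)] by simp_all
  then show ?thesis
    unfolding less_8 by (elim disjE) (auto simp: dec_def)
qed

lemma lab1_dec:
  fixes V :: "nat set"
  assumes "cnf_af V v0" "i < 8 * W" "i mod W \<in> V"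
  shows "cnf_af.lab1 V fl (dec W i) = In \<longleftrightarrow> i div W = 0 \<or> i div W = 6"
    "cnf_af.lab1 V fl (dec W i) = Out \<longleftrightarrow> i div W \<noteq> 0 \<and> i div W \<noteq> 6 \<and> (i div W = 3 \<longrightarrow> fl)"
  using assms(3) by (auto simp: dec_def Let_def cnf_af.lab1.simps[OF assms(1)])

text \<open>One reduction for all semantics: \<open>yf\<close> provides the known extension for
  \<open>ST\<close>, \<open>PR\<close> and \<open>SST\<close>, and \<open>fl\<close> selects the
  version of \<open>Prm\<close> for \<open>ST\<close>. With \<open>SD\<close> empty, the clauses of
  \<open>occD\<close> are tautologies in variable 0, which disables all \<open>Dcl\<close>.\<close>

locale reduction =
  fixes m :: "bool list \<Rightarrow> nat" and yf fl :: bool and SD SC :: "schema list"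
  assumes m: "definable (\<lambda>x y e. m x)" "\<And>x. 0 < m x"
    and len: "\<And>x. length SD \<le> m x" "\<And>x. length SC \<le> m x"
    and ok: "\<forall>s\<in>set SD. schema_ok s" "\<forall>s\<in>set SC. schema_ok s"
begin

abbreviation "W x \<equiv> m x ^ 6"
abbreviation "isY x v \<equiv> dg (m x) v 0 \<le> 20"
abbreviation "occD x \<equiv> occ yf SD (m x) x"
abbreviation "occC x \<equiv> occ yf SC (m x) x"
abbreviation "AF x \<equiv> cnf_af.F {..<W x} (isY x) (occD x) (occC x) fl"
abbreviation "xs x \<equiv> map (dec (W x)) [0..<8 * W x]"

lemma W: "0 < W x" using m(2)[of x] by simp

lemma cnf: "cnf_af {..<W x} 0"
  by unfold_locales (use m(2)[of x] in simp_all)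

lemma xs: "distinct (xs x)" "set (xs x) = args (AF x)"
proof -
  show "distinct (xs x)"
    unfolding distinct_map using dec_inj[of _ "W x"] by (auto intro!: inj_onI)
  have "args (AF x) = {a. idx a < W x}"
    using cnf_af.args_F[OF cnf, of _ x] by auto
  also have "\<dots> = dec (W x) ` {..<8 * W x}"
    using dec_surj[of _ "W x"] idx_dec[of "W x"] m(2)[of x] by (auto simp: image_iff)
  finally show "set (xs x) = args (AF x)" by (simp add: lessThan_atLeast0)
qed

lemma encode_reduction_FP:
  assumes g: "g \<in> {Phi 0, Lit True 0, Lit False 0}" "g' \<in> {Phi 0, Lit True 0, Lit False 0}"
    and L: "L = (\<lambda>_ _. Und) \<or> L = (\<lambda>x. cnf_af.lab1 {..<W x} fl)"
  shows "(\<lambda>x. encode (xs x) (AF x) g (L x) g') \<in> FP"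
proof -
  have W': "definable (\<lambda>x y e. W x)" by (intro definable_intros m)
  have vr: "definable (\<lambda>x y e. e k mod W x)" "definable (\<lambda>x y e. e k div W x)" for k
    by (intro definable_mod definable_div definable_var W' W)+
  have dg: "definable (\<lambda>x y e. dg (m x) (f x y e) 0)" if "definable f" for f
    by (rule definable_dg[OF m that])
  have gd: "decidable (\<lambda>x y e. dec (W x) (e 0) = h)" if "h \<in> {Phi 0, Lit True 0, Lit False 0}" for h
    using that unfolding insert_iff empty_iff
    by (elim disjE FalseE) (simp_all only: dec_eq, (intro decidable_conj decidable_eq definable_const vr)+)
  let ?l = "L = (\<lambda>_ _. Und)"
  let ?A = "\<lambda>x i j. i div W x \<le> 1 \<and> j div W x \<le> 1 \<and> i mod W x = j mod W x \<and> i div W x \<noteq> j div W x \<or>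
      i div W x \<le> 1 \<and> (j div W x = 2 \<or> j div W x = 3) \<and> i mod W x = j mod W x \<and> (j div W x = i div W x + 2 \<or> fl) \<or>
      (i div W x = 2 \<or> i div W x = 3 \<or> i div W x = 5 \<or> i div W x = 7) \<and> i div W x = j div W x \<and> i mod W x = j mod W x \<or>
      i div W x \<le> 1 \<and> j div W x = 4 \<and> occD x (j mod W x) (i div W x = 0) (i mod W x) \<or>
      i div W x \<le> 1 \<and> j div W x = 5 \<and> occC x (j mod W x) (i div W x = 0) (i mod W x) \<or>
      i div W x = 4 \<and> j div W x = 5 \<or> i div W x = 5 \<and> j div W x = 6 \<or> i div W x = 6 \<and> j div W x = 7 \<or>
      i div W x = 7 \<and> j div W x \<le> 1 \<and> \<not> isY x (j mod W x)"
  let ?I = "\<lambda>x i. \<not> ?l \<and> (i div W x = 0 \<or> i div W x = 6)"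
  let ?O = "\<lambda>x i. \<not> ?l \<and> i div W x \<noteq> 0 \<and> i div W x \<noteq> 6 \<and> (i div W x = 3 \<longrightarrow> fl)"
  show ?thesis
  proof (rule encode_FP[where n = "\<lambda>x. 8 * W x" and xs = xs and F = AF and L = L and A = ?A and I = ?I
        and O' = ?O and G = "\<lambda>x i. dec (W x) i = g" and G' = "\<lambda>x i. dec (W x) i = g'"])
    show "definable (\<lambda>x y e. 8 * W x)" by (intro definable_intros W')
    show "decidable (\<lambda>x y e. dec (W x) (e 0) = g)" "decidable (\<lambda>x y e. dec (W x) (e 0) = g')"
      by (rule gd[OF g(1)], rule gd[OF g(2)])
    show "decidable (\<lambda>x y e. ?I x (e 0))"
      by (intro decidable_conj decidable_disj decidable_eq decidable_const definable_const vr)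
    show "decidable (\<lambda>x y e. ?O x (e 0))"
      by (intro decidable_conj decidable_imp decidable_not decidable_eq decidable_const definable_const vr)
    show "decidable (\<lambda>x y e. ?A x (e 0) (e 1))"
      by (intro decidable_conj decidable_disj decidable_not decidable_eq decidable_le decidable_const
          decidable_occ[OF m ok(1)] decidable_occ[OF m ok(2)] definable_const definable_add dg vr)
  next
    fix x i
    assume i: "i < 8 * W x"
    then have n: "xs x ! i = dec (W x) i" by simp
    show "(dec (W x) i = g) = (xs x ! i = g)" "(dec (W x) i = g') = (xs x ! i = g')" unfolding n by simp_all
    have "i mod W x \<in> {..<W x}" using W by simp
    note l = lab1_dec[OF cnf i this, of fl]
    show "?I x i = (L x (xs x ! i) = In)" "?O x i = (L x (xs x ! i) = Out)"
      unfolding n using L l by (cases ?l; force)+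
    fix j
    assume j: "j < 8 * W x"
    then have n': "xs x ! j = dec (W x) j" by simp
    show "?A x i j = ((xs x ! i, xs x ! j) \<in> atts (AF x))"
      unfolding n n' cnf_af.atts_F[OF cnf] attack_dec[OF cnf i j] idx_dec using W by simp
  qed simp_all
qed

lemma reduction_input:
  assumes "legal_input \<sigma> (AF x) g L g'"
  shows "encode (xs x) (AF x) g L g' \<in> CF_CA_inputs \<sigma>"
    "encode (xs x) (AF x) g L g' \<in> CF_CA \<sigma> \<longleftrightarrow> (\<exists>L' \<in> counterfactuals \<sigma> (AF x) g L. L' g' = In)"
  by (rule encode_CF_CA[OF xs assms])+

definition code :: "bool list \<Rightarrow> nat list \<Rightarrow> nat" where
  "code x ds = inv_into {..<W x} (\<lambda>v. digits (m x) v 6) ds"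

lemma code_digits: "v < W x \<Longrightarrow> code x (digits (m x) v 6) = v"
  unfolding code_def by (rule inv_into_f_f) (auto intro!: inj_onI digits_inj)

lemma sat_of:
  assumes "\<And>v. v < W x \<Longrightarrow> v \<noteq> 0 \<Longrightarrow> \<alpha> v = \<beta> (digits (m x) v 6)"
  shows "cnf_af.satC {..<W x} (occC x) \<alpha> \<longleftrightarrow> yf \<and> \<alpha> 0 \<or> sat (m x) (set SC) \<beta> x"
    "cnf_af.satD {..<W x} (occD x) \<alpha> \<longleftrightarrow> yf \<and> \<alpha> 0 \<or> sat (m x) (set SD) \<beta> x"
  unfolding cnf_af.satC_def[OF cnf] cnf_af.satD_def[OF cnf]
  by (rule sat_occ[OF m(2) len(2) ok(2)] sat_occ[OF m(2) len(1) ok(1)]; use assms in blast)+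

lemma occ_v0: "occ True S k x w True 0" "occ b [] k x w c 0"
  by (simp_all add: occ_def)

lemma CO_reduction:
  assumes "\<not> yf" "SD = []"
  shows "encode (xs x) (AF x) (Phi 0) (\<lambda>_. Und) (Phi 0) \<in> CF_CA_inputs CO"
    "encode (xs x) (AF x) (Phi 0) (\<lambda>_. Und) (Phi 0) \<in> CF_CA CO \<longleftrightarrow> (\<exists>\<beta>. sat (m x) (set SC) \<beta> x)"
proof -
  have "\<And>w b. occD x w b 0" using assms(2) occ_v0(2) by simp
  note c = cnf_af.CO_counterfactual[OF cnf[of x], where isY = "isY x" and occD = "occD x" and occC = "occC x" and fl = fl, OF this]
  show "encode (xs x) (AF x) (Phi 0) (\<lambda>_. Und) (Phi 0) \<in> CF_CA_inputs CO"
    by (rule reduction_input[OF c(1)])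
  have "(\<exists>\<alpha>. cnf_af.satC {..<W x} (occC x) \<alpha>) \<longleftrightarrow> (\<exists>\<beta>. sat (m x) (set SC) \<beta> x)"
  proof
    assume "\<exists>\<alpha>. cnf_af.satC {..<W x} (occC x) \<alpha>"
    then obtain \<alpha> where a: "cnf_af.satC {..<W x} (occC x) \<alpha>" by blast
    have "sat (m x) (set SC) (\<lambda>ds. \<alpha> (code x ds)) x"
      using sat_of(1)[of x \<alpha> "\<lambda>ds. \<alpha> (code x ds)"] code_digits a assms(1) by simp
    then show "\<exists>\<beta>. sat (m x) (set SC) \<beta> x" by blast
  next
    assume "\<exists>\<beta>. sat (m x) (set SC) \<beta> x"
    then obtain \<beta> where "sat (m x) (set SC) \<beta> x" by blast
    then have "cnf_af.satC {..<W x} (occC x) (\<lambda>v. \<beta> (digits (m x) v 6))"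
      using sat_of(1)[of x "\<lambda>v. \<beta> (digits (m x) v 6)" \<beta>] by simp
    then show "\<exists>\<alpha>. cnf_af.satC {..<W x} (occC x) \<alpha>" by blast
  qed
  then show "encode (xs x) (AF x) (Phi 0) (\<lambda>_. Und) (Phi 0) \<in> CF_CA CO \<longleftrightarrow> (\<exists>\<beta>. sat (m x) (set SC) \<beta> x)"
    unfolding reduction_input(2)[OF c(1)] c(2) .
qed

lemma ST_reduction:
  assumes "yf" "fl" "SD = []"
  shows "encode (xs x) (AF x) (Lit True 0) (cnf_af.lab1 {..<W x} fl) (Lit False 0) \<in> CF_CA_inputs ST"
    "encode (xs x) (AF x) (Lit True 0) (cnf_af.lab1 {..<W x} fl) (Lit False 0) \<in> CF_CA ST \<longleftrightarrow>
      (\<exists>\<beta>. sat (m x) (set SC) \<beta> x)"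
proof -
  have o: "\<And>w b. occD x w b 0" "\<And>w. occC x w True 0" using assms(1,3) occ_v0 by simp_all
  note c = cnf_af.ST_counterfactual[OF cnf[of x], where isY = "isY x" and occD = "occD x" and occC = "occC x" and fl = fl, OF assms(2) o]
  show "encode (xs x) (AF x) (Lit True 0) (cnf_af.lab1 {..<W x} fl) (Lit False 0) \<in> CF_CA_inputs ST"
    by (rule reduction_input[OF c(1)])
  have "(\<exists>\<alpha>. \<not> \<alpha> 0 \<and> cnf_af.satC {..<W x} (occC x) \<alpha>) \<longleftrightarrow> (\<exists>\<beta>. sat (m x) (set SC) \<beta> x)"
  proof
    assume "\<exists>\<alpha>. \<not> \<alpha> 0 \<and> cnf_af.satC {..<W x} (occC x) \<alpha>"
    then obtain \<alpha> where a: "\<not> \<alpha> 0" "cnf_af.satC {..<W x} (occC x) \<alpha>" by blast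
    have "sat (m x) (set SC) (\<lambda>ds. \<alpha> (code x ds)) x"
      using sat_of(1)[of x \<alpha> "\<lambda>ds. \<alpha> (code x ds)"] code_digits a by simp
    then show "\<exists>\<beta>. sat (m x) (set SC) \<beta> x" by blast
  next
    assume "\<exists>\<beta>. sat (m x) (set SC) \<beta> x"
    then obtain \<beta> where "sat (m x) (set SC) \<beta> x" by blast
    \<comment> \<open>Variable 0 is made false, as the changed label of \<open>g\<close> demands; no
      literal of a schema refers to it.\<close>
    then have "cnf_af.satC {..<W x} (occC x) (\<lambda>v. v \<noteq> 0 \<and> \<beta> (digits (m x) v 6))"
      using sat_of(1)[of x "\<lambda>v. v \<noteq> 0 \<and> \<beta> (digits (m x) v 6)" \<beta>] by simp
    then show "\<exists>\<alpha>. \<not> \<alpha> 0 \<and> cnf_af.satC {..<W x} (occC x) \<alpha>" by (intro exI conjI) auto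
  qed
  then show "encode (xs x) (AF x) (Lit True 0) (cnf_af.lab1 {..<W x} fl) (Lit False 0) \<in> CF_CA ST \<longleftrightarrow>
      (\<exists>\<beta>. sat (m x) (set SC) \<beta> x)"
    unfolding reduction_input(2)[OF c(1)] c(2) .
qed

lemma PR_reduction:
  assumes "yf" "\<not> fl" and \<sigma>: "\<sigma> \<in> {PR, SST}"
    and Y: "\<forall>s\<in>set SD. \<forall>l\<in>set (snd s). \<forall>x e. snd l x e ! 0 \<le> 20"
  shows "encode (xs x) (AF x) (Phi 0) (cnf_af.lab1 {..<W x} fl) (Lit False 0) \<in> CF_CA_inputs \<sigma>"
    "encode (xs x) (AF x) (Phi 0) (cnf_af.lab1 {..<W x} fl) (Lit False 0) \<in> CF_CA \<sigma> \<longleftrightarrow>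
      (\<exists>\<beta>. sat (m x) (set SD) \<beta> x \<and>
        (\<forall>\<beta>'. (\<forall>v. v ! 0 \<le> 20 \<longrightarrow> \<beta>' v = \<beta> v) \<longrightarrow> \<not> sat (m x) (set SC) \<beta>' x))"
proof -
  have o: "\<And>w. occD x w True 0" "\<And>w. occC x w True 0" using assms(1) occ_v0 by simp_all
  have y0: "isY x 0" by (simp add: dg_def)
  have y: "isY x v" if v: "occD x w b v" for w b v
  proof (cases "v = 0")
    case False
    then obtain j l where j: "j < length SD" "l \<in> set (snd (SD ! j))"
      "\<forall>k\<in>set [0..<6]. dg (m x) v k = snd l x (env (digits (m x) w 4)) ! k"
      using v unfolding occ_def by auto
    have "snd l x (env (digits (m x) w 4)) ! 0 \<le> 20" using Y nth_mem[OF j(1)] j(2) by blast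
    then show ?thesis using j(3) by simp
  qed (use y0 in simp)
  have c: "legal_input \<sigma> (AF x) (Phi 0) (cnf_af.lab1 {..<W x} fl) (Lit False 0)"
    "(\<exists>L'\<in>counterfactuals \<sigma> (AF x) (Phi 0) (cnf_af.lab1 {..<W x} fl). L' (Lit False 0) = In) \<longleftrightarrow>
      (\<exists>\<alpha>. cnf_af.satD {..<W x} (occD x) \<alpha> \<and> (\<forall>\<alpha>'. (\<forall>v\<in>{..<W x}. isY x v \<longrightarrow> \<alpha>' v = \<alpha> v) \<longrightarrow>
        \<not> cnf_af.satC {..<W x} (occC x) \<alpha>'))"
    by (rule cnf_af.PR_counterfactual[OF cnf]; use assms(2) \<sigma> y0 o y in blast)+
  show "encode (xs x) (AF x) (Phi 0) (cnf_af.lab1 {..<W x} fl) (Lit False 0) \<in> CF_CA_inputs \<sigma>"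
    by (rule reduction_input[OF c(1)])
  let ?C = "\<lambda>\<alpha>. cnf_af.satC {..<W x} (occC x) \<alpha>" and ?D = "\<lambda>\<alpha>. cnf_af.satD {..<W x} (occD x) \<alpha>"
  have d0: "digits (m x) v 6 ! 0 = dg (m x) v 0" for v by simp
  have "(\<exists>\<alpha>. ?D \<alpha> \<and> (\<forall>\<alpha>'. (\<forall>v\<in>{..<W x}. isY x v \<longrightarrow> \<alpha>' v = \<alpha> v) \<longrightarrow> \<not> ?C \<alpha>')) \<longleftrightarrow>
      (\<exists>\<beta>. sat (m x) (set SD) \<beta> x \<and>
        (\<forall>\<beta>'. (\<forall>v. v ! 0 \<le> 20 \<longrightarrow> \<beta>' v = \<beta> v) \<longrightarrow> \<not> sat (m x) (set SC) \<beta>' x))"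
  proof
    assume "\<exists>\<alpha>. ?D \<alpha> \<and> (\<forall>\<alpha>'. (\<forall>v\<in>{..<W x}. isY x v \<longrightarrow> \<alpha>' v = \<alpha> v) \<longrightarrow> \<not> ?C \<alpha>')"
    then obtain \<alpha> where D: "?D \<alpha>" and C: "\<And>\<alpha>'. (\<And>v. v < W x \<Longrightarrow> isY x v \<Longrightarrow> \<alpha>' v = \<alpha> v) \<Longrightarrow> \<not> ?C \<alpha>'"
      by auto
    let ?\<beta> = "\<lambda>ds. \<alpha> (code x ds)"
    have b: "\<alpha> v = ?\<beta> (digits (m x) v 6)" if "v < W x" for v using code_digits[OF that] by simp
    have "\<not> ?C \<alpha>" by (rule C) simp
    \<comment> \<open>If variable 0 were true, it would satisfy every clause of the inner
      formula.\<close>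
    then have a0: "\<not> \<alpha> 0" using sat_of(1)[of x \<alpha> ?\<beta>] b assms(1) by blast
    have "sat (m x) (set SD) ?\<beta> x" using sat_of(2)[of x \<alpha> ?\<beta>] b D a0 by blast
    moreover have "\<not> sat (m x) (set SC) \<beta>' x" if h: "\<forall>v. v ! 0 \<le> 20 \<longrightarrow> \<beta>' v = ?\<beta> v" for \<beta>'
    proof -
      let ?\<alpha>' = "\<lambda>v. v \<noteq> 0 \<and> \<beta>' (digits (m x) v 6)"
      have "\<not> ?C ?\<alpha>'"
      proof (rule C)
        fix v
        assume v: "v < W x" "isY x v"
        have "digits (m x) v 6 ! 0 \<le> 20" using v(2) d0 by simp
        then have "\<beta>' (digits (m x) v 6) = \<alpha> v" using h b[OF v(1)] by simp
        then show "?\<alpha>' v = \<alpha> v" using a0 by (cases "v = 0") simp_all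
      qed
      then show ?thesis using sat_of(1)[of x ?\<alpha>' \<beta>'] by simp
    qed
    ultimately show "\<exists>\<beta>. sat (m x) (set SD) \<beta> x \<and>
        (\<forall>\<beta>'. (\<forall>v. v ! 0 \<le> 20 \<longrightarrow> \<beta>' v = \<beta> v) \<longrightarrow> \<not> sat (m x) (set SC) \<beta>' x)"
      by blast
  next
    assume "\<exists>\<beta>. sat (m x) (set SD) \<beta> x \<and>
        (\<forall>\<beta>'. (\<forall>v. v ! 0 \<le> 20 \<longrightarrow> \<beta>' v = \<beta> v) \<longrightarrow> \<not> sat (m x) (set SC) \<beta>' x)"
    then obtain \<beta> where D: "sat (m x) (set SD) \<beta> x"
      and C: "\<And>\<beta>'. (\<And>v. v ! 0 \<le> 20 \<Longrightarrow> \<beta>' v = \<beta> v) \<Longrightarrow> \<not> sat (m x) (set SC) \<beta>' x"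
      by blast
    let ?\<alpha> = "\<lambda>v. v \<noteq> 0 \<and> \<beta> (digits (m x) v 6)"
    have "?D ?\<alpha>" using sat_of(2)[of x ?\<alpha> \<beta>] D by simp
    moreover have "\<not> ?C \<alpha>'" if h: "\<forall>v\<in>{..<W x}. isY x v \<longrightarrow> \<alpha>' v = ?\<alpha> v" for \<alpha>'
    proof -
      \<comment> \<open>Outer words keep their values; those of the inner ones are taken from
        \<alpha>'.\<close>
      let ?\<beta>' = "\<lambda>ds. if ds ! 0 \<le> 20 then \<beta> ds else \<alpha>' (code x ds)"
      have a0: "\<not> \<alpha>' 0" using h y0 W[of x] by auto
      have "\<alpha>' v = ?\<beta>' (digits (m x) v 6)" if "v < W x" "v \<noteq> 0" for v
        using h that code_digits[OF that(1)] by (simp del: upt_Suc)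
      then have "?C \<alpha>' \<longleftrightarrow> sat (m x) (set SC) ?\<beta>' x" using sat_of(1)[of x \<alpha>' ?\<beta>'] a0 by blast
      moreover have "\<not> sat (m x) (set SC) ?\<beta>' x" by (rule C) simp
      ultimately show ?thesis by blast
    qed
    ultimately show "\<exists>\<alpha>. ?D \<alpha> \<and> (\<forall>\<alpha>'. (\<forall>v\<in>{..<W x}. isY x v \<longrightarrow> \<alpha>' v = \<alpha> v) \<longrightarrow> \<not> ?C \<alpha>')"
      by blast
  qed
  then show "encode (xs x) (AF x) (Phi 0) (cnf_af.lab1 {..<W x} fl) (Lit False 0) \<in> CF_CA \<sigma> \<longleftrightarrow>
      (\<exists>\<beta>. sat (m x) (set SD) \<beta> x \<and>
        (\<forall>\<beta>'. (\<forall>v. v ! 0 \<le> 20 \<longrightarrow> \<beta>' v = \<beta> v) \<longrightarrow> \<not> sat (m x) (set SC) \<beta>' x))"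
    unfolding reduction_input(2)[OF c(1)] c(2) .
qed

end

section \<open>Definability of the clause schemas\<close>

definition lit_ok :: "(bool list \<Rightarrow> (nat \<Rightarrow> nat) \<Rightarrow> nat list) \<Rightarrow> bool" where
  "lit_ok f \<longleftrightarrow> (\<forall>k<6. definable (\<lambda>x y e. f x e ! k)) \<and> (\<forall>x e. length (f x e) = 6 \<and> f x e ! 0 \<noteq> 0)"

lemma lit_okI:
  assumes "definable (\<lambda>x y e. a x e)" "definable (\<lambda>x y e. b x e)" "definable (\<lambda>x y e. c x e)"
    "definable (\<lambda>x y e. d x e)" "definable (\<lambda>x y e. p x e)" "0 < \<beta>"
  shows "lit_ok (\<lambda>x e. [\<beta>, a x e, b x e, c x e, d x e, p x e])"
proof -
  have "definable (\<lambda>x y e. [\<beta>, a x e, b x e, c x e, d x e, p x e] ! k)" if "k < 6" for k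
  proof -
    have "k = 0 \<or> k = 1 \<or> k = 2 \<or> k = 3 \<or> k = 4 \<or> k = 5" using that by presburger
    then show ?thesis using assms definable_const[of \<beta>] by (elim disjE) simp_all
  qed
  then show ?thesis unfolding lit_ok_def using assms(6) by simp
qed

lemma lit_ok_vars:
  "definable (\<lambda>x y e. u x e) \<Longrightarrow> definable (\<lambda>x y e. t x e) \<Longrightarrow> 0 < \<beta> \<Longrightarrow> lit_ok (\<lambda>x e. tr \<beta> (u x e) (t x e) i)"
  "definable (\<lambda>x y e. u x e) \<Longrightarrow> definable (\<lambda>x y e. t x e) \<Longrightarrow> definable (\<lambda>x y e. p x e) \<Longrightarrow> lit_ok (\<lambda>x e. hp \<beta> (u x e) (t x e) k (p x e))"
  "definable (\<lambda>x y e. u x e) \<Longrightarrow> definable (\<lambda>x y e. t x e) \<Longrightarrow> definable (\<lambda>x y e. p x e) \<Longrightarrow> lit_ok (\<lambda>x e. cel \<beta> (u x e) (t x e) k s (p x e))"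
  "definable (\<lambda>x y e. u x e) \<Longrightarrow> definable (\<lambda>x y e. p x e) \<Longrightarrow> lit_ok (\<lambda>x e. iw \<beta> (u x e) (p x e))"
  "definable (\<lambda>x y e. u x e) \<Longrightarrow> definable (\<lambda>x y e. p x e) \<Longrightarrow> lit_ok (\<lambda>x e. ew \<beta> (u x e) (p x e))"
  "definable (\<lambda>x y e. u x e) \<Longrightarrow> lit_ok (\<lambda>x e. sl \<beta> (u x e))"
  unfolding var_defs by (rule lit_okI; (assumption | rule definable_const | simp))+

definition lits_ok :: "lit list \<Rightarrow> bool" where
  "lits_ok ls \<longleftrightarrow> (\<forall>l\<in>set ls. lit_ok (snd l))"

lemma lits_okI: "lits_ok []" "lit_ok f \<Longrightarrow> lits_ok ls \<Longrightarrow> lits_ok ((b, f) # ls)"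
  "(\<And>i. lit_ok (g i)) \<Longrightarrow> lits_ok (map (\<lambda>i. (b, g i)) is)"
  by (auto simp: lits_ok_def)

lemma schema_okI: "decidable (\<lambda>x y e. G x e) \<Longrightarrow> lits_ok ls \<Longrightarrow> schema_ok (G, ls)"
  by (simp add: schema_ok_def lits_ok_def lit_ok_def)

lemma ball_single: "(\<forall>s\<in>{a}. P s) \<longleftrightarrow> P a"
  by simp

context tableau
begin

lemma tab_ok:
  assumes d: "definable (\<lambda>x y e. off x)" "definable (\<lambda>x y e. U x)" "definable (\<lambda>x y e. T x)" "0 < \<beta>"
  shows "\<forall>s\<in>tab M os \<beta> U T. schema_ok s"
  unfolding tab_def ball_Un ball_UN ball_single
  by (intro conjI ballI schema_okI lits_okI lit_ok_vars definable_intros d)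

lemma minit_ok:
  assumes d: "definable (\<lambda>x y e. off x)"
  shows "\<forall>s\<in>minit M. schema_ok s"
  unfolding minit_def input_sym_def ball_Un ball_UN ball_single
  by (intro conjI ballI schema_okI lits_okI lit_ok_vars definable_intros d)

lemma winit_ok:
  assumes d: "definable (\<lambda>x y e. off x)" "definable (\<lambda>x y e. U x)"
  shows "\<forall>s\<in>winit K b \<beta> U. schema_ok s"
  unfolding winit_def ball_Un ball_UN ball_single
  by (intro conjI ballI schema_okI lits_okI lit_ok_vars definable_intros d)

lemma schemas_ok:
  assumes d: "definable (\<lambda>x y e. off x)" "definable (\<lambda>x y e. T1 x)" "definable (\<lambda>x y e. T2 x)"
  shows "\<forall>s\<in>schemaD M os M' os' T1 T2. schema_ok s" "\<forall>s\<in>schemaC M os M' os' T1 T2. schema_ok s"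
  unfolding schemaD_def schemaC_def uniq_def yesq_def noq_def chain_def ball_Un ball_UN ball_single
  by (intro conjI tab_ok minit_ok winit_ok d definable_const;
      ((intro ballI schema_okI lits_okI lit_ok_vars definable_intros d)?; simp)?)+

lemma schemaD_outer: "\<forall>s\<in>schemaD M os M' os' T1 T2. \<forall>l\<in>set (snd s). \<forall>x e. snd l x e ! 0 \<le> 20"
  unfolding schemaD_def uniq_def yesq_def tab_def minit_def winit_def ball_Un ball_UN ball_single
  by (auto simp: var_defs)

end

text \<open>Time bounds are arbitrary polynomials, while definable functions are closed under fixed
  powers; the shift by 2 lets powers dominate constants.\<close>

lemma poly_le_power: "\<exists>k. \<forall>n. poly (p :: nat poly) n \<le> (n + 2) ^ k"
proof (induction p)
  case (pCons a p)
  then obtain k where k: "\<And>n. poly p n \<le> (n + 2) ^ k" by blast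
  have "poly (pCons a p) n \<le> (n + 2) ^ (a + k + 2)" for n
  proof -
    have "a \<le> 2 ^ a" by (rule less_imp_le[OF less_exp])
    also have "\<dots> \<le> (n + 2) ^ a" by (intro power_mono) simp_all
    also have "\<dots> \<le> (n + 2) ^ (a + k + 1)" by (intro power_increasing) simp_all
    finally have "a \<le> (n + 2) ^ (a + k + 1)" .
    moreover have "n * poly p n \<le> (n + 2) * (n + 2) ^ k" using k[of n] by (intro mult_mono) simp_all
    moreover have "(n + 2) * (n + 2) ^ k \<le> (n + 2) ^ (a + k + 1)"
      unfolding power_Suc[symmetric] by (intro power_increasing) simp_all
    moreover have "2 * (n + 2) ^ (a + k + 1) \<le> (n + 2) * (n + 2) ^ (a + k + 1)" by (intro mult_le_mono1) simp
    moreover have "(n + 2) * (n + 2) ^ (a + k + 1) = (n + 2) ^ (a + k + 2)" by simp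
    ultimately show ?thesis unfolding poly_pCons by linarith
  qed
  then show ?case by blast
qed simp

text \<open>The theorem of Cook and Levin in terms of schemas, with a base \<open>m\<close>
  definable from the input.\<close>

lemma NP_sat:
  assumes "A \<in> NP"
  obtains m S where "definable (\<lambda>x y e. m x)" "\<forall>x. 0 < m x" "\<forall>x. length S \<le> m x"
    "\<forall>s\<in>set S. schema_ok s" "\<forall>x. x \<in> A \<longleftrightarrow> (\<exists>\<beta>. sat (m x) (set S) \<beta> x)"
proof -
  obtain M where H: "A = language M {}" "wf_otm M" "poly_time M {}"
    using assms by (auto simp: NP_def NP_rel_def)
  obtain p where p: "\<And>x t k c. run M {} (init M x) t k c \<Longrightarrow> t \<le> poly p (length x)"
    using H(3) unfolding poly_time_def by blast
  obtain \<kappa> where \<kappa>: "\<And>n. poly p n \<le> (n + 2) ^ \<kappa>" using poly_le_power by blast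
  define T where "T x = (length x + 2) ^ \<kappa>" for x :: "bool list"
  define off where "off x = Suc (T x)" for x
  have dT: "definable (\<lambda>x y e. T x)" unfolding T_def by (intro definable_intros)
  have do: "definable (\<lambda>x y e. off x)" unfolding off_def by (intro definable_intros dT)
  have tT: "run M {} (init M x) t k c \<Longrightarrow> t \<le> T x" for x t k c
    unfolding T_def using p \<kappa> order_trans by blast
  have fin: "finite {q \<in> quads M. kind q \<noteq> 1}" using finite_quads[OF H(2)] by simp
  then obtain os where os: "set os = {q \<in> quads M. kind q \<noteq> 1}" using finite_list[OF fin] by blast
  have fin: "finite (tableau.tab off M os 1 (\<lambda>_. 0) T \<union> tableau.minit off M)"
    by (intro finite_UnI tableau.finite_tab tableau.finite_init)
  then obtain S where S: "set S = tableau.tab off M os 1 (\<lambda>_. 0) T \<union> tableau.minit off M"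
    using finite_list[OF fin] by blast
  \<comment> \<open>The summand 43 covers the 40 classes and the strict bound on positions; the
    other constants make tapes, symbols, quadruples and schemas fit into one digit.\<close>
  define m where "m x = 2 * T x + (43 + ntapes M + bound M + length os + length S)" for x
  have "x \<in> A \<longleftrightarrow> (\<exists>\<beta>. sat (m x) (set S) \<beta> x)" for x
  proof -
    have l: "length os \<le> m x" by (simp add: m_def)
    interpret bounded_tableau off m M T T x
      by unfold_locales (simp_all add: H(2) off_def m_def)
    show ?thesis unfolding H(1) S by (rule language_sat[OF tT os l])
  qed
  moreover have "definable (\<lambda>x y e. m x)" unfolding m_def by (intro definable_intros dT)
  moreover have "\<forall>s\<in>set S. schema_ok s"
    unfolding S ball_Un by (intro conjI tableau.tab_ok tableau.minit_ok do dT definable_const) simp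
  moreover have "0 < m x" "length S \<le> m x" for x by (simp_all add: m_def)
  ultimately show ?thesis by (intro that[of m S] allI)
qed

text \<open>The analogue for the second level: an NP machine with an NP oracle becomes a formula
  with outer and inner variables, separated by the class 20.\<close>

lemma Sigma_sat:
  assumes "A \<in> Sigma_p 2"
  obtains m SD SC where "definable (\<lambda>x y e. m x)" "\<forall>x. 0 < m x"
    "\<forall>x. length SD \<le> m x" "\<forall>x. length SC \<le> m x" "\<forall>s\<in>set SD. schema_ok s" "\<forall>s\<in>set SC. schema_ok s"
    "\<forall>s\<in>set SD. \<forall>l\<in>set (snd s). \<forall>x e. snd l x e ! 0 \<le> 20"
    "\<forall>x. x \<in> A \<longleftrightarrow> (\<exists>\<beta>. sat (m x) (set SD) \<beta> x \<and>
      (\<forall>\<beta>'. (\<forall>v. v ! 0 \<le> 20 \<longrightarrow> \<beta>' v = \<beta> v) \<longrightarrow> \<not> sat (m x) (set SC) \<beta>' x))"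
proof -
  have "\<exists>B\<in>NP. A \<in> NP_rel B" using assms by (simp add: numeral_2_eq_2)
  then obtain M M' where H: "A = language M (language M' {})" "wf_otm M" "poly_time M (language M' {})"
    and M': "wf_otm M'" "poly_time M' {}"
    by (auto simp: NP_def NP_rel_def)
  obtain p where p: "\<And>x t k c. run M (language M' {}) (init M x) t k c \<Longrightarrow> t \<le> poly p (length x)"
    using H(3) unfolding poly_time_def by blast
  obtain p' where p': "\<And>x t k c. run M' {} (init M' x) t k c \<Longrightarrow> t \<le> poly p' (length x)"
    using M'(2) unfolding poly_time_def by blast
  obtain \<kappa> where \<kappa>: "\<And>n. poly p n \<le> (n + 2) ^ \<kappa>" using poly_le_power by blast
  obtain \<mu> where \<mu>: "\<And>n. poly p' n \<le> (n + 2) ^ \<mu>" using poly_le_power by blast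
  define T1 where "T1 x = (length x + 2) ^ \<kappa>" for x :: "bool list"
  \<comment> \<open>Query words have length at most \<open>T1 x\<close>, so the exponent \<mu>
    bounds the oracle machine; \<open>Suc\<close> ensures \<open>T1 x \<le> T2 x\<close> also if
    \<mu> is 0.\<close>
  define T2 where "T2 x = (T1 x + 2) ^ Suc \<mu>" for x
  define off where "off x = Suc (T2 x)" for x
  have dT1: "definable (\<lambda>x y e. T1 x)" unfolding T1_def by (intro definable_intros)
  have dT2: "definable (\<lambda>x y e. T2 x)" unfolding T2_def by (intro definable_intros dT1)
  have do: "definable (\<lambda>x y e. off x)" unfolding off_def by (intro definable_intros dT2)
  have tT1: "run M (language M' {}) (init M x) t k c \<Longrightarrow> t \<le> T1 x" for x t k c
    unfolding T1_def using p \<kappa> order_trans by blast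
  have tT2: "t \<le> T2 x" if "length w \<le> T1 x" "run M' {} (init M' w) t k c" for x w t k c
  proof -
    have "t \<le> (length w + 2) ^ \<mu>" using p'[OF that(2)] \<mu> order_trans by blast
    also have "\<dots> \<le> (T1 x + 2) ^ \<mu>" using that(1) by (intro power_mono) simp_all
    also have "\<dots> \<le> T2 x" unfolding T2_def by (intro power_increasing) simp_all
    finally show ?thesis .
  qed
  have T12: "T1 x \<le> T2 x" for x
  proof -
    have "T1 x \<le> (T1 x + 2) ^ 1" by simp
    also have "\<dots> \<le> T2 x" unfolding T2_def by (intro power_increasing) simp_all
    finally show ?thesis .
  qed
  obtain os where os: "set os = quads M" using finite_list[OF finite_quads[OF H(2)]] by blast
  have fin: "finite {q \<in> quads M'. kind q \<noteq> 1}" using finite_quads[OF M'(1)] by simp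
  then obtain os' where os': "set os' = {q \<in> quads M'. kind q \<noteq> 1}" using finite_list[OF fin] by blast
  obtain SD where SD: "set SD = tableau.schemaD off M os M' os' T1 T2"
    using finite_list[OF tableau.finite_schemas(1)] by blast
  obtain SC where SC: "set SC = tableau.schemaC off M os M' os' T1 T2"
    using finite_list[OF tableau.finite_schemas(2)] by blast
  define m where "m x = 2 * T2 x + (43 + ntapes M + bound M + length os + ntapes M' + bound M' + length os' +
    length SD + length SC)" for x
  have "x \<in> A \<longleftrightarrow> (\<exists>\<beta>. sat (m x) (set SD) \<beta> x \<and>
      (\<forall>\<beta>'. (\<forall>v. v ! 0 \<le> 20 \<longrightarrow> \<beta>' v = \<beta> v) \<longrightarrow> \<not> sat (m x) (set SC) \<beta>' x))" for x
  proof -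
    have l: "length os \<le> m x" "length os' \<le> m x" "ntapes M' \<le> m x" "bound M' \<le> m x" by (simp_all add: m_def)
    interpret bounded_tableau off m M T1 T2 x
      by unfold_locales (simp_all add: H(2) T12 off_def m_def)
    show ?thesis
      unfolding H(1) SD SC by (rule language_relative_sat[OF tT1 M'(1) tT2 os l(1) os' l(2-4)])
  qed
  moreover have "definable (\<lambda>x y e. m x)" unfolding m_def by (intro definable_intros dT2)
  moreover have "\<forall>s\<in>set SD. schema_ok s" "\<forall>s\<in>set SC. schema_ok s"
    unfolding SD SC by (rule tableau.schemas_ok[OF do dT1 dT2])+
  moreover have "\<forall>s\<in>set SD. \<forall>l\<in>set (snd s). \<forall>x e. snd l x e ! 0 \<le> 20"
    unfolding SD by (rule tableau.schemaD_outer)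
  moreover have "0 < m x" "length SD \<le> m x" "length SC \<le> m x" for x by (simp_all add: m_def)
  ultimately show ?thesis by (intro that[of m SD SC] allI)
qed

theorem CO_hard: "hard_for NP (CF_CA_inputs CO) (CF_CA CO)"
  unfolding hard_for_def
proof
  fix A :: lang
  assume "A \<in> NP"
  then obtain m S where H: "definable (\<lambda>x y e. m x)" "\<forall>x. 0 < m x" "\<forall>x. length S \<le> m x"
    "\<forall>s\<in>set S. schema_ok s" "\<forall>x. x \<in> A \<longleftrightarrow> (\<exists>\<beta>. sat (m x) (set S) \<beta> x)" by (rule NP_sat)
  interpret reduction m False False "[]" S by unfold_locales (use H in simp_all)
  show "\<exists>f\<in>FP. \<forall>x. f x \<in> CF_CA_inputs CO \<and> (x \<in> A \<longleftrightarrow> f x \<in> CF_CA CO)"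
    by (rule bexI[OF _ encode_reduction_FP[where g = "Phi 0" and g' = "Phi 0" and L = "\<lambda>_ _. Und"]])
      (use CO_reduction H(5) in simp_all)
qed

theorem ST_hard: "hard_for NP (CF_CA_inputs ST) (CF_CA ST)"
  unfolding hard_for_def
proof
  fix A :: lang
  assume "A \<in> NP"
  then obtain m S where H: "definable (\<lambda>x y e. m x)" "\<forall>x. 0 < m x" "\<forall>x. length S \<le> m x"
    "\<forall>s\<in>set S. schema_ok s" "\<forall>x. x \<in> A \<longleftrightarrow> (\<exists>\<beta>. sat (m x) (set S) \<beta> x)" by (rule NP_sat)
  interpret reduction m True True "[]" S by unfold_locales (use H in simp_all)
  show "\<exists>f\<in>FP. \<forall>x. f x \<in> CF_CA_inputs ST \<and> (x \<in> A \<longleftrightarrow> f x \<in> CF_CA ST)"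
    by (rule bexI[OF _ encode_reduction_FP[where g = "Lit True 0" and g' = "Lit False 0" and
          L = "\<lambda>x. cnf_af.lab1 {..<m x ^ 6} True"]])
      (use ST_reduction H(5) in simp_all)
qed

theorem PR_SST_hard:
  assumes "\<sigma> \<in> {PR, SST}"
  shows "hard_for (Sigma_p 2) (CF_CA_inputs \<sigma>) (CF_CA \<sigma>)"
  unfolding hard_for_def
proof
  fix A :: lang
  assume "A \<in> Sigma_p 2"
  then obtain m SD SC where H: "definable (\<lambda>x y e. m x)" "\<forall>x. 0 < m x"
    "\<forall>x. length SD \<le> m x" "\<forall>x. length SC \<le> m x" "\<forall>s\<in>set SD. schema_ok s" "\<forall>s\<in>set SC. schema_ok s"
    and Y: "\<forall>s\<in>set SD. \<forall>l\<in>set (snd s). \<forall>x e. snd l x e ! 0 \<le> 20"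
    and A: "\<forall>x. x \<in> A \<longleftrightarrow> (\<exists>\<beta>. sat (m x) (set SD) \<beta> x \<and>
      (\<forall>\<beta>'. (\<forall>v. v ! 0 \<le> 20 \<longrightarrow> \<beta>' v = \<beta> v) \<longrightarrow> \<not> sat (m x) (set SC) \<beta>' x))" by (rule Sigma_sat)
  interpret reduction m True False SD SC by unfold_locales (use H in simp_all)
  show "\<exists>f\<in>FP. \<forall>x. f x \<in> CF_CA_inputs \<sigma> \<and> (x \<in> A \<longleftrightarrow> f x \<in> CF_CA \<sigma>)"
    by (rule bexI[OF _ encode_reduction_FP[where g = "Phi 0" and g' = "Lit False 0" and
          L = "\<lambda>x. cnf_af.lab1 {..<m x ^ 6} False"]])
      (use PR_reduction[OF _ _ assms Y] A in simp_all)
qed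

theorem theorem3:
  fixes \<sigma> :: semantics
  shows "(\<sigma> \<in> {CO, ST} \<longrightarrow>
            hard_for NP (CF_CA_inputs \<sigma>) (CF_CA \<sigma>) \<and> CF_CA \<sigma> \<in> Theta_p 2) \<and>
         (\<sigma> \<in> {PR, SST} \<longrightarrow>
            hard_for (Sigma_p 2) (CF_CA_inputs \<sigma>) (CF_CA \<sigma>) \<and> CF_CA \<sigma> \<in> Theta_p 3)"
proof (intro conjI impI)
  assume s: "\<sigma> \<in> {CO, ST}"
  then show "hard_for NP (CF_CA_inputs \<sigma>) (CF_CA \<sigma>)" using CO_hard ST_hard by auto
  have "threshold \<sigma> \<in> Sigma_p (2 - 1)" using threshold_NP[OF s] by simp
  then show "CF_CA \<sigma> \<in> Theta_p 2" by (rule CF_CA_Theta)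
next
  assume s: "\<sigma> \<in> {PR, SST}"
  show "hard_for (Sigma_p 2) (CF_CA_inputs \<sigma>) (CF_CA \<sigma>)" by (rule PR_SST_hard[OF s])
  have "threshold \<sigma> \<in> Sigma_p (3 - 1)" using threshold_Sigma[of \<sigma>] by (simp add: numeral_2_eq_2)
  then show "CF_CA \<sigma> \<in> Theta_p 3" by (rule CF_CA_Theta)
qed

end
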